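(* Let $\beta,\lambda$ satisfy the coefficient assumptions (i)–(iii) of the context, let $y\in\mathbb R$, and let $\Xi_T\in L^2(\mathcal F_T)$ satisfy $\Lambda_\Xi:=\int_0^T\frac{d\,\mathbb E[\Xi_t^2]}{T-t}<\infty$. For $\varepsilon>0$ let $Q^{*,\varepsilon}\in\mathcal Q_{\rm ac}$ be the unique minimizer of $J_\varepsilon$ over $\mathcal Q_{\rm ac}$, let $Y^{*,\varepsilon}:=Y^{Q^{*,\varepsilon}}$ and $Y^0:=Y^{Q^0}$. Define $$\underline c_{\mathcal H}:=\inf_{t\in[0,T]}\frac{2\beta_t+\dot\gamma_t}{2\lambda_t}>0,\qquad C_{\rm inv}:=\frac{2\|\lambda^{-1}\|^2_{L^\infty(0,T)}+T^2\left\|\frac{\beta+\dot\gamma}{\lambda}\right\|^2_{L^\infty(0,T)}}{\underline c_{\mathcal H}}.$$ Then for every $0<\varepsilon\le T^2/4$, $$0\le J_0(Q^{*,\varepsilon})-J_0(Q^0)=\|Y^{*,\varepsilon}-Y^0\|^2_{\mathcal H}\le(1+C_J)\bigl(\widetilde C_{\rm tr}\sqrt\varepsilon+4\Lambda_\Xi\varepsilon\bigr)$$ and $$\mathbb E\int_0^T|Q_t^{*,\varepsilon}-Q_t^0|^2\,dt\le C_{\rm inv}(1+C_J)\bigl(\widetilde C_{\rm tr}\sqrt\varepsilon+4\Lambda_\Xi\varepsilon\bigr).$$ In particular, as $\varepsilon\downarrow0$, $J_0(Q^{*,\varepsilon})-J_0(Q^0)=O(\sqrt\varepsilon)$ and $\mathbb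 E\int_0^T|Q_t^{*,\varepsilon}-Q_t^0|^2\,dt=O(\sqrt\varepsilon)$.
   Context: Fix $T\in(0,\infty)$ and a filtered probability space $(\Omega,\mathcal F,(\mathcal F_t)_{t\in[0,T]},\mathbb P)$ satisfying the usual conditions; $\mathcal F_{0-}$ is the augmentation of the trivial $\sigma$-field. Let $\Xi_t=\mathbb E[\Xi_T\mid\mathcal F_t]$ (càdlàg). $\Lambda_\Xi$ is a Stieltjes integral with respect to the nondecreasing function $t\mapsto\mathbb E[\Xi_t^2]$ on $[0,T]$, with the convention that an atom at $T$ contributes $+\infty$. Coefficient assumptions on the deterministic functions $\beta,\lambda:[0,T]\to(0,\infty)$: (i) $\beta$ is càdlàg and of finite variation. (ii) $\lambda$ is absolutely continuous and bounded away from zero, and its a.e. derivative admits a càdlàg version $\dot\lambda$ of finite variation; $\lambda_{0-}:=\lambda_0$, $\gamma_t:=\log\lambda_t$, $\dot\gamma_t:=\dot\lambda_t/\lambda_t$. (iii) There is $c>0$ with $2\beta_t+\dot\gamma_t>c$ for all $t\in[0,T]$. Set $\eta_t=\frac{\beta_t+\dot\gamma_t}{2\beta_t+\dot\gamma_t}$, $\dot\theta_t=\frac{(\beta_t+\dot\gamma_t)^2}{\lambda_t(2\beta_t+\dot\gamma_t)}$, $\theta_t=\int_0^t\dot\theta_s\,ds$. Strategies and costs. $\mathcal Q$ is the set of càdlàg semimartingales $Q$ with $\mathbb E[\sup_{t\le T}|Q_t|^2]<\infty$, $Q_{0-}=0$, $Q_T=\Xi_T$. For $Q\in\mathcal Q$,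 $Y^Q$ solves $dY_t=-\beta_tY_t\,dt+\lambda_t\,dQ_t$, $Y_{0-}=y$. Let $$\langle Y,Z\rangle_{\mathcal H}=\mathbb E\Big[\int_0^T\tfrac{2\beta_t+\dot\gamma_t}{2\lambda_t}Y_tZ_t\,dt+\tfrac1{2\lambda_T}Y_TZ_T\Big],\quad\|Y\|^2_{\mathcal H}=\langle Y,Y\rangle_{\mathcal H},\quad J_0(Q)=\|Y^Q\|_{\mathcal H}^2-\tfrac{y^2}{2\lambda_0}$$ ($J_0(Q)$ equals the execution cost $\mathbb E[\int_0^TY^Q_{t-}dQ_t+\frac12[Y^Q,Q]_T]$). $\mathcal Q_{\rm ac}\subset\mathcal Q$ consists of the $Q_t=\int_0^tu_s\,ds$ with $u$ progressively measurable, $\mathbb E\int_0^Tu_t^2\,dt<\infty$ and $Q_T=\Xi_T$. For $\varepsilon>0$ and $Q\in\mathcal Q_{\rm ac}$, $J_\varepsilon(Q)=J_0(Q)+\varepsilon\,\mathbb E\int_0^T\dot Q_t^2\,dt$. Under $\Lambda_\Xi<\infty$, the infimum of $J_\varepsilon$ over $\mathcal Q_{\rm ac}$ is attained by a unique strategy $Q^{*,\varepsilon}$. The unregularized optimizer. $Q^0\in\mathcal Q$ is the unique minimizer of $J_0$ over $\mathcal Q$. Explicitly, with the square-integrable martingale $$M_t=\frac{\lambda_T}{1+\lambda_T\theta_T}\Big(\Xi_0+\frac y{\lambda_0}\Big)+\int_{(0,t]}\frac{\lambda_T}{1+\lambda_T(\theta_T-\theta_s)}\,d\Xi_s,\quad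 t\in[0,T],$$ one has $Q^0_t=\frac{\eta_t}{\lambda_t}M_t-\frac y{\lambda_0}+\int_0^t\dot\theta_sM_s\,ds$ for $0\le t<T$ and $Q^0_T=\Xi_T$, $Q^0_{0-}=0$. Constants. $C_J=C_{\mathcal H}^2L_Y^2$ with $$C_{\mathcal H}^2=\tfrac12\max\Big\{\Big\|\tfrac{2\beta+\dot\gamma}{\lambda}\Big\|_{L^\infty(0,T)},\tfrac1{\lambda_T}\Big\},\qquad L_Y=\|\lambda\|_{L^\infty(0,T)}\sqrt{2+T(T+2)\|\beta+\dot\gamma\|^2_{L^\infty(0,T)}};$$ $$\widetilde C_{\rm tr}=2\bigl(C_0+2[Q^0]^2_{\rm tr}+8K_0+10\,\mathbb E[\Xi_T^2]\bigr),$$ where $C_0=2A_\alpha^2m_2+\frac{2y^2}{\lambda_0^2}$, $A_\alpha=\|\eta/\lambda\|_{L^\infty(0,T)}$, $m_2=\mathbb E[M_T^2]$, $K_0=\sup_{t\in[0,T)}\mathbb E|Q^0_t-\Xi_t|^2$, and $[Q^0]^2_{\rm tr}=\sup_{h>0}\frac1h\,\mathbb E\int_0^T|Q^0_t-Q^0_{(t-h)^+}|^2\,dt$ with $(t-h)^+=\max\{t-h,0\}$. *)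

theory Defs
  imports "HOL-Probability.Probability" "HOL-Library.Landau_Symbols"
begin

section \<open>Deterministic functions on an interval\<close>

definition cadlag_on :: "real \<Rightarrow> real \<Rightarrow> (real \<Rightarrow> real) \<Rightarrow> bool" where
  "cadlag_on a b f \<longleftrightarrow>
     (\<forall>t\<in>{a..<b}. (f \<longlongrightarrow> f t) (at_right t)) \<and>
     (\<forall>t\<in>{a<..b}. \<exists>l. (f \<longlongrightarrow> l) (at_left t))"

definition finite_variation_on :: "real \<Rightarrow> real \<Rightarrow> (real \<Rightarrow> real) \<Rightarrow> bool" where
  "finite_variation_on a b f \<longleftrightarrow>
     (\<exists>B. \<forall>(n::nat) (p::nat \<Rightarrow> real).
        (\<forall>i\<le>n. p i \<in> {a..b}) \<and> (\<forall>i<n. p i \<le> p (Suc i))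
        \<longrightarrow> (\<Sum>i<n. \<bar>f (p (Suc i)) - f (p i)\<bar>) \<le> B)"

definition absolutely_continuous_on :: "real \<Rightarrow> real \<Rightarrow> (real \<Rightarrow> real) \<Rightarrow> bool" where
  "absolutely_continuous_on a b f \<longleftrightarrow>
     (\<forall>e>0. \<exists>d>0. \<forall>(n::nat) (l::nat \<Rightarrow> real) (r::nat \<Rightarrow> real).
        (\<forall>i<n. a \<le> l i \<and> l i \<le> r i \<and> r i \<le> b) \<and>
        disjoint_family_on (\<lambda>i. {l i<..<r i}) {..<n} \<and>
        (\<Sum>i<n. r i - l i) < d
        \<longrightarrow> (\<Sum>i<n. \<bar>f (r i) - f (l i)\<bar>) < e)"

definition Linf :: "real \<Rightarrow> (real \<Rightarrow> real) \<Rightarrow> real" where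
  "Linf T f = real_of_ereal (esssup (restrict_space lborel {0<..<T}) (\<lambda>t. ereal \<bar>f t\<bar>))"

definition gamma_dot :: "(real \<Rightarrow> real) \<Rightarrow> (real \<Rightarrow> real) \<Rightarrow> real \<Rightarrow> real" where
  "gamma_dot lam dlam t = dlam t / lam t"

text \<open>In \<open>coefficients T \<beta> lam dlam\<close> the function \<open>dlam\<close> is the cadlag version of the
  a.e. derivative of \<open>lam\<close>.\<close>

definition coefficients ::
  "real \<Rightarrow> (real \<Rightarrow> real) \<Rightarrow> (real \<Rightarrow> real) \<Rightarrow> (real \<Rightarrow> real) \<Rightarrow> bool" where
  "coefficients T \<beta> lam dlam \<longleftrightarrow>
     (\<forall>t\<in>{0..T}. 0 < \<beta> t) \<and> cadlag_on 0 T \<beta> \<and> finite_variation_on 0 T \<beta> \<and>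
     (\<forall>t\<in>{0..T}. 0 < lam t) \<and> absolutely_continuous_on 0 T lam \<and>
     (\<exists>\<delta>>0. \<forall>t\<in>{0..T}. \<delta> \<le> lam t) \<and>
     (AE t in lborel. t \<in> {0<..<T} \<longrightarrow> (lam has_real_derivative dlam t) (at t)) \<and>
     cadlag_on 0 T dlam \<and> finite_variation_on 0 T dlam \<and>
     (\<exists>c>0. \<forall>t\<in>{0..T}. 2 * \<beta> t + gamma_dot lam dlam t > c)"

definition eta :: "(real \<Rightarrow> real) \<Rightarrow> (real \<Rightarrow> real) \<Rightarrow> (real \<Rightarrow> real) \<Rightarrow> real \<Rightarrow> real" where
  "eta \<beta> lam dlam t = (\<beta> t + gamma_dot lam dlam t) / (2 * \<beta> t + gamma_dot lam dlam t)"

definition theta_dot :: "(real \<Rightarrow> real) \<Rightarrow> (real \<Rightarrow> real) \<Rightarrow> (real \<Rightarrow> real) \<Rightarrow> real \<Rightarrow> real" where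
  "theta_dot \<beta> lam dlam t =
     (\<beta> t + gamma_dot lam dlam t)^2 / (lam t * (2 * \<beta> t + gamma_dot lam dlam t))"

definition theta :: "(real \<Rightarrow> real) \<Rightarrow> (real \<Rightarrow> real) \<Rightarrow> (real \<Rightarrow> real) \<Rightarrow> real \<Rightarrow> real" where
  "theta \<beta> lam dlam t = (LINT s:{0..t}|lborel. theta_dot \<beta> lam dlam s)"


section \<open>Stochastic processes on a finite horizon\<close>

text \<open>Only the values of a filtration or process at times in \<open>{0..T}\<close> are relevant.  Path properties
  are required almost surely; a process \<open>X\<close> carries no value at \<open>0-\<close>, which is supplied
  separately where it matters.\<close>

type_synonym 'a process = "real \<Rightarrow> 'a \<Rightarrow> real"

definition usual_filtered_space :: "'a measure \<Rightarrow> (real \<Rightarrow> 'a measure) \<Rightarrow> real \<Rightarrow> bool" where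
  "usual_filtered_space M F T \<longleftrightarrow>
     prob_space M \<and>
     (\<forall>N\<in>null_sets M. \<forall>A\<subseteq>N. A \<in> sets M) \<and>
     (\<forall>t\<in>{0..T}. subalgebra M (F t)) \<and>
     (\<forall>s\<in>{0..T}. \<forall>t\<in>{0..T}. s \<le> t \<longrightarrow> sets (F s) \<subseteq> sets (F t)) \<and>
     null_sets M \<subseteq> sets (F 0) \<and>
     (\<forall>t\<in>{0..<T}. sets (F t) = (\<Inter>s\<in>{t<..T}. sets (F s)))"

definition adapted :: "(real \<Rightarrow> 'a measure) \<Rightarrow> real \<Rightarrow> 'a process \<Rightarrow> bool" where
  "adapted F T X \<longleftrightarrow> (\<forall>t\<in>{0..T}. X t \<in> borel_measurable (F t))"

definition cadlag_adapted :: "'a measure \<Rightarrow> (real \<Rightarrow> 'a measure) \<Rightarrow> real \<Rightarrow> 'a process \<Rightarrow> bool" where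
  "cadlag_adapted M F T X \<longleftrightarrow> adapted F T X \<and> (AE \<omega> in M. cadlag_on 0 T (\<lambda>t. X t \<omega>))"

definition martingale :: "'a measure \<Rightarrow> (real \<Rightarrow> 'a measure) \<Rightarrow> real \<Rightarrow> 'a process \<Rightarrow> bool" where
  "martingale M F T X \<longleftrightarrow>
     adapted F T X \<and> (\<forall>t\<in>{0..T}. integrable M (X t)) \<and>
     (\<forall>s\<in>{0..T}. \<forall>t\<in>{s..T}. AE \<omega> in M. X s \<omega> = real_cond_exp M (F s) (X t) \<omega>)"

text \<open>A localizing sequence on the horizon \<open>T\<close> is a.s. eventually \<open>\<ge> T\<close>; stopping at a time \<open>\<ge> T\<close>
  means not stopping.\<close>

definition local_martingale :: "'a measure \<Rightarrow> (real \<Rightarrow> 'a measure) \<Rightarrow> real \<Rightarrow> 'a process \<Rightarrow> bool" where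
  "local_martingale M F T X \<longleftrightarrow>
     cadlag_adapted M F T X \<and>
     (\<exists>\<tau>::nat \<Rightarrow> 'a \<Rightarrow> real.
        (\<forall>n. \<forall>t\<in>{0..T}. {\<omega>\<in>space M. \<tau> n \<omega> \<le> t} \<in> sets (F t)) \<and>
        (\<forall>n. \<forall>\<omega>\<in>space M. 0 \<le> \<tau> n \<omega>) \<and>
        (AE \<omega> in M. incseq (\<lambda>n. \<tau> n \<omega>) \<and> (\<exists>n. T \<le> \<tau> n \<omega>)) \<and>
        (\<forall>n. martingale M F T (\<lambda>t \<omega>. X (min (\<tau> n \<omega>) t) \<omega> - X 0 \<omega>)))"

definition semimartingale :: "'a measure \<Rightarrow> (real \<Rightarrow> 'a measure) \<Rightarrow> real \<Rightarrow> 'a process \<Rightarrow> bool" where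
  "semimartingale M F T X \<longleftrightarrow>
     cadlag_adapted M F T X \<and>
     (\<exists>N A. local_martingale M F T N \<and> cadlag_adapted M F T A \<and>
        (AE \<omega> in M. finite_variation_on 0 T (\<lambda>t. A t \<omega>)) \<and>
        (AE \<omega> in M. N 0 \<omega> = 0 \<and> A 0 \<omega> = 0) \<and>
        (AE \<omega> in M. \<forall>t\<in>{0..T}. X t \<omega> = X 0 \<omega> + N t \<omega> + A t \<omega>))"

definition progressive :: "(real \<Rightarrow> 'a measure) \<Rightarrow> real \<Rightarrow> 'a process \<Rightarrow> bool" where
  "progressive F T u \<longleftrightarrow>
     (\<forall>t\<in>{0..T}. (\<lambda>(s, \<omega>). u s \<omega>) \<in> borel_measurable (restrict_space borel {0..t} \<Otimes>\<^sub>M F t))"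

text \<open>\<open>is_stoch_int M F T f X I\<close>: the process \<open>I\<close> is the stochastic integral
  \<open>\<integral>\<^bsub>(0,t]\<^esub> f dX\<close>, i.e. the cadlag limit in probability of Riemann sums along deterministic
  partitions of \<open>[0,t]\<close> with mesh tending to zero.  For a continuous deterministic integrand
  \<open>f\<close> (the only case used) and a semimartingale \<open>X\<close> this is the Ito integral; the jump of \<open>X\<close>
  at time \<open>0\<close> is not included.\<close>

definition is_stoch_int ::
  "'a measure \<Rightarrow> (real \<Rightarrow> 'a measure) \<Rightarrow> real \<Rightarrow> (real \<Rightarrow> real) \<Rightarrow> 'a process \<Rightarrow> 'a process \<Rightarrow> bool" where
  "is_stoch_int M F T f X I \<longleftrightarrow>
     cadlag_adapted M F T I \<and>
     (\<forall>t\<in>{0..T}. \<forall>e>0. \<exists>d>0. \<forall>(n::nat) (p::nat \<Rightarrow> real).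
        p 0 = 0 \<and> p n = t \<and> (\<forall>i<n. p i \<le> p (Suc i) \<and> p (Suc i) - p i < d) \<longrightarrow>
        measure M {\<omega>\<in>space M.
          \<bar>(\<Sum>i<n. f (p i) * (X (p (Suc i)) \<omega> - X (p i) \<omega>)) - I t \<omega>\<bar> > e} < e)"

text \<open>The integral is unique up to indistinguishability.\<close>

definition stoch_int ::
  "'a measure \<Rightarrow> (real \<Rightarrow> 'a measure) \<Rightarrow> real \<Rightarrow> (real \<Rightarrow> real) \<Rightarrow> 'a process \<Rightarrow> 'a process" where
  "stoch_int M F T f X = (SOME I. is_stoch_int M F T f X I)"


section \<open>The target process\<close>

definition cadlag_version_of_closed_martingale ::
  "'a measure \<Rightarrow> (real \<Rightarrow> 'a measure) \<Rightarrow> real \<Rightarrow> ('a \<Rightarrow> real) \<Rightarrow> 'a process \<Rightarrow> bool" where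
  "cadlag_version_of_closed_martingale M F T \<Xi>T \<Xi> \<longleftrightarrow>
     cadlag_adapted M F T \<Xi> \<and>
     (\<forall>t\<in>{0..T}. AE \<omega> in M. \<Xi> t \<omega> = real_cond_exp M (F t) \<Xi>T \<omega>)"

text \<open>The integrator \<open>t \<mapsto> E[\<Xi>\<^sub>t\<^sup>2]\<close> is extended to the real line as a constant outside
  \<open>[0,T]\<close>, so its Stieltjes measure lives on \<open>(0,T]\<close>.  In \<^typ>\<open>ennreal\<close> one has
  \<open>inverse 0 = \<infinity>\<close> and \<open>\<infinity> * 0 = 0\<close>: an atom at \<open>T\<close>, and only an atom, makes the
  point \<open>T\<close> contribute \<open>\<infinity>\<close>.\<close>

definition Lambda :: "'a measure \<Rightarrow> real \<Rightarrow> 'a process \<Rightarrow> ennreal" where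
  "Lambda M T \<Xi> =
     (\<integral>\<^sup>+t\<in>{0<..T}. inverse (ennreal (T - t))
        \<partial>interval_measure (\<lambda>t. \<integral>\<omega>. (\<Xi> (max 0 (min T t)) \<omega>)^2 \<partial>M))"


section \<open>Strategies and costs\<close>

text \<open>The convention \<open>Q\<^bsub>0-\<^esub> = 0\<close> is built in: \<open>Q 0\<close> is the size of the initial block trade,
  and it enters the state equation below as the jump \<open>lam 0 * Q 0\<close>.\<close>

definition strategies ::
  "'a measure \<Rightarrow> (real \<Rightarrow> 'a measure) \<Rightarrow> real \<Rightarrow> ('a \<Rightarrow> real) \<Rightarrow> 'a process set" where
  "strategies M F T \<Xi>T =
     {Q. semimartingale M F T Q \<and>
         (\<integral>\<^sup>+\<omega>. (SUP t\<in>{0..T}. ennreal (\<bar>Q t \<omega>\<bar>^2)) \<partial>M) < \<infinity> \<and>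
         (AE \<omega> in M. Q T \<omega> = \<Xi>T \<omega>)}"

definition is_rate ::
  "'a measure \<Rightarrow> (real \<Rightarrow> 'a measure) \<Rightarrow> real \<Rightarrow> 'a process \<Rightarrow> 'a process \<Rightarrow> bool" where
  "is_rate M F T Q u \<longleftrightarrow>
     progressive F T u \<and>
     (\<integral>\<^sup>+\<omega>. (\<integral>\<^sup>+t\<in>{0..T}. ennreal ((u t \<omega>)^2) \<partial>lborel) \<partial>M) < \<infinity> \<and>
     (AE \<omega> in M. \<forall>t\<in>{0..T}. Q t \<omega> = (LINT s:{0..t}|lborel. u s \<omega>))"

definition ac_strategies ::
  "'a measure \<Rightarrow> (real \<Rightarrow> 'a measure) \<Rightarrow> real \<Rightarrow> ('a \<Rightarrow> real) \<Rightarrow> 'a process set" where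
  "ac_strategies M F T \<Xi>T = {Q \<in> strategies M F T \<Xi>T. \<exists>u. is_rate M F T Q u}"

text \<open>The rate is unique \<open>dt \<otimes> P\<close>-a.e.\<close>

definition Q_dot :: "'a measure \<Rightarrow> (real \<Rightarrow> 'a measure) \<Rightarrow> real \<Rightarrow> 'a process \<Rightarrow> 'a process" where
  "Q_dot M F T Q = (SOME u. is_rate M F T Q u)"

text \<open>\<open>dY = -\<beta> Y dt + lam dQ\<close> with \<open>Y\<^bsub>0-\<^esub> = y\<close> and \<open>Q\<^bsub>0-\<^esub> = 0\<close>; the solution is unique up
  to indistinguishability.\<close>

definition solves_state_eq ::
  "'a measure \<Rightarrow> (real \<Rightarrow> 'a measure) \<Rightarrow> real \<Rightarrow> (real \<Rightarrow> real) \<Rightarrow> (real \<Rightarrow> real) \<Rightarrow> real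
     \<Rightarrow> 'a process \<Rightarrow> 'a process \<Rightarrow> bool" where
  "solves_state_eq M F T \<beta> lam y Q Y \<longleftrightarrow>
     cadlag_adapted M F T Y \<and>
     (AE \<omega> in M. \<forall>t\<in>{0..T}.
        Y t \<omega> = y - (LINT s:{0..t}|lborel. \<beta> s * Y s \<omega>)
                 + lam 0 * Q 0 \<omega> + stoch_int M F T lam Q t \<omega>)"

definition state ::
  "'a measure \<Rightarrow> (real \<Rightarrow> 'a measure) \<Rightarrow> real \<Rightarrow> (real \<Rightarrow> real) \<Rightarrow> (real \<Rightarrow> real) \<Rightarrow> real
     \<Rightarrow> 'a process \<Rightarrow> 'a process" where
  "state M F T \<beta> lam y Q = (SOME Y. solves_state_eq M F T \<beta> lam y Q Y)"

definition inner_H ::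
  "'a measure \<Rightarrow> real \<Rightarrow> (real \<Rightarrow> real) \<Rightarrow> (real \<Rightarrow> real) \<Rightarrow> (real \<Rightarrow> real)
     \<Rightarrow> 'a process \<Rightarrow> 'a process \<Rightarrow> real" where
  "inner_H M T \<beta> lam dlam Y Z =
     (\<integral>\<omega>. (LINT t:{0..T}|lborel.
              (2 * \<beta> t + gamma_dot lam dlam t) / (2 * lam t) * Y t \<omega> * Z t \<omega>)
          + 1 / (2 * lam T) * Y T \<omega> * Z T \<omega> \<partial>M)"

definition norm_H_sq ::
  "'a measure \<Rightarrow> real \<Rightarrow> (real \<Rightarrow> real) \<Rightarrow> (real \<Rightarrow> real) \<Rightarrow> (real \<Rightarrow> real) \<Rightarrow> 'a process \<Rightarrow> real" where
  "norm_H_sq M T \<beta> lam dlam Y = inner_H M T \<beta> lam dlam Y Y"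

definition J_zero ::
  "'a measure \<Rightarrow> (real \<Rightarrow> 'a measure) \<Rightarrow> real \<Rightarrow> (real \<Rightarrow> real) \<Rightarrow> (real \<Rightarrow> real) \<Rightarrow> (real \<Rightarrow> real)
     \<Rightarrow> real \<Rightarrow> 'a process \<Rightarrow> real" where
  "J_zero M F T \<beta> lam dlam y Q =
     norm_H_sq M T \<beta> lam dlam (state M F T \<beta> lam y Q) - y^2 / (2 * lam 0)"

definition J_eps ::
  "'a measure \<Rightarrow> (real \<Rightarrow> 'a measure) \<Rightarrow> real \<Rightarrow> (real \<Rightarrow> real) \<Rightarrow> (real \<Rightarrow> real) \<Rightarrow> (real \<Rightarrow> real)
     \<Rightarrow> real \<Rightarrow> real \<Rightarrow> 'a process \<Rightarrow> real" where
  "J_eps M F T \<beta> lam dlam y \<epsilon> Q =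
     J_zero M F T \<beta> lam dlam y Q
       + \<epsilon> * (\<integral>\<omega>. (LINT t:{0..T}|lborel. (Q_dot M F T Q t \<omega>)^2) \<partial>M)"

definition L2_dist_sq :: "'a measure \<Rightarrow> real \<Rightarrow> 'a process \<Rightarrow> 'a process \<Rightarrow> real" where
  "L2_dist_sq M T P Q = (\<integral>\<omega>. (LINT t:{0..T}|lborel. \<bar>P t \<omega> - Q t \<omega>\<bar>^2) \<partial>M)"


section \<open>Constants\<close>

definition C_H_sq ::
  "real \<Rightarrow> (real \<Rightarrow> real) \<Rightarrow> (real \<Rightarrow> real) \<Rightarrow> (real \<Rightarrow> real) \<Rightarrow> real" where
  "C_H_sq T \<beta> lam dlam =
     1/2 * max (Linf T (\<lambda>t. (2 * \<beta> t + gamma_dot lam dlam t) / lam t)) (1 / lam T)"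

definition L_Y ::
  "real \<Rightarrow> (real \<Rightarrow> real) \<Rightarrow> (real \<Rightarrow> real) \<Rightarrow> (real \<Rightarrow> real) \<Rightarrow> real" where
  "L_Y T \<beta> lam dlam =
     Linf T lam * sqrt (2 + T * (T + 2) * (Linf T (\<lambda>t. \<beta> t + gamma_dot lam dlam t))^2)"

definition C_J ::
  "real \<Rightarrow> (real \<Rightarrow> real) \<Rightarrow> (real \<Rightarrow> real) \<Rightarrow> (real \<Rightarrow> real) \<Rightarrow> real" where
  "C_J T \<beta> lam dlam = C_H_sq T \<beta> lam dlam * (L_Y T \<beta> lam dlam)^2"

definition M_process ::
  "'a measure \<Rightarrow> (real \<Rightarrow> 'a measure) \<Rightarrow> real \<Rightarrow> (real \<Rightarrow> real) \<Rightarrow> (real \<Rightarrow> real) \<Rightarrow> (real \<Rightarrow> real)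
     \<Rightarrow> real \<Rightarrow> 'a process \<Rightarrow> 'a process" where
  "M_process M F T \<beta> lam dlam y \<Xi> t \<omega> =
     lam T / (1 + lam T * theta \<beta> lam dlam T) * (\<Xi> 0 \<omega> + y / lam 0)
     + stoch_int M F T
         (\<lambda>s. lam T / (1 + lam T * (theta \<beta> lam dlam T - theta \<beta> lam dlam s))) \<Xi> t \<omega>"

definition C_zero ::
  "'a measure \<Rightarrow> (real \<Rightarrow> 'a measure) \<Rightarrow> real \<Rightarrow> (real \<Rightarrow> real) \<Rightarrow> (real \<Rightarrow> real) \<Rightarrow> (real \<Rightarrow> real)
     \<Rightarrow> real \<Rightarrow> 'a process \<Rightarrow> real" where
  "C_zero M F T \<beta> lam dlam y \<Xi> =
     2 * (Linf T (\<lambda>t. eta \<beta> lam dlam t / lam t))^2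
       * (\<integral>\<omega>. (M_process M F T \<beta> lam dlam y \<Xi> T \<omega>)^2 \<partial>M)
     + 2 * y^2 / (lam 0)^2"

definition K_zero :: "'a measure \<Rightarrow> real \<Rightarrow> 'a process \<Rightarrow> 'a process \<Rightarrow> real" where
  "K_zero M T \<Xi> Q = (SUP t\<in>{0..<T}. \<integral>\<omega>. \<bar>Q t \<omega> - \<Xi> t \<omega>\<bar>^2 \<partial>M)"

definition tr_seminorm_sq :: "'a measure \<Rightarrow> real \<Rightarrow> 'a process \<Rightarrow> real" where
  "tr_seminorm_sq M T Q =
     (SUP h\<in>{0<..}. 1 / h * (\<integral>\<omega>. (LINT t:{0..T}|lborel. \<bar>Q t \<omega> - Q (max (t - h) 0) \<omega>\<bar>^2) \<partial>M))"

definition C_tr ::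
  "'a measure \<Rightarrow> (real \<Rightarrow> 'a measure) \<Rightarrow> real \<Rightarrow> (real \<Rightarrow> real) \<Rightarrow> (real \<Rightarrow> real) \<Rightarrow> (real \<Rightarrow> real)
     \<Rightarrow> real \<Rightarrow> ('a \<Rightarrow> real) \<Rightarrow> 'a process \<Rightarrow> 'a process \<Rightarrow> real" where
  "C_tr M F T \<beta> lam dlam y \<Xi>T \<Xi> Q =
     2 * (C_zero M F T \<beta> lam dlam y \<Xi> + 2 * tr_seminorm_sq M T Q
          + 8 * K_zero M T \<Xi> Q + 10 * (\<integral>\<omega>. (\<Xi>T \<omega>)^2 \<partial>M))"

definition c_H_low ::
  "real \<Rightarrow> (real \<Rightarrow> real) \<Rightarrow> (real \<Rightarrow> real) \<Rightarrow> (real \<Rightarrow> real) \<Rightarrow> real" where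
  "c_H_low T \<beta> lam dlam = (INF t\<in>{0..T}. (2 * \<beta> t + gamma_dot lam dlam t) / (2 * lam t))"

definition C_inv ::
  "real \<Rightarrow> (real \<Rightarrow> real) \<Rightarrow> (real \<Rightarrow> real) \<Rightarrow> (real \<Rightarrow> real) \<Rightarrow> real" where
  "C_inv T \<beta> lam dlam =
     (2 * (Linf T (\<lambda>t. 1 / lam t))^2
      + T^2 * (Linf T (\<lambda>t. (\<beta> t + gamma_dot lam dlam t) / lam t))^2) / c_H_low T \<beta> lam dlam"

end

theory Submission
  imports Defs
begin

text \<open>Integrating by parts removes all stochastic integrals with their deterministic, absolutely
  continuous integrands, so the state is an explicit pathwise functional of \<open>Q\<close>. The state of the
  explicit optimizer \<open>Qh\<close> is \<open>eta M\<close>, and the martingale property of \<open>M\<close> makes it orthogonal in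
  \<open>H\<close> to the difference with the state of every strategy of the same terminal value; hence the excess
  of \<open>J_zero\<close> is the squared distance in \<open>H\<close>. An absolutely continuous recovery strategy, a moving
  average of \<open>Qh\<close> with lag \<open>h\<close> up to \<open>T - h\<close> and then the interpolation of the target martingale
  along times \<open>T - h / 2^k\<close>, is \<open>O(h)\<close>-close to \<open>Qh\<close> in squared \<open>L2\<close>-distance, and \<open>h\<^sup>2\<close> times its energy is
  \<open>O(h)\<close>. Letting \<open>h\<close> tend to \<open>0\<close> identifies \<open>Q0\<close> with \<open>Qh\<close>; taking \<open>h = sqrt \<epsilon>\<close> and comparing with
  the minimizer of \<open>J_eps\<close> gives the estimate.\<close>

section \<open>The fundamental theorem of calculus for absolutely continuous functions\<close>

text \<open>In general the optimizer trades in blocks at \<open>0\<close> and at \<open>T\<close>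
  and follows a martingale in between, so it is no competitor in the regularized problem; the rate
  of convergence is the price of smoothing it. With lag \<open>h\<close> the recovery strategy loses
  \<open>O(h)\<close> in the quadratic cost, while its energy is of order \<open>1 / h\<close>; the
  choice \<open>\<epsilon> = h^2\<close> balances the two. This explains \<open>1 + C_J\<close>: the
  summand \<open>C_J\<close> pays for the distance in \<open>H\<close>, the summand \<open>1\<close>
  for the penalty. Near \<open>T\<close> the obstacle is to reach, with finite energy, a target that
  is fully revealed only at \<open>T\<close>. Halving the remaining time at each node means that a
  martingale increment is traded over a time comparable with the time left when it was revealed; its
  energy is then second moment over remaining time, which is what \<open>Lambda\<close> integrates.
  Finiteness of \<open>Lambda\<close> also excludes a jump of the second moment at \<open>T\<close>.
  A further obstacle is that states, rates and stochastic integrals are chosen by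
  \<open>SOME\<close> and regular only almost surely; they are handled through indistinguishable
  versions with all paths cadlag.\<close>

lemma absolutely_continuous_FTC:
  assumes ab: "a \<le> b" and ac: "absolutely_continuous_on a b f"
    and deriv: "AE t in lborel. t \<in> {a<..<b} \<longrightarrow> (f has_real_derivative f' t) (at t)"
  shows "(f' has_integral (f b - f a)) {a..b}"
proof -
  obtain N0 where N0: "N0 \<in> null_sets lborel"
    "{t. \<not> (t \<in> {a<..<b} \<longrightarrow> (f has_real_derivative f' t) (at t))} \<subseteq> N0"
    using deriv unfolding eventually_ae_filter by auto
  \<comment> \<open>The endpoints count as exceptional because differentiability is assumed in the
    open interval only.\<close>
  define N where "N = N0 \<union> {a, b}"
  have N: "N \<in> null_sets lborel"
    unfolding N_def by (intro null_sets.Un N0 finite_imp_null_set_lborel) auto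
  have good: "(f has_real_derivative f' t) (at t)" if "t \<in> {a..b}" "t \<notin> N" for t
    using that N0(2) unfolding N_def by (auto simp: less_le subset_iff)
  define g where "g t = (if t \<in> N then 0 else f' t)" for t
  \<comment> \<open>A gauge argument. Pieces tagged outside \<open>N\<close> are controlled by
    differentiability at the tag. Pieces tagged in \<open>N\<close> contribute only increments of
    \<open>f\<close>, since \<open>g\<close> vanishes there, and these are small by absolute
    continuity because the pieces lie in an open set of small measure.\<close>
  have "(g has_integral (f b - f a)) {a..b}"
    unfolding has_integral_factor_content box_real[symmetric]
  proof safe
    fix e0 :: real assume "e0 > 0"
    show "\<exists>d. gauge d \<and> (\<forall>p. p tagged_division_of (cbox a b) \<and> d fine p \<longrightarrow>
      norm ((\<Sum>(x, k)\<in>p. measure lborel k *\<^sub>R g x) - (f b - f a)) \<le> e0 * measure lborel (cbox a b))"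
    proof (cases "a = b")
      case True
      have "norm ((\<Sum>(x, k)\<in>p. measure lborel k *\<^sub>R g x) - (f b - f a)) \<le> e0 * measure lborel (cbox a b)"
        if p: "p tagged_division_of (cbox a b)" for p
      proof -
        have "(\<Sum>(x, k)\<in>p. measure lborel k *\<^sub>R g x) = 0"
        proof (rule sum.neutral, safe)
          fix x k assume "(x,k) \<in> p"
          then obtain u v where "k = cbox u v" "k \<subseteq> {a}"
            using tagged_division_ofD(3,4)[OF p] True by (metis box_real(2) atLeastAtMost_singleton)
          then have "measure lborel k = 0"
            by (cases "k = {}") (auto simp: subset_singleton_iff)
          then show "measure lborel k *\<^sub>R g x = 0" by simp
        qed
        then show ?thesis using True by simp
      qed
      moreover have "gauge (\<lambda>x::real. ball x 1)" by (simp add: gauge_ball)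
      ultimately show ?thesis by blast
    next
      case False
      then have ab': "a < b" using ab by simp
      \<comment> \<open>Half of the tolerance goes to the tags outside \<open>N\<close>, half to the
        tags in \<open>N\<close>; each half is \<open>e1\<close>.\<close>
      define e where "e = e0 / 2"
      define e1 where "e1 = e * (b - a)"
      have "e > 0" "e1 > 0" using \<open>e0 > 0\<close> ab' by (auto simp: e_def e1_def)
      then obtain \<delta> where \<delta>: "\<delta> > 0" and acd0: "\<forall>(n::nat) l r.
         (\<forall>i<n. a \<le> l i \<and> l i \<le> r i \<and> r i \<le> b) \<and>
        disjoint_family_on (\<lambda>i. {l i<..<r i}) {..<n} \<and>
        (\<Sum>i<n. r i - l i) < \<delta> \<longrightarrow> (\<Sum>i<n. \<bar>f (r i) - f (l i)\<bar>) < e1"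
        using ac[unfolded absolutely_continuous_on_def, rule_format, OF \<open>e1 > 0\<close>] by blast
      have acd: "(\<Sum>i<n. \<bar>f (r i) - f (l i)\<bar>) < e1"
        if "\<forall>i<n. a \<le> l i \<and> l i \<le> r i \<and> r i \<le> b"
          "disjoint_family_on (\<lambda>i. {l i<..<r i}) {..<n}" "(\<Sum>i<n. r i - l i) < \<delta>" for n::nat and l r
        using acd0 that by blast
      have Nb: "N \<in> sets borel" using null_setsD2[OF N] by simp
      obtain U where U: "open U" "N \<subseteq> U" "emeasure lborel (U - N) < ennreal \<delta>"
        by (rule outer_regular_lborel[OF Nb \<delta>])
      have [measurable]: "N \<in> sets borel" "U \<in> sets borel" using Nb U(1) by auto
      have "emeasure lborel U \<le> emeasure lborel (U - N) + emeasure lborel N"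
        using emeasure_subadditive[of "U - N" lborel N] U(2) by (simp add: Un_absorb2)
      then have Um: "emeasure lborel U < ennreal \<delta>"
        using U(3) N by auto
      have "\<forall>x. \<exists>d>0. (x \<in> N \<longrightarrow> ball x d \<subseteq> U) \<and> (x \<in> {a..b} - N \<longrightarrow>
         (\<forall>y. norm (y-x) < d \<longrightarrow> norm (f y - f x - (y-x) *\<^sub>R f' x) \<le> e * norm (y-x)))"
      proof
        fix x
        consider "x \<in> N" | "x \<in> {a..b} - N" | "x \<notin> N" "x \<notin> {a..b}" by blast
        then show "\<exists>d>0. (x \<in> N \<longrightarrow> ball x d \<subseteq> U) \<and> (x \<in> {a..b} - N \<longrightarrow>
         (\<forall>y. norm (y-x) < d \<longrightarrow> norm (f y - f x - (y-x) *\<^sub>R f' x) \<le> e * norm (y-x)))"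
        proof cases
          case 1
          then show ?thesis using U(1,2) openE[of U x] by blast
        next
          case 2
          then have "(f has_vector_derivative f' x) (at x)"
            using good by (simp add: has_real_derivative_iff_has_vector_derivative)
          then have "\<forall>e>0. \<exists>d>0. \<forall>y\<in>UNIV. norm (y - x) < d \<longrightarrow> norm (f y - f x - (y - x) *\<^sub>R f' x) \<le> e * norm (y - x)"
            unfolding has_vector_derivative_def has_derivative_within_alt by blast
          then obtain d where "d > 0" "\<forall>y\<in>UNIV. norm (y - x) < d \<longrightarrow> norm (f y - f x - (y - x) *\<^sub>R f' x) \<le> e * norm (y - x)"
            using \<open>e > 0\<close> by blast
          then show ?thesis using 2 by blast
        next
          case 3
          then show ?thesis by (intro exI[of _ 1]) auto
        qed
      qed
      from choice[OF this] obtain d where d0: "\<forall>x. 0 < d x \<and> (x \<in> N \<longrightarrow> ball x (d x) \<subseteq> U) \<and> (x \<in> {a..b} - N \<longrightarrow>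
         (\<forall>y. norm (y-x) < d x \<longrightarrow> norm (f y - f x - (y-x) *\<^sub>R f' x) \<le> e * norm (y-x)))" ..
      have d: "\<And>x. 0 < d x" "\<And>x. x \<in> N \<Longrightarrow> ball x (d x) \<subseteq> U"
        "\<And>x y. x \<in> {a..b} \<Longrightarrow> x \<notin> N \<Longrightarrow> norm (y-x) < d x \<Longrightarrow>
            norm (f y - f x - (y-x) *\<^sub>R f' x) \<le> e * norm (y-x)"
        using d0 by blast+
      show ?thesis
      proof (rule exI, safe)
        show "gauge (\<lambda>x. ball x (d x))" using d(1) gauge_ball_dependent by blast
      next
        fix p
        assume ptag: "p tagged_division_of cbox a b" and finep: "(\<lambda>x. ball x (d x)) fine p"
        have ba: "b - a = (\<Sum>(x,K)\<in>p. Sup K - Inf K)" "f b - f a = (\<Sum>(x,K)\<in>p. f(Sup K) - f(Inf K))"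
          using additive_tagged_division_1[where f= "\<lambda>x. x"] additive_tagged_division_1[where f= f]
            ab ptag by auto
        have finp: "finite p" using tagged_division_ofD(1)[OF ptag] .
        have K: "\<exists>u v. K = {u..v} \<and> u \<le> v \<and> Inf K = u \<and> Sup K = v \<and> a \<le> u \<and> v \<le> b \<and> x \<in> K \<and> K \<subseteq> ball x (d x)
            \<and> interior K = {u<..<v} \<and> measure lborel K = v - u \<and> u \<in> K \<and> v \<in> K \<and> x \<in> {a..b}" if xKp: "(x,K) \<in> p" for x K
        proof -
          obtain u v where k: "K = cbox u v" "x \<in> K" "K \<subseteq> cbox a b"
            using tagged_division_ofD(2,3,4)[OF ptag xKp] by metis
          then have "u \<le> v" by auto
          moreover have "K \<subseteq> ball x (d x)" using finep xKp unfolding fine_def by blast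
          ultimately show ?thesis using k
            by (intro exI[of _ u] exI[of _ v]) auto
        qed
        define pb where "pb = {q \<in> p. fst q \<in> N}"
        have finpb: "finite pb" unfolding pb_def using finp by auto
        then obtain h where h: "bij_betw h {..<card pb} pb"
          using ex_bij_betw_nat_finite atLeast0LessThan by metis
        define n where "n = card pb"
        have h: "bij_betw h {..<n} pb" using h n_def by simp
        have hp: "h i \<in> pb" if "i < n" for i using h that bij_betwE by blast
        have disj: "disjoint_family_on (\<lambda>q. {Inf (snd q)<..<Sup (snd q)}) p"
          unfolding disjoint_family_on_def
        proof (intro ballI impI)
          fix q r assume *: "q \<in> p" "r \<in> p" "q \<noteq> r"
          obtain x K y L where q: "q = (x,K)" "r = (y,L)" by fastforce
          have "interior K \<inter> interior L = {}"
            using tagged_division_ofD(5)[OF ptag] * q by blast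
          then show "{Inf (snd q)<..<Sup (snd q)} \<inter> {Inf (snd r)<..<Sup (snd r)} = {}"
            using K[of x K] K[of y L] * q by auto
        qed
        \<comment> \<open>The pieces are enumerated because absolute continuity speaks of finite
          indexed families of intervals; their total length is at most the measure of
          \<open>U\<close>.\<close>
        have bad: "(\<Sum>q\<in>pb. \<bar>f (Sup (snd q)) - f (Inf (snd q))\<bar>) < e1"
        proof -
          have s1: "(\<Sum>q\<in>pb. F q) = (\<Sum>i<n. F (h i))" for F :: "_ \<Rightarrow> real"
            by (rule sum.reindex_bij_betw[OF h, symmetric])
          have inj: "inj_on h {..<n}" using h by (simp add: bij_betw_def)
          have dn: "disjoint_family_on (\<lambda>i. {Inf (snd (h i))<..<Sup (snd (h i))}) {..<n}"
            unfolding disjoint_family_on_def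
          proof (intro ballI impI)
            fix i j assume ij: "i \<in> {..<n}" "j \<in> {..<n}" "i \<noteq> j"
            then have "h i \<noteq> h j" using inj by (auto simp: inj_on_def)
            then show "{Inf (snd (h i))<..<Sup (snd (h i))} \<inter> {Inf (snd (h j))<..<Sup (snd (h j))} = {}"
              using disj hp ij unfolding disjoint_family_on_def pb_def by blast
          qed
          have hK: "a \<le> Inf (snd (h i)) \<and> Inf (snd (h i)) \<le> Sup (snd (h i)) \<and> Sup (snd (h i)) \<le> b
              \<and> {Inf (snd (h i))<..<Sup (snd (h i))} \<subseteq> U" if "i < n" for i
          proof -
            obtain x k where xk: "h i = (x,k)" by fastforce
            then have "(x,k) \<in> p" "x \<in> N" using hp[OF that] unfolding pb_def by auto
            then obtain u v where "k = {u..v} \<and> u \<le> v \<and> Inf k = u \<and> Sup k = v \<and> a \<le> u \<and> v \<le> b \<and> k \<subseteq> ball x (d x)"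
              using K[of x k] by blast
            moreover have "{u<..<v} \<subseteq> {u..v}" by auto
            ultimately show ?thesis using d(2)[OF \<open>x \<in> N\<close>] xk by auto
          qed
          have "ennreal (\<Sum>i<n. Sup (snd (h i)) - Inf (snd (h i)))
              = (\<Sum>i<n. emeasure lborel {Inf (snd (h i))<..<Sup (snd (h i))})"
            using hK by (subst sum_ennreal[symmetric]) auto
          also have "\<dots> = emeasure lborel (\<Union>i<n. {Inf (snd (h i))<..<Sup (snd (h i))})"
            by (rule sum_emeasure) (use dn in auto)
          also have "\<dots> \<le> emeasure lborel U"
            by (rule emeasure_mono) (use hK in auto)
          finally have "ennreal (\<Sum>i<n. Sup (snd (h i)) - Inf (snd (h i))) < ennreal \<delta>"
            using Um by (rule le_less_trans)
          moreover have "0 \<le> (\<Sum>i<n. Sup (snd (h i)) - Inf (snd (h i)))"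
            by (rule sum_nonneg) (use hK in auto)
          ultimately have "(\<Sum>i<n. Sup (snd (h i)) - Inf (snd (h i))) < \<delta>"
            using ennreal_less_iff[of "(\<Sum>i<n. Sup (snd (h i)) - Inf (snd (h i)))" \<delta>] by auto
          then show ?thesis
            unfolding s1 by (intro acd dn) (use hK in auto)
        qed
        have gd: "\<bar>measure lborel K * g x - (f (Sup K) - f (Inf K))\<bar> \<le> e * (Sup K - Inf K)"
          if xK: "(x,K) \<in> p - pb" for x K
        proof -
          obtain u v where k: "K = {u..v}" "u \<le> v" "Inf K = u" "Sup K = v" "x \<in> K" "K \<subseteq> ball x (d x)"
            "measure lborel K = v - u" "u \<in> K" "v \<in> K" "x \<in> {a..b}" using K[of x K] xK by blast
          have xN: "x \<notin> N" using xK unfolding pb_def by auto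
          \<comment> \<open>Straddle estimate: the tag lies between the endpoints, so the two error
            terms have lengths that add up to \<open>v - u\<close>.\<close>
          have 1: "norm (f u - f x - (u - x) *\<^sub>R f' x) \<le> e * norm (u - x)"
            using k(6,8) by (intro d k xN) (auto simp: dist_real_def abs_minus_commute)
          have 2: "norm (f v - f x - (v - x) *\<^sub>R f' x) \<le> e * norm (v - x)"
            using k(6,9) by (intro d k xN) (auto simp: dist_real_def abs_minus_commute)
          have "norm (u - x) = x - u" "norm (v - x) = v - x" using k by auto
          then have 3: "e * norm (u - x) + e * norm (v-x) = e * (v - u)"
            by (simp add: algebra_simps)
          have 4: "measure lborel K * g x - (f (Sup K) - f (Inf K)) =
             (f u - f x - (u - x) *\<^sub>R f' x) - (f v - f x - (v - x) *\<^sub>R f' x)"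
            using k xN by (simp add: g_def algebra_simps)
          show ?thesis
            unfolding 4 unfolding k(3,4) 3[symmetric] using 1 2 by (intro order_trans[OF abs_triangle_ineq4 add_mono]) auto
        qed
        have "(\<Sum>(x, k)\<in>p. measure lborel k *\<^sub>R g x) - (f b - f a)
           = (\<Sum>q\<in>p. measure lborel (snd q) * g (fst q) - (f (Sup (snd q)) - f (Inf (snd q))))"
          unfolding ba(2) by (simp add: sum_subtractf split_def)
        also have "\<dots> = (\<Sum>q\<in>p - pb. measure lborel (snd q) * g (fst q) - (f (Sup (snd q)) - f (Inf (snd q))))
          + (\<Sum>q\<in>pb. measure lborel (snd q) * g (fst q) - (f (Sup (snd q)) - f (Inf (snd q))))"
          by (rule sum.subset_diff) (use finp pb_def in auto)
        also have "(\<Sum>q\<in>pb. measure lborel (snd q) * g (fst q) - (f (Sup (snd q)) - f (Inf (snd q))))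
           = (\<Sum>q\<in>pb. - (f (Sup (snd q)) - f (Inf (snd q))))"
          by (rule sum.cong) (auto simp: pb_def g_def)
        finally have eq: "(\<Sum>(x, k)\<in>p. measure lborel k *\<^sub>R g x) - (f b - f a) =
           (\<Sum>q\<in>p - pb. measure lborel (snd q) * g (fst q) - (f (Sup (snd q)) - f (Inf (snd q))))
           + (\<Sum>q\<in>pb. - (f (Sup (snd q)) - f (Inf (snd q))))" .
        have "\<bar>\<Sum>q\<in>p - pb. measure lborel (snd q) * g (fst q) - (f (Sup (snd q)) - f (Inf (snd q)))\<bar>
           \<le> (\<Sum>q\<in>p - pb. e * (Sup (snd q) - Inf (snd q)))"
          by (rule order_trans[OF sum_abs sum_mono]) (use gd in auto)
        also have "\<dots> \<le> (\<Sum>q\<in>p. e * (Sup (snd q) - Inf (snd q)))"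
        proof (rule sum_mono2)
          fix q assume "q \<in> p - (p - pb)"
          then have "Inf (snd q) \<le> Sup (snd q)" using K[of "fst q" "snd q"] by fastforce
          then show "0 \<le> e * (Sup (snd q) - Inf (snd q))" using \<open>e > 0\<close> by simp
        qed (use finp in auto)
        also have "\<dots> = e1"
          unfolding e1_def ba(1) by (simp add: sum_distrib_left split_def)
        finally have A: "\<bar>\<Sum>q\<in>p - pb. measure lborel (snd q) * g (fst q) - (f (Sup (snd q)) - f (Inf (snd q)))\<bar> \<le> e1" .
        have B: "\<bar>\<Sum>q\<in>pb. - (f (Sup (snd q)) - f (Inf (snd q)))\<bar> \<le> (\<Sum>q\<in>pb. \<bar>f (Sup (snd q)) - f (Inf (snd q))\<bar>)"
          by (rule order_trans[OF sum_abs]) (auto simp: abs_minus_commute)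
        have "measure lborel (cbox a b) = b - a" using ab by simp
        then have "e0 * measure lborel (cbox a b) = e1 + e1" by (simp add: e1_def e_def)
        then show "norm ((\<Sum>(x, k)\<in>p. measure lborel k *\<^sub>R g x) - (f b - f a)) \<le> e0 * measure lborel (cbox a b)"
          unfolding eq real_norm_def using A B bad by linarith
      qed
    qed
  qed
  then show ?thesis
  proof (rule has_integral_spike[rotated 2])
    show "negligible N" using N by (simp add: negligible_iff_null_sets null_sets_completionI)
  qed (auto simp: g_def)
qed

section \<open>Bounded measurable functions and their primitives\<close>

abbreviation prim :: "(real \<Rightarrow> real) \<Rightarrow> real \<Rightarrow> real" where
  "prim f t \<equiv> (LINT s:{0..t}|lborel. f s)"

text \<open>One class serves for coefficients and for paths: it contains the cadlag functions and
  the primitives, is closed under the algebraic operations and makes integrals over subintervals of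
  \<open>{0..T}\<close> exist. Measurability is relative to \<open>{0..T}\<close> because nothing is
  assumed outside the horizon.\<close>

definition bdm :: "real \<Rightarrow> (real \<Rightarrow> real) \<Rightarrow> bool" where
  "bdm T f \<longleftrightarrow> f \<in> borel_measurable (restrict_space borel {0..T}) \<and> (\<exists>B. \<forall>t\<in>{0..T}. \<bar>f t\<bar> \<le> B)"

lemma bdmI: "f \<in> borel_measurable (restrict_space borel {0..T}) \<Longrightarrow> (\<And>t. t \<in> {0..T} \<Longrightarrow> \<bar>f t\<bar> \<le> B) \<Longrightarrow> bdm T f"
  unfolding bdm_def by blast

lemma bdm_meas: "bdm T f \<Longrightarrow> f \<in> borel_measurable (restrict_space borel {0..T})"
  unfolding bdm_def by blast

lemma bdm_bound: assumes "bdm T f" obtains B where "B \<ge> 0" "\<And>t. t \<in> {0..T} \<Longrightarrow> \<bar>f t\<bar> \<le> B"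
proof -
  obtain B where B: "\<forall>t\<in>{0..T}. \<bar>f t\<bar> \<le> B" using assms unfolding bdm_def by blast
  show ?thesis
  proof (rule that[of "\<bar>B\<bar>"])
    fix t assume "t \<in> {0..T}"
    then have "\<bar>f t\<bar> \<le> B" using B by blast
    then show "\<bar>f t\<bar> \<le> \<bar>B\<bar>" by linarith
  qed simp
qed

lemma bdm_cong: "(\<And>t. t \<in> {0..T} \<Longrightarrow> f t = g t) \<Longrightarrow> bdm T f = bdm T g"
proof -
  assume a: "\<And>t. t \<in> {0..T} \<Longrightarrow> f t = g t"
  have "f \<in> borel_measurable (restrict_space borel {0..T}) \<longleftrightarrow> g \<in> borel_measurable (restrict_space borel {0..T})"
    by (rule measurable_cong) (use a in \<open>auto simp: space_restrict_space\<close>)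
  then show ?thesis unfolding bdm_def using a by auto
qed

lemma bdm_const [simp]: "bdm T (\<lambda>t. c)"
  by (rule bdmI[of _ _ "\<bar>c\<bar>"]) auto

lemma bdm_add: assumes "bdm T f" "bdm T g" shows "bdm T (\<lambda>t. f t + g t)"
proof -
  obtain A where A: "\<And>t. t \<in> {0..T} \<Longrightarrow> \<bar>f t\<bar> \<le> A" using bdm_bound[OF assms(1)] by blast
  obtain B where B: "\<And>t. t \<in> {0..T} \<Longrightarrow> \<bar>g t\<bar> \<le> B" using bdm_bound[OF assms(2)] by blast
  have "\<bar>f t + g t\<bar> \<le> A + B" if "t \<in> {0..T}" for t
    using A[OF that] B[OF that] by linarith
  then show ?thesis
    using assms[THEN bdm_meas] by (intro bdmI[of _ _ "A + B"] borel_measurable_add) auto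
qed

lemma bdm_mult: assumes "bdm T f" "bdm T g" shows "bdm T (\<lambda>t. f t * g t)"
proof -
  obtain A where A: "A \<ge> 0" "\<And>t. t \<in> {0..T} \<Longrightarrow> \<bar>f t\<bar> \<le> A" using bdm_bound[OF assms(1)] by blast
  obtain B where B: "B \<ge> 0" "\<And>t. t \<in> {0..T} \<Longrightarrow> \<bar>g t\<bar> \<le> B" using bdm_bound[OF assms(2)] by blast
  have "\<bar>f t * g t\<bar> \<le> A * B" if "t \<in> {0..T}" for t
    unfolding abs_mult by (rule mult_mono[OF A(2)[OF that] B(2)[OF that]]) (use A in auto)
  then show ?thesis
    using assms[THEN bdm_meas] by (intro bdmI[of _ _ "A * B"] borel_measurable_times) auto
qed

lemma bdm_minus: assumes "bdm T f" shows "bdm T (\<lambda>t. - f t)"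
  using bdm_mult[OF bdm_const[of T "-1"] assms] by simp

lemma bdm_diff: assumes "bdm T f" "bdm T g" shows "bdm T (\<lambda>t. f t - g t)"
  using bdm_add[OF assms(1) bdm_minus[OF assms(2)]] by simp

lemma bdm_power2: assumes "bdm T f" shows "bdm T (\<lambda>t. (f t)^2)"
  unfolding power2_eq_square by (rule bdm_mult[OF assms assms])

lemma bdm_divide:
  assumes "bdm T f" "bdm T g" "\<delta> > 0" "\<And>t. t \<in> {0..T} \<Longrightarrow> \<delta> \<le> g t"
  shows "bdm T (\<lambda>t. f t / g t)"
proof -
  obtain A where A: "A \<ge> 0" "\<And>t. t \<in> {0..T} \<Longrightarrow> \<bar>f t\<bar> \<le> A" using bdm_bound[OF assms(1)] by blast
  have "\<bar>f t / g t\<bar> \<le> A / \<delta>" if "t \<in> {0..T}" for t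
    using A(1) A(2)[OF that] assms(3) assms(4)[OF that] by (simp add: frac_le)
  then show ?thesis
    using assms(1,2)[THEN bdm_meas] by (intro bdmI[of _ _ "A / \<delta>"] borel_measurable_divide) auto
qed

lemma bdm_continuous: assumes "continuous_on {0..T} f" shows "bdm T f"
proof -
  have "compact (f ` {0..T})" using assms by (intro compact_continuous_image) auto
  then have "bounded (f ` {0..T})" by (rule compact_imp_bounded)
  then obtain B where "\<And>t. t \<in> {0..T} \<Longrightarrow> \<bar>f t\<bar> \<le> B" unfolding bounded_iff by fastforce
  then show ?thesis
    by (intro bdmI borel_measurable_continuous_on_restrict assms)
qed

lemma bdm_set_borel_measurable:
  assumes "bdm T f" "0 \<le> a" "b \<le> T" shows "set_borel_measurable lborel {a..b} f"
proof -
  have "f \<in> borel_measurable (restrict_space borel {a..b})"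
    by (rule measurable_restrict_mono[OF bdm_meas[OF assms(1)]]) (use assms in auto)
  then show ?thesis
    unfolding set_borel_measurable_def by (subst (asm) borel_measurable_restrict_space_iff) auto
qed

lemma set_integrable_bounded:
  fixes f :: "real \<Rightarrow> real"
  assumes "set_borel_measurable lborel {a..b} f" "\<And>t. t \<in> {a..b} \<Longrightarrow> \<bar>f t\<bar> \<le> B"
  shows "set_integrable lborel {a..b} f"
  unfolding set_integrable_def
proof (rule Bochner_Integration.integrable_bound)
  show "integrable lborel (\<lambda>t. indicator {a..b} t *\<^sub>R B)"
    by (intro integrable_scaleR_left) (auto simp: integrable_indicator_iff emeasure_lborel_Icc_eq)
  show "(\<lambda>x. indicator {a..b} x *\<^sub>R f x) \<in> borel_measurable lborel"
    using assms(1) unfolding set_borel_measurable_def .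
  show "AE x in lborel. norm (indicator {a..b} x *\<^sub>R f x) \<le> norm (indicator {a..b} x *\<^sub>R B)"
  proof (rule AE_I2)
    fix x show "norm (indicator {a..b} x *\<^sub>R f x) \<le> norm (indicator {a..b} x *\<^sub>R B)"
      using assms(2)[of x] by (auto split: split_indicator)
  qed
qed

lemma bdm_set_integrable:
  assumes "bdm T f" "0 \<le> a" "b \<le> T" shows "set_integrable lborel {a..b} f"
proof -
  obtain B where "\<And>t. t \<in> {0..T} \<Longrightarrow> \<bar>f t\<bar> \<le> B" using bdm_bound[OF assms(1)] by blast
  then show ?thesis
    using bdm_set_borel_measurable[OF assms] assms by (intro set_integrable_bounded[of a b f B]) auto
qed

lemma set_integral_bound:
  fixes f :: "real \<Rightarrow> real"
  assumes "a \<le> b" "\<And>t. t \<in> {a..b} \<Longrightarrow> \<bar>f t\<bar> \<le> B"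
  shows "\<bar>LINT s:{a..b}|lborel. f s\<bar> \<le> B * (b - a)"
proof (cases "set_integrable lborel {a..b} f")
  case True
  have c: "set_integrable lborel {a..b} (\<lambda>s. B)"
    by (simp add: set_integrable_def integrable_indicator_iff emeasure_lborel_Icc_eq)
  have "\<bar>LINT s:{a..b}|lborel. f s\<bar> \<le> (LINT s:{a..b}|lborel. \<bar>f s\<bar>)"
    using set_integral_norm_bound[OF True] by simp
  also have "\<dots> \<le> (LINT s:{a..b}|lborel. B)"
    by (rule set_integral_mono) (use True c assms(2) set_integrable_abs in auto)
  also have "\<dots> = B * (b - a)" using assms(1) by (simp add: set_lebesgue_integral_def)
  finally show ?thesis .
next
  case False
  \<comment> \<open>The integral of a non-integrable function is \<open>0\<close> by convention, so
    the bound persists in this case too.\<close>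
  have "0 \<le> B" using assms(2)[of a] assms(1) by auto
  then show ?thesis using False assms(1)
    by (simp add: set_lebesgue_integral_def set_integrable_def not_integrable_integral_eq)
qed

lemma set_integral_singleton_lborel [simp]:
  fixes a :: real and f :: "real \<Rightarrow> real"
  shows "(LINT s:{a}|lborel. f s) = 0"
proof -
  have "AE s in lborel. indicator {a} s *\<^sub>R f s = 0"
    using AE_lborel_singleton[of a] by (auto elim!: eventually_mono)
  then show ?thesis unfolding set_lebesgue_integral_def by (rule integral_eq_zero_AE)
qed

lemma prim_zero: "prim f 0 = 0"
  by simp

lemma set_integral_Icc_split:
  fixes f :: "real \<Rightarrow> real"
  assumes "a \<le> b" "b \<le> c" "set_integrable lborel {a..c} f"
  shows "(LINT s:{a..c}|lborel. f s) = (LINT s:{a..b}|lborel. f s) + (LINT s:{b..c}|lborel. f s)"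
proof -
  have "set_integrable lborel {a..b} f" "set_integrable lborel {b..c} f"
    by (rule set_integrable_subset[OF assms(3)]; use assms in auto)+
  moreover have "(LINT s:{a..b} \<union> {b..c}|lborel. f s) = (LINT s:{a..b}|lborel. f s) + (LINT s:{b..c}|lborel. f s)"
  proof (rule set_integral_Un_AE)
    show "AE x in lborel. \<not> (x \<in> {a..b} \<and> x \<in> {b..c})"
      using AE_lborel_singleton[of b] by eventually_elim auto
  qed (use calculation in auto)
  moreover have "{a..b} \<union> {b..c} = {a..c}" using assms by auto
  ultimately show ?thesis by simp
qed

lemma prim_diff:
  assumes "bdm T f" "0 \<le> a" "a \<le> b" "b \<le> T"
  shows "prim f b - prim f a = (LINT s:{a..b}|lborel. f s)"
  using set_integral_Icc_split[of 0 a b f] bdm_set_integrable[OF assms(1), of 0 b] assms by simp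

lemma prim_lipschitz:
  assumes "bdm T f" obtains B where "B \<ge> 0"
    "\<And>a b. 0 \<le> a \<Longrightarrow> a \<le> b \<Longrightarrow> b \<le> T \<Longrightarrow> \<bar>prim f b - prim f a\<bar> \<le> B * (b - a)"
    "\<And>t. t \<in> {0..T} \<Longrightarrow> \<bar>f t\<bar> \<le> B"
proof -
  obtain B where B: "B \<ge> 0" "\<And>t. t \<in> {0..T} \<Longrightarrow> \<bar>f t\<bar> \<le> B" using bdm_bound[OF assms] by blast
  have "\<bar>prim f b - prim f a\<bar> \<le> B * (b - a)" if "0 \<le> a" "a \<le> b" "b \<le> T" for a b
    unfolding prim_diff[OF assms that] by (rule set_integral_bound) (use that B in auto)
  then show ?thesis by (rule that[OF B(1) _ B(2)])
qed

lemma prim_continuous: assumes "bdm T f" shows "continuous_on {0..T} (prim f)"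
proof -
  obtain B where B: "B \<ge> 0" "\<And>a b. 0 \<le> a \<Longrightarrow> a \<le> b \<Longrightarrow> b \<le> T \<Longrightarrow> \<bar>prim f b - prim f a\<bar> \<le> B * (b - a)"
    using prim_lipschitz[OF assms] by metis
  have "B-lipschitz_on {0..T} (prim f)"
  proof (rule lipschitz_onI)
    fix x y assume xy: "x \<in> {0..T}" "y \<in> {0..T}"
    show "dist (prim f x) (prim f y) \<le> B * dist x y"
    proof (cases "x \<le> y")
      case True then show ?thesis using B(2)[of x y] xy by (auto simp: dist_real_def abs_minus_commute)
    next
      case False then show ?thesis using B(2)[of y x] xy by (auto simp: dist_real_def)
    qed
  qed (rule B)
  then show ?thesis by (rule lipschitz_on_continuous_on)
qed

lemma bdm_prim: "bdm T f \<Longrightarrow> bdm T (prim f)"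
  by (rule bdm_continuous, rule prim_continuous)

lemma prim_add: "bdm T f \<Longrightarrow> bdm T g \<Longrightarrow> t \<in> {0..T} \<Longrightarrow> prim (\<lambda>s. f s + g s) t = prim f t + prim g t"
  by (rule set_integral_add) (auto intro: bdm_set_integrable)

lemma prim_diff_fun: "bdm T f \<Longrightarrow> bdm T g \<Longrightarrow> t \<in> {0..T} \<Longrightarrow> prim (\<lambda>s. f s - g s) t = prim f t - prim g t"
  by (rule set_integral_diff) (auto intro: bdm_set_integrable)

lemma prim_cmult: "prim (\<lambda>s. c * f s) t = c * prim f t"
  by (rule set_integral_mult_right)

lemma prim_cong: "(\<And>s. s \<in> {0..t} \<Longrightarrow> f s = g s) \<Longrightarrow> prim f t = prim g t"
  by (rule set_lebesgue_integral_cong) auto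

lemma set_integral_cong_AE_Icc:
  fixes f g :: "real \<Rightarrow> real"
  assumes "set_borel_measurable lborel {a..b} f" "set_borel_measurable lborel {a..b} g"
    "AE s in lborel. s \<in> {a<..<b} \<longrightarrow> f s = g s"
  shows "(LINT s:{a..b}|lborel. f s) = (LINT s:{a..b}|lborel. g s)"
  unfolding set_lebesgue_integral_def
proof (rule integral_cong_AE)
  show "AE x in lborel. indicat_real {a..b} x *\<^sub>R f x = indicat_real {a..b} x *\<^sub>R g x"
    using assms(3) AE_lborel_singleton[of a] AE_lborel_singleton[of b]
    by eventually_elim (auto split: split_indicator)
qed (use assms in \<open>auto simp: set_borel_measurable_def\<close>)

text \<open>A quadratic bound on increments forces the derivative to vanish at every point. The
  chain rule below is thereby reduced to an estimate of its error over short intervals.\<close>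

lemma quadratic_increments_const:
  fixes G :: "real \<Rightarrow> real"
  assumes q: "\<And>a b. 0 \<le> a \<Longrightarrow> a \<le> b \<Longrightarrow> b \<le> T \<Longrightarrow> \<bar>G b - G a\<bar> \<le> C * (b - a)^2" and t: "t \<in> {0..T}"
  shows "G t = G 0"
proof -
  have "(G has_derivative (\<lambda>h. 0)) (at x within {0..T})" if x: "x \<in> {0..T}" for x
    unfolding has_derivative_within_alt
  proof (intro conjI allI impI)
    fix e :: real assume e: "0 < e"
    have "norm (G y - G x - 0) \<le> e * norm (y - x)" if y: "y \<in> {0..T}" "norm (y - x) < e / (\<bar>C\<bar> + 1)" for y
    proof -
      have "\<bar>G y - G x\<bar> \<le> C * (y - x)^2"
        using q[of x y] q[of y x] x y by (cases "x \<le> y") (auto simp: abs_minus_commute power2_commute)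
      also have "\<dots> \<le> (\<bar>C\<bar> + 1) * (y - x)^2" by (intro mult_right_mono) auto
      also have "\<dots> = (\<bar>C\<bar> + 1) * \<bar>y - x\<bar> * \<bar>y - x\<bar>" by (simp add: power2_eq_square)
      also have "\<dots> \<le> e * \<bar>y - x\<bar>"
        using y(2) by (intro mult_right_mono) (auto simp: field_simps)
      finally show ?thesis by simp
    qed
    moreover have "e / (\<bar>C\<bar> + 1) > 0" using e by auto
    ultimately show "\<exists>d>0. \<forall>y\<in>{0..T}. norm (y - x) < d \<longrightarrow> norm (G y - G x - 0) \<le> e * norm (y - x)" by blast
  qed auto
  then have "\<exists>c. \<forall>x\<in>{0..T}. G x = c"
    by (intro has_derivative_zero_constant) auto
  then show ?thesis using t by force
qed

text \<open>A Lipschitz function together with a chosen bounded density. Carrying the density as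
  data, rather than as a derivative, lets product, quotient and chain rules be computed without
  discussing where derivatives exist.\<close>

definition is_prim :: "real \<Rightarrow> (real \<Rightarrow> real) \<Rightarrow> (real \<Rightarrow> real) \<Rightarrow> bool" where
  "is_prim T F f \<longleftrightarrow> bdm T f \<and> (\<forall>t\<in>{0..T}. F t = F 0 + prim f t)"

lemma is_primD: "is_prim T F f \<Longrightarrow> t \<in> {0..T} \<Longrightarrow> F t = F 0 + prim f t"
  unfolding is_prim_def by blast

lemma is_prim_bdm_deriv: "is_prim T F f \<Longrightarrow> bdm T f"
  unfolding is_prim_def by blast

lemma is_prim_continuous: assumes "is_prim T F f" shows "continuous_on {0..T} F"
proof -
  have "continuous_on {0..T} (\<lambda>t. F 0 + prim f t)"
    using assms by (intro continuous_intros prim_continuous is_prim_bdm_deriv)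
  then show ?thesis
    by (rule continuous_on_eq) (rule is_primD[OF assms, symmetric])
qed

lemma is_prim_bdm: "is_prim T F f \<Longrightarrow> bdm T F"
  by (rule bdm_continuous, rule is_prim_continuous)

lemma is_prim_diff:
  assumes "is_prim T F f" "0 \<le> a" "a \<le> b" "b \<le> T"
  shows "F b - F a = (LINT s:{a..b}|lborel. f s)"
  using prim_diff[OF is_prim_bdm_deriv[OF assms(1)] assms(2-4)] is_primD[OF assms(1), of a]
    is_primD[OF assms(1), of b] assms by auto

lemma is_prim_lipschitz:
  assumes "is_prim T F f" obtains B where "B \<ge> 0"
    "\<And>a b. a \<in> {0..T} \<Longrightarrow> b \<in> {0..T} \<Longrightarrow> \<bar>F b - F a\<bar> \<le> B * \<bar>b - a\<bar>"
    "\<And>t. t \<in> {0..T} \<Longrightarrow> \<bar>f t\<bar> \<le> B"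
proof -
  obtain B where B: "B \<ge> 0" "\<And>t. t \<in> {0..T} \<Longrightarrow> \<bar>f t\<bar> \<le> B"
    using bdm_bound[OF is_prim_bdm_deriv[OF assms]] by metis
  have *: "\<bar>F b - F a\<bar> \<le> B * (b - a)" if "0 \<le> a" "a \<le> b" "b \<le> T" for a b
    unfolding is_prim_diff[OF assms that] by (rule set_integral_bound) (use that B in auto)
  have "\<bar>F b - F a\<bar> \<le> B * \<bar>b - a\<bar>" if "a \<in> {0..T}" "b \<in> {0..T}" for a b
    using *[of a b] *[of b a] that by (cases "a \<le> b") (auto simp: abs_minus_commute)
  then show ?thesis by (rule that[OF B(1) _ B(2)])
qed

lemma is_prim_prim: "bdm T f \<Longrightarrow> is_prim T (prim f) f"
  unfolding is_prim_def by simp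

lemma is_prim_const: "is_prim T (\<lambda>t. c) (\<lambda>t. 0)"
  unfolding is_prim_def set_lebesgue_integral_def by simp

lemma is_prim_add:
  assumes F: "is_prim T F f" and G: "is_prim T G g"
  shows "is_prim T (\<lambda>t. F t + G t) (\<lambda>t. f t + g t)"
  unfolding is_prim_def
proof (intro conjI ballI)
  note bd = is_prim_bdm_deriv[OF F] is_prim_bdm_deriv[OF G]
  show "bdm T (\<lambda>t. f t + g t)" by (rule bdm_add[OF bd])
  fix t assume t: "t \<in> {0..T}"
  show "F t + G t = F 0 + G 0 + prim (\<lambda>s. f s + g s) t"
    using is_primD[OF F t] is_primD[OF G t] prim_add[OF bd t] by linarith
qed

lemma is_prim_minus_fun:
  assumes F: "is_prim T F f" and G: "is_prim T G g"
  shows "is_prim T (\<lambda>t. F t - G t) (\<lambda>t. f t - g t)"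
  unfolding is_prim_def
proof (intro conjI ballI)
  note bd = is_prim_bdm_deriv[OF F] is_prim_bdm_deriv[OF G]
  show "bdm T (\<lambda>t. f t - g t)" by (rule bdm_diff[OF bd])
  fix t assume t: "t \<in> {0..T}"
  show "F t - G t = F 0 - G 0 + prim (\<lambda>s. f s - g s) t"
    using is_primD[OF F t] is_primD[OF G t] prim_diff_fun[OF bd t] by linarith
qed

lemma is_prim_cmult:
  assumes F: "is_prim T F f" shows "is_prim T (\<lambda>t. c * F t) (\<lambda>t. c * f t)"
  unfolding is_prim_def
proof (intro conjI ballI)
  show "bdm T (\<lambda>t. c * f t)" by (rule bdm_mult[OF bdm_const is_prim_bdm_deriv[OF F]])
  fix t assume t: "t \<in> {0..T}"
  show "c * F t = c * F 0 + prim (\<lambda>s. c * f s) t"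
    unfolding prim_cmult is_primD[OF F t] by (simp add: distrib_left)
qed

lemma is_prim_cong:
  assumes "is_prim T F f" "\<And>t. t \<in> {0..T} \<Longrightarrow> F t = G t" "\<And>t. t \<in> {0..T} \<Longrightarrow> f t = g t"
  shows "is_prim T G g"
proof -
  have bd: "bdm T f" "bdm T g" using is_prim_bdm_deriv[OF assms(1)] bdm_cong[of T f g] assms(3) by auto
  have "G t = G 0 + prim g t" if t: "t \<in> {0..T}" for t
  proof -
    have "prim f t = prim g t" by (rule prim_cong) (use assms(3) t in auto)
    moreover have "0 \<in> {0..T}" using t by auto
    ultimately show ?thesis using is_primD[OF assms(1) t] assms(2)[OF t] assms(2)[of 0] by simp
  qed
  then show ?thesis using bd unfolding is_prim_def by blast
qed

text \<open>Second-order Taylor expansion makes the difference of the two sides a function with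
  quadratically small increments, hence constant; no almost everywhere differentiability is needed.\<close>

lemma is_prim_compose:
  assumes F: "is_prim T F f" and S: "\<And>t. t \<in> {0..T} \<Longrightarrow> F t \<in> S"
    and C: "\<And>x y. x \<in> S \<Longrightarrow> y \<in> S \<Longrightarrow> \<bar>\<phi> y - \<phi> x - \<phi>' x * (y - x)\<bar> \<le> C * (y - x)^2"
    and C': "\<And>x y. x \<in> S \<Longrightarrow> y \<in> S \<Longrightarrow> \<bar>\<phi>' y - \<phi>' x\<bar> \<le> C * \<bar>y - x\<bar>"
  shows "is_prim T (\<lambda>t. \<phi> (F t)) (\<lambda>t. \<phi>' (F t) * f t)"
proof -
  obtain B where B: "B \<ge> 0" "\<And>a b. a \<in> {0..T} \<Longrightarrow> b \<in> {0..T} \<Longrightarrow> \<bar>F b - F a\<bar> \<le> B * \<bar>b - a\<bar>"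
     "\<And>t. t \<in> {0..T} \<Longrightarrow> \<bar>f t\<bar> \<le> B" using is_prim_lipschitz[OF F] by metis
  have "continuous_on {0..T} (\<lambda>t. \<phi>' (F t))"
  proof -
    have "\<bar>C * B\<bar>-lipschitz_on {0..T} (\<lambda>t. \<phi>' (F t))"
    proof (rule lipschitz_onI)
      fix x y assume xy: "x \<in> {0..T}" "y \<in> {0..T}"
      have "\<bar>\<phi>' (F x) - \<phi>' (F y)\<bar> \<le> C * \<bar>F x - F y\<bar>" using C' S xy by blast
      also have "\<dots> \<le> \<bar>C\<bar> * \<bar>F x - F y\<bar>" by (intro mult_right_mono) auto
      also have "\<dots> \<le> \<bar>C\<bar> * (B * \<bar>x - y\<bar>)" using B(2) xy by (intro mult_left_mono) auto
      finally show "dist (\<phi>' (F x)) (\<phi>' (F y)) \<le> \<bar>C * B\<bar> * dist x y"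
        using B(1) by (simp add: dist_real_def abs_mult mult_ac)
    qed auto
    then show ?thesis by (rule lipschitz_on_continuous_on)
  qed
  then have bd: "bdm T (\<lambda>t. \<phi>' (F t) * f t)"
    by (intro bdm_mult bdm_continuous is_prim_bdm_deriv[OF F])
  define G where "G t = \<phi> (F t) - prim (\<lambda>t. \<phi>' (F t) * f t) t" for t
  have "\<bar>G b - G a\<bar> \<le> (2 * \<bar>C\<bar> * B^2) * (b - a)^2" if ab: "0 \<le> a" "a \<le> b" "b \<le> T" for a b
  proof -
    have ab': "a \<in> {0..T}" "b \<in> {0..T}" using ab by auto
    have i1: "bdm T (\<lambda>s. \<phi>' (F a) * f s)" by (rule bdm_mult[OF bdm_const is_prim_bdm_deriv[OF F]])
    have i2: "bdm T (\<lambda>s. (\<phi>' (F s) - \<phi>' (F a)) * f s)"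
      unfolding left_diff_distrib by (rule bdm_diff[OF bd i1])
    have "(LINT s:{a..b}|lborel. \<phi>' (F a) * f s + (\<phi>' (F s) - \<phi>' (F a)) * f s)
      = (LINT s:{a..b}|lborel. \<phi>' (F a) * f s) + (LINT s:{a..b}|lborel. (\<phi>' (F s) - \<phi>' (F a)) * f s)"
      by (rule set_integral_add(2)[OF bdm_set_integrable[OF i1] bdm_set_integrable[OF i2]]) (use ab in auto)
    then have "(LINT s:{a..b}|lborel. \<phi>' (F s) * f s)
      = (LINT s:{a..b}|lborel. \<phi>' (F a) * f s) + (LINT s:{a..b}|lborel. (\<phi>' (F s) - \<phi>' (F a)) * f s)"
      by (simp add: left_diff_distrib)
    then have "(LINT s:{a..b}|lborel. \<phi>' (F s) * f s) = \<phi>' (F a) * (F b - F a)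
       + (LINT s:{a..b}|lborel. (\<phi>' (F s) - \<phi>' (F a)) * f s)"
      using is_prim_diff[OF F ab] by simp
    then have "G b - G a = (\<phi> (F b) - \<phi> (F a) - \<phi>' (F a) * (F b - F a))
       - (LINT s:{a..b}|lborel. (\<phi>' (F s) - \<phi>' (F a)) * f s)"
      using prim_diff[OF bd ab] unfolding G_def by simp
    moreover have "\<bar>\<phi> (F b) - \<phi> (F a) - \<phi>' (F a) * (F b - F a)\<bar> \<le> \<bar>C\<bar> * B^2 * (b - a)^2"
    proof -
      have "\<bar>\<phi> (F b) - \<phi> (F a) - \<phi>' (F a) * (F b - F a)\<bar> \<le> C * (F b - F a)^2" using C S ab' by blast
      also have "\<dots> \<le> \<bar>C\<bar> * (F b - F a)^2" by (intro mult_right_mono) auto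
      also have "(F b - F a)^2 \<le> (B * (b - a))^2"
        using B(2)[OF ab'] ab by (intro power2_le_iff_abs_le[THEN iffD2]) auto
      finally show ?thesis by (simp add: power_mult_distrib mult.assoc mult_left_mono)
    qed
    moreover have "\<bar>LINT s:{a..b}|lborel. (\<phi>' (F s) - \<phi>' (F a)) * f s\<bar> \<le> (\<bar>C\<bar> * (B * (b - a)) * B) * (b - a)"
    proof (rule set_integral_bound[OF ab(2)])
      fix s assume s: "s \<in> {a..b}"
      then have s': "s \<in> {0..T}" using ab by auto
      have "\<bar>\<phi>' (F s) - \<phi>' (F a)\<bar> \<le> C * \<bar>F s - F a\<bar>" using C' S ab' s' by blast
      also have "\<dots> \<le> \<bar>C\<bar> * \<bar>F s - F a\<bar>" by (intro mult_right_mono) auto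
      also have "\<dots> \<le> \<bar>C\<bar> * (B * \<bar>s - a\<bar>)" using B(2) ab' s' by (intro mult_left_mono) auto
      also have "\<dots> \<le> \<bar>C\<bar> * (B * (b - a))" using s B(1) by (intro mult_left_mono) auto
      finally show "\<bar>(\<phi>' (F s) - \<phi>' (F a)) * f s\<bar> \<le> \<bar>C\<bar> * (B * (b - a)) * B"
        unfolding abs_mult using B(3)[OF s'] B(1) ab by (intro mult_mono) auto
    qed
    moreover have "(\<bar>C\<bar> * (B * (b - a)) * B) * (b - a) = \<bar>C\<bar> * B^2 * (b - a)^2"
      by (simp add: power2_eq_square algebra_simps)
    ultimately show ?thesis by linarith
  qed
  then have "G t = G 0" if "t \<in> {0..T}" for t
    by (rule quadratic_increments_const) (use that in auto)
  note eq = this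
  show ?thesis
    unfolding is_prim_def
  proof (intro conjI ballI bd)
    fix t assume "t \<in> {0..T}"
    then show "\<phi> (F t) = \<phi> (F 0) + prim (\<lambda>t. \<phi>' (F t) * f t) t"
      using eq[of t] prim_zero[of "\<lambda>t. \<phi>' (F t) * f t"] unfolding G_def by linarith
  qed
qed

lemma is_prim_square: assumes "is_prim T F f" shows "is_prim T (\<lambda>t. (F t)^2) (\<lambda>t. 2 * F t * f t)"
proof (rule is_prim_compose[OF assms, of UNIV _ _ 2])
  fix x y :: real
  have "y\<^sup>2 - x\<^sup>2 - 2 * x * (y - x) = (y - x)^2" by (simp add: power2_eq_square algebra_simps)
  then show "\<bar>y\<^sup>2 - x\<^sup>2 - 2 * x * (y - x)\<bar> \<le> 2 * (y - x)\<^sup>2" by simp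
  show "\<bar>2 * y - 2 * x\<bar> \<le> 2 * \<bar>y - x\<bar>" by (simp add: abs_if)
qed auto

lemma is_prim_mult:
  assumes F: "is_prim T F f" and G: "is_prim T G g"
  shows "is_prim T (\<lambda>t. F t * G t) (\<lambda>t. f t * G t + F t * g t)"
proof -
  \<comment> \<open>Polarization reduces the product rule to the rule for squares.\<close>
  have "is_prim T (\<lambda>t. 1/4 * ((F t + G t)^2 - (F t - G t)^2))
     (\<lambda>t. 1/4 * (2 * (F t + G t) * (f t + g t) - 2 * (F t - G t) * (f t - g t)))"
    by (intro is_prim_cmult is_prim_minus_fun is_prim_square is_prim_add F G)
  then show ?thesis
    by (rule is_prim_cong) (simp_all add: power2_eq_square algebra_simps)
qed

lemma is_prim_inverse:
  assumes F: "is_prim T F f" and \<delta>: "\<delta> > 0" "\<And>t. t \<in> {0..T} \<Longrightarrow> \<delta> \<le> F t"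
  shows "is_prim T (\<lambda>t. 1 / F t) (\<lambda>t. - f t / (F t)^2)"
proof -
  define C where "C = max (1 / \<delta>^3) (2 / \<delta>^3)"
  \<comment> \<open>On \<open>{\<delta>..}\<close> the Taylor remainder of \<open>1 / x\<close> has
    constant \<open>1 / \<delta>^3\<close>, and its derivative is Lipschitz with constant
    \<open>2 / \<delta>^3\<close>; the larger of the two serves for both conditions.\<close>
  have "is_prim T (\<lambda>t. 1 / F t) (\<lambda>t. (- 1 / (F t)^2) * f t)"
  proof (rule is_prim_compose[OF F, of "{\<delta>..}" _ _ "2 / \<delta>^3"])
    fix x y assume xy: "x \<in> {\<delta>..}" "y \<in> {\<delta>..}"
    then have p: "x > 0" "y > 0" using \<delta>(1) by auto
    have *: "1 / (x^2 * y) \<le> 1 / \<delta>^3"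
    proof -
      have "\<delta>^3 = \<delta>^2 * \<delta>" by (simp add: power3_eq_cube power2_eq_square)
      also have "\<dots> \<le> x^2 * y" using xy \<delta> p by (intro mult_mono power_mono) auto
      finally show ?thesis using \<delta>(1) p by (intro divide_left_mono) auto
    qed
    have "1 / y - 1 / x - (- 1 / x^2) * (y - x) = (y - x)^2 * (1 / (x^2 * y))"
      using p by (simp add: field_simps power2_eq_square)
    also have "\<bar>\<dots>\<bar> \<le> (y - x)^2 * (1 / \<delta>^3)" unfolding abs_mult using * p by (intro mult_mono) auto
    also have "\<dots> \<le> 2 / \<delta>^3 * (y - x)^2" using \<delta>(1) by (simp add: field_simps)
    finally show "\<bar>1 / y - 1 / x - (- 1 / x^2) * (y - x)\<bar> \<le> 2 / \<delta>^3 * (y - x)^2" .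
    have **: "1 / (x * y^2) \<le> 1 / \<delta>^3"
    proof -
      have "\<delta>^3 = \<delta> * \<delta>^2" by (simp add: power3_eq_cube power2_eq_square)
      also have "\<dots> \<le> x * y^2" using xy \<delta> p by (intro mult_mono power_mono) auto
      finally show ?thesis using \<delta>(1) p by (intro divide_left_mono) auto
    qed
    have "(- 1 / y^2) - (- 1 / x^2) = (y - x) * (1 / (x^2 * y) + 1 / (x * y^2))"
      using p by (simp add: field_simps power2_eq_square)
    also have "\<bar>\<dots>\<bar> = \<bar>y - x\<bar> * (1 / (x^2 * y) + 1 / (x * y^2))" unfolding abs_mult using p by simp
    also have "\<dots> \<le> \<bar>y - x\<bar> * (2 / \<delta>^3)" using * ** by (intro mult_left_mono) auto
    finally show "\<bar>(- 1 / y^2) - (- 1 / x^2)\<bar> \<le> 2 / \<delta>^3 * \<bar>y - x\<bar>" by (simp add: mult.commute)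
  qed (use \<delta> in auto)
  then show ?thesis by (rule is_prim_cong) auto
qed

lemma is_prim_exp:
  assumes F: "is_prim T F f" shows "is_prim T (\<lambda>t. exp (F t)) (\<lambda>t. exp (F t) * f t)"
proof -
  obtain B where B: "B \<ge> 0" "\<And>t. t \<in> {0..T} \<Longrightarrow> \<bar>F t\<bar> \<le> B" using bdm_bound[OF is_prim_bdm[OF F]] by metis
  have key: "\<bar>exp y - exp x\<bar> \<le> exp B * \<bar>y - x\<bar>" if "x \<in> {-B..B}" "y \<in> {-B..B}" for x y :: real
  proof -
    have "norm (exp y - exp x) \<le> exp B * norm (y - x)"
      by (rule field_differentiable_bound[of "{-B..B}" exp exp])
        (use that in \<open>auto intro: DERIV_exp[THEN has_field_derivative_at_within]\<close>)
    then show ?thesis by simp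
  qed
  show ?thesis
  proof (rule is_prim_compose[OF F, of "{-B..B}" _ _ "exp B"])
    fix x y :: real assume xy: "x \<in> {-B..B}" "y \<in> {-B..B}"
    show "\<bar>exp y - exp x\<bar> \<le> exp B * \<bar>y - x\<bar>" using key xy .
    \<comment> \<open>The mean value bound is applied to \<open>exp z - z * exp x\<close>. Its
      derivative \<open>exp z - exp x\<close> is itself at most
      \<open>exp B * \<bar>y - x\<bar>\<close> on the segment, and this produces the quadratic
      remainder.\<close>
    have "norm ((exp y - y * exp x) - (exp x - x * exp x)) \<le> (exp B * \<bar>y - x\<bar>) * norm (y - x)"
    proof (rule field_differentiable_bound[of "closed_segment x y" _ "\<lambda>z. exp z - exp x"])
      fix z assume z: "z \<in> closed_segment x y"
      show "((\<lambda>z. exp z - z * exp x) has_field_derivative exp z - exp x) (at z within closed_segment x y)"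
        by (auto intro!: derivative_eq_intros)
      have "z \<in> {-B..B}" "\<bar>z - x\<bar> \<le> \<bar>y - x\<bar>"
        using z xy by (auto simp: closed_segment_eq_real_ivl split: if_splits)
      then show "norm (exp z - exp x) \<le> exp B * \<bar>y - x\<bar>"
        using key[of x z] xy by (auto intro: order_trans mult_left_mono)
    qed auto
    then show "\<bar>exp y - exp x - exp x * (y - x)\<bar> \<le> exp B * (y - x)^2"
      by (simp add: algebra_simps power2_eq_square abs_mult_self_eq)
  next
    fix t assume "t \<in> {0..T}"
    then have "\<bar>F t\<bar> \<le> B" by (rule B)
    then show "F t \<in> {-B..B}" by (simp add: abs_le_iff)
  qed
qed

text \<open>One-sided limits bound the function near every point, and compactness of
  \<open>{0..T}\<close> selects finitely many such neighbourhoods; the sum of their bounds is a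
  global one.\<close>

lemma cadlag_bounded:
  assumes "cadlag_on 0 T f" obtains B where "B \<ge> 0" "\<And>t. t \<in> {0..T} \<Longrightarrow> \<bar>f t\<bar> \<le> B"
proof -
  have "\<exists>d>0. \<exists>B. \<forall>s\<in>{0..T}. \<bar>s - t\<bar> < d \<longrightarrow> \<bar>f s\<bar> \<le> B" if t: "t \<in> {0..T}" for t
  proof -
    obtain d1 B1 where d1: "d1 > 0" "\<forall>s\<in>{0..T}. t < s \<and> s < t + d1 \<longrightarrow> \<bar>f s\<bar> \<le> B1"
    proof (cases "t < T")
      case True
      then have "(f \<longlongrightarrow> f t) (at_right t)" using assms t unfolding cadlag_on_def by auto
      then have "\<forall>\<^sub>F s in at_right t. dist (f s) (f t) < 1" by (rule tendstoD) auto
      then obtain b where b: "b > t" "\<And>s. s > t \<Longrightarrow> s < b \<Longrightarrow> dist (f s) (f t) < 1"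
        unfolding eventually_at_right_field by blast
      have "\<bar>f s\<bar> \<le> \<bar>f t\<bar> + 1" if "s > t" "s < b" for s
        using b(2)[OF that] by (simp add: dist_real_def)
      then show ?thesis using b(1) by (intro that[of "b - t"]) auto
    qed (rule that[of 1 0], auto)
    obtain d2 B2 where d2: "d2 > 0" "\<forall>s\<in>{0..T}. s < t \<and> t - d2 < s \<longrightarrow> \<bar>f s\<bar> \<le> B2"
    proof (cases "0 < t")
      case True
      then have "t \<in> {0<..T}" using t by auto
      then obtain l where "(f \<longlongrightarrow> l) (at_left t)" using assms unfolding cadlag_on_def by blast
      then have "\<forall>\<^sub>F s in at_left t. dist (f s) l < 1" by (rule tendstoD) auto
      then obtain b where b: "b < t" "\<And>s. s > b \<Longrightarrow> s < t \<Longrightarrow> dist (f s) l < 1"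
        unfolding eventually_at_left_field by blast
      have "\<bar>f s\<bar> \<le> \<bar>l\<bar> + 1" if "s < t" "s > b" for s
        using b(2)[OF that(2,1)] by (simp add: dist_real_def)
      then show ?thesis using b(1) by (intro that[of "t - b"]) auto
    qed (rule that[of 1 0], auto)
    have "\<forall>s\<in>{0..T}. \<bar>s - t\<bar> < min d1 d2 \<longrightarrow> \<bar>f s\<bar> \<le> max \<bar>f t\<bar> (max B1 B2)"
    proof (intro ballI impI)
      fix s assume s: "s \<in> {0..T}" "\<bar>s - t\<bar> < min d1 d2"
      consider "s = t" | "s > t" | "s < t" by linarith
      then show "\<bar>f s\<bar> \<le> max \<bar>f t\<bar> (max B1 B2)"
        using s d1(2)[rule_format, of s] d2(2)[rule_format, of s] by cases auto
    qed
    moreover have "min d1 d2 > 0" using d1 d2 by auto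
    ultimately show ?thesis by blast
  qed
  then have "\<forall>t\<in>{0..T}. \<exists>d. d > 0 \<and> (\<exists>B. \<forall>s\<in>{0..T}. \<bar>s - t\<bar> < d \<longrightarrow> \<bar>f s\<bar> \<le> B)" by blast
  from bchoice[OF this] obtain d
    where d: "\<forall>t\<in>{0..T}. d t > 0 \<and> (\<exists>B. \<forall>s\<in>{0..T}. \<bar>s - t\<bar> < d t \<longrightarrow> \<bar>f s\<bar> \<le> B)" ..
  then have "\<forall>t\<in>{0..T}. \<exists>B. \<forall>s\<in>{0..T}. \<bar>s - t\<bar> < d t \<longrightarrow> \<bar>f s\<bar> \<le> B" by blast
  from bchoice[OF this] obtain B
    where B: "\<forall>t\<in>{0..T}. \<forall>s\<in>{0..T}. \<bar>s - t\<bar> < d t \<longrightarrow> \<bar>f s\<bar> \<le> B t" ..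
  have d0: "d t > 0" if "t \<in> {0..T}" for t using d that by blast
  have dB: "\<bar>f s\<bar> \<le> B t" if "t \<in> {0..T}" "s \<in> {0..T}" "\<bar>s - t\<bar> < d t" for t s
    using B that by blast
  have cov: "{0..T} \<subseteq> (\<Union>t\<in>{0..T}. ball t (d t))"
  proof
    fix x assume x: "x \<in> {0..T}"
    then have "x \<in> ball x (d x)" using d0[OF x] by simp
    then show "x \<in> (\<Union>t\<in>{0..T}. ball t (d t))" using x by blast
  qed
  obtain C where C: "C \<subseteq> {0..T}" "finite C" "{0..T} \<subseteq> (\<Union>t\<in>C. ball t (d t))"
    by (rule compactE_image[OF compact_Icc _ cov]) auto
  have "\<bar>f s\<bar> \<le> (\<Sum>t\<in>C. \<bar>B t\<bar>)" if s: "s \<in> {0..T}" for s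
  proof -
    obtain t where t: "t \<in> C" "s \<in> ball t (d t)" using C(3) s by blast
    then have "\<bar>f s\<bar> \<le> B t" using dB[of t s] C(1) s by (auto simp: dist_real_def abs_minus_commute)
    also have "\<dots> \<le> \<bar>B t\<bar>" by simp
    also have "\<dots> \<le> (\<Sum>t\<in>C. \<bar>B t\<bar>)" by (rule member_le_sum) (use t C in auto)
    finally show ?thesis .
  qed
  then show ?thesis by (intro that[of "\<Sum>t\<in>C. \<bar>B t\<bar>"]) (auto intro: sum_nonneg)
qed

text \<open>Right-continuity makes the process the limit of its values at the next grid point to the
  right, and each such approximation evaluates it at countably many times only. Capping the grid
  point at \<open>t\<close> uses no information later than \<open>t\<close>, which is what
  progressive measurability asks for.\<close>

lemma right_continuous_jointly_measurable:
  fixes X :: "real \<Rightarrow> 'a \<Rightarrow> real"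
  assumes t: "0 \<le> t" and X: "\<And>s. s \<in> {0..t} \<Longrightarrow> X s \<in> borel_measurable N"
    and rc: "\<And>s \<omega>. \<omega> \<in> space N \<Longrightarrow> s \<in> {0..<t} \<Longrightarrow> ((\<lambda>s. X s \<omega>) \<longlongrightarrow> X s \<omega>) (at_right s)"
  shows "(\<lambda>(s, \<omega>). X s \<omega>) \<in> borel_measurable (restrict_space borel {0..t} \<Otimes>\<^sub>M N)"
proof -
  \<comment> \<open>The grid point lies strictly above \<open>s\<close> as long as
    \<open>s < t\<close>, as the one-sided limit demands, and equals \<open>t\<close> for
    \<open>s = t\<close>, where no limit from the right is available.\<close>
  define g where "g n s = min t ((of_int \<lfloor>s * real (Suc n)\<rfloor> + 1) / real (Suc n))" for n s
  define Z where "Z n = (\<lambda>(s, \<omega>). X (max 0 (g n s)) \<omega>)" for n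
  have Zm: "Z n \<in> borel_measurable (restrict_space borel {0..t} \<Otimes>\<^sub>M N)" for n
  proof -
    have "(\<lambda>p. (\<lambda>(i::int) p. X (max 0 (min t ((of_int i + 1) / real (Suc n)))) (snd p)) \<lfloor>fst p * real (Suc n)\<rfloor> p)
      \<in> borel_measurable (restrict_space borel {0..t} \<Otimes>\<^sub>M N)"
    proof (rule measurable_compose_countable[where
          f = "\<lambda>(i::int) p. X (max 0 (min t ((of_int i + 1) / real (Suc n)))) (snd p)" and g = "\<lambda>p. \<lfloor>fst p * real (Suc n)\<rfloor>"])
      fix i :: int
      show "(\<lambda>p. X (max 0 (min t ((real_of_int i + 1) / real (Suc n)))) (snd p))
         \<in> borel_measurable (restrict_space borel {0..t} \<Otimes>\<^sub>M N)"
        using t by (intro measurable_compose[OF measurable_snd X]) auto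
      have [measurable]: "fst \<in> borel_measurable (restrict_space borel {0..t} \<Otimes>\<^sub>M N)"
        by (rule measurable_compose[OF measurable_fst]) (auto intro: measurable_restrict_space1)
      show "(\<lambda>p. \<lfloor>fst p * real (Suc n)\<rfloor>) \<in> measurable (restrict_space borel {0..t} \<Otimes>\<^sub>M N) (count_space UNIV)"
        by measurable
    qed
    then show ?thesis by (simp add: Z_def g_def split_def)
  qed
  show ?thesis
  proof (rule borel_measurable_LIMSEQ_real[OF _ Zm])
    fix p assume "p \<in> space (restrict_space borel {0..t} \<Otimes>\<^sub>M N)"
    then obtain s \<omega> where p: "p = (s, \<omega>)" "s \<in> {0..t}" "\<omega> \<in> space N"
      by (auto simp: space_pair_measure space_restrict_space)
    have "(\<lambda>n. X (max 0 (g n s)) \<omega>) \<longlonglongrightarrow> X s \<omega>"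
    proof (cases "s < t")
      case True
      have gs: "g n s > s" "g n s \<le> s + 1 / real (Suc n)" for n
      proof -
        have "s * real (Suc n) < of_int \<lfloor>s * real (Suc n)\<rfloor> + 1" by linarith
        then show "g n s > s" using True unfolding g_def by (simp add: pos_less_divide_eq)
        have "of_int \<lfloor>s * real (Suc n)\<rfloor> + 1 \<le> s * real (Suc n) + 1" by linarith
        then have "(of_int \<lfloor>s * real (Suc n)\<rfloor> + 1) / real (Suc n) \<le> (s * real (Suc n) + 1) / real (Suc n)"
          by (intro divide_right_mono) auto
        also have "\<dots> = s + 1 / real (Suc n)" by (simp add: add_divide_distrib)
        finally show "g n s \<le> s + 1 / real (Suc n)" unfolding g_def by linarith
      qed
      have "(\<lambda>n. g n s) \<longlonglongrightarrow> s"
      proof (rule tendsto_sandwich[of "\<lambda>n. s" _ _ "\<lambda>n. s + 1 / real (Suc n)"])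
        have "(\<lambda>n. 1 / real (Suc n)) \<longlonglongrightarrow> 0" by (rule LIMSEQ_Suc) (rule lim_1_over_n)
        then show "(\<lambda>n. s + 1 / real (Suc n)) \<longlonglongrightarrow> s" using tendsto_add[OF tendsto_const, of _ 0 _ s] by simp
      qed (use less_imp_le[OF gs(1)] gs(2) in auto)
      then have "filterlim (\<lambda>n. g n s) (at_right s) sequentially"
        by (rule tendsto_imp_filterlim_at_right) (use gs in auto)
      then have "(\<lambda>n. X (g n s) \<omega>) \<longlonglongrightarrow> X s \<omega>"
        using p True by (intro filterlim_compose[OF rc[OF p(3)]]) auto
      moreover have "max 0 (g n s) = g n s" for n using gs(1)[of n] p by auto
      ultimately show ?thesis by simp
    next
      case False
      then have "s = t" using p by auto
      have "g n t = t" for n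
      proof -
        have "t * real (Suc n) \<le> of_int \<lfloor>t * real (Suc n)\<rfloor> + 1" by linarith
        then have "t \<le> (of_int \<lfloor>t * real (Suc n)\<rfloor> + 1) / real (Suc n)" by (simp add: pos_le_divide_eq)
        then show ?thesis unfolding g_def by simp
      qed
      then show ?thesis using \<open>s = t\<close> t by simp
    qed
    then show "(\<lambda>n. Z n p) \<longlonglongrightarrow> (case p of (s, \<omega>) \<Rightarrow> X s \<omega>)" by (simp add: Z_def p)
  qed
qed

lemma right_continuous_measurable:
  fixes f :: "real \<Rightarrow> real"
  assumes "0 \<le> t" "\<And>s. s \<in> {0..<t} \<Longrightarrow> (f \<longlongrightarrow> f s) (at_right s)"
  shows "f \<in> borel_measurable (restrict_space borel {0..t})"
proof -
  have "(\<lambda>(s, \<omega>::unit). f s) \<in> borel_measurable (restrict_space borel {0..t} \<Otimes>\<^sub>M count_space UNIV)"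
    by (rule right_continuous_jointly_measurable[where X = "\<lambda>s \<omega>. f s"]) (use assms in auto)
  then have "(\<lambda>p. case p of (s, \<omega>) \<Rightarrow> f s) \<circ> (\<lambda>s. (s, ())) \<in> borel_measurable (restrict_space borel {0..t})"
    by (rule measurable_comp[rotated]) auto
  then show ?thesis by (simp add: comp_def)
qed

lemma cadlag_bdm: assumes "cadlag_on 0 T f" "0 \<le> T" shows "bdm T f"
proof -
  obtain B where "\<And>t. t \<in> {0..T} \<Longrightarrow> \<bar>f t\<bar> \<le> B" using cadlag_bounded[OF assms(1)] by metis
  then show ?thesis
    using assms by (intro bdmI right_continuous_measurable) (auto simp: cadlag_on_def)
qed

lemma cadlag_continuous: assumes "continuous_on {0..T} f" shows "cadlag_on 0 T f"
  unfolding cadlag_on_def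
proof (intro conjI ballI)
  fix t assume t: "t \<in> {0..<T}"
  then have "(f \<longlongrightarrow> f t) (at t within {0..T})" using assms by (auto simp: continuous_on_def)
  then have "(f \<longlongrightarrow> f t) (at t within {t..T})" by (rule tendsto_within_subset) (use t in auto)
  then show "(f \<longlongrightarrow> f t) (at_right t)" using t at_within_Icc_at_right[of t T] by auto
next
  fix t assume t: "t \<in> {0<..T}"
  then have "(f \<longlongrightarrow> f t) (at t within {0..T})" using assms by (auto simp: continuous_on_def)
  then have "(f \<longlongrightarrow> f t) (at t within {0..t})" by (rule tendsto_within_subset) (use t in auto)
  then show "\<exists>l. (f \<longlongrightarrow> l) (at_left t)" using t at_within_Icc_at_left[of 0 t] by auto
qed

lemma cadlag_add: "cadlag_on a b f \<Longrightarrow> cadlag_on a b g \<Longrightarrow> cadlag_on a b (\<lambda>t. f t + g t)"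
  unfolding cadlag_on_def by (blast intro: tendsto_add)

lemma cadlag_mult: "cadlag_on a b f \<Longrightarrow> cadlag_on a b g \<Longrightarrow> cadlag_on a b (\<lambda>t. f t * g t)" for f :: "real \<Rightarrow> real"
  unfolding cadlag_on_def by (blast intro: tendsto_mult)

lemma cadlag_diff: "cadlag_on a b f \<Longrightarrow> cadlag_on a b g \<Longrightarrow> cadlag_on a b (\<lambda>t. f t - g t)"
  unfolding cadlag_on_def by (blast intro: tendsto_diff)

lemma cadlag_const: "cadlag_on a b (\<lambda>t. c)"
  unfolding cadlag_on_def by auto

section \<open>The state equation along a path\<close>

lemma power2_add_le: "(a + b)^2 \<le> 2 * a^2 + 2 * (b::real)^2"
  using zero_le_power2[of "a - b"] by (simp add: power2_eq_square algebra_simps)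

lemma power2_diff_le: "(a - b)^2 \<le> 2 * a^2 + 2 * (b::real)^2"
  using power2_add_le[of a "- b"] by simp

lemma bdm_subset: assumes "bdm T f" "t \<le> T" shows "bdm t f"
proof -
  obtain B where B: "\<And>t. t \<in> {0..T} \<Longrightarrow> \<bar>f t\<bar> \<le> B" using bdm_bound[OF assms(1)] by blast
  show ?thesis
    by (rule bdmI[of _ _ B], rule measurable_restrict_mono[OF bdm_meas[OF assms(1)]]) (use assms(2) B in auto)
qed

lemma prim_mono_AE:
  assumes "bdm T f" "bdm T g" "t \<in> {0..T}" "AE s in lborel. s \<in> {0<..<T} \<longrightarrow> f s \<le> g s"
  shows "prim f t \<le> prim g t"
proof -
  have i: "set_integrable lborel {0..t} f" "set_integrable lborel {0..t} g"
    using bdm_set_integrable[OF assms(1)] bdm_set_integrable[OF assms(2)] assms(3) by auto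
  have "AE s in lborel. indicator {0..t} s *\<^sub>R f s \<le> indicator {0..t} s *\<^sub>R g s"
    using assms(4) AE_lborel_singleton[of 0] AE_lborel_singleton[of T]
    by eventually_elim (use assms(3) in \<open>auto split: split_indicator\<close>)
  then show ?thesis
    unfolding set_lebesgue_integral_def
    by (rule integral_mono_AE[OF i[unfolded set_integrable_def]])
qed

lemma prim_mono:
  assumes "bdm T f" "bdm T g" "t \<in> {0..T}" "\<And>s. s \<in> {0..T} \<Longrightarrow> f s \<le> g s"
  shows "prim f t \<le> prim g t"
  by (rule prim_mono_AE[OF assms(1-3)]) (use assms(4) in auto)

lemma prim_nonneg: "(\<And>s. s \<in> {0..t} \<Longrightarrow> 0 \<le> f s) \<Longrightarrow> 0 \<le> prim f t"
  unfolding set_lebesgue_integral_def by (intro integral_nonneg_AE) (auto split: split_indicator)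

lemma bdm_abs: assumes "bdm T f" shows "bdm T (\<lambda>t. \<bar>f t\<bar>)"
proof -
  obtain A where "\<And>t. t \<in> {0..T} \<Longrightarrow> \<bar>f t\<bar> \<le> A" using bdm_bound[OF assms(1)] by blast
  then show ?thesis using bdm_meas[OF assms]
    by (intro bdmI[of _ _ "A"] borel_measurable_abs) auto
qed

lemma prim_abs_le: assumes "bdm T f" "t \<in> {0..T}" shows "\<bar>prim f t\<bar> \<le> prim (\<lambda>s. \<bar>f s\<bar>) t"
proof -
  have "set_integrable lborel {0..t} f" using bdm_set_integrable[OF assms(1)] assms(2) by auto
  from set_integral_norm_bound[OF this] show ?thesis by simp
qed

lemma prim_const: "t \<ge> 0 \<Longrightarrow> prim (\<lambda>s. c) t = c * t"
  unfolding set_lebesgue_integral_def by simp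

lemma bdm_id [simp]: "bdm T (\<lambda>t. t)"
  by (intro bdm_continuous continuous_intros)

lemma is_prim_id: "is_prim T (\<lambda>t. t) (\<lambda>t. 1)"
  unfolding is_prim_def by (simp add: prim_const)

lemma prim_id: assumes "T \<ge> 0" shows "prim (\<lambda>t. t) T = T^2 / 2"
proof -
  have "T^2 = prim (\<lambda>s. 2 * s) T"
    using is_primD[OF is_prim_square[OF is_prim_id[of T]], of T] assms by simp
  then show ?thesis unfolding prim_cmult by simp
qed

lemma prim_cauchy_schwarz:
  assumes f: "bdm T f" and t: "t \<in> {0..T}"
  shows "(prim f t)^2 \<le> t * prim (\<lambda>s. (f s)^2) t"
proof (cases "t = 0")
  case False
  then have tp: "t > 0" using t by auto
  \<comment> \<open>Cauchy-Schwarz is the nonnegativity of the integral of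
    \<open>(f s - m)^2\<close> with \<open>m\<close> the mean of \<open>f\<close>.\<close>
  define m where "m = prim f t / t"
  have f2: "bdm T (\<lambda>s. (f s)^2)" and fm: "bdm T (\<lambda>s. 2 * m * f s)"
    by (rule bdm_power2[OF f], rule bdm_mult[OF bdm_const f])
  have "0 \<le> prim (\<lambda>s. (f s)^2 - 2 * m * f s + m^2) t"
  proof (rule prim_nonneg)
    fix s
    have "(f s)^2 - 2 * m * f s + m^2 = (f s - m)^2" by (simp add: power2_eq_square algebra_simps)
    then show "0 \<le> (f s)^2 - 2 * m * f s + m^2" by simp
  qed
  also have "\<dots> = prim (\<lambda>s. (f s)^2) t - 2 * m * prim f t + m^2 * t"
    using prim_add[OF bdm_diff[OF f2 fm] bdm_const t, of "m^2"] prim_diff_fun[OF f2 fm t] t tp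
    by (simp add: prim_cmult prim_const)
  also have "\<dots> = prim (\<lambda>s. (f s)^2) t - (prim f t)^2 / t"
    using tp unfolding m_def by (simp add: field_simps power2_eq_square)
  finally show ?thesis using tp by (simp add: field_simps)
qed simp

lemma prim_mono_endpoint:
  assumes "bdm T f" "t \<in> {0..T}" "\<And>s. s \<in> {0..T} \<Longrightarrow> 0 \<le> f s"
  shows "prim f t \<le> prim f T"
proof -
  have "prim f T - prim f t = (LINT s:{t..T}|lborel. f s)" by (rule prim_diff[OF assms(1)]) (use assms in auto)
  moreover have "0 \<le> (LINT s:{t..T}|lborel. f s)"
    unfolding set_lebesgue_integral_def by (intro integral_nonneg_AE AE_I2) (use assms in \<open>auto split: split_indicator\<close>)
  ultimately show ?thesis by simp
qed

text \<open>The interval has positive measure, so the essential supremum of a bounded function is a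
  nonnegative real and the conversion from extended reals loses nothing. The third claim carries the
  essential bound to the single point \<open>0\<close> by right-continuity, where the initial trade
  of the optimizer calls for it.\<close>

lemma Linf_AE:
  assumes f: "bdm T f" and T: "0 < T"
  shows "AE t in lborel. t \<in> {0<..<T} \<longrightarrow> \<bar>f t\<bar> \<le> Linf T f"
    and "0 \<le> Linf T f"
    and "(f \<longlongrightarrow> f 0) (at_right 0) \<Longrightarrow> \<bar>f 0\<bar> \<le> Linf T f"
proof -
  let ?M = "restrict_space lborel {0<..<T} :: real measure"
  obtain B where B: "B \<ge> 0" "\<And>t. t \<in> {0..T} \<Longrightarrow> \<bar>f t\<bar> \<le> B" using bdm_bound[OF f] by blast
  have "f \<in> borel_measurable (restrict_space borel {0<..<T})"
    by (rule measurable_restrict_mono[OF bdm_meas[OF f]]) auto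
  moreover have "sets ?M = sets (restrict_space borel {0<..<T})" by (simp add: sets_restrict_space)
  ultimately have m: "f \<in> borel_measurable ?M" by (simp cong: measurable_cong_sets)
  have me: "(\<lambda>t. ereal \<bar>f t\<bar>) \<in> borel_measurable ?M" using m by measurable
  define L where "L = esssup ?M (\<lambda>t. ereal \<bar>f t\<bar>)"
  have LB: "L \<le> ereal B"
    unfolding L_def by (rule esssup_I[OF me]) (auto intro!: AE_I2 B simp: space_restrict_space)
  have AE1: "AE t in ?M. ereal \<bar>f t\<bar> \<le> L" unfolding L_def by (rule esssup_AE)
  have nz: "\<not> (AE t in ?M. False)"
  proof
    assume "AE t in ?M. False"
    then have "ae_filter ?M = bot" by (simp add: trivial_limit_def)
    then have "emeasure ?M (space ?M) = 0" by (simp add: ae_filter_eq_bot_iff)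
    then show False using T by (simp add: space_restrict_space emeasure_restrict_space)
  qed
  have L0: "0 \<le> L"
  proof (rule ccontr)
    assume n: "\<not> 0 \<le> L"
    have "AE t in ?M. False" using AE1
    proof eventually_elim
      case (elim t)
      have "0 \<le> ereal \<bar>f t\<bar>" by simp
      then show False using elim n by (meson order_trans)
    qed
    then show False using nz by blast
  qed
  have Lr: "L = ereal (Linf T f)"
    using L0 LB unfolding Linf_def L_def[symmetric] by (cases L) auto
  show 2: "0 \<le> Linf T f" using L0 unfolding Lr by simp
  have "AE t in ?M. \<bar>f t\<bar> \<le> Linf T f" using AE1 unfolding Lr by simp
  then show 1: "AE t in lborel. t \<in> {0<..<T} \<longrightarrow> \<bar>f t\<bar> \<le> Linf T f"
    by (subst (asm) AE_restrict_space_iff) auto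
  assume rc: "(f \<longlongrightarrow> f 0) (at_right 0)"
  show "\<bar>f 0\<bar> \<le> Linf T f"
  proof (rule ccontr)
    assume "\<not> \<bar>f 0\<bar> \<le> Linf T f"
    moreover have "((\<lambda>t. \<bar>f t\<bar>) \<longlongrightarrow> \<bar>f 0\<bar>) (at_right 0)" using rc by (rule tendsto_rabs)
    ultimately have "\<forall>\<^sub>F t in at_right 0. \<bar>f t\<bar> > Linf T f"
      by (intro order_tendstoD(1)) auto
    then obtain b where b: "b > 0" "\<And>t. t > 0 \<Longrightarrow> t < b \<Longrightarrow> \<bar>f t\<bar> > Linf T f"
      unfolding eventually_at_right_field by blast
    have "AE t in lborel. t \<notin> {0<..<min b T}"
      using 1 by eventually_elim (use b(2) in force)
    then have "emeasure lborel {0<..<min b T} = 0"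
      by (subst (asm) AE_iff_measurable[of "{0<..<min b T}"]) auto
    then show False using b T by (auto simp: min_def split: if_splits)
  qed
qed

section \<open>The coefficients and the pathwise state map\<close>

locale coeffs =
  fixes T :: real and \<beta> lam dlam :: "real \<Rightarrow> real"
  assumes T: "0 < T" and coeff: "coefficients T \<beta> lam dlam"
begin

abbreviation "kap t \<equiv> \<beta> t + gamma_dot lam dlam t"
abbreviation "rho t \<equiv> 2 * \<beta> t + gamma_dot lam dlam t"
abbreviation "wgt t \<equiv> rho t / (2 * lam t)"

lemma lam_pos: "t \<in> {0..T} \<Longrightarrow> 0 < lam t" and beta_pos: "t \<in> {0..T} \<Longrightarrow> 0 < \<beta> t"
  using coeff unfolding coefficients_def by blast+

lemma lam_low: obtains \<delta> where "\<delta> > 0" "\<And>t. t \<in> {0..T} \<Longrightarrow> \<delta> \<le> lam t"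
  using coeff unfolding coefficients_def by blast

lemma rho_low: obtains c where "c > 0" "\<And>t. t \<in> {0..T} \<Longrightarrow> c \<le> rho t"
proof -
  obtain c where "c > 0" "\<forall>t\<in>{0..T}. rho t > c" using coeff unfolding coefficients_def by blast
  then show ?thesis by (intro that[of c]) (auto intro: less_imp_le)
qed

lemma rho_pos: assumes "t \<in> {0..T}" shows "0 < rho t"
proof -
  obtain c where "c > 0" "\<And>t. t \<in> {0..T} \<Longrightarrow> c \<le> rho t" using rho_low by blast
  then show ?thesis using assms by force
qed

lemma cadlag_beta: "cadlag_on 0 T \<beta>" and cadlag_dlam: "cadlag_on 0 T dlam"
  using coeff unfolding coefficients_def by blast+

lemma bdm_beta: "bdm T \<beta>" and bdm_dlam: "bdm T dlam"
  using cadlag_bdm cadlag_beta cadlag_dlam T by auto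

text \<open>Absolute continuity is inherited by \<open>{0..t}\<close>, so the fundamental theorem
  applies up to every \<open>t\<close> and exhibits \<open>dlam\<close> as a density. This makes
  \<open>lam\<close> an integrand for which integration by parts is available.\<close>

lemma is_prim_lam: "is_prim T lam dlam"
  unfolding is_prim_def
proof (intro conjI ballI bdm_dlam)
  fix t assume t: "t \<in> {0..T}"
  have ac: "absolutely_continuous_on 0 T lam" and
    AE: "AE t in lborel. t \<in> {0<..<T} \<longrightarrow> (lam has_real_derivative dlam t) (at t)"
    using coeff unfolding coefficients_def by blast+
  have "absolutely_continuous_on 0 t lam"
    unfolding absolutely_continuous_on_def
  proof (intro allI impI)
    fix e :: real assume "e > 0"
    obtain d where d: "d > 0" "\<forall>(n::nat) l r.
        (\<forall>i<n. 0 \<le> l i \<and> l i \<le> r i \<and> r i \<le> T) \<and>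
        disjoint_family_on (\<lambda>i. {l i<..<r i}) {..<n} \<and>
        (\<Sum>i<n. r i - l i) < d \<longrightarrow> (\<Sum>i<n. \<bar>lam (r i) - lam (l i)\<bar>) < e"
      using ac[unfolded absolutely_continuous_on_def, rule_format, OF \<open>e > 0\<close>] by blast
    have "\<forall>(n::nat) l r.
        (\<forall>i<n. 0 \<le> l i \<and> l i \<le> r i \<and> r i \<le> t) \<and>
        disjoint_family_on (\<lambda>i. {l i<..<r i}) {..<n} \<and>
        (\<Sum>i<n. r i - l i) < d \<longrightarrow> (\<Sum>i<n. \<bar>lam (r i) - lam (l i)\<bar>) < e"
    proof (intro allI impI)
      fix n :: nat and l r :: "nat \<Rightarrow> real"
      assume a: "(\<forall>i<n. 0 \<le> l i \<and> l i \<le> r i \<and> r i \<le> t) \<and>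
        disjoint_family_on (\<lambda>i. {l i<..<r i}) {..<n} \<and> (\<Sum>i<n. r i - l i) < d"
      have "0 \<le> l i \<and> l i \<le> r i \<and> r i \<le> T" if "i < n" for i
        using a[THEN conjunct1, rule_format, OF that] t by auto
      then have "\<forall>i<n. 0 \<le> l i \<and> l i \<le> r i \<and> r i \<le> T" by blast
      then show "(\<Sum>i<n. \<bar>lam (r i) - lam (l i)\<bar>) < e"
        by (intro d(2)[THEN spec, THEN spec, THEN spec, THEN mp] conjI a[THEN conjunct2, THEN conjunct1] a[THEN conjunct2, THEN conjunct2])
    qed
    then show "\<exists>d>0. \<forall>(n::nat) l r.
        (\<forall>i<n. 0 \<le> l i \<and> l i \<le> r i \<and> r i \<le> t) \<and>
        disjoint_family_on (\<lambda>i. {l i<..<r i}) {..<n} \<and>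
        (\<Sum>i<n. r i - l i) < d \<longrightarrow> (\<Sum>i<n. \<bar>lam (r i) - lam (l i)\<bar>) < e" using d(1) by blast
  qed
  moreover have "AE s in lborel. s \<in> {0<..<t} \<longrightarrow> (lam has_real_derivative dlam s) (at s)"
    using AE by eventually_elim (use t in auto)
  ultimately have "(dlam has_integral (lam t - lam 0)) {0..t}"
    using t by (intro absolutely_continuous_FTC) auto
  moreover have "set_integrable lborel {0..t} dlam" by (rule bdm_set_integrable[OF bdm_dlam]) (use t in auto)
  ultimately show "lam t = lam 0 + prim dlam t"
    using set_borel_integral_eq_integral(2)[of "{0..t}" dlam] integral_unique[of dlam "lam t - lam 0" "{0..t}"] by simp
qed

lemma bdm_lam: "bdm T lam"
  by (rule is_prim_bdm[OF is_prim_lam])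

lemma bdm_div_lam: assumes "bdm T f" shows "bdm T (\<lambda>t. f t / lam t)"
proof -
  obtain \<delta> where d: "\<delta> > 0" "\<And>t. t \<in> {0..T} \<Longrightarrow> \<delta> \<le> lam t" using lam_low by blast
  show ?thesis by (rule bdm_divide[OF assms bdm_lam d])
qed

lemma bdm_gamma: "bdm T (gamma_dot lam dlam)"
  using bdm_div_lam[OF bdm_dlam] unfolding gamma_dot_def by simp

lemma bdm_kap: "bdm T (\<lambda>t. kap t)"
  by (rule bdm_add[OF bdm_beta bdm_gamma])

lemma bdm_rho: "bdm T (\<lambda>t. rho t)"
  by (rule bdm_add[OF bdm_mult[OF bdm_const bdm_beta] bdm_gamma])

lemma bdm_rho_lam: "bdm T (\<lambda>t. rho t / lam t)"
  by (rule bdm_div_lam[OF bdm_rho])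

lemma bdm_wgt: "bdm T (\<lambda>t. wgt t)"
  using bdm_mult[OF bdm_const bdm_rho_lam, of "1/2"] by (simp add: field_simps)

lemma wgt_pos: "t \<in> {0..T} \<Longrightarrow> 0 < wgt t"
  using rho_pos lam_pos by simp

lemma bdm_theta_dot: "bdm T (\<lambda>t. theta_dot \<beta> lam dlam t)"
proof -
  obtain c where c: "c > 0" "\<And>t. t \<in> {0..T} \<Longrightarrow> c \<le> rho t" using rho_low by blast
  have "bdm T (\<lambda>t. (kap t)^2 / rho t / lam t)"
    by (rule bdm_div_lam[OF bdm_divide[OF bdm_power2[OF bdm_kap] bdm_rho c]])
  then show ?thesis by (rule bdm_cong[THEN iffD1, rotated]) (simp add: theta_dot_def field_simps)
qed

lemma theta_dot_nonneg: "t \<in> {0..T} \<Longrightarrow> 0 \<le> theta_dot \<beta> lam dlam t"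
  unfolding theta_dot_def using rho_pos lam_pos by (intro divide_nonneg_pos mult_pos_pos) auto

lemma is_prim_inv_lam: "is_prim T (\<lambda>t. 1 / lam t) (\<lambda>t. - dlam t / (lam t)^2)"
proof -
  obtain \<delta> where d: "\<delta> > 0" "\<And>t. t \<in> {0..T} \<Longrightarrow> \<delta> \<le> lam t" using lam_low by blast
  show ?thesis by (rule is_prim_inverse[OF is_prim_lam d])
qed

abbreviation "gco t \<equiv> \<beta> t * lam t + dlam t"
abbreviation "EB t \<equiv> exp (prim \<beta> t)"

lemma gco_kap: "t \<in> {0..T} \<Longrightarrow> gco t = lam t * kap t"
  using lam_pos[of t] by (simp add: gamma_dot_def field_simps)

lemma bdm_gco: "bdm T (\<lambda>t. gco t)"
  by (rule bdm_add[OF bdm_mult[OF bdm_beta bdm_lam] bdm_dlam])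

lemma is_prim_EB: "is_prim T (\<lambda>t. EB t) (\<lambda>t. EB t * \<beta> t)"
  by (rule is_prim_exp[OF is_prim_prim[OF bdm_beta]])

lemma is_prim_EBm: "is_prim T (\<lambda>t. exp (- prim \<beta> t)) (\<lambda>t. - (exp (- prim \<beta> t) * \<beta> t))"
proof -
  have "is_prim T (\<lambda>t. - 1 * prim \<beta> t) (\<lambda>t. - 1 * \<beta> t)" by (rule is_prim_cmult[OF is_prim_prim[OF bdm_beta]])
  from is_prim_exp[OF this] show ?thesis by simp
qed

lemma bdm_src: assumes "bdm T q" shows "bdm T (\<lambda>s. EB s * (gco s * q s))"
  by (rule bdm_mult[OF is_prim_bdm[OF is_prim_EB] bdm_mult[OF bdm_gco assms]])

definition zstate :: "real \<Rightarrow> (real \<Rightarrow> real) \<Rightarrow> real \<Rightarrow> real" where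
  "zstate y q t = exp (- prim \<beta> t) * (y - prim (\<lambda>s. EB s * (gco s * q s)) t)"

text \<open>Variation of constants for the smooth part \<open>Y - lam Q\<close> of the state.\<close>

definition pstate :: "real \<Rightarrow> (real \<Rightarrow> real) \<Rightarrow> real \<Rightarrow> real" where
  "pstate y q t = lam t * q t + zstate y q t"

lemma zstate_0 [simp]: "zstate y q 0 = y"
  unfolding zstate_def by simp

lemma is_prim_zstate:
  assumes q: "bdm T q"
  shows "is_prim T (zstate y q) (\<lambda>t. - (\<beta> t * zstate y q t + gco t * q t))"
proof -
  have 1: "is_prim T (\<lambda>t. y - prim (\<lambda>s. EB s * (gco s * q s)) t) (\<lambda>t. 0 - EB t * (gco t * q t))"
    by (rule is_prim_minus_fun[OF is_prim_const is_prim_prim[OF bdm_src[OF q]]])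
  show ?thesis
    by (rule is_prim_cong[OF is_prim_mult[OF is_prim_EBm 1]])
      (simp_all add: zstate_def exp_minus field_simps)
qed

lemma bdm_zstate: "bdm T q \<Longrightarrow> bdm T (zstate y q)"
  by (rule is_prim_bdm[OF is_prim_zstate])

lemma bdm_pstate: assumes "bdm T q" shows "bdm T (pstate y q)"
  unfolding pstate_def[abs_def] by (rule bdm_add[OF bdm_mult[OF bdm_lam assms] bdm_zstate[OF assms]])

text \<open>The integrating factor \<open>EB\<close> turns the linear equation into one whose
  right-hand side no longer contains the unknown, so the initial value determines the
  solution.\<close>

lemma zstate_unique:
  assumes q: "bdm T q" and Z: "is_prim T Z (\<lambda>t. - (\<beta> t * Z t + gco t * q t))" and t: "t \<in> {0..T}"
  shows "Z t = zstate (Z 0) q t"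
proof -
  have "is_prim T (\<lambda>t. EB t * Z t) (\<lambda>t. - 1 * (EB t * (gco t * q t)))"
    by (rule is_prim_cong[OF is_prim_mult[OF is_prim_EB Z]]) (simp_all add: algebra_simps)
  from is_primD[OF this t] have "EB t * Z t = Z 0 - prim (\<lambda>s. EB s * (gco s * q s)) t"
    unfolding prim_cmult by simp
  then have "exp (- prim \<beta> t) * (EB t * Z t) = zstate (Z 0) q t" unfolding zstate_def by simp
  then show ?thesis by (simp add: mult.assoc[symmetric] exp_minus)
qed

text \<open>The left side is the state equation after integration by parts of the
  \<open>lam dQ\<close> term. Subtracting \<open>lam t * q t\<close> from the state removes the
  jumps and leaves a linear equation for a Lipschitz function, which has exactly one
  solution.\<close>

lemma state_equation_iff:
  assumes q: "bdm T q" and Y: "bdm T Y"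
  shows "(\<forall>t\<in>{0..T}. Y t = y - prim (\<lambda>s. \<beta> s * Y s) t + lam t * q t - prim (\<lambda>s. q s * dlam s) t)
    \<longleftrightarrow> (\<forall>t\<in>{0..T}. Y t = pstate y q t)" (is "?L \<longleftrightarrow> ?R")
proof -
  have bY: "bdm T (\<lambda>s. \<beta> s * Y s)" and bq: "bdm T (\<lambda>s. q s * dlam s)"
    by (rule bdm_mult[OF bdm_beta Y], rule bdm_mult[OF q bdm_dlam])
  define Z where "Z t = Y t - lam t * q t" for t
  have Z': "prim (\<lambda>s. - (\<beta> s * Z s + gco s * q s)) t = - prim (\<lambda>s. \<beta> s * Y s) t - prim (\<lambda>s. q s * dlam s) t"
    if t: "t \<in> {0..T}" for t
  proof -
    have "prim (\<lambda>s. - (\<beta> s * Z s + gco s * q s)) t = prim (\<lambda>s. - 1 * (\<beta> s * Y s + q s * dlam s)) t"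
      by (rule prim_cong) (simp add: Z_def algebra_simps)
    then show ?thesis unfolding prim_cmult using prim_add[OF bY bq t] by simp
  qed
  have bdZ: "bdm T (\<lambda>s. - (\<beta> s * Z s + gco s * q s))"
    unfolding Z_def
    by (rule bdm_minus[OF bdm_add[OF bdm_mult[OF bdm_beta bdm_diff[OF Y bdm_mult[OF bdm_lam q]]] bdm_mult[OF bdm_gco q]]])
  show ?thesis
  proof
    assume L: ?L
    have "0 \<in> {0..T}" using T by simp
    from L[rule_format, OF this] have Z0: "Z 0 = y" unfolding Z_def by simp
    have "is_prim T Z (\<lambda>t. - (\<beta> t * Z t + gco t * q t))"
      unfolding is_prim_def
    proof (intro conjI ballI bdZ)
      fix t assume t: "t \<in> {0..T}"
      show "Z t = Z 0 + prim (\<lambda>s. - (\<beta> s * Z s + gco s * q s)) t"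
        unfolding Z'[OF t] Z0 using L[rule_format, OF t] by (simp add: Z_def)
    qed
    from zstate_unique[OF q this] show ?R
      unfolding Z0 pstate_def by (auto simp: Z_def algebra_simps)
  next
    assume R: ?R
    have Zz: "Z t = zstate y q t" if "t \<in> {0..T}" for t using R that by (simp add: Z_def pstate_def)
    show ?L
    proof
      fix t assume t: "t \<in> {0..T}"
      have "zstate y q t = y + prim (\<lambda>s. - (\<beta> s * zstate y q s + gco s * q s)) t"
        using is_primD[OF is_prim_zstate[OF q] t] by simp
      also have "prim (\<lambda>s. - (\<beta> s * zstate y q s + gco s * q s)) t = prim (\<lambda>s. - (\<beta> s * Z s + gco s * q s)) t"
        by (rule prim_cong) (use Zz t in auto)
      finally show "Y t = y - prim (\<lambda>s. \<beta> s * Y s) t + lam t * q t - prim (\<lambda>s. q s * dlam s) t"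
        using Zz[OF t] unfolding Z'[OF t] by (simp add: Z_def)
    qed
  qed
qed

text \<open>After division by \<open>lam\<close> the strategy enters with coefficient one, and the
  only other varying term is an integral of the state. Read backwards, this recovers a strategy from
  its state, as the bound with \<open>C_inv\<close> will do.\<close>

lemma pstate_normalized:
  assumes q: "bdm T q" and t: "t \<in> {0..T}"
  shows "pstate y q t / lam t = y / lam 0 + q t - prim (\<lambda>s. kap s * (pstate y q s / lam s)) t"
proof -
  have "is_prim T (\<lambda>t. zstate y q t * (1 / lam t)) (\<lambda>t. - 1 * (kap t * (pstate y q t / lam t)))"
  proof (rule is_prim_cong[OF is_prim_mult[OF is_prim_zstate[OF q] is_prim_inv_lam]])
    fix s assume "s \<in> {0..T}"
    then have "lam s > 0" by (rule lam_pos)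
    then show "- (\<beta> s * zstate y q s + gco s * q s) * (1 / lam s) + zstate y q s * (- dlam s / (lam s)\<^sup>2)
       = - 1 * (kap s * (pstate y q s / lam s))"
      by (simp add: pstate_def gamma_dot_def field_simps power2_eq_square)
  qed simp
  from is_primD[OF this t] have "zstate y q t / lam t = y / lam 0 - prim (\<lambda>s. kap s * (pstate y q s / lam s)) t"
    unfolding prim_cmult by simp
  then show ?thesis using lam_pos[OF t] by (simp add: pstate_def add_divide_distrib)
qed

lemma pstate_diff:
  assumes q1: "bdm T q1" and q2: "bdm T q2" and t: "t \<in> {0..T}"
  shows "pstate y q1 t - pstate y q2 t =
    lam t * (q1 t - q2 t) - exp (- prim \<beta> t) * prim (\<lambda>s. EB s * (gco s * (q1 s - q2 s))) t"
proof -
  have "prim (\<lambda>s. EB s * (gco s * (q1 s - q2 s))) t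
     = prim (\<lambda>s. EB s * (gco s * q1 s) - EB s * (gco s * q2 s)) t"
    by (rule prim_cong) (simp add: algebra_simps)
  also have "\<dots> = prim (\<lambda>s. EB s * (gco s * q1 s)) t - prim (\<lambda>s. EB s * (gco s * q2 s)) t"
    by (rule prim_diff_fun[OF bdm_src[OF q1] bdm_src[OF q2] t])
  finally have e: "prim (\<lambda>s. EB s * (gco s * (q1 s - q2 s))) t =
      prim (\<lambda>s. EB s * (gco s * q1 s)) t - prim (\<lambda>s. EB s * (gco s * q2 s)) t" .
  show ?thesis unfolding pstate_def zstate_def e by (simp only: right_diff_distrib)
qed

lemma pstate_diff_normalized:
  assumes q1: "bdm T q1" and q2: "bdm T q2" and t: "t \<in> {0..T}"
  shows "(pstate y q1 t - pstate y q2 t) / lam t =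
    q1 t - q2 t - prim (\<lambda>s. kap s / lam s * (pstate y q1 s - pstate y q2 s)) t"
proof -
  have b: "bdm T (\<lambda>s. kap s * (pstate y q s / lam s))" if "bdm T q" for q
    by (rule bdm_mult[OF bdm_kap bdm_div_lam[OF bdm_pstate[OF that]]])
  have "prim (\<lambda>s. kap s / lam s * (pstate y q1 s - pstate y q2 s)) t
    = prim (\<lambda>s. kap s * (pstate y q1 s / lam s) - kap s * (pstate y q2 s / lam s)) t"
    by (rule prim_cong) (simp add: algebra_simps diff_divide_distrib add_divide_distrib)
  also have "\<dots> = prim (\<lambda>s. kap s * (pstate y q1 s / lam s)) t - prim (\<lambda>s. kap s * (pstate y q2 s / lam s)) t"
    by (rule prim_diff_fun[OF b[OF q1] b[OF q2] t])
  finally show ?thesis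
    using pstate_normalized[OF q1 t] pstate_normalized[OF q2 t] by (simp add: diff_divide_distrib)
qed

lemma prim_bound_square:
  assumes f: "bdm T f" and g: "bdm T g" and L: "L \<ge> 0"
    and le: "AE s in lborel. s \<in> {0<..<T} \<longrightarrow> \<bar>g s\<bar> \<le> L * \<bar>f s\<bar>" and t: "t \<in> {0..T}"
  shows "(prim g t)^2 \<le> L^2 * prim (\<lambda>s. (f s)^2) T * t"
proof -
  have "\<bar>prim g t\<bar> \<le> prim (\<lambda>s. \<bar>g s\<bar>) t" by (rule prim_abs_le[OF g t])
  also have "\<dots> \<le> prim (\<lambda>s. L * \<bar>f s\<bar>) t"
    by (rule prim_mono_AE[OF bdm_abs[OF g] bdm_mult[OF bdm_const bdm_abs[OF f]] t le])
  finally have 1: "\<bar>prim g t\<bar> \<le> L * prim (\<lambda>s. \<bar>f s\<bar>) t" unfolding prim_cmult .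
  have 2: "0 \<le> prim (\<lambda>s. \<bar>f s\<bar>) t" by (rule prim_nonneg) simp
  have "(prim g t)^2 \<le> (L * prim (\<lambda>s. \<bar>f s\<bar>) t)^2"
    using 1 L 2 by (intro power2_le_iff_abs_le[THEN iffD2]) auto
  also have "\<dots> = L^2 * (prim (\<lambda>s. \<bar>f s\<bar>) t)^2" by (simp add: power_mult_distrib)
  finally have 3: "(prim g t)^2 \<le> L^2 * (prim (\<lambda>s. \<bar>f s\<bar>) t)^2" .
  have "(prim (\<lambda>s. \<bar>f s\<bar>) t)^2 \<le> t * prim (\<lambda>s. (f s)^2) t"
    using prim_cauchy_schwarz[OF bdm_abs[OF f] t] by simp
  also have "t * prim (\<lambda>s. (f s)^2) t \<le> t * prim (\<lambda>s. (f s)^2) T"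
    using t by (intro mult_left_mono prim_mono_endpoint[OF bdm_power2[OF f]]) auto
  finally have "L^2 * (prim (\<lambda>s. \<bar>f s\<bar>) t)^2 \<le> L^2 * (t * prim (\<lambda>s. (f s)^2) T)"
    by (rule mult_left_mono) simp
  with 3 have "(prim g t)^2 \<le> L^2 * (t * prim (\<lambda>s. (f s)^2) T)" by linarith
  then show ?thesis by (simp only: mult_ac)
qed

lemma C_H_sq_ge:
  "AE t in lborel. t \<in> {0<..<T} \<longrightarrow> wgt t \<le> C_H_sq T \<beta> lam dlam"
  "1 / (2 * lam T) \<le> C_H_sq T \<beta> lam dlam" "0 \<le> C_H_sq T \<beta> lam dlam"
proof -
  show "AE t in lborel. t \<in> {0<..<T} \<longrightarrow> wgt t \<le> C_H_sq T \<beta> lam dlam"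
    using Linf_AE(1)[OF bdm_rho_lam T]
  proof eventually_elim
    case (elim t)
    show ?case
    proof
      assume "t \<in> {0<..<T}"
      then have "\<bar>rho t / lam t\<bar> \<le> Linf T (\<lambda>t. rho t / lam t)" using elim by blast
      then have "rho t / lam t \<le> max (Linf T (\<lambda>t. rho t / lam t)) (1 / lam T)"
        by (meson abs_ge_self max.coboundedI1 order_trans)
      then have "1/2 * (rho t / lam t) \<le> C_H_sq T \<beta> lam dlam" unfolding C_H_sq_def
        by (intro mult_left_mono) auto
      then show "wgt t \<le> C_H_sq T \<beta> lam dlam" by (simp only: times_divide_times_eq mult_1)
    qed
  qed
  show *: "1 / (2 * lam T) \<le> C_H_sq T \<beta> lam dlam" unfolding C_H_sq_def by simp
  have "0 < 1 / (2 * lam T)" using lam_pos[of T] T by simp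
  then show "0 \<le> C_H_sq T \<beta> lam dlam" using * by linarith
qed

lemma L_Y_sq: "(L_Y T \<beta> lam dlam)^2 = (Linf T lam)^2 * (2 + T * (T + 2) * (Linf T (\<lambda>t. kap t))^2)"
  unfolding L_Y_def using T by (simp add: power_mult_distrib)

lemma C_J_nonneg: "0 \<le> C_J T \<beta> lam dlam"
  unfolding C_J_def using C_H_sq_ge by simp

lemma bdm_wX: "bdm T X \<Longrightarrow> bdm T (\<lambda>t. wgt t * (X t)^2)"
  by (rule bdm_mult[OF bdm_wgt bdm_power2])

text \<open>Origin of \<open>C_J\<close>. Let \<open>L\<close> and \<open>K\<close> be the essential
  bounds of \<open>lam\<close> and \<open>kap\<close>, and \<open>I\<close> the integral of
  \<open>D^2\<close>. The state difference is \<open>lam * D\<close> minus a discounted integral of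
  \<open>D\<close>, whose square at time \<open>t\<close> is at most
  \<open>(L * K)^2 * I * t\<close> by Cauchy-Schwarz. Integration in time yields the
  \<open>2\<close> and the \<open>T^2\<close> part of \<open>T * (T + 2)\<close> in
  \<open>L_Y\<close>. At \<open>T\<close> the strategies agree, so only the integral term remains
  there; it is covered by the part \<open>2 * T\<close>.\<close>

lemma H_norm_le:
  fixes y :: real
  assumes q1: "bdm T q1" and q2: "bdm T q2" and eq: "q1 T = q2 T"
  defines "X \<equiv> \<lambda>t. pstate y q1 t - pstate y q2 t"
  shows "prim (\<lambda>t. wgt t * (X t)^2) T + 1 / (2 * lam T) * (X T)^2
    \<le> C_J T \<beta> lam dlam * prim (\<lambda>t. (q1 t - q2 t)^2) T"
proof -
  let ?L = "Linf T lam" let ?K = "Linf T (\<lambda>t. kap t)" let ?CH = "C_H_sq T \<beta> lam dlam"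
  define D where "D t = q1 t - q2 t" for t
  define I where "I = prim (\<lambda>t. (D t)^2) T"
  have bD: "bdm T D" unfolding D_def by (rule bdm_diff[OF q1 q2])
  have bX: "bdm T X" unfolding X_def by (rule bdm_diff[OF bdm_pstate[OF q1] bdm_pstate[OF q2]])
  have TT: "T \<in> {0..T}" using T by simp
  have L0: "0 \<le> ?L" "0 \<le> ?K" using Linf_AE(2)[OF bdm_lam T] Linf_AE(2)[OF bdm_kap T] by auto
  define z where "z t = exp (- prim \<beta> t) * prim (\<lambda>s. EB s * (gco s * D s)) t" for t
  have bz: "bdm T z"
    unfolding z_def by (rule bdm_mult[OF is_prim_bdm[OF is_prim_EBm] bdm_prim[OF bdm_src[OF bD]]])
  have Xz: "X t = lam t * D t - z t" if "t \<in> {0..T}" for t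
    unfolding X_def z_def D_def by (rule pstate_diff[OF q1 q2 that])
  have zt: "(z t)^2 \<le> (?L * ?K)^2 * I * t" if t: "t \<in> {0..T}" for t
  proof -
    let ?g = "\<lambda>s. exp (- prim \<beta> t) * (EB s * (gco s * D s))"
    \<comment> \<open>The discount factor from \<open>s\<close> to \<open>t\<close> is at most one
      only for \<open>s \<le> t\<close>. The minimum with \<open>1\<close> coincides with it on
      \<open>{0..t}\<close> and extends the bound to all of \<open>{0..T}\<close>, as the general
      estimate asks.\<close>
    let ?h = "\<lambda>s. min 1 (exp (- prim \<beta> t) * EB s)"
    have zg: "z t = prim (\<lambda>s. ?h s * (gco s * D s)) t"
      unfolding z_def prim_cmult[symmetric]
    proof (rule prim_cong)
      fix s assume s: "s \<in> {0..t}"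
      have "prim \<beta> s \<le> prim \<beta> t"
        by (rule prim_mono_endpoint[OF bdm_subset[OF bdm_beta]]) (use s t less_imp_le[OF beta_pos] in auto)
      then have "exp (- prim \<beta> t) * EB s \<le> 1" by (simp add: mult_exp_exp)
      then show "exp (- prim \<beta> t) * (EB s * (gco s * D s)) = ?h s * (gco s * D s)" by simp
    qed
    have h: "0 \<le> ?h s" "?h s \<le> 1" for s by auto
    have bh: "bdm T ?h"
    proof (rule bdm_continuous)
      have "continuous_on {0..T} (\<lambda>s. EB s)" by (rule is_prim_continuous[OF is_prim_EB])
      then show "continuous_on {0..T} ?h"
        by (intro continuous_on_min continuous_on_mult continuous_on_const) auto
    qed
    have "(prim (\<lambda>s. ?h s * (gco s * D s)) t)^2 \<le> (?L * ?K)^2 * prim (\<lambda>s. (D s)^2) T * t"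
    proof (rule prim_bound_square[OF bD bdm_mult[OF bh bdm_mult[OF bdm_gco bD]] _ _ t])
      show "AE s in lborel. s \<in> {0<..<T} \<longrightarrow> \<bar>?h s * (gco s * D s)\<bar> \<le> ?L * ?K * \<bar>D s\<bar>"
        using Linf_AE(1)[OF bdm_lam T] Linf_AE(1)[OF bdm_kap T]
      proof eventually_elim
        case (elim s)
        show ?case
        proof
          assume s: "s \<in> {0<..<T}"
          have "\<bar>gco s\<bar> = \<bar>lam s\<bar> * \<bar>kap s\<bar>" using gco_kap[of s] s by (simp add: abs_mult)
          also have "\<dots> \<le> ?L * ?K" using elim s L0 by (intro mult_mono) auto
          finally have g: "\<bar>gco s\<bar> \<le> ?L * ?K" .
          have "\<bar>?h s * (gco s * D s)\<bar> = ?h s * (\<bar>gco s\<bar> * \<bar>D s\<bar>)" using abs_of_nonneg[OF h(1)[of s]] by (simp only: abs_mult)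
          also have "\<dots> \<le> 1 * (\<bar>gco s\<bar> * \<bar>D s\<bar>)" using h by (intro mult_right_mono) auto
          also have "\<dots> \<le> ?L * ?K * \<bar>D s\<bar>" using g by (simp add: mult_right_mono)
          finally show "\<bar>?h s * (gco s * D s)\<bar> \<le> ?L * ?K * \<bar>D s\<bar>" .
        qed
      qed
    qed (use L0 in auto)
    then show ?thesis unfolding zg I_def .
  qed
  have "prim (\<lambda>t. (X t)^2) T \<le> prim (\<lambda>t. (2 * ?L^2) * (D t)^2 + (2 * (?L * ?K)^2 * I) * t) T"
  proof (rule prim_mono_AE[OF bdm_power2[OF bX] bdm_add[OF bdm_mult[OF bdm_const bdm_power2[OF bD]] bdm_mult[OF bdm_const bdm_id]] TT])
    show "AE s in lborel. s \<in> {0<..<T} \<longrightarrow> (X s)\<^sup>2 \<le> (2 * ?L^2) * (D s)^2 + (2 * (?L * ?K)^2 * I) * s"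
      using Linf_AE(1)[OF bdm_lam T]
    proof eventually_elim
      case (elim s)
      show ?case
      proof
        assume s: "s \<in> {0<..<T}"
        have "(X s)^2 \<le> 2 * (lam s * D s)^2 + 2 * (z s)^2"
          using power2_diff_le[of "lam s * D s" "z s"] Xz[of s] s by simp
        also have "(lam s * D s)^2 \<le> ?L^2 * (D s)^2"
          unfolding power_mult_distrib using elim s L0
          by (intro mult_right_mono power2_le_iff_abs_le[THEN iffD2]) auto
        also have "(z s)^2 \<le> (?L * ?K)^2 * I * s" by (rule zt) (use s in auto)
        finally show "(X s)\<^sup>2 \<le> (2 * ?L^2) * (D s)^2 + (2 * (?L * ?K)^2 * I) * s" by simp
      qed
    qed
  qed
  also have "\<dots> = 2 * ?L^2 * I + (2 * (?L * ?K)^2 * I) * (T^2 / 2)"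
    using prim_add[OF bdm_mult[OF bdm_const bdm_power2[OF bD]] bdm_mult[OF bdm_const bdm_id] TT] T
    by (simp add: prim_cmult I_def prim_id)
  finally have X2: "prim (\<lambda>t. (X t)^2) T \<le> 2 * ?L^2 * I + (?L * ?K)^2 * I * T^2" by simp
  have XT: "(X T)^2 \<le> (?L * ?K)^2 * I * T" using zt[OF TT] Xz[OF TT] eq by (simp add: D_def)
  have I0: "0 \<le> I" unfolding I_def by (rule prim_nonneg) simp
  have "prim (\<lambda>t. wgt t * (X t)^2) T \<le> prim (\<lambda>t. ?CH * (X t)^2) T"
  proof (rule prim_mono_AE[OF bdm_wX[OF bX] bdm_mult[OF bdm_const bdm_power2[OF bX]] TT])
    show "AE s in lborel. s \<in> {0<..<T} \<longrightarrow> wgt s * (X s)\<^sup>2 \<le> ?CH * (X s)\<^sup>2"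
      using C_H_sq_ge(1) by eventually_elim (blast intro: mult_right_mono zero_le_power2)
  qed
  also have "\<dots> = ?CH * prim (\<lambda>t. (X t)^2) T" by (rule prim_cmult)
  finally have "prim (\<lambda>t. wgt t * (X t)^2) T + 1 / (2 * lam T) * (X T)^2
     \<le> ?CH * prim (\<lambda>t. (X t)^2) T + ?CH * (X T)^2"
    using mult_right_mono[OF C_H_sq_ge(2), of "(X T)^2"] by simp
  also have "\<dots> = ?CH * (prim (\<lambda>t. (X t)^2) T + (X T)^2)" by (simp add: distrib_left)
  also have "\<dots> \<le> ?CH * ((L_Y T \<beta> lam dlam)^2 * I)"
  proof (rule mult_left_mono[OF _ C_H_sq_ge(3)])
    have "(L_Y T \<beta> lam dlam)^2 * I = 2 * ?L^2 * I + (?L * ?K)^2 * I * T^2 + 2 * ((?L * ?K)^2 * I * T)"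
      unfolding L_Y_sq by (simp add: power2_eq_square algebra_simps)
    moreover have "0 \<le> (?L * ?K)^2 * I * T" using I0 T by simp
    ultimately show "prim (\<lambda>t. (X t)^2) T + (X T)^2 \<le> (L_Y T \<beta> lam dlam)^2 * I"
      using X2 XT by linarith
  qed
  finally show ?thesis unfolding C_J_def I_def D_def by (simp add: mult.assoc)
qed

text \<open>The infimum is positive because \<open>rho\<close> stays above a positive constant and
  \<open>lam\<close> below one.\<close>

lemma c_H_low:
  "0 < c_H_low T \<beta> lam dlam" "\<And>t. t \<in> {0..T} \<Longrightarrow> c_H_low T \<beta> lam dlam \<le> wgt t"
proof -
  obtain c where c: "c > 0" "\<And>t. t \<in> {0..T} \<Longrightarrow> c \<le> rho t" using rho_low by blast
  obtain A where A: "A \<ge> 0" "\<And>t. t \<in> {0..T} \<Longrightarrow> \<bar>lam t\<bar> \<le> A" using bdm_bound[OF bdm_lam] by blast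
  have low: "c / (2 * (A + 1)) \<le> wgt t" if t: "t \<in> {0..T}" for t
  proof (rule frac_le)
    have "lam t \<le> A" using A(2)[OF t] by simp
    then show "2 * lam t \<le> 2 * (A + 1)" by simp
    show "0 < 2 * lam t" using lam_pos[OF t] by simp
    show "0 \<le> rho t" using rho_pos[OF t] by simp
  qed (use c(2)[OF t] in auto)
  have "c / (2 * (A + 1)) \<le> c_H_low T \<beta> lam dlam"
    unfolding c_H_low_def by (rule cINF_greatest) (use low T in auto)
  moreover have "0 < c / (2 * (A + 1))" using c A by simp
  ultimately show "0 < c_H_low T \<beta> lam dlam" by linarith
  fix t assume "t \<in> {0..T}"
  then show "c_H_low T \<beta> lam dlam \<le> wgt t"
    unfolding c_H_low_def using low by (intro cINF_lower bdd_belowI2) auto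
qed

lemma C_inv_nonneg: "0 \<le> C_inv T \<beta> lam dlam"
  unfolding C_inv_def using c_H_low(1) by (intro divide_nonneg_pos) auto

text \<open>Origin of \<open>C_inv\<close>. By the normalized equation \<open>D\<close> is
  \<open>X / lam\<close> plus an integral of \<open>kap / lam * X\<close>. The square of a sum gives
  the factor \<open>2\<close>, and integrating the Cauchy-Schwarz bound
  \<open>2 * K^2 * I * t\<close> over time gives \<open>T^2 * K^2 * I\<close>, with \<open>K\<close>
  the essential bound of \<open>kap / lam\<close>. Division by \<open>c_H_low\<close> passes from
  \<open>I\<close>, the plain integral of \<open>X^2\<close>, to the weighted norm.\<close>

lemma L2_le_H_norm:
  fixes y :: real
  assumes q1: "bdm T q1" and q2: "bdm T q2"
  defines "X \<equiv> \<lambda>t. pstate y q1 t - pstate y q2 t"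
  shows "prim (\<lambda>t. (q1 t - q2 t)^2) T
    \<le> C_inv T \<beta> lam dlam * (prim (\<lambda>t. wgt t * (X t)^2) T + 1 / (2 * lam T) * (X T)^2)"
proof -
  let ?L = "Linf T (\<lambda>t. 1 / lam t)" let ?K = "Linf T (\<lambda>t. kap t / lam t)"
  define D where "D t = q1 t - q2 t" for t
  have bD: "bdm T D" unfolding D_def by (rule bdm_diff[OF q1 q2])
  have bX: "bdm T X" unfolding X_def by (rule bdm_diff[OF bdm_pstate[OF q1] bdm_pstate[OF q2]])
  have TT: "T \<in> {0..T}" using T by simp
  define I where "I = prim (\<lambda>t. (X t)^2) T"
  have bil: "bdm T (\<lambda>t. 1 / lam t)" and bkl: "bdm T (\<lambda>t. kap t / lam t)"
    by (rule bdm_div_lam[OF bdm_const], rule bdm_div_lam[OF bdm_kap])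
  have L0: "0 \<le> ?L" "0 \<le> ?K" using Linf_AE(2)[OF bil T] Linf_AE(2)[OF bkl T] by auto
  define z where "z t = prim (\<lambda>s. kap s / lam s * X s) t" for t
  have Dz: "D t = 1 / lam t * X t + z t" if "t \<in> {0..T}" for t
    using pstate_diff_normalized[OF q1 q2 that, of y] unfolding X_def z_def D_def by simp
  have zt: "(z t)^2 \<le> ?K^2 * I * t" if t: "t \<in> {0..T}" for t
    unfolding z_def I_def
  proof (rule prim_bound_square[OF bX bdm_mult[OF bkl bX] L0(2) _ t])
    show "AE s in lborel. s \<in> {0<..<T} \<longrightarrow> \<bar>kap s / lam s * X s\<bar> \<le> ?K * \<bar>X s\<bar>"
      using Linf_AE(1)[OF bkl T]
    proof eventually_elim
      case (elim s)
      then show ?case unfolding abs_mult[of "kap s / lam s"] by (blast intro: mult_right_mono abs_ge_zero)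
    qed
  qed
  have "prim (\<lambda>t. (D t)^2) T \<le> prim (\<lambda>t. (2 * ?L^2) * (X t)^2 + (2 * ?K^2 * I) * t) T"
  proof (rule prim_mono_AE[OF bdm_power2[OF bD] bdm_add[OF bdm_mult[OF bdm_const bdm_power2[OF bX]] bdm_mult[OF bdm_const bdm_id]] TT])
    show "AE s in lborel. s \<in> {0<..<T} \<longrightarrow> (D s)\<^sup>2 \<le> (2 * ?L^2) * (X s)^2 + (2 * ?K^2 * I) * s"
      using Linf_AE(1)[OF bil T]
    proof eventually_elim
      case (elim s)
      show ?case
      proof
        assume s: "s \<in> {0<..<T}"
        have "(D s)^2 \<le> 2 * (1 / lam s * X s)^2 + 2 * (z s)^2"
          using power2_add_le[of "1 / lam s * X s" "z s"] Dz[of s] s by simp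
        also have "(1 / lam s * X s)^2 \<le> ?L^2 * (X s)^2"
          unfolding power_mult_distrib using elim s L0
          by (intro mult_right_mono power2_le_iff_abs_le[THEN iffD2]) auto
        also have "(z s)^2 \<le> ?K^2 * I * s" by (rule zt) (use s in auto)
        finally show "(D s)\<^sup>2 \<le> (2 * ?L^2) * (X s)^2 + (2 * ?K^2 * I) * s" by simp
      qed
    qed
  qed
  also have "\<dots> = 2 * ?L^2 * I + (2 * ?K^2 * I) * (T^2 / 2)"
    using prim_add[OF bdm_mult[OF bdm_const bdm_power2[OF bX]] bdm_mult[OF bdm_const bdm_id] TT] T
    by (simp add: prim_cmult I_def prim_id)
  finally have D2: "prim (\<lambda>t. (D t)^2) T \<le> (2 * ?L^2 + T^2 * ?K^2) * I" by (simp add: algebra_simps)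
  have "c_H_low T \<beta> lam dlam * I = prim (\<lambda>t. c_H_low T \<beta> lam dlam * (X t)^2) T"
    unfolding I_def prim_cmult ..
  also have "\<dots> \<le> prim (\<lambda>t. wgt t * (X t)^2) T"
    by (rule prim_mono[OF bdm_mult[OF bdm_const bdm_power2[OF bX]] bdm_wX[OF bX] TT])
      (intro mult_right_mono c_H_low, auto)
  also have "\<dots> \<le> prim (\<lambda>t. wgt t * (X t)^2) T + 1 / (2 * lam T) * (X T)^2"
    using lam_pos[OF TT] by simp
  finally have c: "c_H_low T \<beta> lam dlam * I \<le> prim (\<lambda>t. wgt t * (X t)^2) T + 1 / (2 * lam T) * (X T)^2" .
  have "(2 * ?L^2 + T^2 * ?K^2) * I = C_inv T \<beta> lam dlam * (c_H_low T \<beta> lam dlam * I)"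
    unfolding C_inv_def using c_H_low(1) by simp
  also have "\<dots> \<le> C_inv T \<beta> lam dlam * (prim (\<lambda>t. wgt t * (X t)^2) T + 1 / (2 * lam T) * (X T)^2)"
    by (rule mult_left_mono[OF c C_inv_nonneg])
  finally show ?thesis using D2 unfolding D_def by linarith
qed

end

section \<open>Adapted processes and stochastic integrals\<close>

lemma cadlag_cong:
  assumes "\<And>t. t \<in> {0..T} \<Longrightarrow> f t = g t" "cadlag_on 0 T f" shows "cadlag_on 0 T g"
  unfolding cadlag_on_def
proof (intro conjI ballI)
  fix t assume t: "t \<in> {0..<T}"
  have ev: "\<forall>\<^sub>F s in at_right t. f s = g s"
    unfolding eventually_at_right_field by (rule exI[of _ T]) (use t assms(1) in auto)
  have "(f \<longlongrightarrow> f t) (at_right t)" using assms(2) t unfolding cadlag_on_def by blast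
  moreover have "f t = g t" using assms(1) t by auto
  ultimately show "(g \<longlongrightarrow> g t) (at_right t)" using tendsto_cong[OF ev, of "f t"] by simp
next
  fix t assume t: "t \<in> {0<..T}"
  have ev: "\<forall>\<^sub>F s in at_left t. f s = g s"
    unfolding eventually_at_left_field by (rule exI[of _ 0]) (use t assms(1) in auto)
  obtain l where "(f \<longlongrightarrow> l) (at_left t)" using assms(2) t unfolding cadlag_on_def by blast
  then show "\<exists>l. (g \<longlongrightarrow> l) (at_left t)" using tendsto_cong[OF ev, of l] by blast
qed

lemma partition_mono:
  fixes p :: "nat \<Rightarrow> real"
  assumes "\<And>i. i < n \<Longrightarrow> p i \<le> p (Suc i)" "i \<le> j" "j \<le> n" shows "p i \<le> p j"
  using assms(2,3)
proof (induction j rule: dec_induct)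
  case (step k)
  then have "p i \<le> p k" by simp
  also have "p k \<le> p (Suc k)" using step assms(1) by simp
  finally show ?case .
qed simp

lemma abel_summation:
  fixes f x :: "nat \<Rightarrow> real"
  shows "(\<Sum>i<n. f i * (x (Suc i) - x i)) = f n * x n - f 0 * x 0 - (\<Sum>i<n. x (Suc i) * (f (Suc i) - f i))"
  by (induction n) (auto simp: algebra_simps)

text \<open>The cells are open on the left and closed on the right, so each \<open>s\<close> in the
  range lies in exactly one of them even when partition points repeat.\<close>

lemma step_function_locate:
  fixes p :: "nat \<Rightarrow> real"
  assumes mono: "\<And>i. i < n \<Longrightarrow> p i \<le> p (Suc i)" and s: "p 0 < s" "s \<le> p n"
  obtains i where "i < n" "p i < s" "s \<le> p (Suc i)"
    "(\<Sum>j<n. indicator {p j<..p (Suc j)} s * y j) = (y i :: real)"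
proof -
  define k where "k = (LEAST k. s \<le> p k)"
  have k: "s \<le> p k" "k \<le> n" unfolding k_def using s(2) by (auto intro: LeastI Least_le)
  have "k \<noteq> 0" using k(1) s(1) by (metis not_less)
  then obtain i where i: "k = Suc i" by (cases k) auto
  have pi: "p i < s" using not_less_Least[of i "\<lambda>k. s \<le> p k"] i k_def by (simp add: not_le)
  have "indicator {p j<..p (Suc j)} s * y j = (if j = i then y i else 0)" if "j < n" for j
  proof (cases "j < i")
    case True
    then have "p (Suc j) \<le> p i" using partition_mono[of n p "Suc j" i] mono k i by simp
    then show ?thesis using True pi by simp
  next
    case False
    show ?thesis
    proof (cases "j = i")
      case True then show ?thesis using pi k i by simp
    next
      case F: False
      then have "p (Suc i) \<le> p j" using partition_mono[of n p "Suc i" j] mono False that by simp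
      then show ?thesis using F k i by simp
    qed
  qed
  then have "(\<Sum>j<n. indicator {p j<..p (Suc j)} s * y j) = (\<Sum>j<n. if j = i then y i else 0)"
    by (intro sum.cong) auto
  also have "\<dots> = y i" using k i by simp
  finally show ?thesis using that[of i] pi k i by simp
qed

text \<open>Abel summation moves the increments from the cadlag path to the Lipschitz function
  \<open>f\<close>. The new sum is the integral of \<open>f'\<close> against the step function that
  takes on each cell the value of \<open>x\<close> at its right end. By right-continuity this step
  function converges to \<open>x\<close>, and dominated convergence gives the limit of the
  integrals, path by path.\<close>

lemma cadlag_riemann_sums:
  assumes x: "cadlag_on 0 T x" and f: "is_prim T f f'" and t: "t \<in> {0..T}"
    and p0: "\<And>m. p m 0 = 0" and pn: "\<And>m. p m (n m) = t"
    and mono: "\<And>m i. i < n m \<Longrightarrow> p m i \<le> p m (Suc i)"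
    and mesh: "\<And>m i. i < n m \<Longrightarrow> p m (Suc i) - p m i < 1 / real (Suc m)"
  shows "(\<lambda>m. \<Sum>i<n m. f (p m i) * (x (p m (Suc i)) - x (p m i)))
     \<longlonglongrightarrow> f t * x t - f 0 * x 0 - prim (\<lambda>s. x s * f' s) t"
proof -
  have T0: "0 \<le> T" using t by simp
  obtain B where B: "B \<ge> 0" "\<And>s. s \<in> {0..T} \<Longrightarrow> \<bar>x s\<bar> \<le> B" using cadlag_bounded[OF x] by blast
  obtain C where C: "C \<ge> 0" "\<And>s. s \<in> {0..T} \<Longrightarrow> \<bar>f' s\<bar> \<le> C" using bdm_bound[OF is_prim_bdm_deriv[OF f]] by blast
  have bx: "bdm T x" by (rule cadlag_bdm[OF x T0])
  have rng: "p m i \<in> {0..t}" if "i \<le> n m" for m i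
    using partition_mono[of "n m" "p m" 0 i] partition_mono[of "n m" "p m" i "n m"] mono that p0 pn by auto
  define \<phi> where "\<phi> m s = (\<Sum>i<n m. indicator {p m i<..p m (Suc i)} s * x (p m (Suc i)))" for m s
  define g where "g s = indicator {0..t} s * f' s" for s
  have gi: "integrable lborel g"
    using bdm_set_integrable[OF is_prim_bdm_deriv[OF f], of 0 t] t unfolding g_def set_integrable_def by simp
  have gm: "g \<in> borel_measurable lborel" using gi by simp
  have \<phi>m: "\<phi> m \<in> borel_measurable lborel" for m unfolding \<phi>_def by measurable
  have pieces: "integrable lborel (\<lambda>s. indicator {p m i<..p m (Suc i)} s * x (p m (Suc i)) * g s)"
    "(LINT s|lborel. indicator {p m i<..p m (Suc i)} s * x (p m (Suc i)) * g s) = x (p m (Suc i)) * (f (p m (Suc i)) - f (p m i))"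
    if i: "i < n m" for m i
  proof -
    have r: "0 \<le> p m i" "p m i \<le> p m (Suc i)" "p m (Suc i) \<le> t"
      using rng[of i m] rng[of "Suc i" m] i mono[OF i] by auto
    have "integrable lborel (\<lambda>s. g s * indicator {p m i<..p m (Suc i)} s)"
      by (rule integrable_real_mult_indicator) (auto intro: gi)
    then have "integrable lborel (\<lambda>s. x (p m (Suc i)) * (g s * indicator {p m i<..p m (Suc i)} s))" by simp
    then show "integrable lborel (\<lambda>s. indicator {p m i<..p m (Suc i)} s * x (p m (Suc i)) * g s)"
      by (simp add: mult_ac)
    have "(LINT s|lborel. indicator {p m i<..p m (Suc i)} s * x (p m (Suc i)) * g s)
      = (LINT s|lborel. x (p m (Suc i)) * (indicator {p m i..p m (Suc i)} s *\<^sub>R f' s))"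
    proof (rule integral_cong_AE)
      have "(\<lambda>s. indicator {p m i..p m (Suc i)} s *\<^sub>R f' s) \<in> borel_measurable lborel"
        using bdm_set_borel_measurable[OF is_prim_bdm_deriv[OF f], of "p m i" "p m (Suc i)"] r t
        unfolding set_borel_measurable_def by auto
      then show "(\<lambda>s. x (p m (Suc i)) * (indicator {p m i..p m (Suc i)} s *\<^sub>R f' s)) \<in> borel_measurable lborel"
        by measurable
      show "AE s in lborel. indicator {p m i<..p m (Suc i)} s * x (p m (Suc i)) * g s = x (p m (Suc i)) * (indicator {p m i..p m (Suc i)} s *\<^sub>R f' s)"
        using AE_lborel_singleton[of "p m i"]
        by eventually_elim (use r in \<open>auto simp: g_def split: split_indicator\<close>)
    qed (use gm in measurable)
    also have "\<dots> = x (p m (Suc i)) * (LINT s:{p m i..p m (Suc i)}|lborel. f' s)"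
      by (simp add: set_lebesgue_integral_def)
    also have "(LINT s:{p m i..p m (Suc i)}|lborel. f' s) = f (p m (Suc i)) - f (p m i)"
      by (rule is_prim_diff[OF f, symmetric]) (use r t in auto)
    finally show "(LINT s|lborel. indicator {p m i<..p m (Suc i)} s * x (p m (Suc i)) * g s) = x (p m (Suc i)) * (f (p m (Suc i)) - f (p m i))" .
  qed
  have int: "(LINT s|lborel. \<phi> m s * g s) = (\<Sum>i<n m. x (p m (Suc i)) * (f (p m (Suc i)) - f (p m i)))" for m
    unfolding \<phi>_def sum_distrib_right by (subst Bochner_Integration.integral_sum) (use pieces in auto)
  have "(\<lambda>m. LINT s|lborel. \<phi> m s * g s) \<longlonglongrightarrow> (LINT s|lborel. indicator {0<..t} s * x s * g s)"
  proof (rule integral_dominated_convergence[where w = "\<lambda>s. B * C * indicator {0..t} s"])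
    show "integrable lborel (\<lambda>s. B * C * indicator {0..t} s)"
      by (auto simp: integrable_indicator_iff emeasure_lborel_Icc_eq)
    show "(\<lambda>s. \<phi> m s * g s) \<in> borel_measurable lborel" for m using \<phi>m gm by measurable
    have "(\<lambda>s. indicator {0<..t} s * (x s * g s)) = (\<lambda>s. indicator {0<..t} s * ((indicator {0..t} s *\<^sub>R x s) * g s))"
      by (auto split: split_indicator)
    moreover have "(\<lambda>s. indicator {0..t} s *\<^sub>R x s) \<in> borel_measurable lborel"
      using bdm_set_borel_measurable[OF bx, of 0 t] t unfolding set_borel_measurable_def by auto
    ultimately have "(\<lambda>s. indicator {0<..t} s * (x s * g s)) \<in> borel_measurable lborel" using gm by simp
    then show "(\<lambda>s. indicator {0<..t} s * x s * g s) \<in> borel_measurable lborel" by (simp add: mult.assoc)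
    \<comment> \<open>The right end of the cell of \<open>s\<close> lies less than one mesh width
      above \<open>s\<close>, on the side from which \<open>x\<close> is continuous.\<close>
    have loc: "\<exists>r. s \<le> r \<and> r < s + 1 / real (Suc m) \<and> r \<le> t \<and> \<phi> m s = x r" if s: "s \<in> {0<..t}" for m s
    proof -
      obtain i where i: "i < n m" "p m i < s" "s \<le> p m (Suc i)" "\<phi> m s = x (p m (Suc i))"
        unfolding \<phi>_def using step_function_locate[of "n m" "p m" s "\<lambda>i. x (p m (Suc i))"] mono s p0 pn by auto
      then show ?thesis using mesh[OF i(1)] rng[of "Suc i" m] by (intro exI[of _ "p m (Suc i)"]) auto
    qed
    have out: "\<phi> m s = 0" if s: "s \<notin> {0<..t}" for m s
      unfolding \<phi>_def
    proof (rule sum.neutral, safe)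
      fix i assume "i < n m"
      then have "s \<notin> {p m i<..p m (Suc i)}" using rng[of i m] rng[of "Suc i" m] s by auto
      then show "indicator {p m i<..p m (Suc i)} s * x (p m (Suc i)) = 0" by simp
    qed
    have lim: "(\<lambda>m. \<phi> m s) \<longlonglongrightarrow> indicator {0<..t} s * x s" for s
    proof (cases "s \<in> {0<..t}")
      case False then show ?thesis using out by simp
    next
      case True
      have "(\<lambda>m. \<phi> m s) \<longlonglongrightarrow> x s"
      proof (rule LIMSEQ_I)
        fix e :: real assume e: "e > 0"
        have "\<exists>d>0. \<forall>r. s \<le> r \<and> r < s + d \<and> r \<le> t \<longrightarrow> \<bar>x r - x s\<bar> < e"
        proof (cases "s < T")
          case True
          then have "(x \<longlongrightarrow> x s) (at_right s)" using x \<open>s \<in> {0<..t}\<close> unfolding cadlag_on_def by auto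
          then have "\<forall>\<^sub>F r in at_right s. dist (x r) (x s) < e" using e by (rule tendstoD)
          then obtain b where b: "b > s" "\<And>r. r > s \<Longrightarrow> r < b \<Longrightarrow> dist (x r) (x s) < e"
            unfolding eventually_at_right_field by blast
          have "\<bar>x r - x s\<bar> < e" if "s \<le> r" "r < s + (b - s)" for r
            using b(2)[of r] that e by (cases "r = s") (auto simp: dist_real_def)
          then show ?thesis using b(1) by (intro exI[of _ "b - s"]) auto
        next
          case False
          then have "s = T" "t = T" using \<open>s \<in> {0<..t}\<close> t by auto
          then show ?thesis using e by (intro exI[of _ 1]) auto
        qed
        then obtain d where d: "d > 0" "\<And>r. s \<le> r \<Longrightarrow> r < s + d \<Longrightarrow> r \<le> t \<Longrightarrow> \<bar>x r - x s\<bar> < e" by blast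
        obtain m0 where m0: "1 / real (Suc m0) < d" using reals_Archimedean[OF d(1)] by (auto simp: inverse_eq_divide)
        show "\<exists>no. \<forall>m\<ge>no. norm (\<phi> m s - x s) < e"
        proof (intro exI allI impI)
          fix m assume m: "m \<ge> m0"
          obtain r where r: "s \<le> r" "r < s + 1 / real (Suc m)" "r \<le> t" "\<phi> m s = x r" using loc[OF \<open>s \<in> {0<..t}\<close>, of m] by blast
          have "1 / real (Suc m) \<le> 1 / real (Suc m0)" using m by (intro divide_left_mono) auto
          then have "r < s + d" using r(2) m0 by linarith
          then show "norm (\<phi> m s - x s) < e" using d(2)[OF r(1) _ r(3)] r(4) by simp
        qed
      qed
      then show ?thesis using True by simp
    qed
    show "AE s in lborel. (\<lambda>m. \<phi> m s * g s) \<longlonglongrightarrow> indicator {0<..t} s * x s * g s"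
      by (intro AE_I2 tendsto_mult lim tendsto_const)
    show "AE s in lborel. norm (\<phi> m s * g s) \<le> B * C * indicator {0..t} s" for m
    proof (rule AE_I2)
      fix s
      show "norm (\<phi> m s * g s) \<le> B * C * indicator {0..t} s"
      proof (cases "s \<in> {0<..t}")
        case True
        obtain r where r: "s \<le> r" "r \<le> t" "\<phi> m s = x r" using loc[OF True, of m] by blast
        have "\<bar>x r\<bar> \<le> B" using B(2)[of r] r True t by auto
        moreover have "\<bar>f' s\<bar> \<le> C" using C(2)[of s] True t by auto
        ultimately show ?thesis using True r B(1) by (simp add: g_def abs_mult mult_mono)
      next
        case False
        then show ?thesis using out[OF False] B C by simp
      qed
    qed
  qed
  moreover have "(LINT s|lborel. indicator {0<..t} s * x s * g s) = prim (\<lambda>s. x s * f' s) t"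
    unfolding set_lebesgue_integral_def
  proof (rule integral_cong_AE)
    have m1: "(\<lambda>s. indicator {0..t} s *\<^sub>R (x s * f' s)) \<in> borel_measurable lborel"
      using bdm_set_borel_measurable[OF bdm_mult[OF bx is_prim_bdm_deriv[OF f]], of 0 t] t unfolding set_borel_measurable_def by auto
    then show "(\<lambda>s. indicator {0..t} s *\<^sub>R (x s * f' s)) \<in> borel_measurable lborel" .
    have "(\<lambda>s. indicator {0<..t} s * x s * g s) = (\<lambda>s. indicator {0<..t} s * (indicator {0..t} s *\<^sub>R (x s * f' s)))"
      unfolding g_def by (auto split: split_indicator)
    then show "(\<lambda>s. indicator {0<..t} s * x s * g s) \<in> borel_measurable lborel" using m1 by simp
    show "AE s in lborel. indicator {0<..t} s * x s * g s = indicator {0..t} s *\<^sub>R (x s * f' s)"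
      using AE_lborel_singleton[of 0] by eventually_elim (auto simp: g_def split: split_indicator)
  qed
  ultimately have L: "(\<lambda>m. \<Sum>i<n m. x (p m (Suc i)) * (f (p m (Suc i)) - f (p m i))) \<longlonglongrightarrow> prim (\<lambda>s. x s * f' s) t"
    unfolding int by simp
  have eq: "(\<Sum>i<n m. f (p m i) * (x (p m (Suc i)) - x (p m i))) =
     f t * x t - f 0 * x 0 - (\<Sum>i<n m. x (p m (Suc i)) * (f (p m (Suc i)) - f (p m i)))" for m
    using abel_summation[of "\<lambda>i. f (p m i)" "\<lambda>i. x (p m i)" "n m"] by (simp add: p0 pn)
  show ?thesis unfolding eq by (intro tendsto_diff tendsto_const L)
qed

lemma prim_measurable:
  assumes G: "(\<lambda>(s, \<omega>). G s \<omega>) \<in> borel_measurable (restrict_space borel {0..t} \<Otimes>\<^sub>M N)"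
  shows "(\<lambda>\<omega>. prim (\<lambda>s. G s \<omega>) t) \<in> borel_measurable N"
proof -
  let ?L = "restrict_space lborel {0..t} :: real measure"
  have sL: "sets ?L = sets (restrict_space borel {0..t})" by (simp add: sets_restrict_space)
  have "finite_measure ?L"
    by (rule finite_measureI) (simp add: emeasure_restrict_space space_restrict_space emeasure_lborel_Icc_eq)
  then interpret L: finite_measure ?L .
  have "(\<lambda>(s, \<omega>). G s \<omega>) \<in> borel_measurable (?L \<Otimes>\<^sub>M N)"
    using G measurable_cong_sets[OF sets_pair_measure_cong[OF sL refl] refl] by blast
  then have "(\<lambda>(\<omega>, s). G s \<omega>) \<in> borel_measurable (N \<Otimes>\<^sub>M ?L)"
    by (subst measurable_pair_swap_iff) (simp add: split_def)
  then have "(\<lambda>\<omega>. \<integral>s. G s \<omega> \<partial>?L) \<in> borel_measurable N"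
    by (rule L.borel_measurable_lebesgue_integral)
  then show ?thesis
    by (simp add: integral_restrict_space set_lebesgue_integral_def)
qed

text \<open>Reduces the mesh condition in the definition of the integral to sequences of partitions
  with mesh below \<open>1 / (m + 1)\<close>, for which limit theorems are available: if it failed,
  a bad partition could be picked for every \<open>m\<close>.\<close>

lemma mesh_limit_criterion:
  fixes adm :: "real \<Rightarrow> nat \<Rightarrow> (nat \<Rightarrow> real) \<Rightarrow> bool" and g :: "nat \<Rightarrow> (nat \<Rightarrow> real) \<Rightarrow> real"
  assumes lim: "\<And>n p. \<forall>m. adm (1 / real (Suc m)) (n m) (p m) \<Longrightarrow> (\<lambda>m. g (n m) (p m)) \<longlonglongrightarrow> 0" and e: "0 < e"
  shows "\<exists>d>0. \<forall>n p. adm d n p \<longrightarrow> g n p < e"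
proof (rule ccontr)
  assume neg: "\<not> (\<exists>d>0. \<forall>n p. adm d n p \<longrightarrow> g n p < e)"
  have "\<forall>m. \<exists>np. adm (1 / real (Suc m)) (fst np) (snd np) \<and> \<not> g (fst np) (snd np) < e"
  proof
    fix m
    have "1 / real (Suc m) > 0" by simp
    then obtain n p where "adm (1 / real (Suc m)) n p" "\<not> g n p < e" using neg by blast
    then show "\<exists>np. adm (1 / real (Suc m)) (fst np) (snd np) \<and> \<not> g (fst np) (snd np) < e"
      by (intro exI[of _ "(n, p)"]) simp
  qed
  from choice[OF this] obtain np
    where np: "\<forall>m. adm (1 / real (Suc m)) (fst (np m)) (snd (np m)) \<and> \<not> g (fst (np m)) (snd (np m)) < e" ..
  have "(\<lambda>m. g (fst (np m)) (snd (np m))) \<longlonglongrightarrow> 0"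
    by (rule lim) (use np in blast)
  then have "\<forall>\<^sub>F m in sequentially. g (fst (np m)) (snd (np m)) < e"
    using e by (rule order_tendstoD(2))
  then obtain m where "g (fst (np m)) (snd (np m)) < e" using eventually_happens' sequentially_bot by blast
  then show False using np by blast
qed

section \<open>The filtered space, versions of processes and the stochastic integral\<close>

locale filtered_horizon =
  fixes M :: "'a measure" and F :: "real \<Rightarrow> 'a measure" and T :: real
  assumes T: "0 < T" and filt: "usual_filtered_space M F T"
begin

sublocale prob_space M
  using filt unfolding usual_filtered_space_def by blast

lemma zero_T [simp]: "0 \<in> {0..T}" and T_T [simp]: "T \<in> {0..T}"
  using T by auto

lemma subalg: "t \<in> {0..T} \<Longrightarrow> subalgebra M (F t)"
  using filt[unfolded usual_filtered_space_def, THEN conjunct2, THEN conjunct2, THEN conjunct1] by (rule bspec)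

lemma space_F: "t \<in> {0..T} \<Longrightarrow> space (F t) = space M"
  using subalg unfolding subalgebra_def by blast

lemma sets_F_mono: "s \<in> {0..T} \<Longrightarrow> t \<in> {0..T} \<Longrightarrow> s \<le> t \<Longrightarrow> sets (F s) \<subseteq> sets (F t)"
  using filt[unfolded usual_filtered_space_def, THEN conjunct2, THEN conjunct2, THEN conjunct2, THEN conjunct1] by simp

lemma subalg_F: "s \<in> {0..T} \<Longrightarrow> t \<in> {0..T} \<Longrightarrow> s \<le> t \<Longrightarrow> subalgebra (F t) (F s)"
  unfolding subalgebra_def using sets_F_mono[of s t] space_F[of s] space_F[of t] by simp

lemma measurable_F_mono: "X \<in> borel_measurable (F s) \<Longrightarrow> s \<in> {0..T} \<Longrightarrow> t \<in> {0..T} \<Longrightarrow> s \<le> t \<Longrightarrow> X \<in> borel_measurable (F t)"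
  using measurable_from_subalg[OF subalg_F] by blast

lemma measurable_F_M: "X \<in> borel_measurable (F s) \<Longrightarrow> s \<in> {0..T} \<Longrightarrow> X \<in> borel_measurable M"
  using measurable_from_subalg[OF subalg] by blast

lemma subset_null: assumes "N \<in> null_sets M" "A \<subseteq> N" shows "A \<in> null_sets M"
proof -
  have "A \<in> sets M"
    using filt[unfolded usual_filtered_space_def, THEN conjunct2, THEN conjunct1] assms by simp
  then show ?thesis by (rule null_sets_subset[OF assms(1) _ assms(2)])
qed

lemma null_F: assumes "A \<in> null_sets M" "t \<in> {0..T}" shows "A \<in> sets (F t)"
proof -
  have "null_sets M \<subseteq> sets (F 0)" using filt unfolding usual_filtered_space_def by (elim conjE)
  then have "A \<in> sets (F 0)" using assms(1) by (rule subsetD)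
  then show ?thesis using sets_F_mono[of 0 t] assms(2) by auto
qed

text \<open>By completeness, altering a function on a null set keeps it measurable for every
  sigma-algebra that contains the null sets, hence for \<open>M\<close> and for each
  \<open>F t\<close> alike.\<close>

lemma measurable_AE_cong_aux:
  fixes f g :: "'a \<Rightarrow> real"
  assumes f: "f \<in> borel_measurable N" and sp: "space N = space M" and nul: "null_sets M \<subseteq> sets N"
    and ae: "AE \<omega> in M. f \<omega> = g \<omega>"
  shows "g \<in> borel_measurable N"
proof -
  obtain Z where Z: "Z \<in> null_sets M" "{\<omega>\<in>space M. f \<omega> \<noteq> g \<omega>} \<subseteq> Z"
    using ae unfolding eventually_ae_filter by auto
  have ZN: "Z \<in> sets N" by (rule subsetD[OF nul Z(1)])
  show ?thesis
  proof (rule measurableI)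
    fix A :: "real set" assume A: "A \<in> sets borel"
    have eq: "g -` A \<inter> space N = ((f -` A \<inter> space N) - Z) \<union> (g -` A \<inter> space N \<inter> Z)"
      using Z(2) sp by auto
    have "g -` A \<inter> space N \<inter> Z \<in> sets N"
      by (rule subsetD[OF nul subset_null[OF Z(1)]]) simp
    then show "g -` A \<inter> space N \<in> sets N"
      by (subst eq) (rule sets.Un[OF sets.Diff[OF measurable_sets[OF f A] ZN]])
  qed auto
qed

lemma measurable_AE_cong: "f \<in> borel_measurable M \<Longrightarrow> AE \<omega> in M. f \<omega> = g \<omega> \<Longrightarrow> g \<in> borel_measurable M"
  for f g :: "'a \<Rightarrow> real"
  by (rule measurable_AE_cong_aux) auto

lemma measurable_F_AE_cong: "f \<in> borel_measurable (F t) \<Longrightarrow> t \<in> {0..T} \<Longrightarrow> AE \<omega> in M. f \<omega> = g \<omega> \<Longrightarrow> g \<in> borel_measurable (F t)"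
  for f g :: "'a \<Rightarrow> real"
  by (rule measurable_AE_cong_aux) (auto simp: space_F null_F)

text \<open>Unlike \<open>cadlag_adapted\<close>, this asks for every path to be cadlag, so that joint measurability is
  available; by completeness every process has such a version.\<close>

definition nice :: "(real \<Rightarrow> 'a \<Rightarrow> real) \<Rightarrow> bool" where
  "nice X \<longleftrightarrow> (\<forall>t\<in>{0..T}. X t \<in> borel_measurable (F t)) \<and> (\<forall>\<omega>\<in>space M. cadlag_on 0 T (\<lambda>t. X t \<omega>))"

definition indist :: "(real \<Rightarrow> 'a \<Rightarrow> real) \<Rightarrow> (real \<Rightarrow> 'a \<Rightarrow> real) \<Rightarrow> bool" where
  "indist X Y \<longleftrightarrow> (AE \<omega> in M. \<forall>t\<in>{0..T}. X t \<omega> = Y t \<omega>)"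

lemma nice_adapted: "nice X \<Longrightarrow> t \<in> {0..T} \<Longrightarrow> X t \<in> borel_measurable (F t)"
  unfolding nice_def by blast

lemma nice_meas: "nice X \<Longrightarrow> t \<in> {0..T} \<Longrightarrow> X t \<in> borel_measurable M"
  using nice_adapted measurable_F_M by blast

lemma nice_cadlag: "nice X \<Longrightarrow> \<omega> \<in> space M \<Longrightarrow> cadlag_on 0 T (\<lambda>t. X t \<omega>)"
  unfolding nice_def by blast

lemma nice_bdm: "nice X \<Longrightarrow> \<omega> \<in> space M \<Longrightarrow> bdm T (\<lambda>t. X t \<omega>)"
  by (rule cadlag_bdm[OF nice_cadlag]) (use T in auto)

lemma indist_sym: "indist X Y \<Longrightarrow> indist Y X"
  unfolding indist_def by (auto elim!: eventually_mono)

lemma indist_trans: assumes "indist X Y" "indist Y Z" shows "indist X Z"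
  using assms unfolding indist_def by eventually_elim auto

lemma indist_at: "indist X Y \<Longrightarrow> t \<in> {0..T} \<Longrightarrow> AE \<omega> in M. X t \<omega> = Y t \<omega>"
  unfolding indist_def by (auto elim!: eventually_mono)

text \<open>Setting the process to zero on the exceptional null set repairs all its paths; since
  every \<open>F t\<close> contains the null sets, the result stays adapted.\<close>

lemma cadlag_version:
  assumes "cadlag_adapted M F T X" obtains X' where "nice X'" "indist X X'"
proof -
  have "AE \<omega> in M. cadlag_on 0 T (\<lambda>t. X t \<omega>)" using assms unfolding cadlag_adapted_def by blast
  then obtain N where N: "N \<in> null_sets M" "{\<omega>\<in>space M. \<not> cadlag_on 0 T (\<lambda>t. X t \<omega>)} \<subseteq> N"
    unfolding eventually_ae_filter by auto
  define X' where "X' t \<omega> = (if \<omega> \<in> N then 0 else X t \<omega>)" for t \<omega>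
  have ae: "AE \<omega> in M. \<omega> \<notin> N" using N(1) by (rule AE_not_in)
  have ind: "indist X X'" unfolding indist_def using ae by eventually_elim (simp add: X'_def)
  have "nice X'"
    unfolding nice_def
  proof (intro conjI ballI)
    fix t assume t: "t \<in> {0..T}"
    have "X t \<in> borel_measurable (F t)" using assms t unfolding cadlag_adapted_def adapted_def by blast
    then show "X' t \<in> borel_measurable (F t)" by (rule measurable_F_AE_cong[OF _ t indist_at[OF ind t]])
  next
    fix \<omega> assume "\<omega> \<in> space M"
    then show "cadlag_on 0 T (\<lambda>t. X' t \<omega>)"
      using N(2) by (cases "\<omega> \<in> N") (auto simp: X'_def cadlag_const)
  qed
  then show ?thesis using ind that by blast
qed

lemma indist_cadlag_adapted:
  assumes X: "nice X" and ind: "indist X Y" shows "cadlag_adapted M F T Y"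
  unfolding cadlag_adapted_def adapted_def
proof (intro conjI ballI)
  fix t assume t: "t \<in> {0..T}"
  show "Y t \<in> borel_measurable (F t)"
    by (rule measurable_F_AE_cong[OF nice_adapted[OF X t] t indist_at[OF ind t]])
next
  show "AE \<omega> in M. cadlag_on 0 T (\<lambda>t. Y t \<omega>)"
    using ind[unfolded indist_def] AE_space
  proof eventually_elim
    case (elim \<omega>)
    show ?case by (rule cadlag_cong[OF _ nice_cadlag[OF X elim(2)]]) (use elim(1) in auto)
  qed
qed

text \<open>A difference at \<open>t < T\<close> would persist on an interval to the right of
  \<open>t\<close>, which contains rationals. The point \<open>T\<close> joins the countable set
  because right-continuity says nothing there.\<close>

lemma right_continuous_eq_aux:
  fixes f g :: "real \<Rightarrow> real"
  assumes f: "cadlag_on 0 T f" and g: "cadlag_on 0 T g"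
    and q: "\<And>q. q \<in> {0..T} \<Longrightarrow> q \<in> \<rat> \<or> q = T \<Longrightarrow> f q = g q" and t: "t \<in> {0..T}"
  shows "f t = g t"
proof (rule ccontr)
  assume ne: "f t \<noteq> g t"
  have "t \<noteq> T" using ne q[OF t] by blast
  then have tT: "t \<in> {0..<T}" using t by auto
  have "((\<lambda>s. f s - g s) \<longlongrightarrow> f t - g t) (at_right t)"
    using f g tT unfolding cadlag_on_def by (intro tendsto_diff) blast+
  then have "\<forall>\<^sub>F s in at_right t. f s - g s \<noteq> 0"
    by (rule tendsto_imp_eventually_ne) (use ne in auto)
  then obtain b where b: "b > t" "\<And>s. s > t \<Longrightarrow> s < b \<Longrightarrow> f s - g s \<noteq> 0"
    unfolding eventually_at_right_field by blast
  obtain r where r: "r \<in> \<rat>" "t < r" "r < min b T"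
    using Rats_dense_in_real[of t "min b T"] b(1) tT by auto
  then have "f r = g r" using q[of r] tT by auto
  then show False using b(2)[of r] r by auto
qed

lemma cadlag_indistI:
  assumes X: "cadlag_adapted M F T X" and Y: "cadlag_adapted M F T Y"
    and eq: "\<And>t. t \<in> {0..T} \<Longrightarrow> AE \<omega> in M. X t \<omega> = Y t \<omega>"
  shows "indist X Y"
proof -
  define Qs where "Qs = {q. q \<in> {0..T} \<and> (q \<in> \<rat> \<or> q = T)}"
  have "Qs \<subseteq> \<rat> \<union> {T}" unfolding Qs_def by blast
  then have cnt: "countable Qs" by (rule countable_subset) (simp add: countable_rat)
  have "AE \<omega> in M. X q \<omega> = Y q \<omega>" if "q \<in> Qs" for q
    by (rule eq) (use that in \<open>simp add: Qs_def\<close>)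
  then have "AE \<omega> in M. \<forall>q\<in>Qs. X q \<omega> = Y q \<omega>"
    unfolding AE_ball_countable[OF cnt] by blast
  moreover have "AE \<omega> in M. cadlag_on 0 T (\<lambda>t. X t \<omega>)" "AE \<omega> in M. cadlag_on 0 T (\<lambda>t. Y t \<omega>)"
    using X Y unfolding cadlag_adapted_def by blast+
  ultimately show ?thesis unfolding indist_def
  proof eventually_elim
    case (elim \<omega>)
    have "X q \<omega> = Y q \<omega>" if "q \<in> {0..T}" "q \<in> \<rat> \<or> q = T" for q
      using elim(1) that unfolding Qs_def by blast
    then show ?case using right_continuous_eq_aux[OF elim(2,3)] by blast
  qed
qed

lemma right_continuous_progressive:
  fixes X :: "real \<Rightarrow> 'a \<Rightarrow> real"
  assumes ad: "\<And>s. s \<in> {0..T} \<Longrightarrow> X s \<in> borel_measurable (F s)"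
    and rc: "\<And>s \<omega>. \<omega> \<in> space M \<Longrightarrow> s \<in> {0..<T} \<Longrightarrow> ((\<lambda>s. X s \<omega>) \<longlongrightarrow> X s \<omega>) (at_right s)"
    and t: "t \<in> {0..T}"
  shows "(\<lambda>(s, \<omega>). X s \<omega>) \<in> borel_measurable (restrict_space borel {0..t} \<Otimes>\<^sub>M F t)"
proof (rule right_continuous_jointly_measurable)
  show "X s \<in> borel_measurable (F t)" if "s \<in> {0..t}" for s
    by (rule measurable_F_mono[OF ad]) (use that t in auto)
qed (use t rc space_F[OF t] in auto)

lemma nice_progressive:
  assumes "nice X" "t \<in> {0..T}"
  shows "(\<lambda>(s, \<omega>). X s \<omega>) \<in> borel_measurable (restrict_space borel {0..t} \<Otimes>\<^sub>M F t)"
  by (rule right_continuous_progressive[OF nice_adapted[OF assms(1)] _ assms(2)])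
    (use nice_cadlag[OF assms(1)] in \<open>auto simp: cadlag_on_def\<close>)

lemma bdm_joint:
  assumes "bdm T f" "t \<in> {0..T}"
  shows "(\<lambda>(s, \<omega>). f s) \<in> borel_measurable (restrict_space borel {0..t} \<Otimes>\<^sub>M N)"
proof -
  have "f \<in> borel_measurable (restrict_space borel {0..t})"
    by (rule measurable_restrict_mono[OF bdm_meas[OF assms(1)]]) (use assms(2) in auto)
  from measurable_compose[OF measurable_fst this] show ?thesis by (simp add: split_def)
qed

lemma nice_continuousI:
  assumes "\<And>t. t \<in> {0..T} \<Longrightarrow> X t \<in> borel_measurable (F t)" "\<And>\<omega>. \<omega> \<in> space M \<Longrightarrow> continuous_on {0..T} (\<lambda>t. X t \<omega>)"
  shows "nice X"
  unfolding nice_def using assms cadlag_continuous by blast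

lemma nice_prim:
  assumes X: "nice X" and f: "bdm T f" shows "nice (\<lambda>t \<omega>. prim (\<lambda>s. f s * X s \<omega>) t)"
proof (rule nice_continuousI)
  fix t assume t: "t \<in> {0..T}"
  have "(\<lambda>p. (case p of (s, \<omega>) \<Rightarrow> f s) * (case p of (s, \<omega>) \<Rightarrow> X s \<omega>)) \<in> borel_measurable (restrict_space borel {0..t} \<Otimes>\<^sub>M F t)"
    by (rule borel_measurable_times[OF bdm_joint[OF f t] nice_progressive[OF X t]])
  then show "(\<lambda>\<omega>. prim (\<lambda>s. f s * X s \<omega>) t) \<in> borel_measurable (F t)"
    by (intro prim_measurable) (simp add: split_def)
next
  fix \<omega> assume "\<omega> \<in> space M"
  then show "continuous_on {0..T} (prim (\<lambda>s. f s * X s \<omega>))"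
    by (intro prim_continuous bdm_mult f nice_bdm[OF X])
qed

lemma nice_add: "nice X \<Longrightarrow> nice Y \<Longrightarrow> nice (\<lambda>t \<omega>. X t \<omega> + Y t \<omega>)"
  unfolding nice_def by (intro conjI ballI cadlag_add borel_measurable_add) blast+

lemma nice_diff: "nice X \<Longrightarrow> nice Y \<Longrightarrow> nice (\<lambda>t \<omega>. X t \<omega> - Y t \<omega>)"
  unfolding nice_def by (intro conjI ballI cadlag_diff borel_measurable_diff) blast+

lemma nice_mult: "nice X \<Longrightarrow> nice Y \<Longrightarrow> nice (\<lambda>t \<omega>. X t \<omega> * Y t \<omega>)"
  unfolding nice_def by (intro conjI ballI cadlag_mult borel_measurable_times) blast+

lemma nice_det: "cadlag_on 0 T f \<Longrightarrow> nice (\<lambda>t \<omega>. f t)"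
  unfolding nice_def by auto

lemma nice_rv: "U \<in> borel_measurable (F 0) \<Longrightarrow> nice (\<lambda>t. U)"
  unfolding nice_def by (intro conjI ballI cadlag_const) (rule measurable_F_mono[of U 0], simp_all)

text \<open>Integration by parts for the integral of \<open>f\<close> against \<open>X\<close> over
  \<open>(0,t]\<close>, where \<open>f\<close> has density \<open>f'\<close>; there is no
  covariation term because \<open>f\<close> is continuous and of finite variation.\<close>

definition ibp :: "(real \<Rightarrow> real) \<Rightarrow> (real \<Rightarrow> real) \<Rightarrow> (real \<Rightarrow> 'a \<Rightarrow> real) \<Rightarrow> real \<Rightarrow> 'a \<Rightarrow> real" where
  "ibp f f' X t \<omega> = f t * X t \<omega> - f 0 * X 0 \<omega> - prim (\<lambda>s. X s \<omega> * f' s) t"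

lemma nice_ibp: assumes X: "nice X" and f: "is_prim T f f'" shows "nice (ibp f f' X)"
proof -
  have "nice (\<lambda>t \<omega>. f t * X t \<omega> - f 0 * X 0 \<omega> - prim (\<lambda>s. f' s * X s \<omega>) t)"
  proof (intro nice_diff nice_mult nice_det X)
    show "cadlag_on 0 T f" by (rule cadlag_continuous[OF is_prim_continuous[OF f]])
    show "nice (\<lambda>t. X 0)" by (rule nice_rv[OF nice_adapted[OF X zero_T]])
    show "nice (\<lambda>t \<omega>. prim (\<lambda>s. f' s * X s \<omega>) t)" by (rule nice_prim[OF X is_prim_bdm_deriv[OF f]])
  qed (auto intro: cadlag_const)
  then show ?thesis unfolding ibp_def[abs_def] by (simp add: mult.commute)
qed

lemma indist_ibp: assumes "indist X Y" shows "indist (ibp f f' X) (ibp f f' Y)"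
  using assms unfolding indist_def
proof eventually_elim
  case (elim \<omega>)
  have "prim (\<lambda>s. X s \<omega> * f' s) t = prim (\<lambda>s. Y s \<omega> * f' s) t" if "t \<in> {0..T}" for t
    by (rule prim_cong) (use elim that in auto)
  then show ?case using elim[rule_format, OF zero_T] elim unfolding ibp_def by simp
qed

lemma prob_gt_tendsto_0:
  fixes S :: "nat \<Rightarrow> 'a \<Rightarrow> real"
  assumes S: "\<And>m. S m \<in> borel_measurable M" and I: "I \<in> borel_measurable M"
    and lim: "AE \<omega> in M. (\<lambda>m. S m \<omega>) \<longlonglongrightarrow> I \<omega>" and e: "0 < e"
  shows "(\<lambda>m. measure M {\<omega>\<in>space M. \<bar>S m \<omega> - I \<omega>\<bar> > e}) \<longlonglongrightarrow> 0"
proof -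
  let ?A = "\<lambda>m. {\<omega>\<in>space M. \<bar>S m \<omega> - I \<omega>\<bar> > e}"
  have [measurable]: "?A m \<in> sets M" for m using S I by measurable
  have "(\<lambda>m. LINT \<omega>|M. indicator (?A m) \<omega>) \<longlonglongrightarrow> (LINT \<omega>|M. (0::real))"
  proof (rule integral_dominated_convergence[where w = "\<lambda>_. 1"])
    show "AE \<omega> in M. (\<lambda>m. indicator (?A m) \<omega> :: real) \<longlonglongrightarrow> 0"
      using lim
    proof eventually_elim
      case (elim \<omega>)
      have "\<forall>\<^sub>F m in sequentially. dist (S m \<omega>) (I \<omega>) < e" by (rule tendstoD[OF elim e])
      then have "\<forall>\<^sub>F m in sequentially. indicator (?A m) \<omega> = (0::real)"
        by eventually_elim (auto simp: dist_real_def)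
      then show ?case by (rule tendsto_eventually)
    qed
  qed (auto simp: indicator_def)
  then show ?thesis by simp
qed

text \<open>The Riemann sums converge on every cadlag path along each sequence of partitions with
  vanishing mesh. Almost sure convergence implies convergence in probability, and the sequence
  criterion returns a statement about all fine partitions.\<close>

lemma is_stoch_int_ibp:
  assumes X: "cadlag_adapted M F T X" and f: "is_prim T f f'"
  shows "is_stoch_int M F T f X (ibp f f' X)"
  unfolding is_stoch_int_def
proof (intro conjI ballI allI impI)
  obtain X' where X': "nice X'" "indist X X'" using cadlag_version[OF X] by blast
  show ca: "cadlag_adapted M F T (ibp f f' X)"
    by (rule indist_cadlag_adapted[OF nice_ibp[OF X'(1) f] indist_ibp[OF indist_sym[OF X'(2)]]])
  fix t e :: real assume t: "t \<in> {0..T}" and e: "e > 0"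
  let ?S = "\<lambda>n p \<omega>. (\<Sum>i<n. f (p i) * (X (p (Suc i)) \<omega> - X (p i) \<omega>))"
  let ?adm = "\<lambda>d n p. p 0 = (0::real) \<and> p n = t \<and> (\<forall>i<(n::nat). p i \<le> p (Suc i) \<and> p (Suc i) - p i < d)"
  show "\<exists>d>0. \<forall>(n::nat) p. ?adm d n p \<longrightarrow> measure M {\<omega>\<in>space M. \<bar>?S n p \<omega> - ibp f f' X t \<omega>\<bar> > e} < e"
  proof (rule mesh_limit_criterion[where adm = ?adm and g = "\<lambda>n p. measure M {\<omega>\<in>space M. \<bar>?S n p \<omega> - ibp f f' X t \<omega>\<bar> > e}", OF _ e])
    fix n and p :: "nat \<Rightarrow> nat \<Rightarrow> real"
    assume adm0: "\<forall>m. ?adm (1 / real (Suc m)) (n m) (p m)"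
    have adm: "?adm (1 / real (Suc m)) (n m) (p m)" for m using adm0 by (rule spec)
    have rng: "p m i \<in> {0..T}" if "i \<le> n m" for m i
    proof -
      have mono: "\<And>i. i < n m \<Longrightarrow> p m i \<le> p m (Suc i)" using adm[of m] by blast
      have "p m 0 \<le> p m i" by (rule partition_mono[of "n m"]) (use mono that in auto)
      moreover have "p m i \<le> p m (n m)" by (rule partition_mono[of "n m"]) (use mono that in auto)
      ultimately show ?thesis using adm[of m] t by auto
    qed
    have Xm: "X s \<in> borel_measurable M" if "s \<in> {0..T}" for s
      using X that measurable_F_M unfolding cadlag_adapted_def adapted_def by blast
    have Sm: "?S (n m) (p m) \<in> borel_measurable M" for m
    proof (intro borel_measurable_sum borel_measurable_times borel_measurable_const borel_measurable_diff)
      fix i assume "i \<in> {..<n m}"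
      then show "X (p m (Suc i)) \<in> borel_measurable M" "X (p m i) \<in> borel_measurable M"
        using rng[of i m] rng[of "Suc i" m] Xm by auto
    qed
    have Im: "ibp f f' X t \<in> borel_measurable M"
      using ca t measurable_F_M unfolding cadlag_adapted_def adapted_def by blast
    have "AE \<omega> in M. cadlag_on 0 T (\<lambda>s. X s \<omega>)" using X unfolding cadlag_adapted_def by blast
    then have "AE \<omega> in M. (\<lambda>m. ?S (n m) (p m) \<omega>) \<longlonglongrightarrow> ibp f f' X t \<omega>"
    proof eventually_elim
      case (elim \<omega>)
      show ?case unfolding ibp_def
        by (rule cadlag_riemann_sums[OF elim f t]) (use adm in auto)
    qed
    from prob_gt_tendsto_0[OF Sm Im this e]
    show "(\<lambda>m. measure M {\<omega>\<in>space M. \<bar>?S (n m) (p m) \<omega> - ibp f f' X t \<omega>\<bar> > e}) \<longlonglongrightarrow> 0" .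
  qed
qed

text \<open>Two limits in probability of the same Riemann sums agree almost surely at each fixed
  time, and cadlag paths turn this into indistinguishability.\<close>

lemma is_stoch_int_unique:
  assumes X: "cadlag_adapted M F T X" and I: "is_stoch_int M F T f X I" and J: "is_stoch_int M F T f X J"
  shows "indist I J"
proof (rule cadlag_indistI)
  show caI: "cadlag_adapted M F T I" and caJ: "cadlag_adapted M F T J"
    using I J unfolding is_stoch_int_def by blast+
  fix t assume t: "t \<in> {0..T}"
  let ?S = "\<lambda>n p \<omega>. (\<Sum>i<n. f (p i) * (X (p (Suc i)) \<omega> - X (p i) \<omega>))"
  let ?adm = "\<lambda>d n p. p 0 = (0::real) \<and> p n = t \<and> (\<forall>i<(n::nat). p i \<le> p (Suc i) \<and> p (Suc i) - p i < d)"
  have [measurable]: "I t \<in> borel_measurable M" "J t \<in> borel_measurable M"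
    using caI caJ t measurable_F_M unfolding cadlag_adapted_def adapted_def by blast+
  have Xm: "X s \<in> borel_measurable M" if "s \<in> {0..T}" for s
    using X that measurable_F_M unfolding cadlag_adapted_def adapted_def by blast
  have small: "measure M {\<omega>\<in>space M. \<bar>I t \<omega> - J t \<omega>\<bar> > 2 * e} < 2 * e" if e: "e > 0" for e
  proof -
    obtain d1 where d1: "d1 > 0" "\<forall>n p. ?adm d1 n p \<longrightarrow> measure M {\<omega>\<in>space M. \<bar>?S n p \<omega> - I t \<omega>\<bar> > e} < e"
      using I[unfolded is_stoch_int_def, THEN conjunct2, THEN bspec, OF t, THEN spec, THEN mp, OF e] by blast
    obtain d2 where d2: "d2 > 0" "\<forall>n p. ?adm d2 n p \<longrightarrow> measure M {\<omega>\<in>space M. \<bar>?S n p \<omega> - J t \<omega>\<bar> > e} < e"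
      using J[unfolded is_stoch_int_def, THEN conjunct2, THEN bspec, OF t, THEN spec, THEN mp, OF e] by blast
    define d where "d = min d1 d2"
    have d: "d > 0" using d1 d2 by (simp add: d_def)
    \<comment> \<open>A uniform partition with more than \<open>t / d\<close> cells meets both mesh
      conditions at once; taking \<open>Suc k\<close> cells excludes the empty partition.\<close>
    obtain k :: nat where k: "t / d < real k" using reals_Archimedean2 by blast
    define n where "n = Suc k"
    define p where "p i = real i * t / real n" for i
    have n: "real n > 0" "t / real n < d"
    proof -
      have "t < real k * d" using k d by (simp add: pos_divide_less_eq)
      also have "\<dots> \<le> real n * d" using d by (simp add: n_def)
      finally show "t / real n < d" by (simp add: n_def divide_less_eq mult.commute)
    qed (simp add: n_def)
    have step: "p (Suc i) - p i = t / real n" for i by (simp add: p_def field_simps add_divide_distrib)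
    have adm: "p 0 = 0" "p n = t" "\<forall>i<n. p i \<le> p (Suc i) \<and> p (Suc i) - p i < d"
    proof -
      show "\<forall>i<n. p i \<le> p (Suc i) \<and> p (Suc i) - p i < d"
      proof (intro allI impI)
        fix i
        have "0 \<le> p (Suc i) - p i" unfolding step using t n by simp
        then show "p i \<le> p (Suc i) \<and> p (Suc i) - p i < d" using step[of i] n(2) by simp
      qed
    qed (use n in \<open>auto simp: p_def\<close>)
    have rng: "p i \<in> {0..T}" if "i \<le> n" for i
    proof -
      have mono: "\<And>i. i < n \<Longrightarrow> p i \<le> p (Suc i)" using adm(3) by blast
      have "p 0 \<le> p i" by (rule partition_mono[of n]) (use mono that in auto)
      moreover have "p i \<le> p n" by (rule partition_mono[of n]) (use mono that in auto)
      ultimately show ?thesis using adm(1,2) t by auto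
    qed
    have [measurable]: "?S n p \<in> borel_measurable M"
    proof (intro borel_measurable_sum borel_measurable_times borel_measurable_const borel_measurable_diff)
      fix i assume "i \<in> {..<n}"
      then show "X (p (Suc i)) \<in> borel_measurable M" "X (p i) \<in> borel_measurable M"
        using rng[of i] rng[of "Suc i"] Xm by auto
    qed
    have a1: "measure M {\<omega>\<in>space M. \<bar>?S n p \<omega> - I t \<omega>\<bar> > e} < e"
      by (rule d1(2)[rule_format]) (use adm in \<open>auto simp: d_def\<close>)
    have a2: "measure M {\<omega>\<in>space M. \<bar>?S n p \<omega> - J t \<omega>\<bar> > e} < e"
      by (rule d2(2)[rule_format]) (use adm in \<open>auto simp: d_def\<close>)
    have "measure M {\<omega>\<in>space M. \<bar>I t \<omega> - J t \<omega>\<bar> > 2 * e}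
      \<le> measure M ({\<omega>\<in>space M. \<bar>?S n p \<omega> - I t \<omega>\<bar> > e} \<union> {\<omega>\<in>space M. \<bar>?S n p \<omega> - J t \<omega>\<bar> > e})"
    proof (rule finite_measure_mono)
      show "{\<omega> \<in> space M. 2 * e < \<bar>I t \<omega> - J t \<omega>\<bar>} \<subseteq> {\<omega>\<in>space M. \<bar>?S n p \<omega> - I t \<omega>\<bar> > e} \<union> {\<omega>\<in>space M. \<bar>?S n p \<omega> - J t \<omega>\<bar> > e}"
      proof
        fix \<omega> assume w: "\<omega> \<in> {\<omega> \<in> space M. 2 * e < \<bar>I t \<omega> - J t \<omega>\<bar>}"
        then have "\<bar>?S n p \<omega> - I t \<omega>\<bar> > e \<or> \<bar>?S n p \<omega> - J t \<omega>\<bar> > e"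
          by (simp add: abs_if split: if_splits) linarith+
        then show "\<omega> \<in> {\<omega>\<in>space M. \<bar>?S n p \<omega> - I t \<omega>\<bar> > e} \<union> {\<omega>\<in>space M. \<bar>?S n p \<omega> - J t \<omega>\<bar> > e}" using w by blast
      qed
    qed measurable
    also have "\<dots> \<le> measure M {\<omega>\<in>space M. \<bar>?S n p \<omega> - I t \<omega>\<bar> > e} + measure M {\<omega>\<in>space M. \<bar>?S n p \<omega> - J t \<omega>\<bar> > e}"
      by (rule measure_Un_le) measurable
    finally show ?thesis using a1 a2 by linarith
  qed
  have zero: "measure M {\<omega>\<in>space M. \<bar>I t \<omega> - J t \<omega>\<bar> > a} = 0" if a: "a > 0" for a
  proof (rule ccontr)
    assume "measure M {\<omega>\<in>space M. \<bar>I t \<omega> - J t \<omega>\<bar> > a} \<noteq> 0"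
    then have m: "measure M {\<omega>\<in>space M. \<bar>I t \<omega> - J t \<omega>\<bar> > a} > 0" by (simp add: zero_less_measure_iff)
    define e where "e = min a (measure M {\<omega>\<in>space M. \<bar>I t \<omega> - J t \<omega>\<bar> > a}) / 2"
    have e: "e > 0" "2 * e \<le> a" "2 * e \<le> measure M {\<omega>\<in>space M. \<bar>I t \<omega> - J t \<omega>\<bar> > a}" using a m by (auto simp: e_def)
    have "measure M {\<omega>\<in>space M. \<bar>I t \<omega> - J t \<omega>\<bar> > a} \<le> measure M {\<omega>\<in>space M. \<bar>I t \<omega> - J t \<omega>\<bar> > 2 * e}"
      by (rule finite_measure_mono) (use e in auto)
    then show False using small[OF e(1)] e(3) by linarith
  qed
  have "AE \<omega> in M. \<not> \<bar>I t \<omega> - J t \<omega>\<bar> > 1 / real (Suc k)" for k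
  proof (rule AE_I[of _ _ "{\<omega>\<in>space M. \<bar>I t \<omega> - J t \<omega>\<bar> > 1 / real (Suc k)}"])
    show "emeasure M {\<omega>\<in>space M. \<bar>I t \<omega> - J t \<omega>\<bar> > 1 / real (Suc k)} = 0"
      using zero[of "1 / real (Suc k)"] by (simp add: emeasure_eq_measure)
  qed auto
  then have "AE \<omega> in M. \<forall>k. \<not> \<bar>I t \<omega> - J t \<omega>\<bar> > 1 / real (Suc k)" by (subst AE_all_countable) blast
  then show "AE \<omega> in M. I t \<omega> = J t \<omega>"
  proof eventually_elim
    case (elim \<omega>)
    show ?case
    proof (rule ccontr)
      assume "I t \<omega> \<noteq> J t \<omega>"
      then have "\<bar>I t \<omega> - J t \<omega>\<bar> > 0" by simp
      then obtain k where "inverse (real (Suc k)) < \<bar>I t \<omega> - J t \<omega>\<bar>"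
        using reals_Archimedean by blast
      then show False using elim unfolding inverse_eq_divide by blast
    qed
  qed
qed

text \<open>Existence and uniqueness together resolve the choice in \<open>stoch_int\<close>: the
  integral becomes an explicit functional of the path.\<close>

lemma stoch_int_ibp:
  assumes X: "cadlag_adapted M F T X" and f: "is_prim T f f'"
  shows "indist (stoch_int M F T f X) (ibp f f' X)"
proof -
  have 1: "is_stoch_int M F T f X (ibp f f' X)" by (rule is_stoch_int_ibp[OF X f])
  then have 2: "is_stoch_int M F T f X (stoch_int M F T f X)" unfolding stoch_int_def by (rule someI[of "is_stoch_int M F T f X"])
  show ?thesis by (rule is_stoch_int_unique[OF X 2 1])
qed

end

section \<open>Square-integrable processes\<close>

lemma abs_mult_le_power2: "\<bar>a * b\<bar> \<le> a^2 + (b::real)^2"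
proof -
  have "0 \<le> (\<bar>a\<bar> - \<bar>b\<bar>)^2" by simp
  then have "2 * (\<bar>a\<bar> * \<bar>b\<bar>) \<le> a^2 + b^2" by (simp add: power2_diff)
  moreover have "0 \<le> \<bar>a\<bar> * \<bar>b\<bar>" by simp
  ultimately show ?thesis unfolding abs_mult by linarith
qed

section \<open>Fubini on the horizon, second moments and martingales\<close>

context filtered_horizon
begin

lemma T_nonneg [simp]: "0 \<le> T"
  using T by simp

abbreviation LT :: "real measure" where "LT \<equiv> restrict_space lborel {0..T}"

lemma sets_LT: "sets LT = sets (restrict_space borel {0..T})"
  by (simp add: sets_restrict_space)

lemma space_LT: "space LT = {0..T}"
  by (simp add: space_restrict_space)

lemma finite_LT: "finite_measure LT"
  by (rule finite_measureI) (simp add: emeasure_restrict_space space_restrict_space emeasure_lborel_Icc_eq)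

lemma pair_LT: "pair_sigma_finite LT M"
proof -
  interpret L: finite_measure LT by (rule finite_LT)
  show ?thesis ..
qed

lemma integral_LT: "(\<integral>s. f s \<partial>LT) = prim f T" for f :: "real \<Rightarrow> real"
  by (simp add: integral_restrict_space set_lebesgue_integral_def)

lemma nn_integral_LT: "(\<integral>\<^sup>+s. f s \<partial>LT) = (\<integral>\<^sup>+s\<in>{0..T}. f s \<partial>lborel)"
  by (simp add: nn_integral_restrict_space)

lemma integrable_LT_bdm: "bdm T f \<Longrightarrow> integrable LT f"
  using bdm_set_integrable[of T f 0 T] by (simp add: set_integrable_def integrable_restrict_space)

lemma bdm_LT: "bdm T f \<Longrightarrow> f \<in> borel_measurable LT"
  using bdm_meas measurable_cong_sets[OF sets_LT refl] by blast

lemma joint_LT: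
  assumes "(\<lambda>(s, \<omega>). G s \<omega>) \<in> borel_measurable (restrict_space borel {0..T} \<Otimes>\<^sub>M F T)"
  shows "(\<lambda>(s, \<omega>). G s \<omega>) \<in> borel_measurable (LT \<Otimes>\<^sub>M M)"
proof -
  have "restrict_space borel {0..T} \<Otimes>\<^sub>M F T = restrict_space borel {0..T} \<Otimes>\<^sub>M F T" ..
  have id: "(\<lambda>p. p) \<in> measurable (LT \<Otimes>\<^sub>M M) (restrict_space borel {0..T} \<Otimes>\<^sub>M F T)"
  proof (rule measurable_pair)
    have "fst \<in> measurable (LT \<Otimes>\<^sub>M M) LT" by simp
    then have "fst \<in> measurable (LT \<Otimes>\<^sub>M M) (restrict_space borel {0..T})"
      using measurable_cong_sets[OF refl sets_LT] by blast
    then show "fst \<circ> (\<lambda>p. p) \<in> measurable (LT \<Otimes>\<^sub>M M) (restrict_space borel {0..T})" by (simp add: comp_def)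
    have "(\<lambda>\<omega>. \<omega>) \<in> measurable M (F T)"
      using subalg[OF T_T] by (intro measurableI) (auto simp: subalgebra_def)
    then have "(\<lambda>p. snd p) \<in> measurable (LT \<Otimes>\<^sub>M M) (F T)"
      using measurable_compose[OF measurable_snd] by fastforce
    then show "snd \<circ> (\<lambda>p. p) \<in> measurable (LT \<Otimes>\<^sub>M M) (F T)" by (simp add: comp_def)
  qed
  from measurable_compose[OF id assms] show ?thesis by simp
qed

lemma nice_joint: "nice X \<Longrightarrow> (\<lambda>(s, \<omega>). X s \<omega>) \<in> borel_measurable (LT \<Otimes>\<^sub>M M)"
  by (rule joint_LT[OF nice_progressive]) simp_all

lemma bdm_joint_LT: assumes "bdm T f" shows "(\<lambda>(s, \<omega>). f s) \<in> borel_measurable (LT \<Otimes>\<^sub>M M)"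
  using measurable_compose[OF measurable_fst bdm_LT[OF assms]] by (simp add: split_def)

text \<open>The working class of processes: all paths cadlag and second moments bounded uniformly in
  time. It supplies joint measurability and domination for Fubini, and it is shared by versions of
  strategies, the target martingale and the explicit optimizer.\<close>

definition L2b :: "(real \<Rightarrow> 'a \<Rightarrow> real) \<Rightarrow> bool" where
  "L2b X \<longleftrightarrow> nice X \<and> (\<exists>C. \<forall>t\<in>{0..T}. integrable M (\<lambda>\<omega>. (X t \<omega>)^2) \<and> (\<integral>\<omega>. (X t \<omega>)^2 \<partial>M) \<le> C)"

lemma L2b_nice: "L2b X \<Longrightarrow> nice X"
  unfolding L2b_def by blast

lemma L2b_meas: "L2b X \<Longrightarrow> t \<in> {0..T} \<Longrightarrow> X t \<in> borel_measurable M"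
  by (rule nice_meas[OF L2b_nice])

lemma L2b_adapted: "L2b X \<Longrightarrow> t \<in> {0..T} \<Longrightarrow> X t \<in> borel_measurable (F t)"
  by (rule nice_adapted[OF L2b_nice])

lemma L2b_bdm: "L2b X \<Longrightarrow> \<omega> \<in> space M \<Longrightarrow> bdm T (\<lambda>t. X t \<omega>)"
  by (rule nice_bdm[OF L2b_nice])

lemma L2b_cadlag: "L2b X \<Longrightarrow> \<omega> \<in> space M \<Longrightarrow> cadlag_on 0 T (\<lambda>t. X t \<omega>)"
  by (rule nice_cadlag[OF L2b_nice])

lemma L2b_jointly_measurable: "L2b X \<Longrightarrow> (\<lambda>(s, \<omega>). X s \<omega>) \<in> borel_measurable (LT \<Otimes>\<^sub>M M)"
  by (rule nice_joint[OF L2b_nice])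

lemma L2b_int: "L2b X \<Longrightarrow> t \<in> {0..T} \<Longrightarrow> integrable M (\<lambda>\<omega>. (X t \<omega>)^2)"
  unfolding L2b_def by blast

lemma L2b_bound: assumes "L2b X" obtains C where "C \<ge> 0" "\<And>t. t \<in> {0..T} \<Longrightarrow> (\<integral>\<omega>. (X t \<omega>)^2 \<partial>M) \<le> C"
proof -
  obtain C where C: "\<forall>t\<in>{0..T}. integrable M (\<lambda>\<omega>. (X t \<omega>)^2) \<and> (\<integral>\<omega>. (X t \<omega>)^2 \<partial>M) \<le> C"
    using assms unfolding L2b_def by blast
  have "0 \<le> (\<integral>\<omega>. (X 0 \<omega>)^2 \<partial>M)" by simp
  also have "\<dots> \<le> C" using C by simp
  finally show ?thesis using that[of C] C by blast
qed

lemma L2bI: "nice X \<Longrightarrow> (\<And>t. t \<in> {0..T} \<Longrightarrow> integrable M (\<lambda>\<omega>. (X t \<omega>)^2)) \<Longrightarrow>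
   (\<And>t. t \<in> {0..T} \<Longrightarrow> (\<integral>\<omega>. (X t \<omega>)^2 \<partial>M) \<le> C) \<Longrightarrow> L2b X"
  unfolding L2b_def by blast

lemma L2b_dominated:
  assumes X: "nice X"
    and G: "\<And>t. t \<in> {0..T} \<Longrightarrow> integrable M (G t)" "\<And>t. t \<in> {0..T} \<Longrightarrow> (\<integral>\<omega>. G t \<omega> \<partial>M) \<le> C"
    and le: "\<And>t \<omega>. t \<in> {0..T} \<Longrightarrow> \<omega> \<in> space M \<Longrightarrow> (X t \<omega>)^2 \<le> G t \<omega>"
  shows "L2b X"
proof (rule L2bI[OF X])
  fix t assume t: "t \<in> {0..T}"
  show i: "integrable M (\<lambda>\<omega>. (X t \<omega>)^2)"
    by (rule Bochner_Integration.integrable_bound[OF G(1)[OF t]])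
      (use nice_meas[OF X t] le[OF t] in \<open>auto intro!: AE_I2 order_trans[OF _ abs_ge_self]\<close>)
  have "(\<integral>\<omega>. (X t \<omega>)^2 \<partial>M) \<le> (\<integral>\<omega>. G t \<omega> \<partial>M)"
    by (rule integral_mono[OF i G(1)[OF t] le[OF t]])
  then show "(\<integral>\<omega>. (X t \<omega>)^2 \<partial>M) \<le> C" using G(2)[OF t] by linarith
qed

lemma L2b_add: assumes X: "L2b X" and Y: "L2b Y" shows "L2b (\<lambda>t \<omega>. X t \<omega> + Y t \<omega>)"
proof -
  obtain A where A: "\<And>t. t \<in> {0..T} \<Longrightarrow> (\<integral>\<omega>. (X t \<omega>)^2 \<partial>M) \<le> A" using L2b_bound[OF X] by blast
  obtain B where B: "\<And>t. t \<in> {0..T} \<Longrightarrow> (\<integral>\<omega>. (Y t \<omega>)^2 \<partial>M) \<le> B" using L2b_bound[OF Y] by blast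
  show ?thesis
  proof (rule L2b_dominated[where G = "\<lambda>t \<omega>. 2 * (X t \<omega>)^2 + 2 * (Y t \<omega>)^2" and C = "2 * A + 2 * B"])
    fix t assume t: "t \<in> {0..T}"
    show "(\<integral>\<omega>. 2 * (X t \<omega>)^2 + 2 * (Y t \<omega>)^2 \<partial>M) \<le> 2 * A + 2 * B"
      using L2b_int[OF X t] L2b_int[OF Y t] A[OF t] B[OF t] by simp
  qed (use L2b_int[OF X] L2b_int[OF Y] nice_add[OF L2b_nice[OF X] L2b_nice[OF Y]] power2_add_le in auto)
qed

lemma L2b_det_mult: assumes X: "L2b X" and f: "cadlag_on 0 T f" shows "L2b (\<lambda>t \<omega>. f t * X t \<omega>)"
proof -
  obtain A where A: "A \<ge> 0" "\<And>t. t \<in> {0..T} \<Longrightarrow> (\<integral>\<omega>. (X t \<omega>)^2 \<partial>M) \<le> A" using L2b_bound[OF X] by blast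
  obtain B where B: "B \<ge> 0" "\<And>t. t \<in> {0..T} \<Longrightarrow> \<bar>f t\<bar> \<le> B" using cadlag_bounded[OF f] by blast
  have fB: "(f t)^2 \<le> B^2" if "t \<in> {0..T}" for t
    using power2_le_iff_abs_le[OF B(1)] B(2)[OF that] by blast
  show ?thesis
  proof (rule L2b_dominated[where G = "\<lambda>t \<omega>. B^2 * (X t \<omega>)^2" and C = "B^2 * A"])
    fix t assume t: "t \<in> {0..T}"
    show "(\<integral>\<omega>. B^2 * (X t \<omega>)^2 \<partial>M) \<le> B^2 * A"
      using L2b_int[OF X t] A(2)[OF t] by (simp add: mult_left_mono)
    show "integrable M (\<lambda>\<omega>. B^2 * (X t \<omega>)^2)" using L2b_int[OF X t] by simp
    fix \<omega> show "(f t * X t \<omega>)^2 \<le> B^2 * (X t \<omega>)^2"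
      unfolding power_mult_distrib by (rule mult_right_mono[OF fB[OF t]]) simp
  qed (rule nice_mult[OF nice_det[OF f] L2b_nice[OF X]])
qed

lemma L2b_diff: assumes X: "L2b X" and Y: "L2b Y" shows "L2b (\<lambda>t \<omega>. X t \<omega> - Y t \<omega>)"
  using L2b_add[OF X L2b_det_mult[OF Y cadlag_const[of 0 T "-1"]]] by simp

lemma L2b_const: "L2b (\<lambda>t \<omega>. c)"
  by (rule L2bI[where C = "c^2"]) (auto intro: nice_det cadlag_const simp: prob_space)

lemma integrable_L2_mult:
  assumes "U \<in> borel_measurable M" "V \<in> borel_measurable M"
    "integrable M (\<lambda>\<omega>. (U \<omega>)^2)" "integrable M (\<lambda>\<omega>. (V \<omega>)^2)"
  shows "integrable M (\<lambda>\<omega>. U \<omega> * V \<omega> :: real)"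
proof (rule Bochner_Integration.integrable_bound)
  show "integrable M (\<lambda>\<omega>. (U \<omega>)^2 + (V \<omega>)^2)" using assms by simp
  show "AE \<omega> in M. norm (U \<omega> * V \<omega>) \<le> norm ((U \<omega>)\<^sup>2 + (V \<omega>)\<^sup>2)"
    by (intro AE_I2) (use abs_mult_le_power2 in auto)
qed (use assms in measurable)

lemma L2b_mult_int: assumes "L2b X" "L2b Y" "t \<in> {0..T}" "s \<in> {0..T}" shows "integrable M (\<lambda>\<omega>. X t \<omega> * Y s \<omega>)"
  by (rule integrable_L2_mult) (use assms L2b_int nice_meas L2b_nice in auto)

text \<open>Fubini under a bound on first absolute moments that is uniform in time; the finite
  length of the horizon makes the iterated integral finite.\<close>

lemma integrable_joint_bounded:
  fixes G :: "real \<Rightarrow> 'a \<Rightarrow> real"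
  assumes m: "(\<lambda>(s, \<omega>). G s \<omega>) \<in> borel_measurable (LT \<Otimes>\<^sub>M M)"
    and i: "\<And>s. s \<in> {0..T} \<Longrightarrow> integrable M (G s)"
    and b: "\<And>s. s \<in> {0..T} \<Longrightarrow> (\<integral>\<omega>. \<bar>G s \<omega>\<bar> \<partial>M) \<le> C"
  shows "integrable (LT \<Otimes>\<^sub>M M) (\<lambda>(s, \<omega>). G s \<omega>)"
    "integrable M (\<lambda>\<omega>. prim (\<lambda>s. G s \<omega>) T)"
    "(\<integral>\<omega>. prim (\<lambda>s. G s \<omega>) T \<partial>M) = prim (\<lambda>s. \<integral>\<omega>. G s \<omega> \<partial>M) T"
    "set_borel_measurable lborel {0..T} (\<lambda>s. \<integral>\<omega>. G s \<omega> \<partial>M)"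
proof -
  interpret P: pair_sigma_finite LT M by (rule pair_LT)
  interpret L: finite_measure LT by (rule finite_LT)
  show int: "integrable (LT \<Otimes>\<^sub>M M) (\<lambda>(s, \<omega>). G s \<omega>)"
  proof (rule P.Fubini_integrable[OF m])
    have "(\<lambda>(s, \<omega>). \<bar>G s \<omega>\<bar>) \<in> borel_measurable (LT \<Otimes>\<^sub>M M)"
      using borel_measurable_abs[OF m] by (simp add: split_def)
    then have "(\<lambda>s. \<integral>\<omega>. \<bar>G s \<omega>\<bar> \<partial>M) \<in> borel_measurable LT" by (rule borel_measurable_lebesgue_integral)
    then have "integrable LT (\<lambda>s. \<integral>\<omega>. \<bar>G s \<omega>\<bar> \<partial>M)"
      by (rule L.integrable_const_bound[where B = C, rotated]) (use b in \<open>auto intro!: AE_I2 simp: space_LT\<close>)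
    then show "integrable LT (\<lambda>x. \<integral>y. norm (case (x, y) of (s, \<omega>) \<Rightarrow> G s \<omega>) \<partial>M)" by simp
    show "AE x in LT. integrable M (\<lambda>y. case (x, y) of (s, \<omega>) \<Rightarrow> G s \<omega>)"
      using i by (intro AE_I2) (simp add: space_LT)
  qed
  show "integrable M (\<lambda>\<omega>. prim (\<lambda>s. G s \<omega>) T)"
    using P.integrable_snd[OF int] by (simp add: integral_LT)
  show "(\<integral>\<omega>. prim (\<lambda>s. G s \<omega>) T \<partial>M) = prim (\<lambda>s. \<integral>\<omega>. G s \<omega> \<partial>M) T"
    using P.Fubini_integral[OF int] by (simp add: integral_LT)
  have "(\<lambda>s. \<integral>\<omega>. G s \<omega> \<partial>M) \<in> borel_measurable LT"
    by (rule borel_measurable_lebesgue_integral[OF m])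
  then show "set_borel_measurable lborel {0..T} (\<lambda>s. \<integral>\<omega>. G s \<omega> \<partial>M)"
    unfolding set_borel_measurable_def by (subst (asm) borel_measurable_restrict_space_iff) auto
qed

lemma L2b_joint:
  assumes X: "L2b X" and Y: "L2b Y" and w: "bdm T w"
  shows "integrable M (\<lambda>\<omega>. prim (\<lambda>s. w s * (X s \<omega> * Y s \<omega>)) T)"
    "(\<integral>\<omega>. prim (\<lambda>s. w s * (X s \<omega> * Y s \<omega>)) T \<partial>M) = prim (\<lambda>s. w s * (\<integral>\<omega>. X s \<omega> * Y s \<omega> \<partial>M)) T"
    "bdm T (\<lambda>s. \<integral>\<omega>. X s \<omega> * Y s \<omega> \<partial>M)"
proof -
  obtain A where A: "A \<ge> 0" "\<And>t. t \<in> {0..T} \<Longrightarrow> (\<integral>\<omega>. (X t \<omega>)^2 \<partial>M) \<le> A" using L2b_bound[OF X] by blast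
  obtain B where B: "B \<ge> 0" "\<And>t. t \<in> {0..T} \<Longrightarrow> (\<integral>\<omega>. (Y t \<omega>)^2 \<partial>M) \<le> B" using L2b_bound[OF Y] by blast
  have ab: "(\<integral>\<omega>. \<bar>X s \<omega> * Y s \<omega>\<bar> \<partial>M) \<le> A + B" if s: "s \<in> {0..T}" for s
  proof -
    have "(\<integral>\<omega>. \<bar>X s \<omega> * Y s \<omega>\<bar> \<partial>M) \<le> (\<integral>\<omega>. (X s \<omega>)^2 + (Y s \<omega>)^2 \<partial>M)"
    proof (rule integral_mono)
      show "integrable M (\<lambda>\<omega>. \<bar>X s \<omega> * Y s \<omega>\<bar>)" using L2b_mult_int[OF X Y s s] by simp
      show "\<bar>X s \<omega> * Y s \<omega>\<bar> \<le> (X s \<omega>)^2 + (Y s \<omega>)^2" for \<omega> by (rule abs_mult_le_power2)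
    qed (use L2b_int[OF X s] L2b_int[OF Y s] in auto)
    also have "\<dots> \<le> A + B" using L2b_int[OF X s] L2b_int[OF Y s] A(2)[OF s] B(2)[OF s] by simp
    finally show ?thesis .
  qed
  obtain W where W: "W \<ge> 0" "\<And>t. t \<in> {0..T} \<Longrightarrow> \<bar>w t\<bar> \<le> W" using bdm_bound[OF w] by blast
  have m: "(\<lambda>(s, \<omega>). X s \<omega> * Y s \<omega>) \<in> borel_measurable (LT \<Otimes>\<^sub>M M)"
    using borel_measurable_times[OF L2b_jointly_measurable[OF X] L2b_jointly_measurable[OF Y]] by (simp add: split_def)
  have mw: "(\<lambda>(s, \<omega>). w s * (X s \<omega> * Y s \<omega>)) \<in> borel_measurable (LT \<Otimes>\<^sub>M M)"
    using borel_measurable_times[OF bdm_joint_LT[OF w] m] by (simp add: split_def)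
  have bw: "(\<integral>\<omega>. \<bar>w s * (X s \<omega> * Y s \<omega>)\<bar> \<partial>M) \<le> W * (A + B)" if s: "s \<in> {0..T}" for s
  proof -
    have "(\<integral>\<omega>. \<bar>w s * (X s \<omega> * Y s \<omega>)\<bar> \<partial>M) = \<bar>w s\<bar> * (\<integral>\<omega>. \<bar>X s \<omega> * Y s \<omega>\<bar> \<partial>M)"
      unfolding abs_mult[of "w s"] by simp
    also have "\<dots> \<le> W * (A + B)"
      using W(2)[OF s] ab[OF s] W(1) by (intro mult_mono) auto
    finally show ?thesis .
  qed
  have iw: "integrable M (\<lambda>\<omega>. w s * (X s \<omega> * Y s \<omega>))" if "s \<in> {0..T}" for s
    using L2b_mult_int[OF X Y that that] by simp
  show "integrable M (\<lambda>\<omega>. prim (\<lambda>s. w s * (X s \<omega> * Y s \<omega>)) T)"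
    by (rule integrable_joint_bounded(2)[OF mw iw bw])
  show "(\<integral>\<omega>. prim (\<lambda>s. w s * (X s \<omega> * Y s \<omega>)) T \<partial>M) = prim (\<lambda>s. w s * (\<integral>\<omega>. X s \<omega> * Y s \<omega> \<partial>M)) T"
    using integrable_joint_bounded(3)[OF mw iw bw] by simp
  show "bdm T (\<lambda>s. \<integral>\<omega>. X s \<omega> * Y s \<omega> \<partial>M)"
  proof (rule bdmI[of _ _ "A + B"])
    have "(\<lambda>s. \<integral>\<omega>. X s \<omega> * Y s \<omega> \<partial>M) \<in> borel_measurable LT"
      by (rule borel_measurable_lebesgue_integral[OF m])
    then show "(\<lambda>s. \<integral>\<omega>. X s \<omega> * Y s \<omega> \<partial>M) \<in> borel_measurable (restrict_space borel {0..T})"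
      using measurable_cong_sets[OF sets_LT refl] by blast
    fix s assume s: "s \<in> {0..T}"
    have "\<bar>\<integral>\<omega>. X s \<omega> * Y s \<omega> \<partial>M\<bar> \<le> (\<integral>\<omega>. \<bar>X s \<omega> * Y s \<omega>\<bar> \<partial>M)" by (rule integral_abs_bound)
    then show "\<bar>\<integral>\<omega>. X s \<omega> * Y s \<omega> \<partial>M\<bar> \<le> A + B" using ab[OF s] by linarith
  qed
qed

lemma L2b_prim:
  assumes X: "L2b X" and f: "bdm T f" shows "L2b (\<lambda>t \<omega>. prim (\<lambda>s. f s * X s \<omega>) t)"
proof (rule L2b_dominated[where G = "\<lambda>t \<omega>. T * prim (\<lambda>s. (f s)^2 * (X s \<omega> * X s \<omega>)) T"])
  show "nice (\<lambda>t \<omega>. prim (\<lambda>s. f s * X s \<omega>) t)" by (rule nice_prim[OF L2b_nice[OF X] f])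
  note j = L2b_joint[OF X X bdm_power2[OF f]]
  show "integrable M (\<lambda>\<omega>. T * prim (\<lambda>s. (f s)^2 * (X s \<omega> * X s \<omega>)) T)" using j(1) by simp
  show "(\<integral>\<omega>. T * prim (\<lambda>s. (f s)^2 * (X s \<omega> * X s \<omega>)) T \<partial>M) \<le> (\<integral>\<omega>. T * prim (\<lambda>s. (f s)^2 * (X s \<omega> * X s \<omega>)) T \<partial>M)" ..
  fix t \<omega> assume t: "t \<in> {0..T}" and w: "\<omega> \<in> space M"
  have b: "bdm T (\<lambda>s. f s * X s \<omega>)" by (rule bdm_mult[OF f L2b_bdm[OF X w]])
  have "(prim (\<lambda>s. f s * X s \<omega>) t)^2 \<le> t * prim (\<lambda>s. (f s * X s \<omega>)^2) t" by (rule prim_cauchy_schwarz[OF b t])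
  also have "\<dots> \<le> T * prim (\<lambda>s. (f s * X s \<omega>)^2) T"
    using t by (intro mult_mono prim_mono_endpoint[OF bdm_power2[OF b]] prim_nonneg) auto
  also have "(\<lambda>s. (f s * X s \<omega>)^2) = (\<lambda>s. (f s)^2 * (X s \<omega> * X s \<omega>))" by (simp add: power2_eq_square mult_ac)
  finally show "(prim (\<lambda>s. f s * X s \<omega>) t)^2 \<le> T * prim (\<lambda>s. (f s)^2 * (X s \<omega> * X s \<omega>)) T" .
qed

text \<open>The supremum condition on strategies dominates the second moment at each time, so a
  cadlag version lies in the working class. Estimates are proved for such versions and carried back
  by indistinguishability.\<close>

lemma strategy_L2b:
  assumes "Q \<in> strategies M F T \<Xi>T"
  obtains Q' where "L2b Q'" "indist Q Q'" "AE \<omega> in M. Q' T \<omega> = \<Xi>T \<omega>" "cadlag_adapted M F T Q"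
proof -
  have ca: "cadlag_adapted M F T Q" and sup: "(\<integral>\<^sup>+\<omega>. (SUP t\<in>{0..T}. ennreal (\<bar>Q t \<omega>\<bar>^2)) \<partial>M) < \<infinity>"
    and tmn: "AE \<omega> in M. Q T \<omega> = \<Xi>T \<omega>"
    using assms unfolding strategies_def semimartingale_def by blast+
  obtain Q' where Q': "nice Q'" "indist Q Q'" using cadlag_version[OF ca] by blast
  define S where "S = (\<integral>\<^sup>+\<omega>. (SUP t\<in>{0..T}. ennreal (\<bar>Q t \<omega>\<bar>^2)) \<partial>M)"
  have S: "(\<integral>\<^sup>+\<omega>. ennreal ((Q' t \<omega>)^2) \<partial>M) \<le> S" if t: "t \<in> {0..T}" for t
    unfolding S_def
  proof (rule nn_integral_mono_AE)
    show "AE \<omega> in M. ennreal ((Q' t \<omega>)\<^sup>2) \<le> (SUP t\<in>{0..T}. ennreal (\<bar>Q t \<omega>\<bar>^2))"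
      using indist_at[OF Q'(2) t]
    proof eventually_elim
      case (elim \<omega>)
      have "ennreal ((Q' t \<omega>)\<^sup>2) = ennreal (\<bar>Q t \<omega>\<bar>^2)" using elim by simp
      also have "\<dots> \<le> (SUP t\<in>{0..T}. ennreal (\<bar>Q t \<omega>\<bar>^2))" by (rule SUP_upper[OF t])
      finally show ?case .
    qed
  qed
  have Sf: "S < \<infinity>" using sup unfolding S_def .
  have "L2b Q'"
  proof (rule L2bI[OF Q'(1)])
    fix t assume t: "t \<in> {0..T}"
    have m: "Q' t \<in> borel_measurable M" by (rule nice_meas[OF Q'(1) t])
    show i: "integrable M (\<lambda>\<omega>. (Q' t \<omega>)^2)"
      by (rule integrableI_nonneg) (use m S[OF t] Sf in auto)
    have "ennreal (\<integral>\<omega>. (Q' t \<omega>)^2 \<partial>M) = (\<integral>\<^sup>+\<omega>. ennreal ((Q' t \<omega>)^2) \<partial>M)"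
      by (rule nn_integral_eq_integral[symmetric, OF i]) simp
    also have "\<dots> \<le> S" by (rule S[OF t])
    also have "\<dots> = ennreal (enn2real S)" using Sf by simp
    finally show "(\<integral>\<omega>. (Q' t \<omega>)^2 \<partial>M) \<le> enn2real S" by (simp add: ennreal_le_iff)
  qed
  moreover have "AE \<omega> in M. Q' T \<omega> = \<Xi>T \<omega>"
    using tmn indist_at[OF Q'(2) T_T] by eventually_elim simp
  ultimately show ?thesis using that Q'(2) ca by blast
qed

text \<open>The martingale property in weak form, tested against square-integrable variables known
  at time \<open>s\<close>. It enters the arguments as an orthogonality relation, which is exactly
  this form.\<close>

definition L2mart :: "(real \<Rightarrow> 'a \<Rightarrow> real) \<Rightarrow> bool" where
  "L2mart X \<longleftrightarrow> L2b X \<and> (\<forall>s\<in>{0..T}. \<forall>t\<in>{s..T}. \<forall>U. U \<in> borel_measurable (F s) \<longrightarrow> integrable M (\<lambda>\<omega>. (U \<omega>)^2) \<longrightarrow>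
     (\<integral>\<omega>. U \<omega> * X t \<omega> \<partial>M) = (\<integral>\<omega>. U \<omega> * X s \<omega> \<partial>M))"

lemma L2mart_L2b: "L2mart X \<Longrightarrow> L2b X"
  unfolding L2mart_def by blast

lemma L2mart_test:
  "L2mart X \<Longrightarrow> 0 \<le> s \<Longrightarrow> s \<le> t \<Longrightarrow> t \<le> T \<Longrightarrow> U \<in> borel_measurable (F s) \<Longrightarrow> integrable M (\<lambda>\<omega>. (U \<omega>)^2) \<Longrightarrow>
     (\<integral>\<omega>. U \<omega> * X t \<omega> \<partial>M) = (\<integral>\<omega>. U \<omega> * X s \<omega> \<partial>M)"
  unfolding L2mart_def by auto

text \<open>Testing with \<open>U = X s\<close> shows that the increment is orthogonal to
  \<open>X s\<close>.\<close>

lemma L2mart_increment: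
  assumes X: "L2mart X" and st: "0 \<le> s" "s \<le> t" "t \<le> T"
  shows "(\<integral>\<omega>. (X t \<omega> - X s \<omega>)^2 \<partial>M) = (\<integral>\<omega>. (X t \<omega>)^2 \<partial>M) - (\<integral>\<omega>. (X s \<omega>)^2 \<partial>M)"
    and "integrable M (\<lambda>\<omega>. (X t \<omega> - X s \<omega>)^2)"
proof -
  have b: "L2b X" by (rule L2mart_L2b[OF X])
  have s: "s \<in> {0..T}" and t: "t \<in> {0..T}" using st by auto
  have c: "(\<integral>\<omega>. X s \<omega> * X t \<omega> \<partial>M) = (\<integral>\<omega>. X s \<omega> * X s \<omega> \<partial>M)"
    by (rule L2mart_test[OF X st L2b_adapted[OF b s] L2b_int[OF b s]])
  have eq: "(X t \<omega> - X s \<omega>)^2 = (X t \<omega>)^2 - 2 * (X s \<omega> * X t \<omega>) + (X s \<omega>)^2" for \<omega>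
    by (simp add: power2_eq_square algebra_simps)
  note i = L2b_int[OF b s] L2b_int[OF b t] L2b_mult_int[OF b b s t]
  show "integrable M (\<lambda>\<omega>. (X t \<omega> - X s \<omega>)^2)" unfolding eq using i by simp
  show "(\<integral>\<omega>. (X t \<omega> - X s \<omega>)^2 \<partial>M) = (\<integral>\<omega>. (X t \<omega>)^2 \<partial>M) - (\<integral>\<omega>. (X s \<omega>)^2 \<partial>M)"
    unfolding eq using i c by (simp add: power2_eq_square)
qed

lemma L2mart_mono:
  assumes X: "L2mart X" and st: "0 \<le> s" "s \<le> t" "t \<le> T"
  shows "(\<integral>\<omega>. (X s \<omega>)^2 \<partial>M) \<le> (\<integral>\<omega>. (X t \<omega>)^2 \<partial>M)"
proof -
  have "0 \<le> (\<integral>\<omega>. (X t \<omega> - X s \<omega>)^2 \<partial>M)" by simp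
  then show ?thesis using L2mart_increment(1)[OF assms] by linarith
qed

text \<open>Jensen's inequality for conditional expectations gives square integrability at each
  time. Against a variable known at \<open>s\<close>, both \<open>X s\<close> and \<open>X t\<close>
  test like the terminal value, by the defining property of conditional expectation. Orthogonality
  then bounds all second moments by the terminal one.\<close>

lemma closed_martingale_L2mart:
  assumes tm: "\<Xi>T \<in> borel_measurable (F T)" and t2: "integrable M (\<lambda>\<omega>. (\<Xi>T \<omega>)^2)"
    and Xi: "cadlag_version_of_closed_martingale M F T \<Xi>T \<Xi>"
  obtains X where "L2mart X" "indist \<Xi> X" "AE \<omega> in M. X T \<omega> = \<Xi>T \<omega>" "cadlag_adapted M F T \<Xi>"
proof -
  have ca: "cadlag_adapted M F T \<Xi>" and ce: "\<And>t. t \<in> {0..T} \<Longrightarrow> AE \<omega> in M. \<Xi> t \<omega> = real_cond_exp M (F t) \<Xi>T \<omega>"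
    using Xi unfolding cadlag_version_of_closed_martingale_def by blast+
  obtain X where X: "nice X" "indist \<Xi> X" using cadlag_version[OF ca] by blast
  have mM: "\<Xi>T \<in> borel_measurable M" by (rule measurable_F_M[OF tm T_T])
  have i1: "integrable M \<Xi>T" using integrable_L2_mult[OF mM _ t2, of "\<lambda>_. 1"] by simp
  have Xce: "AE \<omega> in M. X t \<omega> = real_cond_exp M (F t) \<Xi>T \<omega>" if "t \<in> {0..T}" for t
    using ce[OF that] indist_at[OF X(2) that] by eventually_elim simp
  have sf: "finite_measure_subalgebra M (F t)" if "t \<in> {0..T}" for t
    using subalg[OF that] by (simp add: finite_measure_subalgebra_def finite_measure_subalgebra_axioms_def finite_measure_axioms)
  have int: "integrable M (\<lambda>\<omega>. (X t \<omega>)^2)" if t: "t \<in> {0..T}" for t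
  proof -
    interpret S: finite_measure_subalgebra M "F t" by (rule sf[OF t])
    have cv: "convex_on UNIV (\<lambda>x::real. x^2)" using convex_power2 by simp
    have "integrable M (\<lambda>\<omega>. (real_cond_exp M (F t) \<Xi>T \<omega>)^2)"
      by (rule S.integrable_convex_cond_exp[of \<Xi>T UNIV, OF i1 _ _ t2 cv]) auto
    then show ?thesis
      by (rule integrable_cong_AE_imp) (use nice_meas[OF X(1) t] Xce[OF t] in auto)
  qed
  have tst: "(\<integral>\<omega>. U \<omega> * X s \<omega> \<partial>M) = (\<integral>\<omega>. U \<omega> * \<Xi>T \<omega> \<partial>M)"
    if s: "s \<in> {0..T}" and U: "U \<in> borel_measurable (F s)" "integrable M (\<lambda>\<omega>. (U \<omega>)^2)" for s U
  proof -
    interpret S: finite_measure_subalgebra M "F s" by (rule sf[OF s])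
    have Um: "U \<in> borel_measurable M" by (rule measurable_F_M[OF U(1) s])
    have "(\<integral>\<omega>. U \<omega> * X s \<omega> \<partial>M) = (\<integral>\<omega>. U \<omega> * real_cond_exp M (F s) \<Xi>T \<omega> \<partial>M)"
    proof (rule integral_cong_AE)
      show "AE \<omega> in M. U \<omega> * X s \<omega> = U \<omega> * real_cond_exp M (F s) \<Xi>T \<omega>"
        using Xce[OF s] by eventually_elim simp
    qed (use Um nice_meas[OF X(1) s] in measurable)
    also have "\<dots> = (\<integral>\<omega>. U \<omega> * \<Xi>T \<omega> \<partial>M)"
      by (rule S.real_cond_exp_intg(2)[OF integrable_L2_mult[OF Um mM U(2) t2] U(1) mM])
    finally show ?thesis .
  qed
  have mart: "(\<integral>\<omega>. U \<omega> * X t \<omega> \<partial>M) = (\<integral>\<omega>. U \<omega> * X s \<omega> \<partial>M)"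
    if "s \<in> {0..T}" "t \<in> {s..T}" "U \<in> borel_measurable (F s)" "integrable M (\<lambda>\<omega>. (U \<omega>)^2)" for s t U
  proof -
    have t: "t \<in> {0..T}" using that by auto
    have "U \<in> borel_measurable (F t)" by (rule measurable_F_mono[OF that(3)]) (use that t in auto)
    then show ?thesis using tst[OF t _ that(4)] tst[OF that(1,3,4)] by simp
  qed
  have bd: "(\<integral>\<omega>. (X s \<omega>)^2 \<partial>M) \<le> (\<integral>\<omega>. (X T \<omega>)^2 \<partial>M)" if s: "s \<in> {0..T}" for s
  proof -
    have c: "(\<integral>\<omega>. X s \<omega> * X T \<omega> \<partial>M) = (\<integral>\<omega>. X s \<omega> * X s \<omega> \<partial>M)"
      by (rule mart[OF s _ nice_adapted[OF X(1) s] int[OF s]]) (use s in auto)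
    have "0 \<le> (\<integral>\<omega>. (X T \<omega> - X s \<omega>)^2 \<partial>M)" by simp
    also have "(\<lambda>\<omega>. (X T \<omega> - X s \<omega>)^2) = (\<lambda>\<omega>. (X T \<omega>)^2 - 2 * (X s \<omega> * X T \<omega>) + (X s \<omega>)^2)"
      by (simp add: power2_eq_square algebra_simps)
    finally show ?thesis
      using int[OF s] int[OF T_T] integrable_L2_mult[OF nice_meas[OF X(1) s] nice_meas[OF X(1) T_T] int[OF s] int[OF T_T]] c
      by (simp add: power2_eq_square)
  qed
  have "L2b X" by (rule L2bI[OF X(1) int bd])
  then have 1: "L2mart X" unfolding L2mart_def using mart by blast
  have 2: "AE \<omega> in M. X T \<omega> = \<Xi>T \<omega>"
  proof -
    interpret S: finite_measure_subalgebra M "F T" by (rule sf[OF T_T])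
    show ?thesis using Xce[OF T_T] S.real_cond_exp_F_meas[OF i1 tm] by eventually_elim simp
  qed
  show ?thesis by (rule that[OF 1 X(2) 2 ca])
qed

end

section \<open>States and the Hilbert norm of processes\<close>

locale control = filtered_horizon M F T + coeffs T \<beta> lam dlam
  for M :: "'a measure" and F and T and \<beta> lam dlam :: "real \<Rightarrow> real"
begin

abbreviation pst :: "real \<Rightarrow> (real \<Rightarrow> 'a \<Rightarrow> real) \<Rightarrow> real \<Rightarrow> 'a \<Rightarrow> real" where
  "pst y Q t \<omega> \<equiv> pstate y (\<lambda>s. Q s \<omega>) t"

lemma pst_eq: "pst y Q t \<omega> = lam t * Q t \<omega> + exp (- prim \<beta> t) * (y - prim (\<lambda>s. (EB s * gco s) * Q s \<omega>) t)"
  unfolding pstate_def zstate_def by (simp add: mult.assoc)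

lemma cadlag_lam: "cadlag_on 0 T lam"
  by (rule cadlag_continuous[OF is_prim_continuous[OF is_prim_lam]])

lemma cadlag_EBm: "cadlag_on 0 T (\<lambda>t. exp (- prim \<beta> t))"
  by (rule cadlag_continuous[OF is_prim_continuous[OF is_prim_EBm]])

lemma bdm_EBg: "bdm T (\<lambda>s. EB s * gco s)"
  by (rule bdm_mult[OF is_prim_bdm[OF is_prim_EB] bdm_gco])

lemma nice_pst: assumes "nice Q" shows "nice (pst y Q)"
  unfolding pst_eq[abs_def]
  by (intro nice_add nice_mult nice_diff nice_det cadlag_lam cadlag_EBm cadlag_const assms nice_prim bdm_EBg)

lemma L2b_pst: assumes "L2b Q" shows "L2b (pst y Q)"
  unfolding pst_eq[abs_def]
  by (intro L2b_add L2b_det_mult L2b_diff L2b_const cadlag_lam cadlag_EBm assms L2b_prim bdm_EBg)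

lemma pstate_cong: "(\<And>s. s \<in> {0..T} \<Longrightarrow> q s = q' s) \<Longrightarrow> t \<in> {0..T} \<Longrightarrow> pstate y q t = pstate y q' t"
  unfolding pstate_def zstate_def using prim_cong[of t "\<lambda>s. EB s * (gco s * q s)" "\<lambda>s. EB s * (gco s * q' s)"] by auto

lemma indist_pst: assumes "indist Q Q'" shows "indist (pst y Q) (pst y Q')"
  using assms unfolding indist_def
proof eventually_elim
  case (elim \<omega>)
  show ?case by (intro ballI pstate_cong) (use elim in auto)
qed

text \<open>The initial block \<open>lam 0 * Q 0\<close> in the state equation cancels against the
  boundary term at \<open>0\<close> from integration by parts; what is left is the pathwise
  equation.\<close>

lemma solves_state_eq_iff:
  assumes Q: "cadlag_adapted M F T Q" and Y: "cadlag_adapted M F T Y"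
  shows "solves_state_eq M F T \<beta> lam y Q Y \<longleftrightarrow> indist Y (pst y Q)"
proof -
  have si: "indist (stoch_int M F T lam Q) (ibp lam dlam Q)" by (rule stoch_int_ibp[OF Q is_prim_lam])
  have cQ: "AE \<omega> in M. cadlag_on 0 T (\<lambda>t. Q t \<omega>)" and cY: "AE \<omega> in M. cadlag_on 0 T (\<lambda>t. Y t \<omega>)"
    using Q Y unfolding cadlag_adapted_def by blast+
  have "AE \<omega> in M. (\<forall>t\<in>{0..T}. Y t \<omega> = y - (LINT s:{0..t}|lborel. \<beta> s * Y s \<omega>)
                 + lam 0 * Q 0 \<omega> + stoch_int M F T lam Q t \<omega>) \<longleftrightarrow> (\<forall>t\<in>{0..T}. Y t \<omega> = pst y Q t \<omega>)"
    using si[unfolded indist_def] cQ cY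
  proof eventually_elim
    case (elim \<omega>)
    have T0: "0 \<le> T" using T by simp
    have "(\<forall>t\<in>{0..T}. Y t \<omega> = y - (LINT s:{0..t}|lborel. \<beta> s * Y s \<omega>) + lam 0 * Q 0 \<omega> + stoch_int M F T lam Q t \<omega>)
     \<longleftrightarrow> (\<forall>t\<in>{0..T}. Y t \<omega> = y - prim (\<lambda>s. \<beta> s * Y s \<omega>) t + lam t * Q t \<omega> - prim (\<lambda>s. Q s \<omega> * dlam s) t)"
      by (intro ball_cong refl) (use elim(1) in \<open>auto simp: ibp_def\<close>)
    also have "\<dots> \<longleftrightarrow> (\<forall>t\<in>{0..T}. Y t \<omega> = pst y Q t \<omega>)"
      by (rule state_equation_iff[OF cadlag_bdm[OF elim(2) T0] cadlag_bdm[OF elim(3) T0]])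
    finally show ?case .
  qed
  then have "(AE \<omega> in M. \<forall>t\<in>{0..T}. Y t \<omega> = y - (LINT s:{0..t}|lborel. \<beta> s * Y s \<omega>)
                 + lam 0 * Q 0 \<omega> + stoch_int M F T lam Q t \<omega>) \<longleftrightarrow> (AE \<omega> in M. \<forall>t\<in>{0..T}. Y t \<omega> = pst y Q t \<omega>)"
    by (rule eventually_subst)
  then show ?thesis unfolding solves_state_eq_def indist_def using Y by blast
qed

text \<open>The explicit state is a solution, so the choice in \<open>state\<close> has a witness,
  and uniqueness identifies the chosen solution with it.\<close>

lemma state_indist:
  assumes Q: "cadlag_adapted M F T Q" shows "indist (state M F T \<beta> lam y Q) (pst y Q)"
proof -
  obtain Q' where Q': "nice Q'" "indist Q Q'" using cadlag_version[OF Q] by blast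
  have ca: "cadlag_adapted M F T (pst y Q)"
    by (rule indist_cadlag_adapted[OF nice_pst[OF Q'(1)] indist_pst[OF indist_sym[OF Q'(2)]]])
  have "indist (pst y Q) (pst y Q)" unfolding indist_def by simp
  then have "solves_state_eq M F T \<beta> lam y Q (pst y Q)" using solves_state_eq_iff[OF Q ca] by blast
  then have s: "solves_state_eq M F T \<beta> lam y Q (state M F T \<beta> lam y Q)"
    unfolding state_def by (rule someI[of "solves_state_eq M F T \<beta> lam y Q"])
  then have "cadlag_adapted M F T (state M F T \<beta> lam y Q)" unfolding solves_state_eq_def by blast
  from solves_state_eq_iff[OF Q this] show ?thesis using s by blast
qed

text \<open>Arguments such as \<open>state\<close> are regular only almost surely. Completeness
  makes the integrand formed from them measurable, so the two expectations agree.\<close>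

lemma inner_H_cong:
  assumes Y: "nice Y'" "indist Y Y'" and Z: "nice Z'" "indist Z Z'"
  shows "inner_H M T \<beta> lam dlam Y Z = inner_H M T \<beta> lam dlam Y' Z'"
proof -
  have YZ: "nice (\<lambda>t \<omega>. Y' t \<omega> * Z' t \<omega>)" by (rule nice_mult[OF Y(1) Z(1)])
  have m: "(\<lambda>\<omega>. prim (\<lambda>t. wgt t * Y' t \<omega> * Z' t \<omega>) T + 1 / (2 * lam T) * Y' T \<omega> * Z' T \<omega>) \<in> borel_measurable M"
    unfolding mult.assoc[of "wgt _"]
    by (intro borel_measurable_add borel_measurable_times borel_measurable_const
        nice_meas[OF nice_prim[OF YZ bdm_wgt] T_T] nice_meas[OF Y(1) T_T] nice_meas[OF Z(1) T_T])
  have ae: "AE \<omega> in M. prim (\<lambda>t. wgt t * Y' t \<omega> * Z' t \<omega>) T + 1 / (2 * lam T) * Y' T \<omega> * Z' T \<omega>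
      = prim (\<lambda>t. wgt t * Y t \<omega> * Z t \<omega>) T + 1 / (2 * lam T) * Y T \<omega> * Z T \<omega>"
    using Y(2)[unfolded indist_def] Z(2)[unfolded indist_def]
  proof eventually_elim
    case (elim \<omega>)
    have "prim (\<lambda>t. wgt t * Y' t \<omega> * Z' t \<omega>) T = prim (\<lambda>t. wgt t * Y t \<omega> * Z t \<omega>) T"
      by (rule prim_cong) (use elim in auto)
    then show ?case using elim by simp
  qed
  show ?thesis unfolding inner_H_def
  proof (rule integral_cong_AE[OF measurable_AE_cong[OF m ae] m])
    show "AE \<omega> in M. prim (\<lambda>t. wgt t * Y t \<omega> * Z t \<omega>) T + 1 / (2 * lam T) * Y T \<omega> * Z T \<omega>
      = prim (\<lambda>t. wgt t * Y' t \<omega> * Z' t \<omega>) T + 1 / (2 * lam T) * Y' T \<omega> * Z' T \<omega>"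
      using ae by eventually_elim simp
  qed
qed

lemma inner_H_L2b:
  assumes Y: "L2b Y" and Z: "L2b Z"
  shows "integrable M (\<lambda>\<omega>. prim (\<lambda>t. wgt t * (Y t \<omega> * Z t \<omega>)) T + 1 / (2 * lam T) * (Y T \<omega> * Z T \<omega>))"
    "inner_H M T \<beta> lam dlam Y Z = (\<integral>\<omega>. prim (\<lambda>t. wgt t * (Y t \<omega> * Z t \<omega>)) T + 1 / (2 * lam T) * (Y T \<omega> * Z T \<omega>) \<partial>M)"
    "inner_H M T \<beta> lam dlam Y Z = prim (\<lambda>t. wgt t * (\<integral>\<omega>. Y t \<omega> * Z t \<omega> \<partial>M)) T + 1 / (2 * lam T) * (\<integral>\<omega>. Y T \<omega> * Z T \<omega> \<partial>M)"
proof -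
  note j = L2b_joint[OF Y Z bdm_wgt] and i = L2b_mult_int[OF Y Z T_T T_T]
  show 1: "integrable M (\<lambda>\<omega>. prim (\<lambda>t. wgt t * (Y t \<omega> * Z t \<omega>)) T + 1 / (2 * lam T) * (Y T \<omega> * Z T \<omega>))"
    using j(1) i by simp
  show 2: "inner_H M T \<beta> lam dlam Y Z = (\<integral>\<omega>. prim (\<lambda>t. wgt t * (Y t \<omega> * Z t \<omega>)) T + 1 / (2 * lam T) * (Y T \<omega> * Z T \<omega>) \<partial>M)"
    unfolding inner_H_def by (simp add: mult.assoc)
  show "inner_H M T \<beta> lam dlam Y Z = prim (\<lambda>t. wgt t * (\<integral>\<omega>. Y t \<omega> * Z t \<omega> \<partial>M)) T + 1 / (2 * lam T) * (\<integral>\<omega>. Y T \<omega> * Z T \<omega> \<partial>M)"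
    unfolding 2 using j(1,2) i by simp
qed

lemma norm_H_sq_expand:
  assumes Y: "L2b Y" and Z: "L2b Z"
  shows "norm_H_sq M T \<beta> lam dlam Y = norm_H_sq M T \<beta> lam dlam Z
    + 2 * inner_H M T \<beta> lam dlam Z (\<lambda>t \<omega>. Y t \<omega> - Z t \<omega>) + norm_H_sq M T \<beta> lam dlam (\<lambda>t \<omega>. Y t \<omega> - Z t \<omega>)"
proof -
  let ?D = "\<lambda>t \<omega>. Y t \<omega> - Z t \<omega>"
  let ?g = "\<lambda>A B \<omega>. prim (\<lambda>t. wgt t * (A t \<omega> * B t \<omega>)) T + 1 / (2 * lam T) * (A T \<omega> * B T \<omega>)"
  have D: "L2b ?D" by (rule L2b_diff[OF Y Z])
  \<comment> \<open>The same polynomial identity serves under the time integral and for the terminal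
    term.\<close>
  have quad: "w * (a * a) = (w * (b * b) + 2 * (w * (b * (a - b)))) + w * ((a - b) * (a - b))" for w a b :: real
    by (simp add: algebra_simps)
  have comb: "A + B = (a + d) + 2 * (b + e) + (c + f)" if "A = a + 2 * b + c" "B = d + 2 * e + f" for A B a b c d e f :: real
    using that by simp
  have e: "?g Y Y \<omega> = ?g Z Z \<omega> + 2 * ?g Z ?D \<omega> + ?g ?D ?D \<omega>" if w: "\<omega> \<in> space M" for \<omega>
  proof -
    have b: "bdm T (\<lambda>t. wgt t * (A t \<omega> * B t \<omega>))" if "L2b A" "L2b B" for A B
      by (intro bdm_mult bdm_wgt nice_bdm[OF L2b_nice w] that)
    have "prim (\<lambda>t. wgt t * (Y t \<omega> * Y t \<omega>)) T
      = prim (\<lambda>t. (wgt t * (Z t \<omega> * Z t \<omega>) + 2 * (wgt t * (Z t \<omega> * ?D t \<omega>))) + wgt t * (?D t \<omega> * ?D t \<omega>)) T"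
      by (rule prim_cong) (rule quad)
    also have "\<dots> = prim (\<lambda>t. wgt t * (Z t \<omega> * Z t \<omega>)) T + 2 * prim (\<lambda>t. wgt t * (Z t \<omega> * ?D t \<omega>)) T + prim (\<lambda>t. wgt t * (?D t \<omega> * ?D t \<omega>)) T"
      using prim_add[OF bdm_add[OF b[OF Z Z] bdm_mult[OF bdm_const b[OF Z D]]] b[OF D D] T_T]
        prim_add[OF b[OF Z Z] bdm_mult[OF bdm_const b[OF Z D]] T_T] by (simp only: prim_cmult)
    finally show ?thesis by (rule comb[OF _ quad])
  qed
  have gen: "(\<integral>\<omega>. f \<omega> + 2 * g \<omega> + h \<omega> \<partial>M) = (\<integral>\<omega>. f \<omega> \<partial>M) + 2 * (\<integral>\<omega>. g \<omega> \<partial>M) + (\<integral>\<omega>. h \<omega> \<partial>M)"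
    if "integrable M f" "integrable M g" "integrable M h" for f g h :: "'a \<Rightarrow> real"
    using that by simp
  have "(\<integral>\<omega>. ?g Y Y \<omega> \<partial>M) = (\<integral>\<omega>. ?g Z Z \<omega> + 2 * ?g Z ?D \<omega> + ?g ?D ?D \<omega> \<partial>M)"
    by (rule Bochner_Integration.integral_cong[OF refl e])
  also have "\<dots> = (\<integral>\<omega>. ?g Z Z \<omega> \<partial>M) + 2 * (\<integral>\<omega>. ?g Z ?D \<omega> \<partial>M) + (\<integral>\<omega>. ?g ?D ?D \<omega> \<partial>M)"
    by (rule gen[OF inner_H_L2b(1)[OF Z Z] inner_H_L2b(1)[OF Z D] inner_H_L2b(1)[OF D D]])
  finally show ?thesis unfolding norm_H_sq_def inner_H_L2b(2)[OF Y Y] inner_H_L2b(2)[OF Z Z] inner_H_L2b(2)[OF Z D] inner_H_L2b(2)[OF D D] .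
qed

lemma norm_H_sq_L2b:
  assumes X: "L2b X"
  shows "integrable M (\<lambda>\<omega>. prim (\<lambda>t. wgt t * (X t \<omega>)^2) T + 1 / (2 * lam T) * (X T \<omega>)^2)"
    "norm_H_sq M T \<beta> lam dlam X = (\<integral>\<omega>. prim (\<lambda>t. wgt t * (X t \<omega>)^2) T + 1 / (2 * lam T) * (X T \<omega>)^2 \<partial>M)"
    "0 \<le> norm_H_sq M T \<beta> lam dlam X"
proof -
  show 1: "integrable M (\<lambda>\<omega>. prim (\<lambda>t. wgt t * (X t \<omega>)^2) T + 1 / (2 * lam T) * (X T \<omega>)^2)"
    and 2: "norm_H_sq M T \<beta> lam dlam X = (\<integral>\<omega>. prim (\<lambda>t. wgt t * (X t \<omega>)^2) T + 1 / (2 * lam T) * (X T \<omega>)^2 \<partial>M)"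
    using inner_H_L2b(1,2)[OF X X] unfolding norm_H_sq_def by (simp_all only: power2_eq_square)
  show "0 \<le> norm_H_sq M T \<beta> lam dlam X" unfolding 2
  proof (rule Bochner_Integration.integral_nonneg)
    fix \<omega>
    have "0 \<le> prim (\<lambda>t. wgt t * (X t \<omega>)^2) T"
      using wgt_pos by (intro prim_nonneg mult_nonneg_nonneg) (auto intro: less_imp_le)
    moreover have "0 \<le> 1 / (2 * lam T) * (X T \<omega>)^2" using lam_pos[OF T_T] by simp
    ultimately show "0 \<le> prim (\<lambda>t. wgt t * (X t \<omega>)^2) T + 1 / (2 * lam T) * (X T \<omega>)^2" by simp
  qed
qed

end

section \<open>The explicit optimizer\<close>

lemma set_integral_cauchy_schwarz_L2:
  fixes f :: "real \<Rightarrow> real"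
  assumes ab: "a \<le> b" and f: "set_integrable lborel {a..b} f" and f2: "set_integrable lborel {a..b} (\<lambda>s. (f s)^2)"
  shows "(LINT s:{a..b}|lborel. f s)^2 \<le> (b - a) * (LINT s:{a..b}|lborel. (f s)^2)"
proof (cases "a = b")
  case False
  then have tp: "b - a > 0" using ab by auto
  have gen: "A - 2 * (x / d) * x + (x / d)^2 * d = A - x^2 / d" if "d > 0" for A x d :: real
    using that by (simp add: field_simps power2_eq_square)
  define I where "I = (LINT s:{a..b}|lborel. f s)"
  define m where "m = I / (b - a)"
  have fm: "set_integrable lborel {a..b} (\<lambda>s. 2 * m * f s)" using f by (intro set_integrable_mult_right)
  have c: "set_integrable lborel {a..b} (\<lambda>s. m^2)"
    by (simp add: set_integrable_def integrable_indicator_iff emeasure_lborel_Icc_eq)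
  have "0 \<le> (LINT s:{a..b}|lborel. (f s)^2 - 2 * m * f s + m^2)"
    unfolding set_lebesgue_integral_def
  proof (rule Bochner_Integration.integral_nonneg)
    fix s
    have "(f s)^2 - 2 * m * f s + m^2 = (f s - m)^2" by (simp add: power2_eq_square algebra_simps)
    then show "0 \<le> indicator {a..b} s *\<^sub>R ((f s)^2 - 2 * m * f s + m^2)" by simp
  qed
  also have "\<dots> = (LINT s:{a..b}|lborel. (f s)^2) - 2 * m * I + m^2 * (b - a)"
  proof -
    have "(LINT s:{a..b}|lborel. m^2) = m^2 * (b - a)" unfolding set_lebesgue_integral_def using ab by simp
    then show ?thesis
      using set_integral_add(2)[OF set_integral_diff(1)[OF f2 fm] c] set_integral_diff(2)[OF f2 fm] by (simp add: I_def)
  qed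
  also have "\<dots> = (LINT s:{a..b}|lborel. (f s)^2) - I^2 / (b - a)"
    unfolding m_def using gen[OF tp] .
  finally show ?thesis using tp unfolding I_def by (simp add: field_simps)
qed simp

lemma set_integral_cauchy_schwarz:
  assumes f: "bdm T f" and ab: "0 \<le> a" "a \<le> b" "b \<le> T"
  shows "(LINT s:{a..b}|lborel. f s)^2 \<le> (b - a) * (LINT s:{a..b}|lborel. (f s)^2)"
  by (rule set_integral_cauchy_schwarz_L2[OF ab(2)])
    (use bdm_set_integrable[OF f] bdm_set_integrable[OF bdm_power2[OF f]] ab in auto)

lemma set_integral_shift:
  fixes f :: "real \<Rightarrow> real"
  shows "(LINT s:{a..b}|lborel. f (s - h)) = (LINT s:{a - h..b - h}|lborel. f s)"
proof -
  have "(LINT s|lborel. indicator {a - h..b - h} s *\<^sub>R f s) = (LINT s|lborel. indicator {a - h..b - h} (- h + 1 * s) *\<^sub>R f (- h + 1 * s))"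
    by (subst lborel_integral_real_affine[of 1 _ "- h"]) auto
  also have "\<dots> = (LINT s|lborel. indicator {a..b} s *\<^sub>R f (s - h))"
    by (rule Bochner_Integration.integral_cong) (auto split: split_indicator)
  finally show ?thesis unfolding set_lebesgue_integral_def by simp
qed

lemma mono_bdm:
  fixes g :: "real \<Rightarrow> real"
  assumes "\<And>s t. 0 \<le> s \<Longrightarrow> s \<le> t \<Longrightarrow> t \<le> T \<Longrightarrow> g s \<le> g t" "0 \<le> T" shows "bdm T g"
proof -
  have "mono (\<lambda>t. g (max 0 (min T t)))" by (rule monoI) (use assms in auto)
  then have "(\<lambda>t. g (max 0 (min T t))) \<in> borel_measurable borel" by (rule borel_measurable_mono)
  then have m: "(\<lambda>t. g (max 0 (min T t))) \<in> borel_measurable (restrict_space borel {0..T})"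
    by (rule measurable_restrict_space1)
  have "bdm T (\<lambda>t. g (max 0 (min T t)))"
  proof (rule bdmI[OF m, of "\<bar>g 0\<bar> + \<bar>g T\<bar>"])
    fix t assume t: "t \<in> {0..T}"
    then have "g 0 \<le> g t" "g t \<le> g T" using assms by auto
    then show "\<bar>g (max 0 (min T t))\<bar> \<le> \<bar>g 0\<bar> + \<bar>g T\<bar>" using t by auto
  qed
  then show ?thesis by (rule bdm_cong[THEN iffD1, rotated]) auto
qed

lemma bdm_shift:
  assumes f: "bdm T f" and h: "h > 0" shows "bdm T (\<lambda>t. f (max (t - h) 0))"
proof -
  obtain B where B: "\<And>t. t \<in> {0..T} \<Longrightarrow> \<bar>f t\<bar> \<le> B" using bdm_bound[OF f] by blast
  have "(\<lambda>t. max (t - h) 0) \<in> measurable (restrict_space borel {0..T}) (restrict_space borel {0..T})"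
    by (rule measurable_restrict_space2) (use h in \<open>auto simp: space_restrict_space intro!: measurable_restrict_space1\<close>)
  from measurable_compose[OF this bdm_meas[OF f]] show ?thesis
    by (rule bdmI[of _ _ B]) (use B h in auto)
qed

lemma prim_shift_eq:
  assumes f: "bdm T f" and h: "0 < h" "h \<le> t" "t \<le> T"
  shows "prim (\<lambda>s. f (max (s - h) 0)) t = h * f 0 + prim f (t - h)"
proof -
  have "prim (\<lambda>s. f (max (s - h) 0)) t
      = prim (\<lambda>s. f (max (s - h) 0)) h + (LINT s:{h..t}|lborel. f (max (s - h) 0))"
    by (rule set_integral_Icc_split[OF _ _ bdm_set_integrable[OF bdm_shift[OF f h(1)]]]) (use h in auto)
  also have "prim (\<lambda>s. f (max (s - h) 0)) h = prim (\<lambda>s. f 0) h"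
    by (rule prim_cong) auto
  also have "\<dots> = f 0 * h" using h by (simp add: prim_const)
  also have "(LINT s:{h..t}|lborel. f (max (s - h) 0)) = (LINT s:{h..t}|lborel. f (s - h))"
    by (rule set_lebesgue_integral_cong) auto
  also have "\<dots> = prim f (t - h)" by (subst set_integral_shift) simp
  finally show ?thesis by simp
qed

text \<open>Shifting the integral of \<open>g\<close> by \<open>h\<close> leaves only a window of
  length \<open>h\<close> at either end, and monotonicity bounds the difference by \<open>h\<close>
  times the total increase. For \<open>h \<ge> T\<close> the whole interval is no longer than
  \<open>h\<close>, and bounding the integrand suffices.\<close>

lemma mono_shift_integral:
  assumes mono: "\<And>s t. 0 \<le> s \<Longrightarrow> s \<le> t \<Longrightarrow> t \<le> T \<Longrightarrow> g s \<le> g t" and T: "0 \<le> T" and h: "h > 0"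
  shows "prim (\<lambda>t. g t - g (max (t - h) 0)) T \<le> h * (g T - g 0)"
proof (cases "h < T")
  case False
  have g: "bdm T g" by (rule mono_bdm[OF mono T])
  have "prim (\<lambda>t. g t - g (max (t - h) 0)) T \<le> prim (\<lambda>t. g T - g 0) T"
    by (rule prim_mono[OF bdm_diff[OF g bdm_shift[OF g h]] bdm_const]) (use T h mono False in \<open>auto intro!: diff_mono\<close>)
  also have "\<dots> = (g T - g 0) * T" using T by (simp add: prim_const)
  also have "\<dots> \<le> (g T - g 0) * h" using False mono[of 0 T] T by (intro mult_left_mono) auto
  finally show ?thesis by (simp add: mult.commute)
next
  case True
  have g: "bdm T g" by (rule mono_bdm[OF mono T])
  have "prim (\<lambda>t. g t - g (max (t - h) 0)) T = prim g T - (h * g 0 + prim g (T - h))"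
    using prim_diff_fun[OF g bdm_shift[OF g h], of T] prim_shift_eq[OF g h, of T] True T by simp
  also have "prim g T = prim g (T - h) + (LINT s:{T - h..T}|lborel. g s)"
    using prim_diff[OF g, of "T - h" T] True h by simp
  also have "(LINT s:{T - h..T}|lborel. g s) \<le> (LINT s:{T - h..T}|lborel. g T)"
  proof (rule set_integral_mono)
    show "set_integrable lborel {T - h..T} g" by (rule bdm_set_integrable[OF g]) (use True in auto)
    show "set_integrable lborel {T - h..T} (\<lambda>s. g T)" by (rule bdm_set_integrable[OF bdm_const]) (use True in auto)
  qed (use mono True in auto)
  also have "(LINT s:{T - h..T}|lborel. g T) = h * g T" using h by (simp add: set_lebesgue_integral_def)
  finally show ?thesis by (simp add: algebra_simps)
qed

text \<open>Finite variation encoded by a function whose increments dominate those of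
  \<open>f\<close>. Such a \<open>v\<close> is nondecreasing, obeys simple calculus rules and fits
  the shift estimate for monotone functions.\<close>

definition variation_bound :: "real \<Rightarrow> (real \<Rightarrow> real) \<Rightarrow> (real \<Rightarrow> real) \<Rightarrow> bool" where
  "variation_bound T f v \<longleftrightarrow> (\<forall>s t. 0 \<le> s \<and> s \<le> t \<and> t \<le> T \<longrightarrow> \<bar>f t - f s\<bar> \<le> v t - v s)"

lemma variation_boundD: "variation_bound T f v \<Longrightarrow> 0 \<le> s \<Longrightarrow> s \<le> t \<Longrightarrow> t \<le> T \<Longrightarrow> \<bar>f t - f s\<bar> \<le> v t - v s"
  unfolding variation_bound_def by blast

lemma finite_variation_bound:
  assumes "finite_variation_on 0 T f" obtains v where "variation_bound T f v"
proof -
  obtain B where B: "\<And>(n::nat) p. (\<forall>i\<le>n. p i \<in> {0..T}) \<Longrightarrow> (\<forall>i<n. p i \<le> p (Suc i)) \<Longrightarrow> (\<Sum>i<n. \<bar>f (p (Suc i)) - f (p i)\<bar>) \<le> B"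
    using assms unfolding finite_variation_on_def by blast
  define P where "P t = {(n::nat, p). (\<forall>i\<le>n. p i \<in> {0..t}) \<and> (\<forall>i<n. p i \<le> p (Suc i))}" for t :: real
  define S where "S np = (\<Sum>i<fst np. \<bar>f (snd np (Suc i)) - f (snd np i)\<bar>)" for np :: "nat \<times> (nat \<Rightarrow> real)"
  define v where "v t = (SUP np\<in>P t. S np)" for t
  have bd: "bdd_above (S ` P t)" if "t \<le> T" for t
  proof (rule bdd_aboveI2[where M = B])
    fix np assume "np \<in> P t"
    then have "\<forall>i\<le>fst np. snd np i \<in> {0..t}" "\<forall>i<fst np. snd np i \<le> snd np (Suc i)" unfolding P_def by auto
    then show "S np \<le> B" unfolding S_def using that by (intro B) force+
  qed
  have "variation_bound T f v"
    unfolding variation_bound_def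
  proof (intro allI impI, elim conjE)
    fix s t assume st: "0 \<le> s" "s \<le> t" "t \<le> T"
    have "v s \<le> v t - \<bar>f t - f s\<bar>"
      unfolding v_def[of s]
    proof (rule cSUP_least)
      have "(0, \<lambda>_. 0) \<in> P s" unfolding P_def using st by auto
      then show "P s \<noteq> {}" by blast
      fix np assume "np \<in> P s"
      then obtain n p where np: "np = (n, p)" "\<forall>i\<le>n. p i \<in> {0..s}" "\<forall>i<n. p i \<le> p (Suc i)" unfolding P_def by auto
      \<comment> \<open>Appending \<open>s\<close> and \<open>t\<close> to a partition of
        \<open>{0..s}\<close> adds at least the increment from \<open>s\<close> to \<open>t\<close>
        to the variation sum.\<close>
      define q where "q i = (if i \<le> n then p i else if i = Suc n then s else t)" for i
      have "(Suc (Suc n), q) \<in> P t"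
        unfolding P_def using np(2,3) st by (auto simp: q_def less_Suc_eq)
      then have "S (Suc (Suc n), q) \<le> v t" unfolding v_def by (rule cSUP_upper[OF _ bd[OF st(3)]])
      moreover have "S (Suc (Suc n), q) = S np + \<bar>f s - f (p n)\<bar> + \<bar>f t - f s\<bar>"
      proof -
        have "(\<Sum>i<n. \<bar>f (q (Suc i)) - f (q i)\<bar>) = (\<Sum>i<n. \<bar>f (p (Suc i)) - f (p i)\<bar>)"
          by (rule sum.cong) (auto simp: q_def)
        then show ?thesis unfolding S_def np by (simp add: q_def)
      qed
      ultimately show "S np \<le> v t - \<bar>f t - f s\<bar>" by linarith
    qed
    then show "\<bar>f t - f s\<bar> \<le> v t - v s" by linarith
  qed
  then show ?thesis by (rule that)
qed

lemma variation_bound_add: "variation_bound T f v \<Longrightarrow> variation_bound T g w \<Longrightarrow> variation_bound T (\<lambda>t. f t + g t) (\<lambda>t. v t + w t)"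
  unfolding variation_bound_def
proof (intro allI impI)
  fix s t assume a: "\<forall>s t. 0 \<le> s \<and> s \<le> t \<and> t \<le> T \<longrightarrow> \<bar>f t - f s\<bar> \<le> v t - v s"
    "\<forall>s t. 0 \<le> s \<and> s \<le> t \<and> t \<le> T \<longrightarrow> \<bar>g t - g s\<bar> \<le> w t - w s" "0 \<le> s \<and> s \<le> t \<and> t \<le> T"
  then have "\<bar>f t - f s\<bar> \<le> v t - v s" "\<bar>g t - g s\<bar> \<le> w t - w s" by blast+
  then show "\<bar>f t + g t - (f s + g s)\<bar> \<le> v t + w t - (v s + w s)" by linarith
qed

lemma variation_bound_mult:
  assumes f: "variation_bound T f v" and g: "variation_bound T g w"
    and A: "\<And>t. t \<in> {0..T} \<Longrightarrow> \<bar>f t\<bar> \<le> A" and B: "\<And>t. t \<in> {0..T} \<Longrightarrow> \<bar>g t\<bar> \<le> B" and "A \<ge> 0" "B \<ge> 0"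
  shows "variation_bound T (\<lambda>t. f t * g t) (\<lambda>t. A * w t + B * v t)"
  unfolding variation_bound_def
proof (intro allI impI)
  fix s t assume st: "0 \<le> s \<and> s \<le> t \<and> t \<le> T"
  have "f t * g t - f s * g s = f t * (g t - g s) + (f t - f s) * g s" by (simp add: algebra_simps)
  then have "\<bar>f t * g t - f s * g s\<bar> \<le> \<bar>f t\<bar> * \<bar>g t - g s\<bar> + \<bar>f t - f s\<bar> * \<bar>g s\<bar>"
    by (metis abs_triangle_ineq abs_mult)
  also have "\<dots> \<le> A * (w t - w s) + (v t - v s) * B"
  proof (rule add_mono)
    have fv: "\<bar>f t - f s\<bar> \<le> v t - v s" and gw: "\<bar>g t - g s\<bar> \<le> w t - w s"
      using variation_boundD[OF f] variation_boundD[OF g] st by auto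
    show "\<bar>f t\<bar> * \<bar>g t - g s\<bar> \<le> A * (w t - w s)" using gw A[of t] st assms(5) by (intro mult_mono) auto
    show "\<bar>f t - f s\<bar> * \<bar>g s\<bar> \<le> (v t - v s) * B" using fv B[of s] st by (intro mult_mono) auto
  qed
  finally show "\<bar>f t * g t - f s * g s\<bar> \<le> A * w t + B * v t - (A * w s + B * v s)" by (simp add: algebra_simps)
qed

lemma variation_bound_inverse:
  assumes g: "variation_bound T g w" and d: "\<delta> > 0" "\<And>t. t \<in> {0..T} \<Longrightarrow> \<delta> \<le> g t"
  shows "variation_bound T (\<lambda>t. 1 / g t) (\<lambda>t. w t / \<delta>^2)"
  unfolding variation_bound_def
proof (intro allI impI)
  fix s t assume st: "0 \<le> s \<and> s \<le> t \<and> t \<le> T"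
  have gs: "\<delta> \<le> g s" "\<delta> \<le> g t" using d(2) st by auto
  then have "1 / g t - 1 / g s = (g s - g t) / (g t * g s)" using d(1) by (simp add: field_simps)
  then have "\<bar>1 / g t - 1 / g s\<bar> = \<bar>g t - g s\<bar> / (g t * g s)" using gs d(1) by (simp add: abs_mult abs_minus_commute)
  also have "\<dots> \<le> (w t - w s) / \<delta>^2"
  proof (rule frac_le)
    show "\<bar>g t - g s\<bar> \<le> w t - w s" using variation_boundD[OF g] st by auto
    then show "0 \<le> w t - w s" by linarith
    show "\<delta>^2 \<le> g t * g s" unfolding power2_eq_square using gs d(1) by (intro mult_mono) auto
  qed (use d in auto)
  finally show "\<bar>1 / g t - 1 / g s\<bar> \<le> w t / \<delta>^2 - w s / \<delta>^2" by (simp add: diff_divide_distrib)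
qed

lemma is_prim_variation: assumes "is_prim T F f" obtains v where "variation_bound T F v"
proof -
  obtain B where B: "\<And>a b. a \<in> {0..T} \<Longrightarrow> b \<in> {0..T} \<Longrightarrow> \<bar>F b - F a\<bar> \<le> B * \<bar>b - a\<bar>"
    using is_prim_lipschitz[OF assms] by metis
  have "variation_bound T F (\<lambda>t. B * t)"
    unfolding variation_bound_def
  proof (intro allI impI)
    fix s t assume "0 \<le> s \<and> s \<le> t \<and> t \<le> T"
    then show "\<bar>F t - F s\<bar> \<le> B * t - B * s" using B[of s t] by (simp add: right_diff_distrib)
  qed
  then show ?thesis by (rule that)
qed

lemma cadlag_divide:
  assumes f: "cadlag_on 0 T f" and g: "cadlag_on 0 T g" and d: "\<delta> > 0" "\<And>t. t \<in> {0..T} \<Longrightarrow> \<delta> \<le> g t"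
  shows "cadlag_on 0 T (\<lambda>t. f t / g t :: real)"
  unfolding cadlag_on_def
proof (intro conjI ballI)
  fix t assume t: "t \<in> {0..<T}"
  then have "g t \<noteq> 0" using d(1) d(2)[of t] by auto
  then show "((\<lambda>t. f t / g t) \<longlongrightarrow> f t / g t) (at_right t)"
    using f g t unfolding cadlag_on_def by (intro tendsto_divide) auto
next
  fix t assume t: "t \<in> {0<..T}"
  obtain l where l: "(f \<longlongrightarrow> l) (at_left t)" using f t unfolding cadlag_on_def by blast
  obtain k where k: "(g \<longlongrightarrow> k) (at_left t)" using g t unfolding cadlag_on_def by blast
  have "\<forall>\<^sub>F s in at_left t. \<delta> \<le> g s"
    unfolding eventually_at_left_field by (rule exI[of _ 0]) (use t d(2) in auto)
  then have "\<delta> \<le> k" by (rule tendsto_lowerbound[OF k]) simp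
  then have "k \<noteq> 0" using d(1) by auto
  then show "\<exists>l. ((\<lambda>t. f t / g t) \<longlongrightarrow> l) (at_left t)" using tendsto_divide[OF l k] by blast
qed

text \<open>The value at \<open>T\<close> is seen neither by right-continuity, which concerns
  earlier times, nor by left limits. This permits the terminal block trade of the optimizer.\<close>

lemma cadlag_endpoint:
  assumes f: "cadlag_on 0 T f" and eq: "\<And>t. 0 \<le> t \<Longrightarrow> t < T \<Longrightarrow> f t = g t" shows "cadlag_on 0 T g"
  unfolding cadlag_on_def
proof (intro conjI ballI)
  fix t assume t: "t \<in> {0..<T}"
  have ev: "\<forall>\<^sub>F s in at_right t. f s = g s"
    unfolding eventually_at_right_field by (rule exI[of _ T]) (use t eq in auto)
  have "(f \<longlongrightarrow> f t) (at_right t)" using f t unfolding cadlag_on_def by blast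
  moreover have "f t = g t" using eq t by auto
  ultimately show "(g \<longlongrightarrow> g t) (at_right t)" using tendsto_cong[OF ev, of "f t"] by simp
next
  fix t assume t: "t \<in> {0<..T}"
  have ev: "\<forall>\<^sub>F s in at_left t. f s = g s"
    unfolding eventually_at_left_field by (rule exI[of _ 0]) (use t eq in auto)
  obtain l where "(f \<longlongrightarrow> l) (at_left t)" using f t unfolding cadlag_on_def by blast
  then show "\<exists>l. (g \<longlongrightarrow> l) (at_left t)" using tendsto_cong[OF ev, of l] by blast
qed

lemma cadlag_shift:
  assumes f: "cadlag_on 0 T f" and h: "h > 0" shows "cadlag_on 0 T (\<lambda>t. f (max (t - h) 0))"
  unfolding cadlag_on_def
proof (intro conjI ballI)
  fix t assume t: "t \<in> {0..<T}"
  show "((\<lambda>t. f (max (t - h) 0)) \<longlongrightarrow> f (max (t - h) 0)) (at_right t)"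
  proof (cases "t < h")
    case True
    have "\<forall>\<^sub>F s in at_right t. f (max (s - h) 0) = f (max (t - h) 0)"
      unfolding eventually_at_right_field by (rule exI[of _ h]) (use True in auto)
    then show ?thesis by (rule tendsto_eventually)
  next
    case False
    have "(f \<longlongrightarrow> f (t - h)) (at_right (t - h))" using f t h False unfolding cadlag_on_def by auto
    moreover have "filterlim (\<lambda>s. s - h) (at_right (t - h)) (at_right t)"
    proof (rule tendsto_imp_filterlim_at_right)
      show "((\<lambda>s. s - h) \<longlongrightarrow> t - h) (at_right t)" by (intro tendsto_intros)
      show "\<forall>\<^sub>F s in at_right t. t - h < s - h" using eventually_at_right_less[of t] by eventually_elim simp
    qed
    ultimately have "((\<lambda>s. f (s - h)) \<longlongrightarrow> f (t - h)) (at_right t)" by (rule filterlim_compose)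
    moreover have "\<forall>\<^sub>F s in at_right t. f (s - h) = f (max (s - h) 0)"
      unfolding eventually_at_right_field by (rule exI[of _ T]) (use False t in auto)
    ultimately have "((\<lambda>s. f (max (s - h) 0)) \<longlongrightarrow> f (t - h)) (at_right t)" by (rule Lim_transform_eventually)
    moreover have "max (t - h) 0 = t - h" using False by simp
    ultimately show ?thesis by simp
  qed
next
  fix t assume t: "t \<in> {0<..T}"
  show "\<exists>l. ((\<lambda>t. f (max (t - h) 0)) \<longlongrightarrow> l) (at_left t)"
  proof (cases "t \<le> h")
    case True
    have "\<forall>\<^sub>F s in at_left t. f (max (s - h) 0) = f 0"
      unfolding eventually_at_left_field by (rule exI[of _ 0]) (use True t in auto)
    then have "((\<lambda>s. f (max (s - h) 0)) \<longlongrightarrow> f 0) (at_left t)" by (rule tendsto_eventually)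
    then show ?thesis by (rule exI)
  next
    case False
    then have "t - h \<in> {0<..T}" using t h by auto
    then obtain l where "(f \<longlongrightarrow> l) (at_left (t - h))" using f unfolding cadlag_on_def by blast
    moreover have "filterlim (\<lambda>s. s - h) (at_left (t - h)) (at_left t)"
    proof (rule tendsto_imp_filterlim_at_left)
      show "((\<lambda>s. s - h) \<longlongrightarrow> t - h) (at_left t)" by (intro tendsto_intros)
      show "\<forall>\<^sub>F s in at_left t. s - h < t - h"
        unfolding eventually_at_left_field by (rule exI[of _ "t - 1"]) simp
    qed
    ultimately have "((\<lambda>s. f (s - h)) \<longlongrightarrow> l) (at_left t)" by (rule filterlim_compose)
    moreover have "\<forall>\<^sub>F s in at_left t. f (s - h) = f (max (s - h) 0)"
      unfolding eventually_at_left_field by (rule exI[of _ h]) (use False in auto)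
    ultimately have "((\<lambda>s. f (max (s - h) 0)) \<longlongrightarrow> l) (at_left t)" by (rule Lim_transform_eventually)
    then show ?thesis by (rule exI)
  qed
qed

context filtered_horizon
begin

lemma L2b_joint_rv:
  assumes X: "L2b X" and U: "U \<in> borel_measurable M" "integrable M (\<lambda>\<omega>. (U \<omega>)^2)" and w: "bdm T w"
  shows "integrable M (\<lambda>\<omega>. U \<omega> * prim (\<lambda>s. w s * X s \<omega>) T)"
    "(\<integral>\<omega>. U \<omega> * prim (\<lambda>s. w s * X s \<omega>) T \<partial>M) = prim (\<lambda>s. w s * (\<integral>\<omega>. U \<omega> * X s \<omega> \<partial>M)) T"
proof -
  obtain A where A: "A \<ge> 0" "\<And>t. t \<in> {0..T} \<Longrightarrow> (\<integral>\<omega>. (X t \<omega>)^2 \<partial>M) \<le> A" using L2b_bound[OF X] by blast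
  obtain W where W: "W \<ge> 0" "\<And>t. t \<in> {0..T} \<Longrightarrow> \<bar>w t\<bar> \<le> W" using bdm_bound[OF w] by blast
  define B where "B = (\<integral>\<omega>. (U \<omega>)^2 \<partial>M)"
  have B0: "0 \<le> B" unfolding B_def by simp
  have i: "integrable M (\<lambda>\<omega>. U \<omega> * X s \<omega>)" if "s \<in> {0..T}" for s
    by (rule integrable_L2_mult[OF U(1) L2b_meas[OF X that] U(2) L2b_int[OF X that]])
  have ab: "(\<integral>\<omega>. \<bar>U \<omega> * X s \<omega>\<bar> \<partial>M) \<le> B + A" if s: "s \<in> {0..T}" for s
  proof -
    have "(\<integral>\<omega>. \<bar>U \<omega> * X s \<omega>\<bar> \<partial>M) \<le> (\<integral>\<omega>. (U \<omega>)^2 + (X s \<omega>)^2 \<partial>M)"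
    proof (rule integral_mono)
      show "integrable M (\<lambda>\<omega>. \<bar>U \<omega> * X s \<omega>\<bar>)" using i[OF s] by simp
      show "\<bar>U \<omega> * X s \<omega>\<bar> \<le> (U \<omega>)^2 + (X s \<omega>)^2" for \<omega> by (rule abs_mult_le_power2)
    qed (use L2b_int[OF X s] U(2) in auto)
    also have "\<dots> \<le> B + A" using L2b_int[OF X s] U(2) A(2)[OF s] by (simp add: B_def)
    finally show ?thesis .
  qed
  have mU: "(\<lambda>(s, \<omega>). U \<omega>) \<in> borel_measurable (LT \<Otimes>\<^sub>M M)"
    using measurable_compose[OF measurable_snd U(1)] by (simp add: split_def)
  have mw: "(\<lambda>(s, \<omega>). w s * (U \<omega> * X s \<omega>)) \<in> borel_measurable (LT \<Otimes>\<^sub>M M)"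
    using borel_measurable_times[OF bdm_joint_LT[OF w] borel_measurable_times[OF mU L2b_jointly_measurable[OF X]]]
    by (simp add: split_def)
  have bw: "(\<integral>\<omega>. \<bar>w s * (U \<omega> * X s \<omega>)\<bar> \<partial>M) \<le> W * (B + A)" if s: "s \<in> {0..T}" for s
  proof -
    have "(\<integral>\<omega>. \<bar>w s * (U \<omega> * X s \<omega>)\<bar> \<partial>M) = \<bar>w s\<bar> * (\<integral>\<omega>. \<bar>U \<omega> * X s \<omega>\<bar> \<partial>M)"
      unfolding abs_mult[of "w s"] by simp
    also have "\<dots> \<le> W * (B + A)"
      using W(2)[OF s] ab[OF s] W(1) by (intro mult_mono) auto
    finally show ?thesis .
  qed
  have iw: "integrable M (\<lambda>\<omega>. w s * (U \<omega> * X s \<omega>))" if "s \<in> {0..T}" for s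
    using i[OF that] by simp
  have e: "prim (\<lambda>s. w s * (U \<omega> * X s \<omega>)) T = U \<omega> * prim (\<lambda>s. w s * X s \<omega>) T" for \<omega>
    unfolding prim_cmult[symmetric] by (rule prim_cong) (simp add: mult_ac)
  show "integrable M (\<lambda>\<omega>. U \<omega> * prim (\<lambda>s. w s * X s \<omega>) T)"
    using integrable_joint_bounded(2)[OF mw iw bw] unfolding e .
  show "(\<integral>\<omega>. U \<omega> * prim (\<lambda>s. w s * X s \<omega>) T \<partial>M) = prim (\<lambda>s. w s * (\<integral>\<omega>. U \<omega> * X s \<omega> \<partial>M)) T"
    using integrable_joint_bounded(3)[OF mw iw bw] unfolding e by simp
qed

lemma L2b_shift: assumes X: "L2b X" and h: "h > 0" shows "L2b (\<lambda>t. X (max (t - h) 0))"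
proof -
  obtain A where A: "A \<ge> 0" "\<And>t. t \<in> {0..T} \<Longrightarrow> (\<integral>\<omega>. (X t \<omega>)^2 \<partial>M) \<le> A" using L2b_bound[OF X] by blast
  have r: "max (t - h) 0 \<in> {0..T}" "max (t - h) 0 \<le> t" if "t \<in> {0..T}" for t using that h by auto
  have "nice (\<lambda>t. X (max (t - h) 0))"
    unfolding nice_def
  proof (intro conjI ballI)
    fix t assume t: "t \<in> {0..T}"
    show "X (max (t - h) 0) \<in> borel_measurable (F t)"
      by (rule measurable_F_mono[OF L2b_adapted[OF X r(1)[OF t]] r(1)[OF t] t r(2)[OF t]])
  next
    fix \<omega> assume "\<omega> \<in> space M"
    then show "cadlag_on 0 T (\<lambda>t. X (max (t - h) 0) \<omega>)"
      by (rule cadlag_shift[OF L2b_cadlag[OF X] h])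
  qed
  then show ?thesis by (rule L2bI) (rule L2b_int[OF X r(1)] A(2)[OF r(1)], assumption)+
qed

lemma nice_endpoint:
  assumes X: "nice X" and U: "U \<in> borel_measurable (F T)" shows "nice (\<lambda>t \<omega>. if t < T then X t \<omega> else U \<omega>)"
  unfolding nice_def
proof (intro conjI ballI)
  fix t assume t: "t \<in> {0..T}"
  show "(\<lambda>\<omega>. if t < T then X t \<omega> else U \<omega>) \<in> borel_measurable (F t)"
  proof (cases "t < T")
    case True then show ?thesis using nice_adapted[OF X t] by simp
  next
    case False
    then have "t = T" using t by simp
    then show ?thesis using U by simp
  qed
next
  fix \<omega> assume "\<omega> \<in> space M"
  then show "cadlag_on 0 T (\<lambda>t. if t < T then X t \<omega> else U \<omega>)"
    by (intro cadlag_endpoint[OF nice_cadlag[OF X]]) auto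
qed

end

section \<open>The martingale, the optimal state and orthogonality\<close>

context control
begin

abbreviation "thd \<equiv> theta_dot \<beta> lam dlam"
abbreviation "alp t \<equiv> eta \<beta> lam dlam t / lam t"

text \<open>The denominator in the integrand of the martingale; it is nonincreasing and ends at
  \<open>1\<close>. Hence \<open>kk\<close>, the integrand itself, ends at \<open>lam T\<close>, and
  \<open>kd\<close> is its density by the quotient rule.\<close>

definition Den :: "real \<Rightarrow> real" where "Den s = 1 + lam T * (prim thd T - prim thd s)"
definition kk :: "real \<Rightarrow> real" where "kk s = lam T / Den s"
definition kd :: "real \<Rightarrow> real" where "kd s = (lam T)^2 * thd s / (Den s)^2"

lemma bdm_thd: "bdm T thd"
  using bdm_theta_dot by simp

lemma Den_ge: "t \<in> {0..T} \<Longrightarrow> 1 \<le> Den t"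
  using prim_mono_endpoint[OF bdm_thd, of t] theta_dot_nonneg lam_pos[OF T_T] unfolding Den_def by simp

lemma is_prim_Den: "is_prim T Den (\<lambda>s. - (lam T * thd s))"
proof -
  have "is_prim T (\<lambda>s. (1 + lam T * prim thd T) + - lam T * prim thd s) (\<lambda>s. 0 + - lam T * thd s)"
    by (intro is_prim_add is_prim_const is_prim_cmult is_prim_prim bdm_thd)
  then show ?thesis by (rule is_prim_cong) (simp_all add: Den_def algebra_simps)
qed

lemma is_prim_kk: "is_prim T kk kd"
proof -
  have "is_prim T (\<lambda>s. lam T * (1 / Den s)) (\<lambda>s. lam T * (- (- (lam T * thd s)) / (Den s)^2))"
    by (rule is_prim_cmult[OF is_prim_inverse[OF is_prim_Den, of 1]]) (use Den_ge in auto)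
  then show ?thesis by (rule is_prim_cong) (simp_all add: kk_def kd_def power2_eq_square)
qed

lemma kk_T: "kk T = lam T" and kk_0: "kk 0 = lam T / (1 + lam T * prim thd T)"
  unfolding kk_def Den_def by simp_all

text \<open>The martingale \<open>M\<close> and the explicit optimizer of the paper, with the stochastic integral
  integrated by parts.\<close>

definition Mp :: "real \<Rightarrow> (real \<Rightarrow> 'a \<Rightarrow> real) \<Rightarrow> real \<Rightarrow> 'a \<Rightarrow> real" where
  "Mp y X t \<omega> = kk 0 * (y / lam 0) + (kk t * X t \<omega> - prim (\<lambda>s. kd s * X s \<omega>) t)"

lemma cadlag_kk: "cadlag_on 0 T kk"
  by (rule cadlag_continuous[OF is_prim_continuous[OF is_prim_kk]])

lemma L2b_Mp: assumes "L2b X" shows "L2b (Mp y X)"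
  unfolding Mp_def[abs_def]
  by (intro L2b_add L2b_const L2b_diff L2b_det_mult L2b_prim assms cadlag_kk is_prim_bdm_deriv[OF is_prim_kk])

text \<open>For a variable \<open>U\<close> known at \<open>s\<close>, the expectation of
  \<open>U * X r\<close> does not depend on \<open>r \<ge> s\<close>. By Fubini the integral term
  over \<open>{s..t}\<close> equals that constant times \<open>kk t - kk s\<close>, which cancels
  the change of the boundary term \<open>kk * X\<close>.\<close>

lemma L2mart_Mp: assumes X: "L2mart X" shows "L2mart (Mp y X)"
  unfolding L2mart_def
proof (intro conjI ballI allI impI)
  note b = L2mart_L2b[OF X]
  show "L2b (Mp y X)" by (rule L2b_Mp[OF b])
  fix s t and U :: "'a \<Rightarrow> real" assume s: "s \<in> {0..T}" and t': "t \<in> {s..T}" and U: "U \<in> borel_measurable (F s)" "integrable M (\<lambda>\<omega>. (U \<omega>)^2)"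
  have t: "t \<in> {0..T}" using s t' by auto
  have Um: "U \<in> borel_measurable M" by (rule measurable_F_M[OF U(1) s])
  have bkd: "bdm T kd" by (rule is_prim_bdm_deriv[OF is_prim_kk])
  \<comment> \<open>The indicator turns the integral over \<open>{s..t}\<close> into one over the
    whole horizon, the form in which Fubini was stated.\<close>
  define w where "w r = indicator {s..t} r * kd r" for r
  have "bdm T (\<lambda>r. indicator {s..t} r)"
    by (rule bdmI[of _ _ 1], rule measurable_restrict_space1) (auto simp: indicator_def)
  then have bw: "bdm T w" unfolding w_def by (rule bdm_mult[OF _ bkd])
  have wint: "prim (\<lambda>r. w r * f r) T = (LINT r:{s..t}|lborel. kd r * f r)" for f
    unfolding set_lebesgue_integral_def
    by (rule Bochner_Integration.integral_cong) (use s t in \<open>auto simp: w_def split: split_indicator\<close>)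
  have UX: "(\<integral>\<omega>. U \<omega> * X r \<omega> \<partial>M) = (\<integral>\<omega>. U \<omega> * X s \<omega> \<partial>M)" if "r \<in> {s..T}" for r
    by (rule L2mart_test[OF X _ _ _ U]) (use s that in auto)
  have iUX: "integrable M (\<lambda>\<omega>. U \<omega> * X r \<omega>)" if "r \<in> {0..T}" for r
    by (rule integrable_L2_mult[OF Um L2b_meas[OF b that] U(2) L2b_int[OF b that]])
  note j = L2b_joint_rv[OF b Um U(2) bw]
  have "(\<integral>\<omega>. U \<omega> * prim (\<lambda>r. w r * X r \<omega>) T \<partial>M) = prim (\<lambda>r. w r * (\<integral>\<omega>. U \<omega> * X r \<omega> \<partial>M)) T" by (rule j(2))
  also have "\<dots> = prim (\<lambda>r. w r * (\<integral>\<omega>. U \<omega> * X s \<omega> \<partial>M)) T"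
  proof (rule prim_cong)
    fix r assume r: "r \<in> {0..T}"
    show "w r * (\<integral>\<omega>. U \<omega> * X r \<omega> \<partial>M) = w r * (\<integral>\<omega>. U \<omega> * X s \<omega> \<partial>M)"
    proof (cases "r \<in> {s..t}")
      case True
      then have "r \<in> {s..T}" using r by auto
      from UX[OF this] show ?thesis by (rule arg_cong)
    qed (simp add: w_def)
  qed
  also have "\<dots> = (\<integral>\<omega>. U \<omega> * X s \<omega> \<partial>M) * (LINT r:{s..t}|lborel. kd r)"
    unfolding wint by simp
  also have "(LINT r:{s..t}|lborel. kd r) = kk t - kk s"
    by (rule is_prim_diff[OF is_prim_kk, symmetric]) (use s t' in auto)
  finally have E1: "(\<integral>\<omega>. U \<omega> * prim (\<lambda>r. w r * X r \<omega>) T \<partial>M) = (\<integral>\<omega>. U \<omega> * X s \<omega> \<partial>M) * (kk t - kk s)" .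
  have pw: "U \<omega> * Mp y X t \<omega> = U \<omega> * Mp y X s \<omega> + kk t * (U \<omega> * X t \<omega>) - kk s * (U \<omega> * X s \<omega>) - U \<omega> * prim (\<lambda>r. w r * X r \<omega>) T"
    if w: "\<omega> \<in> space M" for \<omega>
  proof -
    have "prim (\<lambda>r. kd r * X r \<omega>) t - prim (\<lambda>r. kd r * X r \<omega>) s = (LINT r:{s..t}|lborel. kd r * X r \<omega>)"
      by (rule prim_diff[OF bdm_mult[OF bkd L2b_bdm[OF b w]]]) (use s t' in auto)
    then have "Mp y X t \<omega> - Mp y X s \<omega> = kk t * X t \<omega> - kk s * X s \<omega> - prim (\<lambda>r. w r * X r \<omega>) T"
      unfolding Mp_def wint by simp
    then have "U \<omega> * (Mp y X t \<omega> - Mp y X s \<omega>) = U \<omega> * (kk t * X t \<omega> - kk s * X s \<omega> - prim (\<lambda>r. w r * X r \<omega>) T)" by simp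
    then show ?thesis by (simp add: algebra_simps)
  qed
  have iM: "integrable M (\<lambda>\<omega>. U \<omega> * Mp y X s \<omega>)"
    by (rule integrable_L2_mult[OF Um nice_meas[OF L2b_nice[OF L2b_Mp[OF b]] s] U(2) L2b_int[OF L2b_Mp[OF b] s]])
  have "(\<integral>\<omega>. U \<omega> * Mp y X t \<omega> \<partial>M) = (\<integral>\<omega>. U \<omega> * Mp y X s \<omega> + kk t * (U \<omega> * X t \<omega>) - kk s * (U \<omega> * X s \<omega>) - U \<omega> * prim (\<lambda>r. w r * X r \<omega>) T \<partial>M)"
    by (rule Bochner_Integration.integral_cong[OF refl pw])
  also have "\<dots> = (\<integral>\<omega>. U \<omega> * Mp y X s \<omega> \<partial>M) + kk t * (\<integral>\<omega>. U \<omega> * X t \<omega> \<partial>M) - kk s * (\<integral>\<omega>. U \<omega> * X s \<omega> \<partial>M)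
       - (\<integral>\<omega>. U \<omega> * prim (\<lambda>r. w r * X r \<omega>) T \<partial>M)"
    using iM iUX[OF s] iUX[OF t] j(1) by simp
  also have "\<dots> = (\<integral>\<omega>. U \<omega> * Mp y X s \<omega> \<partial>M)"
    unfolding E1 UX[OF t'] by (simp add: algebra_simps)
  finally show "(\<integral>\<omega>. U \<omega> * Mp y X t \<omega> \<partial>M) = (\<integral>\<omega>. U \<omega> * Mp y X s \<omega> \<partial>M)" .
qed

text \<open>The boundary term \<open>kk 0 * X 0\<close> from integration by parts cancels the
  multiple of \<open>\<Xi> 0\<close> in the definition of the martingale.\<close>

lemma M_process_indist:
  assumes X: "indist \<Xi> X" and ca: "cadlag_adapted M F T \<Xi>"
  shows "indist (M_process M F T \<beta> lam dlam y \<Xi>) (Mp y X)"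
proof -
  have th: "theta \<beta> lam dlam s = prim thd s" for s unfolding theta_def ..
  have k0: "lam T / (1 + lam T * theta \<beta> lam dlam T) = kk 0" unfolding th kk_0 ..
  have kkf: "(\<lambda>s. lam T / (1 + lam T * (theta \<beta> lam dlam T - theta \<beta> lam dlam s))) = kk"
    unfolding kk_def[abs_def] Den_def th ..
  have "indist (stoch_int M F T kk \<Xi>) (ibp kk kd X)"
    by (rule indist_trans[OF stoch_int_ibp[OF ca is_prim_kk] indist_ibp[OF X]])
  then show ?thesis using X unfolding indist_def
  proof eventually_elim
    case (elim \<omega>)
    have e0: "\<Xi> 0 \<omega> = X 0 \<omega>" using elim(2) by simp
    show ?case
    proof
      fix t assume t: "t \<in> {0..T}"
      have "prim (\<lambda>s. X s \<omega> * kd s) t = prim (\<lambda>s. kd s * X s \<omega>) t" by (simp add: mult.commute)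
      then show "M_process M F T \<beta> lam dlam y \<Xi> t \<omega> = Mp y X t \<omega>"
        unfolding M_process_def kkf k0 Mp_def using elim(1) t e0
        by (simp add: ibp_def algebra_simps)
    qed
  qed
qed

text \<open>The identity behind the integrand \<open>kk\<close>: it makes the terminal trade bring
  the state exactly to \<open>Mp y X T\<close>. Since \<open>Den\<close> ends at \<open>1\<close>
  and \<open>P\<close> starts at \<open>0\<close>, the product rule for \<open>Den * P\<close>
  expresses \<open>P T\<close> as the integral that is needed.\<close>

lemma Mp_terminal:
  assumes X: "nice X" and w: "\<omega> \<in> space M"
  shows "Mp y X T \<omega> / lam T + prim (\<lambda>s. thd s * Mp y X s \<omega>) T = X T \<omega> + y / lam 0"
proof -
  define x where "x s = X s \<omega>" for s
  have bx: "bdm T x" unfolding x_def by (rule nice_bdm[OF X w])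
  have bkd: "bdm T kd" by (rule is_prim_bdm_deriv[OF is_prim_kk])
  define c where "c = kk 0 * (y / lam 0)"
  define P where "P = prim (\<lambda>s. kd s * x s)"
  have bkx: "bdm T (\<lambda>s. kd s * x s)" by (rule bdm_mult[OF bkd bx])
  have P: "is_prim T P (\<lambda>s. kd s * x s)" unfolding P_def by (rule is_prim_prim[OF bkx])
  have lT: "lam T > 0" by (rule lam_pos[OF T_T])
  have WP: "is_prim T (\<lambda>t. Den t * P t) (\<lambda>s. - (lam T * thd s) * P s + Den s * (kd s * x s))"
    by (rule is_prim_mult[OF is_prim_Den P])
  have "Den T * P T = prim (\<lambda>s. - (lam T * thd s) * P s + Den s * (kd s * x s)) T"
    using is_primD[OF WP T_T] by (simp add: P_def)
  also have "\<dots> = prim (\<lambda>s. lam T * (thd s * (kk s * x s) - thd s * P s)) T"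
  proof (rule prim_cong)
    fix s assume "s \<in> {0..T}"
    then have "Den s > 0" using Den_ge[of s] by linarith
    then show "- (lam T * thd s) * P s + Den s * (kd s * x s) = lam T * (thd s * (kk s * x s) - thd s * P s)"
      unfolding kd_def kk_def by (simp add: field_simps power2_eq_square)
  qed
  finally have PT: "P T = lam T * prim (\<lambda>s. thd s * (kk s * x s) - thd s * P s) T"
    unfolding prim_cmult by (simp add: Den_def)
  have b1: "bdm T (\<lambda>s. thd s * (kk s * x s) - thd s * P s)"
    by (intro bdm_diff bdm_mult bdm_thd is_prim_bdm[OF is_prim_kk] bx is_prim_bdm[OF P])
  have "prim (\<lambda>s. thd s * Mp y X s \<omega>) T = prim (\<lambda>s. c * thd s + (thd s * (kk s * x s) - thd s * P s)) T"
    by (rule prim_cong) (simp add: Mp_def c_def x_def P_def algebra_simps)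
  also have "\<dots> = c * prim thd T + prim (\<lambda>s. thd s * (kk s * x s) - thd s * P s) T"
    using prim_add[OF bdm_mult[OF bdm_const bdm_thd] b1 T_T] by (simp only: prim_cmult)
  finally have I: "prim (\<lambda>s. thd s * Mp y X s \<omega>) T = c * prim thd T + P T / lam T"
    using PT lT by simp
  have "Mp y X T \<omega> / lam T = c / lam T + x T - P T / lam T"
    unfolding Mp_def c_def[symmetric] kk_T using lT by (simp add: x_def[symmetric] P_def diff_divide_distrib add_divide_distrib)
  moreover have "c / lam T + c * prim thd T = y / lam 0"
  proof -
    have gen: "l / (1 + l * p) * z / l + l / (1 + l * p) * z * p = z" if "l > 0" "1 + l * p > 0" for l p z :: real
    proof -
      have "l / (1 + l * p) * z / l + l / (1 + l * p) * z * p = (z + l * z * p) / (1 + l * p)"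
        using that(1) by (simp add: add_divide_distrib)
      also have "z + l * z * p = z * (1 + l * p)" by (simp add: algebra_simps)
      finally show ?thesis using that(2) by simp
    qed
    have "Den 0 > 0" using Den_ge[of 0] by simp
    moreover have "Den 0 = 1 + lam T * prim thd T" unfolding Den_def by simp
    ultimately have "1 + lam T * prim thd T > 0" by simp
    then show ?thesis unfolding c_def kk_0 by (rule gen[OF lT])
  qed
  ultimately show ?thesis unfolding I by (simp add: x_def)
qed

definition Qh :: "real \<Rightarrow> (real \<Rightarrow> 'a \<Rightarrow> real) \<Rightarrow> real \<Rightarrow> 'a \<Rightarrow> real" where
  "Qh y X t \<omega> = (if t < T then alp t * Mp y X t \<omega> - y / lam 0 + prim (\<lambda>s. thd s * Mp y X s \<omega>) t else X T \<omega>)"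

lemma cadlag_gamma: "cadlag_on 0 T (gamma_dot lam dlam)"
proof -
  obtain \<delta> where d: "\<delta> > 0" "\<And>t. t \<in> {0..T} \<Longrightarrow> \<delta> \<le> lam t" using lam_low by blast
  show ?thesis using cadlag_divide[OF cadlag_dlam cadlag_lam d] unfolding gamma_dot_def[abs_def] .
qed

lemma cadlag_alp: "cadlag_on 0 T (\<lambda>t. alp t)"
proof -
  obtain \<delta> where d: "\<delta> > 0" "\<And>t. t \<in> {0..T} \<Longrightarrow> \<delta> \<le> lam t" using lam_low by blast
  obtain c where c: "c > 0" "\<And>t. t \<in> {0..T} \<Longrightarrow> c \<le> rho t" using rho_low by blast
  show ?thesis unfolding eta_def
    by (intro cadlag_divide[OF cadlag_divide[OF _ _ c] cadlag_lam d] cadlag_add cadlag_mult cadlag_beta cadlag_gamma cadlag_const)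
qed

text \<open>Here the finite variation of \<open>\<beta>\<close> and \<open>dlam\<close> enters:
  \<open>alp\<close> is built from them and the Lipschitz function \<open>lam\<close> by sums,
  products and quotients with denominators bounded away from zero.\<close>

lemma alp_variation: obtains v where "variation_bound T (\<lambda>t. alp t) v"
proof -
  obtain v1 where v1: "variation_bound T \<beta> v1"
    using finite_variation_bound[of T \<beta>] coeff unfolding coefficients_def by blast
  obtain v2 where v2: "variation_bound T dlam v2"
    using finite_variation_bound[of T dlam] coeff unfolding coefficients_def by blast
  obtain v3 where v3: "variation_bound T lam v3" using is_prim_variation[OF is_prim_lam] by blast
  obtain \<delta> where d: "\<delta> > 0" "\<And>t. t \<in> {0..T} \<Longrightarrow> \<delta> \<le> lam t" using lam_low by blast
  obtain c where c: "c > 0" "\<And>t. t \<in> {0..T} \<Longrightarrow> c \<le> rho t" using rho_low by blast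
  have mult: "\<exists>v. variation_bound T (\<lambda>t. f t * g t) v"
    if fg: "variation_bound T f v" "variation_bound T g w" "bdm T f" "bdm T g" for f g v w
  proof -
    obtain A where A: "A \<ge> 0" "\<And>t. t \<in> {0..T} \<Longrightarrow> \<bar>f t\<bar> \<le> A" using bdm_bound[OF fg(3)] by blast
    obtain B where B: "B \<ge> 0" "\<And>t. t \<in> {0..T} \<Longrightarrow> \<bar>g t\<bar> \<le> B" using bdm_bound[OF fg(4)] by blast
    show ?thesis using variation_bound_mult[OF fg(1,2) A(2) B(2) A(1) B(1)] by blast
  qed
  have il: "variation_bound T (\<lambda>t. 1 / lam t) (\<lambda>t. v3 t / \<delta>^2)" by (rule variation_bound_inverse[OF v3 d])
  have bil: "bdm T (\<lambda>t. 1 / lam t)" by (rule bdm_div_lam[OF bdm_const])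
  obtain v4 where v4: "variation_bound T (\<lambda>t. dlam t * (1 / lam t)) v4" using mult[OF v2 il bdm_dlam bil] by blast
  have v5: "variation_bound T (\<lambda>t. kap t) (\<lambda>t. v1 t + v4 t)"
    using variation_bound_add[OF v1 v4] unfolding gamma_dot_def by simp
  have v6: "variation_bound T (\<lambda>t. rho t) (\<lambda>t. v1 t + (v1 t + v4 t))"
    using variation_bound_add[OF v1 v5] unfolding mult_2 add.assoc .
  have ir: "variation_bound T (\<lambda>t. 1 / rho t) (\<lambda>t. (v1 t + (v1 t + v4 t)) / c^2)" by (rule variation_bound_inverse[OF v6 c])
  have bir: "bdm T (\<lambda>t. 1 / rho t)" by (rule bdm_divide[OF bdm_const bdm_rho c])
  obtain v7 where v7: "variation_bound T (\<lambda>t. kap t * (1 / rho t)) v7" using mult[OF v5 ir bdm_kap bir] by blast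
  obtain v8 where "variation_bound T (\<lambda>t. kap t * (1 / rho t) * (1 / lam t)) v8"
    using mult[OF v7 il bdm_mult[OF bdm_kap bir] bil] by blast
  then have "variation_bound T (\<lambda>t. alp t) v8" by (simp add: eta_def)
  then show ?thesis by (rule that)
qed

lemma L2b_Qh0: assumes X: "L2b X" shows "L2b (\<lambda>t \<omega>. alp t * Mp y X t \<omega> - y / lam 0 + prim (\<lambda>s. thd s * Mp y X s \<omega>) t)"
  by (intro L2b_add L2b_diff L2b_const L2b_det_mult L2b_prim L2b_Mp X cadlag_alp bdm_thd)

lemma L2b_Qh: assumes X: "L2b X" shows "L2b (Qh y X)"
proof -
  let ?A = "\<lambda>t \<omega>. alp t * Mp y X t \<omega> - y / lam 0 + prim (\<lambda>s. thd s * Mp y X s \<omega>) t"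
  have A: "L2b ?A" by (rule L2b_Qh0[OF X])
  obtain C where C: "C \<ge> 0" "\<And>t. t \<in> {0..T} \<Longrightarrow> (\<integral>\<omega>. (?A t \<omega>)^2 \<partial>M) \<le> C" using L2b_bound[OF A] by blast
  obtain D where D: "D \<ge> 0" "\<And>t. t \<in> {0..T} \<Longrightarrow> (\<integral>\<omega>. (X t \<omega>)^2 \<partial>M) \<le> D" using L2b_bound[OF X] by blast
  have n: "nice (Qh y X)"
    unfolding Qh_def[abs_def] by (rule nice_endpoint[OF L2b_nice[OF A] L2b_adapted[OF X T_T]])
  show ?thesis
  proof (rule L2bI[OF n, where C = "C + D"])
    fix t assume t: "t \<in> {0..T}"
    have "(t < T \<and> Qh y X t = ?A t) \<or> Qh y X t = X T"
      by (auto simp: Qh_def fun_eq_iff)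
    then show "integrable M (\<lambda>\<omega>. (Qh y X t \<omega>)^2)" "(\<integral>\<omega>. (Qh y X t \<omega>)^2 \<partial>M) \<le> C + D"
      using L2b_int[OF A t] L2b_int[OF X T_T] C(1) C(2)[OF t] D(1) D(2)[OF T_T] by fastforce+
  qed
qed

text \<open>The smooth part of this state can be guessed: \<open>lam\<close> times the difference of
  \<open>y / lam 0\<close> and the running integral of \<open>thd * M\<close>. It solves the linear
  equation driven by \<open>Qh\<close>, and uniqueness makes it the right one. When
  \<open>lam * Qh\<close> is added the integrals cancel and \<open>eta * M\<close> remains; at
  \<open>T\<close> the terminal identity gives \<open>M\<close> itself.\<close>

lemma pst_Qh:
  assumes X: "L2b X" and w: "\<omega> \<in> space M" and t: "t \<in> {0..T}"
  shows "pst y (Qh y X) t \<omega> = (if t < T then eta \<beta> lam dlam t * Mp y X t \<omega> else Mp y X T \<omega>)"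
proof -
  define m where "m s = Mp y X s \<omega>" for s
  define q where "q s = alp s * m s - y / lam 0 + prim (\<lambda>s. thd s * m s) s" for s
  define Z where "Z s = lam s * (y / lam 0 - prim (\<lambda>s. thd s * m s) s)" for s
  have bm: "bdm T m" unfolding m_def by (rule nice_bdm[OF L2b_nice[OF L2b_Mp[OF X]] w])
  have btm: "bdm T (\<lambda>s. thd s * m s)" by (rule bdm_mult[OF bdm_thd bm])
  have bq: "bdm T q" unfolding q_def m_def by (rule nice_bdm[OF L2b_nice[OF L2b_Qh0[OF X]] w])
  have bQ: "bdm T (\<lambda>s. Qh y X s \<omega>)" by (rule nice_bdm[OF L2b_nice[OF L2b_Qh[OF X]] w])
  have "is_prim T Z (\<lambda>s. dlam s * (y / lam 0 - prim (\<lambda>s. thd s * m s) s) + lam s * (0 - thd s * m s))"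
    unfolding Z_def by (rule is_prim_mult[OF is_prim_lam is_prim_minus_fun[OF is_prim_const is_prim_prim[OF btm]]])
  then have "is_prim T Z (\<lambda>s. - (\<beta> s * Z s + gco s * q s))"
  proof (rule is_prim_cong)
    fix s assume s: "s \<in> {0..T}"
    define p where "p = y / lam 0 - prim (\<lambda>s. thd s * m s) s"
    have l: "lam s > 0" and r: "rho s > 0" using lam_pos[OF s] rho_pos[OF s] .
    \<comment> \<open>Both sides equal \<open>kap^2 / rho * m\<close>; \<open>thd\<close> and
      \<open>eta\<close> are matched through this identity.\<close>
    have a: "lam s * (thd s * m s) = gco s * (alp s * m s)"
      unfolding gco_kap[OF s] theta_dot_def eta_def using l r by (simp add: power2_eq_square)
    have "\<beta> s * Z s + gco s * q s = \<beta> s * (lam s * p) + gco s * (alp s * m s) - gco s * p"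
      unfolding Z_def q_def p_def by (simp add: algebra_simps)
    also have "\<dots> = lam s * (thd s * m s) - dlam s * p" unfolding a[symmetric] by (simp add: algebra_simps)
    finally show "dlam s * (y / lam 0 - prim (\<lambda>s. thd s * m s) s) + lam s * (0 - thd s * m s) = - (\<beta> s * Z s + gco s * q s)"
      unfolding p_def by simp
  qed simp
  from zstate_unique[OF bq this t] have Zq: "Z t = zstate (Z 0) q t" .
  have Z0: "Z 0 = y" unfolding Z_def using lam_pos[OF zero_T] by simp
  \<comment> \<open>\<open>q\<close> and \<open>Qh\<close> differ at most at \<open>T\<close>, which
    the integral does not see.\<close>
  have "prim (\<lambda>s. EB s * (gco s * q s)) t = prim (\<lambda>s. EB s * (gco s * Qh y X s \<omega>)) t"
  proof (rule set_integral_cong_AE_Icc)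
    show "set_borel_measurable lborel {0..t} (\<lambda>s. EB s * (gco s * q s))"
      "set_borel_measurable lborel {0..t} (\<lambda>s. EB s * (gco s * Qh y X s \<omega>))"
      using bdm_set_borel_measurable[OF bdm_src[OF bq]] bdm_set_borel_measurable[OF bdm_src[OF bQ]] t by auto
  qed (use t in \<open>auto simp: Qh_def q_def m_def\<close>)
  then have Zt: "zstate y (\<lambda>s. Qh y X s \<omega>) t = Z t" unfolding Zq Z0 zstate_def by simp
  have l: "lam t > 0" by (rule lam_pos[OF t])
  show ?thesis
  proof (cases "t < T")
    case True
    then have "pst y (Qh y X) t \<omega> = lam t * q t + Z t"
      unfolding pstate_def Zt by (simp add: Qh_def q_def m_def)
    also have "\<dots> = eta \<beta> lam dlam t * m t" unfolding q_def Z_def using l by (simp add: field_simps)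
    finally show ?thesis using True by (simp add: m_def)
  next
    case False
    then have tT: "t = T" using t by simp
    have "pst y (Qh y X) T \<omega> = lam T * X T \<omega> + Z T" using Zt unfolding tT pstate_def by (simp add: Qh_def)
    also have "\<dots> = lam T * (X T \<omega> + y / lam 0 - prim (\<lambda>s. thd s * m s) T)" unfolding Z_def by (simp add: algebra_simps)
    also have "X T \<omega> + y / lam 0 - prim (\<lambda>s. thd s * m s) T = m T / lam T"
      using Mp_terminal[OF L2b_nice[OF X] w, of y] unfolding m_def by linarith
    finally show ?thesis using l tT False by (simp add: m_def)
  qed
qed

text \<open>Since the discounted difference \<open>D = (pst y Q - pst y (Qh y X)) / lam\<close> has u_integral_terminal value
  \<open>- \<integral> kap D dt\<close>, the martingale property of \<open>Mp\<close> makes the two terms of the scalar product cancel.\<close>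

lemma first_order_condition:
  assumes X: "L2mart X" and Q: "L2b Q" and QT: "AE \<omega> in M. Q T \<omega> = X T \<omega>"
  shows "inner_H M T \<beta> lam dlam (pst y (Qh y X)) (\<lambda>t \<omega>. pst y Q t \<omega> - pst y (Qh y X) t \<omega>) = 0"
proof -
  let ?Y = "pst y (Qh y X)"
  define D where "D t \<omega> = pst y Q t \<omega> - ?Y t \<omega>" for t \<omega>
  note b = L2mart_L2b[OF X]
  have Y: "L2b ?Y" by (rule L2b_pst[OF L2b_Qh[OF b]])
  have D: "L2b D" unfolding D_def[abs_def] by (rule L2b_diff[OF L2b_pst[OF Q] Y])
  have Mb: "L2b (Mp y X)" by (rule L2b_Mp[OF b])
  have MT: "Mp y X T \<in> borel_measurable M" "integrable M (\<lambda>\<omega>. (Mp y X T \<omega>)^2)"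
    by (rule L2b_meas[OF Mb T_T], rule L2b_int[OF Mb T_T])
  have bkl: "bdm T (\<lambda>t. kap t / lam t)" by (rule bdm_div_lam[OF bdm_kap])
  define e where "e s = (\<integral>\<omega>. D s \<omega> * Mp y X s \<omega> \<partial>M)" for s
  have be: "bdm T e" unfolding e_def by (rule L2b_joint(3)[OF D Mb bkl])
  have lT: "lam T > 0" by (rule lam_pos[OF T_T])
  \<comment> \<open>At \<open>T\<close> both strategies hold the same position, so the normalized
    state difference there is purely an integral, and the state of \<open>Qh\<close> is the
    martingale itself.\<close>
  have term2: "(\<integral>\<omega>. ?Y T \<omega> * D T \<omega> \<partial>M) = - lam T * prim (\<lambda>s. kap s / lam s * e s) T"
  proof -
    have "(\<integral>\<omega>. ?Y T \<omega> * D T \<omega> \<partial>M) = (\<integral>\<omega>. - lam T * (Mp y X T \<omega> * prim (\<lambda>s. kap s / lam s * D s \<omega>) T) \<partial>M)"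
    proof (rule integral_cong_AE)
      show "(\<lambda>\<omega>. ?Y T \<omega> * D T \<omega>) \<in> borel_measurable M"
        by (rule borel_measurable_times[OF L2b_meas[OF Y T_T] L2b_meas[OF D T_T]])
      show "(\<lambda>\<omega>. - lam T * (Mp y X T \<omega> * prim (\<lambda>s. kap s / lam s * D s \<omega>) T)) \<in> borel_measurable M"
        using L2b_joint_rv(1)[OF D MT bkl] by simp
      show "AE \<omega> in M. ?Y T \<omega> * D T \<omega> = - lam T * (Mp y X T \<omega> * prim (\<lambda>s. kap s / lam s * D s \<omega>) T)"
        using QT AE_space
      proof eventually_elim
        case (elim \<omega>)
        have "D T \<omega> / lam T = Q T \<omega> - Qh y X T \<omega> - prim (\<lambda>s. kap s / lam s * D s \<omega>) T"
          unfolding D_def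
          by (rule pstate_diff_normalized[OF L2b_bdm[OF Q elim(2)] nice_bdm[OF L2b_nice[OF L2b_Qh[OF b]] elim(2)] T_T])
        moreover have "Qh y X T \<omega> = X T \<omega>" by (simp add: Qh_def)
        ultimately have "D T \<omega> = - lam T * prim (\<lambda>s. kap s / lam s * D s \<omega>) T" using elim(1) lT by (simp add: field_simps)
        moreover have "?Y T \<omega> = Mp y X T \<omega>" using pst_Qh[OF b elim(2) T_T] by simp
        ultimately show ?case by simp
      qed
    qed
    also have "\<dots> = - lam T * (\<integral>\<omega>. Mp y X T \<omega> * prim (\<lambda>s. kap s / lam s * D s \<omega>) T \<partial>M)"
      by (rule integral_mult_right_zero)
    also have "(\<integral>\<omega>. Mp y X T \<omega> * prim (\<lambda>s. kap s / lam s * D s \<omega>) T \<partial>M) = prim (\<lambda>s. kap s / lam s * (\<integral>\<omega>. Mp y X T \<omega> * D s \<omega> \<partial>M)) T"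
      by (rule L2b_joint_rv(2)[OF D MT bkl])
    also have "\<dots> = prim (\<lambda>s. kap s / lam s * e s) T"
    proof (rule prim_cong)
      fix s assume s: "s \<in> {0..T}"
      \<comment> \<open>\<open>D s\<close> is known at time \<open>s\<close>, so the martingale may
        be evaluated at \<open>s\<close> instead of \<open>T\<close>.\<close>
      have "(\<integral>\<omega>. D s \<omega> * Mp y X T \<omega> \<partial>M) = e s"
        unfolding e_def
        by (rule L2mart_test[OF L2mart_Mp[OF X] _ _ _ L2b_adapted[OF D s] L2b_int[OF D s]]) (use s in auto)
      then show "kap s / lam s * (\<integral>\<omega>. Mp y X T \<omega> * D s \<omega> \<partial>M) = kap s / lam s * e s" by (simp add: mult.commute)
    qed
    finally show ?thesis .
  qed
  \<comment> \<open>Since \<open>wgt * eta = kap / (2 * lam)\<close>, the running term is half of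
    the integral found at \<open>T\<close>, and the terminal term is minus that half.\<close>
  have term1: "prim (\<lambda>t. wgt t * (\<integral>\<omega>. ?Y t \<omega> * D t \<omega> \<partial>M)) T = 1/2 * prim (\<lambda>s. kap s / lam s * e s) T"
    unfolding prim_cmult[symmetric]
  proof (rule set_integral_cong_AE_Icc)
    show "set_borel_measurable lborel {0..T} (\<lambda>t. wgt t * (\<integral>\<omega>. ?Y t \<omega> * D t \<omega> \<partial>M))"
      by (rule bdm_set_borel_measurable[OF bdm_mult[OF bdm_wgt L2b_joint(3)[OF Y D bkl]]]) auto
    show "set_borel_measurable lborel {0..T} (\<lambda>s. 1/2 * (kap s / lam s * e s))"
      by (rule bdm_set_borel_measurable[OF bdm_mult[OF bdm_const bdm_mult[OF bkl be]]]) auto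
    show "AE s in lborel. s \<in> {0<..<T} \<longrightarrow> wgt s * (\<integral>\<omega>. ?Y s \<omega> * D s \<omega> \<partial>M) = 1/2 * (kap s / lam s * e s)"
    proof (intro AE_I2 impI)
      fix s assume s: "s \<in> {0<..<T}"
      then have s': "s \<in> {0..T}" by auto
      have "(\<integral>\<omega>. ?Y s \<omega> * D s \<omega> \<partial>M) = (\<integral>\<omega>. eta \<beta> lam dlam s * (D s \<omega> * Mp y X s \<omega>) \<partial>M)"
        by (rule Bochner_Integration.integral_cong[OF refl]) (use pst_Qh[OF b _ s'] s in simp)
      also have "\<dots> = eta \<beta> lam dlam s * e s" unfolding e_def by simp
      finally have "wgt s * (\<integral>\<omega>. ?Y s \<omega> * D s \<omega> \<partial>M) = (wgt s * eta \<beta> lam dlam s) * e s" by simp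
      also have "wgt s * eta \<beta> lam dlam s = 1/2 * (kap s / lam s)"
        unfolding eta_def using rho_pos[OF s'] lam_pos[OF s'] by simp
      finally show "wgt s * (\<integral>\<omega>. ?Y s \<omega> * D s \<omega> \<partial>M) = 1/2 * (kap s / lam s * e s)" by simp
    qed
  qed
  have "inner_H M T \<beta> lam dlam ?Y D = 1/2 * prim (\<lambda>s. kap s / lam s * e s) T + 1 / (2 * lam T) * (- lam T * prim (\<lambda>s. kap s / lam s * e s) T)"
    unfolding inner_H_L2b(3)[OF Y D] term1 term2 ..
  also have "\<dots> = 0" using lT by simp
  finally show ?thesis unfolding D_def[abs_def] .
qed

text \<open>Pythagoras: the cross term vanishes by orthogonality. It applies to any process in the
  working class with the right terminal value, so to versions of both minimizers and of the recovery
  strategies.\<close>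

lemma norm_H_sq_excess:
  assumes X: "L2mart X" and Q: "L2b Q" and QT: "AE \<omega> in M. Q T \<omega> = X T \<omega>"
  shows "norm_H_sq M T \<beta> lam dlam (pst y Q) = norm_H_sq M T \<beta> lam dlam (pst y (Qh y X))
    + norm_H_sq M T \<beta> lam dlam (\<lambda>t \<omega>. pst y Q t \<omega> - pst y (Qh y X) t \<omega>)"
  using norm_H_sq_expand[OF L2b_pst[OF Q, of y] L2b_pst[OF L2b_Qh[OF L2mart_L2b[OF X], of y], of y]]
    first_order_condition[OF X Q QT, of y] by simp

end

section \<open>Translation and energy estimates\<close>

context filtered_horizon
begin

text \<open>Passes from an integrand known only up to a null set of paths to the second moments of a
  regular version; completeness provides the measurability.\<close>

lemma expectation_prim_cong:
  assumes D: "L2b D" and ae: "AE \<omega> in M. \<forall>t\<in>{0..T}. f t \<omega> = (D t \<omega>)^2"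
  shows "(\<integral>\<omega>. prim (\<lambda>t. f t \<omega>) T \<partial>M) = prim (\<lambda>t. \<integral>\<omega>. (D t \<omega>)^2 \<partial>M) T"
    "integrable M (\<lambda>\<omega>. prim (\<lambda>t. f t \<omega>) T)" "integrable M (\<lambda>\<omega>. prim (\<lambda>t. (D t \<omega>)^2) T)"
proof -
  have c: "bdm T (\<lambda>t. 1)" by simp
  note j = L2b_joint[OF D D c]
  have i: "integrable M (\<lambda>\<omega>. prim (\<lambda>t. (D t \<omega>)^2) T)" using j(1) by (simp add: power2_eq_square)
  show "integrable M (\<lambda>\<omega>. prim (\<lambda>t. (D t \<omega>)^2) T)" by (rule i)
  have ae2: "AE \<omega> in M. prim (\<lambda>t. (D t \<omega>)^2) T = prim (\<lambda>t. f t \<omega>) T"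
    using ae by eventually_elim (rule prim_cong, simp)
  have m: "(\<lambda>\<omega>. prim (\<lambda>t. f t \<omega>) T) \<in> borel_measurable M"
    by (rule measurable_AE_cong[OF _ ae2]) (use i in simp)
  show "integrable M (\<lambda>\<omega>. prim (\<lambda>t. f t \<omega>) T)"
    by (rule integrable_cong_AE_imp[OF i m]) (use ae2 in \<open>auto elim: eventually_mono\<close>)
  have "(\<integral>\<omega>. prim (\<lambda>t. f t \<omega>) T \<partial>M) = (\<integral>\<omega>. prim (\<lambda>t. (D t \<omega>)^2) T \<partial>M)"
    using integral_cong_AE[OF _ m ae2] i by simp
  also have "\<dots> = prim (\<lambda>t. \<integral>\<omega>. (D t \<omega>)^2 \<partial>M) T" using j(2) by (simp add: power2_eq_square)
  finally show "(\<integral>\<omega>. prim (\<lambda>t. f t \<omega>) T \<partial>M) = prim (\<lambda>t. \<integral>\<omega>. (D t \<omega>)^2 \<partial>M) T" .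
qed

lemma bdm_second_moment: "L2b D \<Longrightarrow> bdm T (\<lambda>t. \<integral>\<omega>. (D t \<omega>)^2 \<partial>M)"
  using L2b_joint(3)[of D D "\<lambda>t. 1"] by (simp add: power2_eq_square)

lemma expectation_square_add_le:
  assumes "U \<in> borel_measurable M" "V \<in> borel_measurable M"
    "integrable M (\<lambda>\<omega>. (U \<omega>)^2)" "integrable M (\<lambda>\<omega>. (V \<omega>)^2)"
  shows "integrable M (\<lambda>\<omega>. (U \<omega> + V \<omega> :: real)^2)"
    "(\<integral>\<omega>. (U \<omega> + V \<omega>)^2 \<partial>M) \<le> 2 * (\<integral>\<omega>. (U \<omega>)^2 \<partial>M) + 2 * (\<integral>\<omega>. (V \<omega>)^2 \<partial>M)"
proof -
  have "(\<lambda>\<omega>. (U \<omega> + V \<omega>)^2) = (\<lambda>\<omega>. (U \<omega>)^2 + 2 * (U \<omega> * V \<omega>) + (V \<omega>)^2)"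
    by (simp add: power2_eq_square algebra_simps)
  then show i: "integrable M (\<lambda>\<omega>. (U \<omega> + V \<omega>)^2)"
    using integrable_L2_mult[OF assms] assms(3,4) by simp
  have "(\<integral>\<omega>. (U \<omega> + V \<omega>)^2 \<partial>M) \<le> (\<integral>\<omega>. 2 * (U \<omega>)^2 + 2 * (V \<omega>)^2 \<partial>M)"
    by (rule integral_mono[OF i]) (use assms(3,4) power2_add_le in auto)
  also have "\<dots> = 2 * (\<integral>\<omega>. (U \<omega>)^2 \<partial>M) + 2 * (\<integral>\<omega>. (V \<omega>)^2 \<partial>M)" using assms(3,4) by simp
  finally show "(\<integral>\<omega>. (U \<omega> + V \<omega>)^2 \<partial>M) \<le> 2 * (\<integral>\<omega>. (U \<omega>)^2 \<partial>M) + 2 * (\<integral>\<omega>. (V \<omega>)^2 \<partial>M)" .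
qed

definition shift_sq :: "(real \<Rightarrow> 'a \<Rightarrow> real) \<Rightarrow> real \<Rightarrow> real \<Rightarrow> real" where
  "shift_sq Q h t = (\<integral>\<omega>. (Q t \<omega> - Q (max (t - h) 0) \<omega>)^2 \<partial>M)"

lemma bdm_shift_sq: "L2b Q \<Longrightarrow> h > 0 \<Longrightarrow> bdm T (shift_sq Q h)"
  unfolding shift_sq_def[abs_def] by (rule bdm_second_moment[OF L2b_diff[OF _ L2b_shift]])

text \<open>A real supremum bounds its members only if the family is bounded above. The hypothesis
  with \<open>G\<close> guarantees this, after which \<open>G\<close> is replaced by the
  seminorm.\<close>

lemma tr_seminorm_upper:
  assumes Q: "L2b Q" and ind: "indist P Q" and G: "\<And>h. h > 0 \<Longrightarrow> prim (shift_sq Q h) T \<le> h * G" and h: "h > 0"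
  shows "prim (shift_sq Q h) T \<le> h * tr_seminorm_sq M T P"
proof -
  have e: "1 / r * (\<integral>\<omega>. (LINT t:{0..T}|lborel. \<bar>P t \<omega> - P (max (t - r) 0) \<omega>\<bar>^2) \<partial>M) = 1 / r * prim (shift_sq Q r) T" if r: "r > 0" for r
  proof -
    have "AE \<omega> in M. \<forall>t\<in>{0..T}. \<bar>P t \<omega> - P (max (t - r) 0) \<omega>\<bar>^2 = (Q t \<omega> - Q (max (t - r) 0) \<omega>)^2"
      using ind unfolding indist_def
    proof eventually_elim
      case (elim \<omega>)
      show ?case
      proof
        fix t assume t: "t \<in> {0..T}"
        then have "max (t - r) 0 \<in> {0..T}" using r by auto
        then show "\<bar>P t \<omega> - P (max (t - r) 0) \<omega>\<bar>^2 = (Q t \<omega> - Q (max (t - r) 0) \<omega>)^2" using elim t by simp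
      qed
    qed
    from expectation_prim_cong(1)[OF L2b_diff[OF Q L2b_shift[OF Q r]] this]
    show ?thesis unfolding shift_sq_def[abs_def] by simp
  qed
  have "1 / h * prim (shift_sq Q h) T \<le> tr_seminorm_sq M T P"
    unfolding tr_seminorm_sq_def e[OF h, symmetric]
  proof (rule cSUP_upper)
    show "bdd_above ((\<lambda>h. 1 / h * (\<integral>\<omega>. (LINT t:{0..T}|lborel. \<bar>P t \<omega> - P (max (t - h) 0) \<omega>\<bar>^2) \<partial>M)) ` {0<..})"
    proof (rule bdd_aboveI2[where M = G])
      fix r :: real assume "r \<in> {0<..}"
      then have r: "r > 0" by simp
      show "1 / r * (\<integral>\<omega>. (LINT t:{0..T}|lborel. \<bar>P t \<omega> - P (max (t - r) 0) \<omega>\<bar>^2) \<partial>M) \<le> G"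
        unfolding e[OF r] using G[OF r] r by (simp add: field_simps)
    qed
  qed (use h in auto)
  then show ?thesis using h by (simp add: field_simps)
qed

lemma K_zero_upper:
  assumes Q: "L2b Q" and ind: "indist P Q" and X: "L2b X" and ind2: "indist \<Xi> X" and t: "0 \<le> t" "t < T"
  shows "(\<integral>\<omega>. (Q t \<omega> - X t \<omega>)^2 \<partial>M) \<le> K_zero M T \<Xi> P"
proof -
  have D: "L2b (\<lambda>t \<omega>. Q t \<omega> - X t \<omega>)" by (rule L2b_diff[OF Q X])
  have e: "(\<integral>\<omega>. \<bar>P s \<omega> - \<Xi> s \<omega>\<bar>^2 \<partial>M) = (\<integral>\<omega>. (Q s \<omega> - X s \<omega>)^2 \<partial>M)" if s: "s \<in> {0..<T}" for s
  proof -
    have s': "s \<in> {0..T}" using s by auto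
    have ae: "AE \<omega> in M. (Q s \<omega> - X s \<omega>)^2 = \<bar>P s \<omega> - \<Xi> s \<omega>\<bar>^2"
      using indist_at[OF ind s'] indist_at[OF ind2 s'] by eventually_elim simp
    have m: "(\<lambda>\<omega>. (Q s \<omega> - X s \<omega>)^2) \<in> borel_measurable M" using L2b_int[OF D s'] by simp
    show ?thesis
      by (rule integral_cong_AE[OF measurable_AE_cong[OF m ae] m]) (use ae in \<open>auto elim: eventually_mono\<close>)
  qed
  obtain C where C: "\<And>t. t \<in> {0..T} \<Longrightarrow> (\<integral>\<omega>. (Q t \<omega> - X t \<omega>)^2 \<partial>M) \<le> C" using L2b_bound[OF D] by blast
  have "(\<integral>\<omega>. \<bar>P t \<omega> - \<Xi> t \<omega>\<bar>^2 \<partial>M) \<le> K_zero M T \<Xi> P"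
    unfolding K_zero_def
  proof (rule cSUP_upper)
    show "bdd_above ((\<lambda>t. \<integral>\<omega>. \<bar>P t \<omega> - \<Xi> t \<omega>\<bar>^2 \<partial>M) ` {0..<T})"
      by (rule bdd_aboveI2[where M = C]) (use e C in auto)
  qed (use t in auto)
  then show ?thesis using e t by simp
qed

text \<open>Fatou's lemma along times decreasing to \<open>t\<close> gives the inequality that does not follow from
  monotonicity.\<close>

lemma L2mart_right_continuous:
  assumes X: "L2mart X" and t: "0 \<le> t" "t < T"
  shows "((\<lambda>s. \<integral>\<omega>. (X s \<omega>)^2 \<partial>M) \<longlongrightarrow> (\<integral>\<omega>. (X t \<omega>)^2 \<partial>M)) (at_right t)"
proof -
  note b = L2mart_L2b[OF X]
  define g where "g s = (\<integral>\<omega>. (X s \<omega>)^2 \<partial>M)" for s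
  have gm: "g r \<le> g s" if "0 \<le> r" "r \<le> s" "s \<le> T" for r s unfolding g_def by (rule L2mart_mono[OF X that])
  define l where "l = (INF s\<in>{t<..T}. g s)"
  have bb: "bdd_below (g ` {t<..T})" by (rule bdd_belowI2[where m = "g t"]) (use gm t in auto)
  have lg: "l \<le> g s" if "s \<in> {t<..T}" for s unfolding l_def by (rule cINF_lower[OF bb that])
  have lim: "(g \<longlongrightarrow> l) (at_right t)"
  proof (rule order_tendstoI)
    fix a assume a: "a < l"
    show "\<forall>\<^sub>F s in at_right t. a < g s"
      unfolding eventually_at_right_field by (rule exI[of _ T]) (use t lg a in \<open>auto intro: less_le_trans\<close>)
  next
    fix a assume a: "l < a"
    then obtain s where s: "s \<in> {t<..T}" "g s < a"
      unfolding l_def using cINF_less_iff[OF _ bb] t by auto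
    show "\<forall>\<^sub>F r in at_right t. g r < a"
      unfolding eventually_at_right_field
    proof (intro exI[of _ s] conjI allI impI)
      fix r assume "t < r" "r < s"
      then show "g r < a" using gm[of r s] s t by auto
    qed (use s in auto)
  qed
  define sn where "sn n = t + (T - t) / real (Suc n)" for n
  have sn: "t < sn n" "sn n \<le> T" for n
  proof -
    show "t < sn n" unfolding sn_def using t by simp
    have "(T - t) / real (Suc n) \<le> T - t" using t by (simp add: divide_le_eq mult_left_mono)
    then show "sn n \<le> T" unfolding sn_def by simp
  qed
  have sn0: "0 \<le> sn n" "sn n \<in> {0..T}" for n using sn[of n] t by auto
  have snlim: "sn \<longlonglongrightarrow> t"
  proof -
    have "(\<lambda>n. (T - t) * (1 / real (Suc n))) \<longlonglongrightarrow> (T - t) * 0"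
      by (intro tendsto_mult tendsto_const LIMSEQ_Suc[OF lim_1_over_n])
    then show ?thesis unfolding sn_def using tendsto_add[OF tendsto_const[of t]] by fastforce
  qed
  have fr: "filterlim sn (at_right t) sequentially"
    by (rule tendsto_imp_filterlim_at_right[OF snlim]) (use sn in auto)
  have gl: "(\<lambda>n. g (sn n)) \<longlonglongrightarrow> l" by (rule filterlim_compose[OF lim fr])
  \<comment> \<open>For fixed \<open>n\<close> the left side is the second moment of an increment.
    By Fatou it is at most the lower limit over \<open>m\<close> of
    \<open>g (sn n) - g (sn m)\<close>, and these numbers stay below the right side. The common term
    then cancels.\<close>
  have key: "g (sn n) - g t \<le> g (sn n) - l" for n
  proof -
    have tn: "t \<in> {0..T}" "sn n \<in> {0..T}" using t sn[of n] by auto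
    have "ennreal (g (sn n) - g t) = (\<integral>\<^sup>+\<omega>. ennreal ((X (sn n) \<omega> - X t \<omega>)^2) \<partial>M)"
    proof -
      have "g (sn n) - g t = (\<integral>\<omega>. (X (sn n) \<omega> - X t \<omega>)^2 \<partial>M)"
        unfolding g_def by (rule L2mart_increment(1)[OF X, symmetric]) (use t sn[of n] in auto)
      also have "ennreal \<dots> = (\<integral>\<^sup>+\<omega>. ennreal ((X (sn n) \<omega> - X t \<omega>)^2) \<partial>M)"
        by (rule nn_integral_eq_integral[symmetric, OF L2mart_increment(2)[OF X]]) (use t sn[of n] in auto)
      finally show ?thesis .
    qed
    also have "\<dots> = (\<integral>\<^sup>+\<omega>. liminf (\<lambda>m. ennreal ((X (sn n) \<omega> - X (sn m) \<omega>)^2)) \<partial>M)"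
    proof (rule nn_integral_cong)
      fix \<omega> assume w: "\<omega> \<in> space M"
      have "((\<lambda>s. X s \<omega>) \<longlongrightarrow> X t \<omega>) (at_right t)"
        using L2b_cadlag[OF b w] t unfolding cadlag_on_def by auto
      then have "(\<lambda>m. X (sn m) \<omega>) \<longlonglongrightarrow> X t \<omega>" using fr by (rule filterlim_compose)
      then have "(\<lambda>m. ennreal ((X (sn n) \<omega> - X (sn m) \<omega>)^2)) \<longlonglongrightarrow> ennreal ((X (sn n) \<omega> - X t \<omega>)^2)"
        by (intro tendsto_ennrealI tendsto_intros)
      then show "ennreal ((X (sn n) \<omega> - X t \<omega>)^2) = liminf (\<lambda>m. ennreal ((X (sn n) \<omega> - X (sn m) \<omega>)^2))"
        by (rule lim_imp_Liminf[symmetric, OF trivial_limit_sequentially])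
    qed
    also have "\<dots> \<le> liminf (\<lambda>m. \<integral>\<^sup>+\<omega>. ennreal ((X (sn n) \<omega> - X (sn m) \<omega>)^2) \<partial>M)"
    proof (rule nn_integral_liminf)
      fix m
      have "X (sn n) \<in> borel_measurable M" "X (sn m) \<in> borel_measurable M"
        by (rule L2b_meas[OF b sn0(2)])+
      then show "(\<lambda>\<omega>. ennreal ((X (sn n) \<omega> - X (sn m) \<omega>)^2)) \<in> borel_measurable M" by measurable
    qed
    also have "\<dots> \<le> ennreal (g (sn n) - l)"
    proof -
      have "(\<integral>\<^sup>+\<omega>. ennreal ((X (sn n) \<omega> - X (sn m) \<omega>)^2) \<partial>M) \<le> ennreal (g (sn n) - l)" if m: "m \<ge> n" for m
      proof -
        have mn: "sn m \<le> sn n" unfolding sn_def using m t by (auto intro!: divide_left_mono)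
        have "(\<integral>\<^sup>+\<omega>. ennreal ((X (sn n) \<omega> - X (sn m) \<omega>)^2) \<partial>M) = ennreal (\<integral>\<omega>. (X (sn n) \<omega> - X (sn m) \<omega>)^2 \<partial>M)"
          by (rule nn_integral_eq_integral[OF L2mart_increment(2)[OF X]]) (use sn0 sn mn in auto)
        also have "(\<integral>\<omega>. (X (sn n) \<omega> - X (sn m) \<omega>)^2 \<partial>M) = g (sn n) - g (sn m)"
          unfolding g_def by (rule L2mart_increment(1)[OF X]) (use sn0 sn mn in auto)
        also have "ennreal (g (sn n) - g (sn m)) \<le> ennreal (g (sn n) - l)"
          using lg[of "sn m"] sn[of m] by (intro ennreal_leI) auto
        finally show ?thesis .
      qed
      then have "\<forall>\<^sub>F m in sequentially. (\<integral>\<^sup>+\<omega>. ennreal ((X (sn n) \<omega> - X (sn m) \<omega>)^2) \<partial>M) \<le> ennreal (g (sn n) - l)"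
        unfolding eventually_sequentially by blast
      then have "limsup (\<lambda>m. \<integral>\<^sup>+\<omega>. ennreal ((X (sn n) \<omega> - X (sn m) \<omega>)^2) \<partial>M) \<le> ennreal (g (sn n) - l)"
        by (rule Limsup_bounded)
      then show ?thesis using Liminf_le_Limsup[OF trivial_limit_sequentially] order_trans by blast
    qed
    finally show ?thesis
      using lg[of "sn n"] sn[of n] by (subst (asm) ennreal_le_iff) auto
  qed
  then have "l \<le> g t" using key[of 0] by linarith
  moreover have "g t \<le> l" unfolding l_def by (rule cINF_greatest) (use gm t in auto)
  ultimately show ?thesis using lim unfolding g_def by simp
qed

text \<open>Clamped outside \<open>{0..T}\<close> exactly like the integrator in
  \<open>Lambda\<close>, so that both have the same Stieltjes measure.\<close>

definition energy :: "(real \<Rightarrow> 'a \<Rightarrow> real) \<Rightarrow> real \<Rightarrow> real" where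
  "energy X t = (\<integral>\<omega>. (X (max 0 (min T t)) \<omega>)^2 \<partial>M)"

lemma energy_mono: "L2mart X \<Longrightarrow> s \<le> t \<Longrightarrow> energy X s \<le> energy X t"
  unfolding energy_def by (rule L2mart_mono) auto

text \<open>Right-continuity lets the Stieltjes measure of a half-open interval be read off as an
  increment. Outside \<open>{0..<T}\<close> the function is locally constant to the right.\<close>

lemma energy_right_continuous: assumes X: "L2mart X" shows "continuous (at_right t) (energy X)"
  unfolding continuous_within
proof -
  have eq: "(energy X \<longlongrightarrow> energy X t) (at_right t)" if "b > t" "\<And>s. t < s \<Longrightarrow> s < b \<Longrightarrow> energy X s = energy X t" for b
  proof (rule tendsto_eventually)
    show "\<forall>\<^sub>F s in at_right t. energy X s = energy X t"
      unfolding eventually_at_right_field by (rule exI[of _ b]) (use that in auto)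
  qed
  consider "t < 0" | "t \<ge> T" | "0 \<le> t" "t < T" by linarith
  then show "(energy X \<longlongrightarrow> energy X t) (at_right t)"
  proof cases
    case 1
    have "max 0 (min T s) = 0" if "s < 0" for s using that T by (simp add: min_def)
    then show ?thesis by (intro eq[of 0]) (use 1 in \<open>auto simp: energy_def\<close>)
  next
    case 2
    have "max 0 (min T s) = T" if "s \<ge> T" for s using that T by (simp add: min_def)
    then show ?thesis by (intro eq[of "t + 1"]) (use 2 in \<open>auto simp: energy_def\<close>)
  next
    case 3
    have "\<forall>\<^sub>F s in at_right t. (\<integral>\<omega>. (X s \<omega>)^2 \<partial>M) = energy X s"
      unfolding eventually_at_right_field by (rule exI[of _ T]) (use 3 in \<open>auto simp: energy_def\<close>)
    moreover have "energy X t = (\<integral>\<omega>. (X t \<omega>)^2 \<partial>M)" using 3 by (simp add: energy_def)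
    ultimately show ?thesis using Lim_transform_eventually[OF L2mart_right_continuous[OF X 3]] by simp
  qed
qed

lemma energy_Ioc: "L2mart X \<Longrightarrow> s \<le> t \<Longrightarrow> emeasure (interval_measure (energy X)) {s<..t} = ennreal (energy X t - energy X s)"
  by (rule emeasure_interval_measure_Ioc) (auto intro: energy_mono energy_right_continuous)

lemma Lambda_energy:
  assumes ind: "indist \<Xi> X" and X: "L2b X"
  shows "Lambda M T \<Xi> = (\<integral>\<^sup>+t\<in>{0<..T}. inverse (ennreal (T - t)) \<partial>interval_measure (energy X))"
proof -
  have "(\<integral>\<omega>. (\<Xi> (max 0 (min T t)) \<omega>)^2 \<partial>M) = energy X t" for t
  proof -
    define s where "s = max 0 (min T t)"
    have s: "s \<in> {0..T}" by (auto simp: s_def)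
    have ae: "AE \<omega> in M. (X s \<omega>)^2 = (\<Xi> s \<omega>)^2"
      using indist_at[OF ind s] by eventually_elim simp
    have m: "(\<lambda>\<omega>. (X s \<omega>)^2) \<in> borel_measurable M" using L2b_int[OF X s] by simp
    have "(\<integral>\<omega>. (\<Xi> s \<omega>)^2 \<partial>M) = (\<integral>\<omega>. (X s \<omega>)^2 \<partial>M)"
      by (rule integral_cong_AE[OF measurable_AE_cong[OF m ae] m]) (use ae in \<open>auto elim: eventually_mono\<close>)
    then show ?thesis unfolding energy_def s_def .
  qed
  then show ?thesis unfolding Lambda_def by simp
qed

text \<open>The weight in \<open>Lambda\<close> is infinite at \<open>T\<close>, so a finite
  integral excludes an atom there, and the second moment is then left-continuous at
  \<open>T\<close>. This is why the recovery strategies can meet the terminal constraint.\<close>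

lemma energy_no_atom:
  assumes X: "L2mart X" and fin: "(\<integral>\<^sup>+t\<in>{0<..T}. inverse (ennreal (T - t)) \<partial>interval_measure (energy X)) < \<infinity>"
    and s: "s \<longlonglongrightarrow> T" "\<And>k. 0 \<le> s k" "\<And>k. s k \<le> T"
  shows "(\<lambda>k. energy X (s k)) \<longlonglongrightarrow> energy X T"
proof -
  let ?\<mu> = "interval_measure (energy X)"
  have zero: "emeasure ?\<mu> {T} = 0"
  proof (rule ccontr)
    assume nz: "emeasure ?\<mu> {T} \<noteq> 0"
    have "\<infinity> = \<infinity> * emeasure ?\<mu> {T}" using nz by (simp add: ennreal_top_mult)
    also have "\<dots> = (\<integral>\<^sup>+t. \<infinity> * indicator {T} t \<partial>?\<mu>)" by (subst nn_integral_cmult_indicator) auto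
    also have "\<dots> \<le> (\<integral>\<^sup>+t\<in>{0<..T}. inverse (ennreal (T - t)) \<partial>?\<mu>)"
      by (rule nn_integral_mono) (use T in \<open>auto split: split_indicator\<close>)
    finally show False using fin by simp
  qed
  show ?thesis
  proof (rule order_tendstoI)
    fix a assume "energy X T < a"
    then have "energy X (s k) < a" for k using energy_mono[OF X s(3)[of k]] by linarith
    then show "\<forall>\<^sub>F k in sequentially. energy X (s k) < a" by simp
  next
    fix a assume a: "a < energy X T"
    \<comment> \<open>The intervals from \<open>r n\<close> to \<open>T\<close> shrink to
      \<open>{T}\<close>, so their masses tend to that of the single point.\<close>
    define r where "r n = T - T / real (Suc n)" for n
    have rT: "r n < T" "0 \<le> r n" for n using T by (auto simp: r_def field_simps)
    have "(\<lambda>n. emeasure ?\<mu> {r n<..T}) \<longlonglongrightarrow> emeasure ?\<mu> (\<Inter>n. {r n<..T})"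
    proof (rule Lim_emeasure_decseq)
      show "decseq (\<lambda>n. {r n<..T})"
      proof (rule decseq_SucI)
        fix n
        have "T / real (Suc (Suc n)) \<le> T / real (Suc n)" using T by (intro divide_left_mono) auto
        then show "{r (Suc n)<..T} \<subseteq> {r n<..T}" by (auto simp: r_def)
      qed
      show "emeasure ?\<mu> {r n<..T} \<noteq> \<infinity>" for n
        using energy_Ioc[OF X, of "r n" T] rT[of n] by simp
    qed auto
    moreover have "(\<Inter>n. {r n<..T}) = {T}"
    proof
      show "(\<Inter>n. {r n<..T}) \<subseteq> {T}"
      proof
        fix x assume x: "x \<in> (\<Inter>n. {r n<..T})"
        show "x \<in> {T}"
        proof (rule ccontr)
          assume "x \<notin> {T}"
          then have "T - x > 0" using x by auto
          then have "(T - x) / T > 0" using T by simp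
          then obtain n where "inverse (real (Suc n)) < (T - x) / T" using reals_Archimedean by blast
          then have "T / real (Suc n) < T - x" using T by (simp add: field_simps)
          then have "x < r n" unfolding r_def by simp
          moreover have "r n < x" using x by auto
          ultimately show False by simp
        qed
      qed
    qed (use rT in auto)
    moreover have nn: "0 \<le> energy X T - energy X (r n)" for n
      using energy_mono[OF X, of "r n" T] rT[of n] by simp
    ultimately have "(\<lambda>n. ennreal (energy X T - energy X (r n))) \<longlonglongrightarrow> ennreal 0"
      using energy_Ioc[OF X] rT zero by (simp add: less_imp_le)
    then have "(\<lambda>n. energy X T - energy X (r n)) \<longlonglongrightarrow> 0"
      by (rule tendsto_ennrealD) (use nn in auto)
    then have "\<forall>\<^sub>F n in sequentially. energy X T - energy X (r n) < energy X T - a"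
      using a by (intro order_tendstoD(2)) auto
    then obtain n where n: "energy X T - energy X (r n) < energy X T - a"
      using eventually_happens' sequentially_bot by blast
    have "\<forall>\<^sub>F k in sequentially. r n < s k" using s(1) rT(1) by (rule order_tendstoD(1))
    then show "\<forall>\<^sub>F k in sequentially. a < energy X (s k)"
    proof eventually_elim
      case (elim k)
      then have "energy X (r n) \<le> energy X (s k)" by (intro energy_mono[OF X]) auto
      then show ?case using n by linarith
    qed
  qed
qed

end

section \<open>Translation and initial bounds for the explicit optimizer\<close>

context control
begin

text \<open>An increment of the optimizer splits into \<open>alp\<close> times a martingale
  increment, an increment of \<open>alp\<close> times the martingale, and an integral over the lag.
  The mean squares of the first two are dominated by increments of monotone functions, the second
  moment of the martingale and the variation of \<open>alp\<close>; the third is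
  \<open>O(h)\<close>. Integrated over time all three are \<open>O(h)\<close>, although jumps of
  \<open>alp\<close> may prevent any rate at single times.\<close>

lemma shift_sq_Qh_bound:
  assumes X: "L2mart X" obtains G where "\<And>h. h > 0 \<Longrightarrow> prim (shift_sq (Qh y X) h) T \<le> h * G"
proof -
  note b = L2mart_L2b[OF X]
  note Mm = L2mart_Mp[OF X, of y] and Mb = L2b_Mp[OF b, of y]
  define m where "m t = (\<integral>\<omega>. (Mp y X t \<omega>)^2 \<partial>M)" for t
  have mm: "m r \<le> m s" if "0 \<le> r" "r \<le> s" "s \<le> T" for r s unfolding m_def by (rule L2mart_mono[OF Mm that])
  have m0: "0 \<le> m t" for t unfolding m_def by simp
  obtain v where v: "variation_bound T (\<lambda>t. alp t) v" by (rule alp_variation)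
  obtain A where A: "A \<ge> 0" "\<And>t. t \<in> {0..T} \<Longrightarrow> \<bar>alp t\<bar> \<le> A" using cadlag_bounded[OF cadlag_alp] by blast
  have vm: "v r \<le> v s" if "0 \<le> r" "r \<le> s" "s \<le> T" for r s using variation_boundD[OF v that] by linarith
  define P where "P t \<omega> = prim (\<lambda>s. thd s * Mp y X s \<omega>) t" for t \<omega>
  have Pb: "L2b P" unfolding P_def[abs_def] by (rule L2b_prim[OF Mb bdm_thd])
  define R where "R = (\<integral>\<omega>. prim (\<lambda>s. (thd s)^2 * (Mp y X s \<omega> * Mp y X s \<omega>)) T \<partial>M)"
  note jR = L2b_joint(1)[OF Mb Mb bdm_power2[OF bdm_thd]]
  \<comment> \<open>The bound for the square of a sum is used twice, so the first summand gets a
    factor \<open>2\<close> and the others a factor \<open>4\<close>; \<open>8 * A * m T\<close> is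
    \<open>4\<close> times the constant \<open>2 * A * m T\<close> found for the second.\<close>
  define g where "g t = 2 * A^2 * m t + 8 * A * m T * v t" for t
  have gm: "g r \<le> g s" if "0 \<le> r" "r \<le> s" "s \<le> T" for r s
    unfolding g_def using mm[OF that] vm[OF that] A(1) m0 by (intro add_mono mult_left_mono) auto
  have Q: "L2b (Qh y X)" by (rule L2b_Qh[OF b])
  \<comment> \<open>The endpoint \<open>t = T\<close> is left out because of the terminal block
    trade; a single time does not affect the integral.\<close>
  have main: "shift_sq (Qh y X) h t \<le> (g t - g (max (t - h) 0)) + 4 * h * R" if h: "h > 0" and t: "0 < t" "t < T" for h t
  proof -
    define s where "s = max (t - h) 0"
    have s: "0 \<le> s" "s \<le> t" "t - s \<le> h" "s < T" "s \<in> {0..T}" "t \<in> {0..T}" using h t by (auto simp: s_def)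
    let ?U = "\<lambda>\<omega>. alp t * (Mp y X t \<omega> - Mp y X s \<omega>)"
    let ?V = "\<lambda>\<omega>. (alp t - alp s) * Mp y X s \<omega>"
    let ?W = "\<lambda>\<omega>. P t \<omega> - P s \<omega>"
    have Mt: "Mp y X t \<in> borel_measurable M" and Ms: "Mp y X s \<in> borel_measurable M"
      and Pt: "P t \<in> borel_measurable M" and Ps: "P s \<in> borel_measurable M"
      using L2b_meas[OF Mb] L2b_meas[OF Pb] s by auto
    have dec: "Qh y X t \<omega> - Qh y X s \<omega> = ?U \<omega> + (?V \<omega> + ?W \<omega>)" for \<omega>
      using t s(4) by (simp add: Qh_def P_def algebra_simps)
    have inc: "integrable M (\<lambda>\<omega>. (Mp y X t \<omega> - Mp y X s \<omega>)^2)" "(\<integral>\<omega>. (Mp y X t \<omega> - Mp y X s \<omega>)^2 \<partial>M) = m t - m s"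
      unfolding m_def using L2mart_increment[OF Mm s(1,2)] t by auto
    have iU: "integrable M (\<lambda>\<omega>. (?U \<omega>)^2)" and iV: "integrable M (\<lambda>\<omega>. (?V \<omega>)^2)"
      unfolding power_mult_distrib using inc(1) L2b_int[OF Mb s(5)] by auto
    have iW: "integrable M (\<lambda>\<omega>. (?W \<omega>)^2)"
      using expectation_square_add_le(1)[of "P t" "\<lambda>\<omega>. - P s \<omega>"] Pt Ps L2b_int[OF Pb s(6)] L2b_int[OF Pb s(5)] by simp
    have mU: "?U \<in> borel_measurable M" and mV: "?V \<in> borel_measurable M" and mW: "?W \<in> borel_measurable M"
      using Mt Ms Pt Ps by auto
    have EU: "(\<integral>\<omega>. (?U \<omega>)^2 \<partial>M) \<le> A^2 * (m t - m s)"
    proof -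
      have "(\<integral>\<omega>. (?U \<omega>)^2 \<partial>M) = (alp t)^2 * (m t - m s)" unfolding power_mult_distrib using inc(2) by simp
      also have "\<dots> \<le> A^2 * (m t - m s)"
        using A s mm[of s t] t power2_le_iff_abs_le[of A "alp t"] by (intro mult_right_mono) auto
      finally show ?thesis .
    qed
    \<comment> \<open>One factor of the squared increment is bounded by \<open>2 * A\<close>, so
      that the other appears to the first power and is dominated by the variation.\<close>
    have EV: "(\<integral>\<omega>. (?V \<omega>)^2 \<partial>M) \<le> 2 * A * m T * (v t - v s)"
    proof -
      have d: "\<bar>alp t - alp s\<bar> \<le> v t - v s" using variation_boundD[OF v s(1,2)] t by auto
      have d2: "\<bar>alp t - alp s\<bar> \<le> 2 * A" using A(2)[OF s(5)] A(2)[OF s(6)] by linarith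
      have "(alp t - alp s)^2 = \<bar>alp t - alp s\<bar> * \<bar>alp t - alp s\<bar>" by (simp add: power2_eq_square abs_mult_self_eq)
      also have "\<dots> \<le> (2 * A) * (v t - v s)" using d d2 A(1) by (intro mult_mono) auto
      finally have q: "(alp t - alp s)^2 \<le> 2 * A * (v t - v s)" .
      have "(\<integral>\<omega>. (?V \<omega>)^2 \<partial>M) = (alp t - alp s)^2 * m s" unfolding power_mult_distrib m_def by simp
      also have "\<dots> \<le> (2 * A * (v t - v s)) * m T"
        using q mm[of s T] s m0[of s] A(1) vm[of s t] t by (intro mult_mono) auto
      finally show ?thesis by (simp add: mult_ac)
    qed
    have EW: "(\<integral>\<omega>. (?W \<omega>)^2 \<partial>M) \<le> h * R"
    proof -
      have "(\<integral>\<omega>. (?W \<omega>)^2 \<partial>M) \<le> (\<integral>\<omega>. h * prim (\<lambda>s. (thd s)^2 * (Mp y X s \<omega> * Mp y X s \<omega>)) T \<partial>M)"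
      proof (rule integral_mono[OF iW])
        show "integrable M (\<lambda>\<omega>. h * prim (\<lambda>s. (thd s)^2 * (Mp y X s \<omega> * Mp y X s \<omega>)) T)" using jR by simp
        fix \<omega> assume w: "\<omega> \<in> space M"
        let ?f = "\<lambda>s. thd s * Mp y X s \<omega>"
        have bf: "bdm T ?f" by (rule bdm_mult[OF bdm_thd L2b_bdm[OF Mb w]])
        have "?W \<omega> = (LINT r:{s..t}|lborel. ?f r)" unfolding P_def by (rule prim_diff[OF bf]) (use s t in auto)
        then have "(?W \<omega>)^2 \<le> (t - s) * (LINT r:{s..t}|lborel. (?f r)^2)"
          using set_integral_cauchy_schwarz[OF bf s(1,2)] t by simp
        also have "\<dots> \<le> h * prim (\<lambda>r. (?f r)^2) T"
        proof (rule mult_mono)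
          have "(LINT r:{s..t}|lborel. (?f r)^2) = prim (\<lambda>r. (?f r)^2) t - prim (\<lambda>r. (?f r)^2) s"
            by (rule prim_diff[OF bdm_power2[OF bf], symmetric]) (use s t in auto)
          also have "\<dots> \<le> prim (\<lambda>r. (?f r)^2) t" using prim_nonneg[of s "\<lambda>r. (?f r)^2"] by simp
          also have "\<dots> \<le> prim (\<lambda>r. (?f r)^2) T" by (rule prim_mono_endpoint[OF bdm_power2[OF bf] s(6)]) simp
          finally show "(LINT r:{s..t}|lborel. (?f r)^2) \<le> prim (\<lambda>r. (?f r)^2) T" .
          show "0 \<le> (LINT r:{s..t}|lborel. (?f r)^2)"
            unfolding set_lebesgue_integral_def by (rule Bochner_Integration.integral_nonneg) simp
        qed (use s h in auto)
        also have "prim (\<lambda>r. (?f r)^2) T = prim (\<lambda>s. (thd s)^2 * (Mp y X s \<omega> * Mp y X s \<omega>)) T"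
          by (rule prim_cong) (simp add: power2_eq_square mult_ac)
        finally show "(?W \<omega>)^2 \<le> h * prim (\<lambda>s. (thd s)^2 * (Mp y X s \<omega> * Mp y X s \<omega>)) T" .
      qed
      then show ?thesis unfolding R_def by simp
    qed
    have "shift_sq (Qh y X) h t = (\<integral>\<omega>. (?U \<omega> + (?V \<omega> + ?W \<omega>))^2 \<partial>M)"
      unfolding shift_sq_def s_def[symmetric] dec ..
    also have "\<dots> \<le> 2 * (\<integral>\<omega>. (?U \<omega>)^2 \<partial>M) + 2 * (\<integral>\<omega>. (?V \<omega> + ?W \<omega>)^2 \<partial>M)" (is "_ \<le> ?rhs")
      by (rule expectation_square_add_le(2)[OF mU borel_measurable_add[OF mV mW] iU expectation_square_add_le(1)[OF mV mW iV iW]])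
    finally have "shift_sq (Qh y X) h t \<le> ?rhs" .
    moreover have "(\<integral>\<omega>. (?V \<omega> + ?W \<omega>)^2 \<partial>M) \<le> 2 * (\<integral>\<omega>. (?V \<omega>)^2 \<partial>M) + 2 * (\<integral>\<omega>. (?W \<omega>)^2 \<partial>M)"
      by (rule expectation_square_add_le(2)[OF mV mW iV iW])
    ultimately have "shift_sq (Qh y X) h t \<le> 2 * (A^2 * (m t - m s)) + 4 * (2 * A * m T * (v t - v s)) + 4 * (h * R)"
      using EU EV EW by linarith
    also have "\<dots> = (g t - g s) + 4 * h * R" unfolding g_def by (simp add: algebra_simps)
    finally show ?thesis unfolding s_def .
  qed
  have "prim (shift_sq (Qh y X) h) T \<le> h * (g T - g 0 + 4 * R * T)" if h: "h > 0" for h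
  proof -
    have bg: "bdm T g" by (rule mono_bdm[OF gm T_nonneg])
    have bgd: "bdm T (\<lambda>t. g t - g (max (t - h) 0))" by (rule bdm_diff[OF bg bdm_shift[OF bg h]])
    have "prim (shift_sq (Qh y X) h) T \<le> prim (\<lambda>t. (g t - g (max (t - h) 0)) + 4 * h * R) T"
      by (rule prim_mono_AE[OF bdm_shift_sq[OF Q h] bdm_add[OF bgd bdm_const] T_T]) (use main[OF h] in auto)
    also have "\<dots> = prim (\<lambda>t. g t - g (max (t - h) 0)) T + 4 * h * R * T"
      using prim_add[OF bgd bdm_const T_T, of "4 * h * R"] by (simp add: prim_const)
    also have "prim (\<lambda>t. g t - g (max (t - h) 0)) T \<le> h * (g T - g 0)"
      by (rule mono_shift_integral[OF gm T_nonneg h])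
    finally show ?thesis by (simp add: algebra_simps)
  qed
  then show ?thesis by (rule that)
qed

text \<open>The initial trade is \<open>alp 0 * Mp y X 0 - y / lam 0\<close>. The essential bound on
  \<open>alp\<close> is valid at the point \<open>0\<close> by right-continuity, and the second
  moment of a martingale is largest at \<open>T\<close>.\<close>

lemma Qh_initial_bound:
  assumes X: "L2mart X" and ind: "indist \<Xi> X" and ca: "cadlag_adapted M F T \<Xi>"
  shows "(\<integral>\<omega>. (Qh y X 0 \<omega>)^2 \<partial>M) \<le> C_zero M F T \<beta> lam dlam y \<Xi>"
proof -
  note b = L2mart_L2b[OF X]
  note Mm = L2mart_Mp[OF X, of y] and Mb = L2b_Mp[OF b, of y]
  let ?L = "Linf T (\<lambda>t. alp t)"
  define m where "m t = (\<integral>\<omega>. (Mp y X t \<omega>)^2 \<partial>M)" for t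
  have mT: "(\<integral>\<omega>. (M_process M F T \<beta> lam dlam y \<Xi> T \<omega>)^2 \<partial>M) = m T"
  proof -
    have ae: "AE \<omega> in M. (Mp y X T \<omega>)^2 = (M_process M F T \<beta> lam dlam y \<Xi> T \<omega>)^2"
      using indist_at[OF M_process_indist[OF ind ca, of y] T_T] by eventually_elim simp
    have mm: "(\<lambda>\<omega>. (Mp y X T \<omega>)^2) \<in> borel_measurable M" using L2b_int[OF Mb T_T] by simp
    show ?thesis unfolding m_def
      by (rule integral_cong_AE[OF measurable_AE_cong[OF mm ae] mm]) (use ae in \<open>auto elim: eventually_mono\<close>)
  qed
  have a0: "\<bar>alp 0\<bar> \<le> ?L"
    by (rule Linf_AE(3)[OF cadlag_bdm[OF cadlag_alp T_nonneg] T]) (use cadlag_alp T in \<open>auto simp: cadlag_on_def\<close>)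
  have "(\<integral>\<omega>. (Qh y X 0 \<omega>)^2 \<partial>M) = (\<integral>\<omega>. (alp 0 * Mp y X 0 \<omega> + (- y / lam 0))^2 \<partial>M)"
    using T by (simp add: Qh_def)
  also have "\<dots> \<le> 2 * (\<integral>\<omega>. (alp 0 * Mp y X 0 \<omega>)^2 \<partial>M) + 2 * (\<integral>\<omega>. (- y / lam 0)^2 \<partial>M)"
  proof (rule expectation_square_add_le(2))
    show "(\<lambda>\<omega>. alp 0 * Mp y X 0 \<omega>) \<in> borel_measurable M"
      using L2b_meas[OF Mb zero_T] by simp
    show "integrable M (\<lambda>\<omega>. (alp 0 * Mp y X 0 \<omega>)^2)"
      unfolding power_mult_distrib using L2b_int[OF Mb zero_T] by (rule integrable_mult_right)
  qed auto
  also have "(\<integral>\<omega>. (alp 0 * Mp y X 0 \<omega>)^2 \<partial>M) = (alp 0)^2 * m 0" unfolding power_mult_distrib m_def by simp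
  also have "(alp 0)^2 * m 0 \<le> ?L^2 * m T"
  proof (rule mult_mono)
    show "(alp 0)^2 \<le> ?L^2"
      by (rule power2_le_iff_abs_le[THEN iffD2, OF order_trans[OF abs_ge_zero a0] a0])
    show "m 0 \<le> m T" unfolding m_def by (rule L2mart_mono[OF Mm]) auto
  qed (auto simp: m_def)
  also have "(\<integral>\<omega>. (- y / lam 0)^2 \<partial>M) = y^2 / (lam 0)^2" by (simp add: prob_space power_divide)
  finally show ?thesis unfolding C_zero_def mT by (simp add: mult.assoc)
qed

end

section \<open>Recovery strategies\<close>

lemma set_integral_reflect:
  fixes f :: "real \<Rightarrow> real"
  shows "(LINT r:{a..b}|lborel. f (t - r)) = (LINT s:{t - b..t - a}|lborel. f s)"
proof -
  have "(LINT s|lborel. indicator {t - b..t - a} s *\<^sub>R f s) = \<bar>-1\<bar> *\<^sub>R (LINT s|lborel. indicator {t - b..t - a} (t + -1 * s) *\<^sub>R f (t + -1 * s))"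
    by (rule lborel_integral_real_affine) simp
  also have "\<dots> = (LINT s|lborel. indicator {a..b} s *\<^sub>R f (t - s))"
    by (simp, rule Bochner_Integration.integral_cong) (auto split: split_indicator)
  finally show ?thesis unfolding set_lebesgue_integral_def by simp
qed

lemma bdm_reflect:
  assumes f: "bdm T f" and t: "t \<in> {0..T}" shows "bdm T (\<lambda>r. f (max (t - r) 0))"
proof -
  obtain B where B: "\<And>t. t \<in> {0..T} \<Longrightarrow> \<bar>f t\<bar> \<le> B" using bdm_bound[OF f] by blast
  have "(\<lambda>r. max (t - r) 0) \<in> measurable (restrict_space borel {0..T}) (restrict_space borel {0..T})"
    by (rule measurable_restrict_space2) (use t in \<open>auto simp: space_restrict_space intro!: measurable_restrict_space1\<close>)
  from measurable_compose[OF this bdm_meas[OF f]] show ?thesis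
    by (rule bdmI[of _ _ B]) (use B t in auto)
qed

lemma prim_reflect_eq:
  assumes f: "bdm T f" and t: "t \<in> {0..T}" and h: "0 < h" "h \<le> T"
  shows "prim (\<lambda>r. f (max (t - r) 0)) h = prim f t - prim f (max (t - h) 0) + max (h - t) 0 * f 0"
proof (cases "h \<le> t")
  case True
  have "prim (\<lambda>r. f (max (t - r) 0)) h = (LINT r:{0..h}|lborel. f (t - r))"
    by (rule set_lebesgue_integral_cong) (use True in auto)
  also have "\<dots> = (LINT s:{t - h..t}|lborel. f s)" unfolding set_integral_reflect by simp
  also have "\<dots> = prim f t - prim f (t - h)" by (rule prim_diff[OF f, symmetric]) (use True t h in auto)
  finally show ?thesis using True by simp
next
  case False
  have "prim (\<lambda>r. f (max (t - r) 0)) h = prim (\<lambda>r. f (max (t - r) 0)) t + (LINT r:{t..h}|lborel. f (max (t - r) 0))"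
    by (rule set_integral_Icc_split[OF _ _ bdm_set_integrable[OF bdm_reflect[OF f t]]]) (use False t h in auto)
  also have "prim (\<lambda>r. f (max (t - r) 0)) t = (LINT r:{0..t}|lborel. f (t - r))"
    by (rule set_lebesgue_integral_cong) auto
  also have "\<dots> = prim f t" unfolding set_integral_reflect by simp
  also have "(LINT r:{t..h}|lborel. f (max (t - r) 0)) = (LINT r:{t..h}|lborel. f 0)"
    by (rule set_lebesgue_integral_cong) auto
  also have "\<dots> = (h - t) * f 0" using False by (simp add: set_lebesgue_integral_def)
  finally show ?thesis using False by simp
qed

section \<open>Construction and energy of the recovery strategy\<close>

context filtered_horizon
begin

abbreviation rate_energy :: "(real \<Rightarrow> 'a \<Rightarrow> real) \<Rightarrow> ennreal" where
  "rate_energy u \<equiv> (\<integral>\<^sup>+\<omega>. (\<integral>\<^sup>+t\<in>{0..T}. ennreal ((u t \<omega>)^2) \<partial>lborel) \<partial>M)"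

abbreviation Lam :: "(real \<Rightarrow> 'a \<Rightarrow> real) \<Rightarrow> ennreal" where
  "Lam X \<equiv> (\<integral>\<^sup>+t\<in>{0<..T}. inverse (ennreal (T - t)) \<partial>interval_measure (energy X))"

lemma nn_prim_eq:
  assumes f: "bdm T f" and nn: "\<And>t. t \<in> {0..T} \<Longrightarrow> 0 \<le> f t"
  shows "(\<integral>\<^sup>+t. ennreal (f t) \<partial>LT) = ennreal (prim f T)"
  unfolding integral_LT[symmetric]
  by (rule nn_integral_eq_integral[OF integrable_LT_bdm[OF f]]) (use nn in \<open>auto intro!: AE_I2 simp: space_LT\<close>)

lemma joint_reflect:
  assumes X: "nice X" and t: "t \<in> {0..T}"
  shows "(\<lambda>(r, \<omega>). X (max (t - r) 0) \<omega>) \<in> borel_measurable (LT \<Otimes>\<^sub>M M)"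
proof -
  have m: "(\<lambda>p. max (t - fst p) 0) \<in> borel_measurable (LT \<Otimes>\<^sub>M M)"
    using measurable_compose[OF measurable_fst bdm_LT[OF bdm_id]] by measurable
  have "(\<lambda>p. (max (t - fst p) 0, snd p)) \<in> measurable (LT \<Otimes>\<^sub>M M) (LT \<Otimes>\<^sub>M M)"
  proof (rule measurable_Pair)
    show "(\<lambda>p. max (t - fst p) 0) \<in> measurable (LT \<Otimes>\<^sub>M M) LT"
      by (rule measurable_restrict_space2) (use m t in \<open>auto simp: space_pair_measure space_LT\<close>)
  qed simp
  from measurable_compose[OF this nice_joint[OF X]] show ?thesis by (simp add: split_def)
qed

text \<open>Joint measurability in time and lag, so that the two integrations can be interchanged
  when displacements are averaged over the lag.\<close>

lemma shift_sq_joint: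
  assumes X: "nice X"
  shows "(\<lambda>(t, r). shift_sq X r t) \<in> borel_measurable (LT \<Otimes>\<^sub>M LT)"
proof -
  let ?N = "(LT \<Otimes>\<^sub>M LT) \<Otimes>\<^sub>M M"
  have f1: "(\<lambda>p. fst (fst p)) \<in> measurable ?N LT" "(\<lambda>p. snd (fst p)) \<in> measurable ?N LT" by measurable
  have m1: "(\<lambda>p. (fst (fst p), snd p)) \<in> measurable ?N (LT \<Otimes>\<^sub>M M)" by (intro measurable_Pair f1) measurable
  have b: "(\<lambda>p. fst (fst p)) \<in> borel_measurable ?N" "(\<lambda>p. snd (fst p)) \<in> borel_measurable ?N"
    using measurable_compose[OF f1(1) bdm_LT[OF bdm_id]] measurable_compose[OF f1(2) bdm_LT[OF bdm_id]] by auto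
  have b2: "(\<lambda>p. max (fst (fst p) - snd (fst p)) 0) \<in> borel_measurable ?N" using b by measurable
  have m2: "(\<lambda>p. (max (fst (fst p) - snd (fst p)) 0, snd p)) \<in> measurable ?N (LT \<Otimes>\<^sub>M M)"
  proof (rule measurable_Pair)
    show "(\<lambda>p. max (fst (fst p) - snd (fst p)) 0) \<in> measurable ?N LT"
      by (rule measurable_restrict_space2) (use b2 in \<open>auto simp: space_pair_measure space_LT\<close>)
  qed measurable
  have "(\<lambda>p. (X (fst (fst p)) (snd p) - X (max (fst (fst p) - snd (fst p)) 0) (snd p))^2) \<in> borel_measurable ?N"
    using measurable_compose[OF m1 nice_joint[OF X]] measurable_compose[OF m2 nice_joint[OF X]]
    by (auto simp: split_def)
  then have "(\<lambda>(q, \<omega>). (X (fst q) \<omega> - X (max (fst q - snd q) 0) \<omega>)^2) \<in> borel_measurable ?N" by (simp add: split_def)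
  from borel_measurable_lebesgue_integral[OF this] show ?thesis
    unfolding shift_sq_def by (simp add: split_def)
qed

end

text \<open>The bounds \<open>G\<close>, \<open>c0\<close> and \<open>K\<close> are parameters
  because the construction is used twice: with any finite bounds, to identify the minimizer, and
  with the explicit constants, for the rate. The condition \<open>h \<le> T / 2\<close> keeps the
  averaging window that ends at \<open>T - h\<close> inside the horizon.\<close>

locale recovery = filtered_horizon M F T
  for M :: "'a measure" and F and T +
  fixes Q X :: "real \<Rightarrow> 'a \<Rightarrow> real" and h :: real and \<Xi>T :: "'a \<Rightarrow> real" and G c0 K :: real
  assumes Q: "L2b Q" and X: "L2mart X" and QX: "AE \<omega> in M. X T \<omega> = \<Xi>T \<omega>"
    and h0: "0 < h" and h2: "h \<le> T / 2"
    and fin: "Lam X < \<infinity>"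
    and G: "\<And>r. r > 0 \<Longrightarrow> prim (shift_sq Q r) T \<le> r * G"
    and c0: "(\<integral>\<omega>. (Q 0 \<omega>)^2 \<partial>M) \<le> c0"
    and K: "\<And>t. 0 \<le> t \<Longrightarrow> t < T \<Longrightarrow> (\<integral>\<omega>. (Q t \<omega> - X t \<omega>)^2 \<partial>M) \<le> K"
begin

abbreviation "eXT \<equiv> energy X T"

definition "a = T - h"
text \<open>The remaining time halves at each node, so the piece that starts at \<open>tk k\<close>
  has a length \<open>len k\<close> equal to the time left after it. Durations and remaining times
  are thus comparable, as the weight in \<open>Lambda\<close> requires.\<close>

definition "tk k = T - h / 2^k" for k :: nat
definition "len k = h / 2^(Suc k)" for k :: nat

lemma a: "h \<le> a" "0 < a" "a < T" "a \<in> {0..T}" "0 \<le> a - h"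
  using h0 h2 T unfolding a_def by auto

lemma Xb: "L2b X"
  by (rule L2mart_L2b[OF X])

lemma tk_0: "tk 0 = a"
  by (simp add: tk_def a_def)

lemma len_pos: "0 < len k"
  using h0 by (simp add: len_def)

lemma tk_Suc: "tk (Suc k) = tk k + len k"
  by (simp add: tk_def len_def field_simps)

lemma tk_less: "tk k < tk (Suc k)"
  using tk_Suc[of k] len_pos[of k] by simp

lemma tk_mono: "i \<le> j \<Longrightarrow> tk i \<le> tk j"
  by (rule lift_Suc_mono_le[of tk]) (use tk_less in \<open>auto intro: less_imp_le\<close>)

lemma tk_range: "a \<le> tk k" "tk k < T" "tk k \<in> {0..T}" "0 \<le> tk k"
proof -
  show 1: "a \<le> tk k" using tk_mono[of 0 k] tk_0 by simp
  show 2: "tk k < T" unfolding tk_def using h0 by simp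
  show "0 \<le> tk k" using 1 a by linarith
  then show "tk k \<in> {0..T}" using 2 by simp
qed

lemma tk_lim: "tk \<longlonglongrightarrow> T"
proof -
  have "(\<lambda>k. h * (1 / 2)^k) \<longlonglongrightarrow> h * 0"
    by (intro tendsto_mult tendsto_const LIMSEQ_power_zero) simp
  then have "(\<lambda>k. T - h * (1 / 2)^k) \<longlonglongrightarrow> T - 0" by (intro tendsto_diff tendsto_const) simp
  then show ?thesis unfolding tk_def[abs_def] by (simp add: power_divide)
qed

definition "idx t = (LEAST k. t < tk (Suc k))"

lemma idx_bounds: assumes "a \<le> t" "t < T" shows "tk (idx t) \<le> t" "t < tk (Suc (idx t))"
proof -
  have "\<forall>\<^sub>F k in sequentially. t < tk k" using tk_lim assms(2) by (rule order_tendstoD(1))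
  then obtain k where "t < tk k" using eventually_happens' sequentially_bot by blast
  then have "t < tk (Suc k)" using tk_less[of k] by linarith
  then show "t < tk (Suc (idx t))" unfolding idx_def by (rule LeastI)
  show "tk (idx t) \<le> t"
  proof (cases "idx t")
    case 0 then show ?thesis using tk_0 assms by simp
  next
    case (Suc j)
    then have "\<not> t < tk (Suc j)" using not_less_Least[of j "\<lambda>k. t < tk (Suc k)"] unfolding idx_def by simp
    then show ?thesis using Suc by simp
  qed
qed

lemma idx_eq: assumes "tk k \<le> t" "t < tk (Suc k)" shows "idx t = k"
  unfolding idx_def
proof (rule Least_equality)
  fix j assume "t < tk (Suc j)"
  show "k \<le> j"
  proof (rule ccontr)
    assume "\<not> k \<le> j"
    then have "tk (Suc j) \<le> tk k" by (intro tk_mono) simp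
    then show False using \<open>t < tk (Suc j)\<close> assms by linarith
  qed
qed (rule assms)

text \<open>Positions at the nodes: the moving average at \<open>tk 0\<close>, and at each later
  node the target as it stood one node earlier. Because of this delay the position aimed at for
  \<open>tk (Suc k)\<close> is known at \<open>tk k\<close>, when the slope towards it must be
  chosen.\<close>

definition bb :: "nat \<Rightarrow> 'a \<Rightarrow> real" where
  "bb k \<omega> = (case k of 0 \<Rightarrow> (prim (\<lambda>s. Q s \<omega>) a - prim (\<lambda>s. Q s \<omega>) (a - h)) / h | Suc j \<Rightarrow> X (tk j) \<omega>)"

lemma bb_0: "bb 0 \<omega> = (prim (\<lambda>s. Q s \<omega>) a - prim (\<lambda>s. Q s \<omega>) (a - h)) / h"
  and bb_Suc: "bb (Suc k) \<omega> = X (tk k) \<omega>"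
  by (simp_all add: bb_def)

lemma nice_primQ: "nice (\<lambda>t \<omega>. prim (\<lambda>s. Q s \<omega>) t)"
  using nice_prim[OF L2b_nice[OF Q] bdm_const[of T 1]] by simp

lemma L2b_primQ: "L2b (\<lambda>t \<omega>. prim (\<lambda>s. Q s \<omega>) t)"
  using L2b_prim[OF Q bdm_const[of T 1]] by simp

lemma bb_adapted: "bb (Suc k) \<in> borel_measurable (F (tk k))" "bb k \<in> borel_measurable (F (tk k))"
proof -
  show "bb (Suc k) \<in> borel_measurable (F (tk k))"
    unfolding bb_Suc[abs_def] using L2b_adapted[OF Xb tk_range(3)] by simp
  show "bb k \<in> borel_measurable (F (tk k))"
  proof (cases k)
    case 0
    have 1: "(\<lambda>\<omega>. prim (\<lambda>s. Q s \<omega>) a) \<in> borel_measurable (F a)" by (rule nice_adapted[OF nice_primQ a(4)])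
    have ah: "a - h \<in> {0..T}" using a h0 by auto
    have 2: "(\<lambda>\<omega>. prim (\<lambda>s. Q s \<omega>) (a - h)) \<in> borel_measurable (F a)"
      by (rule measurable_F_mono[OF nice_adapted[OF nice_primQ ah] ah a(4)]) (use h0 in simp)
    show ?thesis unfolding 0 tk_0 bb_0[abs_def] using 1 2 by simp
  next
    case (Suc j)
    have "X (tk j) \<in> borel_measurable (F (tk (Suc j)))"
      by (rule measurable_F_mono[OF L2b_adapted[OF Xb tk_range(3)] tk_range(3) tk_range(3)]) (use tk_less[of j] in simp)
    then show ?thesis unfolding Suc bb_Suc[abs_def] by simp
  qed
qed

lemma bb_meas: "bb k \<in> borel_measurable M"
  by (rule measurable_F_M[OF bb_adapted(2) tk_range(3)])

lemma bb_L2: "integrable M (\<lambda>\<omega>. (bb k \<omega>)^2)"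
proof (cases k)
  case 0
  have ah: "a - h \<in> {0..T}" using a h0 by auto
  have "integrable M (\<lambda>\<omega>. (prim (\<lambda>s. Q s \<omega>) a + - prim (\<lambda>s. Q s \<omega>) (a - h))^2)"
    using expectation_square_add_le(1)[of "\<lambda>\<omega>. prim (\<lambda>s. Q s \<omega>) a" "\<lambda>\<omega>. - prim (\<lambda>s. Q s \<omega>) (a - h)"]
      nice_meas[OF nice_primQ a(4)] nice_meas[OF nice_primQ ah] L2b_int[OF L2b_primQ a(4)] L2b_int[OF L2b_primQ ah] by simp
  then show ?thesis unfolding 0 bb_0 power_divide by simp
next
  case (Suc j)
  then show ?thesis unfolding Suc bb_Suc using L2b_int[OF Xb tk_range(3)] by simp
qed

text \<open>Before time \<open>a = T - h\<close> the rate of the moving average of \<open>Q\<close> over windows of length \<open>h\<close>;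
  afterwards that of the linear interpolation of \<open>X\<close> along the times \<open>tk k\<close> increasing to \<open>T\<close>,
  with a lag of one step to keep it adapted.\<close>

definition u :: "real \<Rightarrow> 'a \<Rightarrow> real" where
  "u t \<omega> = (if t < a then (Q t \<omega> - (if h \<le> t then Q (t - h) \<omega> else 0)) / h
    else if t < T then (bb (Suc (idx t)) \<omega> - bb (idx t) \<omega>) / len (idx t) else 0)"

lemma u_piece: "tk k \<le> t \<Longrightarrow> t < tk (Suc k) \<Longrightarrow> u t \<omega> = (bb (Suc k) \<omega> - bb k \<omega>) / len k"
  using idx_eq[of k t] tk_range(1)[of k] tk_range(2)[of "Suc k"] unfolding u_def by simp

lemma u_adapted: assumes t: "t \<in> {0..T}" shows "u t \<in> borel_measurable (F t)"
proof -
  consider "t < a" "h \<le> t" | "t < a" "t < h" | "a \<le> t" "t < T" | "t = T" using t by fastforce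
  then show ?thesis
  proof cases
    case 1
    have th: "t - h \<in> {0..T}" using 1 t h0 by auto
    have "Q (t - h) \<in> borel_measurable (F t)"
      by (rule measurable_F_mono[OF L2b_adapted[OF Q th] th t]) (use h0 in simp)
    then show ?thesis using L2b_adapted[OF Q t] 1 unfolding u_def[abs_def] by simp
  next
    case 2
    then show ?thesis using L2b_adapted[OF Q t] unfolding u_def[abs_def] by simp
  next
    case 3
    have "bb (Suc (idx t)) \<in> borel_measurable (F t)" "bb (idx t) \<in> borel_measurable (F t)"
      by (rule measurable_F_mono[OF bb_adapted(1) tk_range(3) t idx_bounds(1)[OF 3]],
          rule measurable_F_mono[OF bb_adapted(2) tk_range(3) t idx_bounds(1)[OF 3]])
    then show ?thesis using 3 unfolding u_def[abs_def] by simp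
  next
    case 4
    then show ?thesis using a unfolding u_def[abs_def] by simp
  qed
qed

text \<open>Together with adaptedness this gives progressive measurability of the rate.\<close>

lemma u_right_continuous:
  assumes w: "\<omega> \<in> space M" and t: "t \<in> {0..<T}"
  shows "((\<lambda>s. u s \<omega>) \<longlongrightarrow> u t \<omega>) (at_right t)"
proof -
  have rc: "((\<lambda>s. Q s \<omega>) \<longlongrightarrow> Q r \<omega>) (at_right r)" if "r \<in> {0..<T}" for r
    using L2b_cadlag[OF Q w] that unfolding cadlag_on_def by blast
  consider "t < a" "h \<le> t" | "t < a" "t < h" | "a \<le> t" using t by fastforce
  then show ?thesis
  proof cases
    case 1
    have sh: "filterlim (\<lambda>s. s - h) (at_right (t - h)) (at_right t)"
    proof (rule tendsto_imp_filterlim_at_right)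
      show "((\<lambda>s. s - h) \<longlongrightarrow> t - h) (at_right t)" by (intro tendsto_intros)
      show "\<forall>\<^sub>F s in at_right t. t - h < s - h" using eventually_at_right_less[of t] by eventually_elim simp
    qed
    have "((\<lambda>s. Q (s - h) \<omega>) \<longlongrightarrow> Q (t - h) \<omega>) (at_right t)"
      by (rule filterlim_compose[OF rc sh]) (use 1 t h0 in auto)
    then have "((\<lambda>s. (Q s \<omega> - Q (s - h) \<omega>) / h) \<longlongrightarrow> (Q t \<omega> - Q (t - h) \<omega>) / h) (at_right t)"
      using rc[OF t] h0 by (intro tendsto_divide tendsto_diff tendsto_const) auto
    moreover have "\<forall>\<^sub>F s in at_right t. (Q s \<omega> - Q (s - h) \<omega>) / h = u s \<omega>"
      unfolding eventually_at_right_field by (rule exI[of _ a]) (use 1 in \<open>auto simp: u_def\<close>)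
    ultimately show ?thesis using Lim_transform_eventually 1 by (fastforce simp: u_def)
  next
    case 2
    have "((\<lambda>s. Q s \<omega> / h) \<longlongrightarrow> Q t \<omega> / h) (at_right t)"
      using rc[OF t] h0 by (intro tendsto_divide tendsto_const) auto
    moreover have "\<forall>\<^sub>F s in at_right t. Q s \<omega> / h = u s \<omega>"
      unfolding eventually_at_right_field by (rule exI[of _ h]) (use 2 a in \<open>auto simp: u_def\<close>)
    ultimately show ?thesis using Lim_transform_eventually 2 by (fastforce simp: u_def)
  next
    case 3
    have i: "tk (idx t) \<le> t" "t < tk (Suc (idx t))" using idx_bounds[OF 3] t by auto
    have "\<forall>\<^sub>F s in at_right t. u s \<omega> = u t \<omega>"
      unfolding eventually_at_right_field
    proof (intro exI[of _ "tk (Suc (idx t))"] conjI allI impI)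
      fix s assume "t < s" "s < tk (Suc (idx t))"
      then show "u s \<omega> = u t \<omega>" using u_piece[of "idx t" s] u_piece[of "idx t" t] i by simp
    qed (rule i)
    then show ?thesis by (rule tendsto_eventually)
  qed
qed

lemma u_progressive: "progressive F T u"
  unfolding progressive_def using right_continuous_progressive[OF u_adapted u_right_continuous] by blast

lemma u_joint: "(\<lambda>(s, \<omega>). u s \<omega>) \<in> borel_measurable (LT \<Otimes>\<^sub>M M)"
  by (rule joint_LT) (use u_progressive in \<open>auto simp: progressive_def\<close>)

definition "ek k = (\<integral>\<omega>. (bb (Suc k) \<omega> - bb k \<omega>)^2 \<partial>M)"

lemma ek_int: "integrable M (\<lambda>\<omega>. (bb (Suc k) \<omega> - bb k \<omega>)^2)"
  using expectation_square_add_le(1)[of "bb (Suc k)" "\<lambda>\<omega>. - bb k \<omega>"] bb_meas bb_L2 by simp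

lemma ek_Suc: "ek (Suc k) = energy X (tk (Suc k)) - energy X (tk k)"
proof -
  have "ek (Suc k) = (\<integral>\<omega>. (X (tk (Suc k)) \<omega> - X (tk k) \<omega>)^2 \<partial>M)" unfolding ek_def bb_Suc ..
  also have "\<dots> = (\<integral>\<omega>. (X (tk (Suc k)) \<omega>)^2 \<partial>M) - (\<integral>\<omega>. (X (tk k) \<omega>)^2 \<partial>M)"
    by (rule L2mart_increment(1)[OF X]) (use tk_range tk_less[of k] in \<open>auto intro: less_imp_le\<close>)
  finally show ?thesis using tk_range(2,4)[of k] tk_range(2,4)[of "Suc k"] by (simp add: energy_def min_def max_def)
qed

lemma energy_at: "t \<in> {0..T} \<Longrightarrow> energy X t = (\<integral>\<omega>. (X t \<omega>)^2 \<partial>M)"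
  by (auto simp: energy_def)

lemma X_increment_le: assumes "s \<in> {0..T}" "t \<in> {0..T}" shows "(\<integral>\<omega>. (X s \<omega> - X t \<omega>)^2 \<partial>M) \<le> eXT"
    "integrable M (\<lambda>\<omega>. (X s \<omega> - X t \<omega>)^2)"
proof -
  have *: "(\<integral>\<omega>. (X q \<omega> - X p \<omega>)^2 \<partial>M) \<le> eXT \<and> integrable M (\<lambda>\<omega>. (X q \<omega> - X p \<omega>)^2)" if "0 \<le> p" "p \<le> q" "q \<le> T" for p q
  proof -
    have "(\<integral>\<omega>. (X q \<omega>)^2 \<partial>M) \<le> eXT" using energy_mono[OF X, of q T] energy_at[of q] that by simp
    moreover have "0 \<le> (\<integral>\<omega>. (X p \<omega>)^2 \<partial>M)" by simp
    ultimately show ?thesis using L2mart_increment[OF X that] by linarith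
  qed
  have "(\<lambda>\<omega>. (X s \<omega> - X t \<omega>)^2) = (\<lambda>\<omega>. (X t \<omega> - X s \<omega>)^2)" by (simp add: power2_commute)
  then show "(\<integral>\<omega>. (X s \<omega> - X t \<omega>)^2 \<partial>M) \<le> eXT" "integrable M (\<lambda>\<omega>. (X s \<omega> - X t \<omega>)^2)"
    using *[of s t] *[of t s] assms by (cases "s \<le> t"; auto)+
qed

lemma eXT_nonneg: "0 \<le> eXT"
  by (simp add: energy_def)

lemma K_nonneg: "0 \<le> K"
proof -
  have "0 \<le> (\<integral>\<omega>. (Q 0 \<omega> - X 0 \<omega>)^2 \<partial>M)" by simp
  also have "\<dots> \<le> K" using K[of 0] T by simp
  finally show ?thesis .
qed

lemma c0_nonneg: "0 \<le> c0"
  using c0 by (rule order_trans[rotated]) simp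

lemma Q_X_bound:
  assumes "0 \<le> s" "s < T" "t \<in> {0..T}"
  shows "(\<integral>\<omega>. (Q s \<omega> - X t \<omega>)^2 \<partial>M) \<le> 2 * K + 2 * eXT" "integrable M (\<lambda>\<omega>. (Q s \<omega> - X t \<omega>)^2)"
proof -
  have s: "s \<in> {0..T}" using assms by auto
  have m: "(\<lambda>\<omega>. Q s \<omega> - X s \<omega>) \<in> borel_measurable M" "(\<lambda>\<omega>. X s \<omega> - X t \<omega>) \<in> borel_measurable M"
    using L2b_meas[OF Q s] L2b_meas[OF Xb s] L2b_meas[OF Xb assms(3)] by auto
  have e: "Q s \<omega> - X t \<omega> = (Q s \<omega> - X s \<omega>) + (X s \<omega> - X t \<omega>)" for \<omega> by simp
  note l = expectation_square_add_le[OF m L2b_int[OF L2b_diff[OF Q Xb] s] X_increment_le(2)[OF s assms(3)]]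
  show "integrable M (\<lambda>\<omega>. (Q s \<omega> - X t \<omega>)^2)" using l(1) unfolding e[symmetric] .
  show "(\<integral>\<omega>. (Q s \<omega> - X t \<omega>)^2 \<partial>M) \<le> 2 * K + 2 * eXT"
    using l(2) K[OF assms(1,2)] X_increment_le(1)[OF s assms(3)] unfolding e[symmetric] by linarith
qed

text \<open>The window average differs from \<open>X t\<close> by the average of
  \<open>Q s - X t\<close>. Cauchy-Schwarz in \<open>s\<close> and Fubini reduce the claim to the
  bound at single times, which holds because the window ends before \<open>T\<close>.\<close>

lemma average_bound:
  assumes t: "t \<in> {0..T}" shows "(\<integral>\<omega>. (bb 0 \<omega> - X t \<omega>)^2 \<partial>M) \<le> 2 * K + 2 * eXT"
proof -
  let ?w = "\<lambda>s. indicator {a - h..a} s :: real"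
  define V where "V s \<omega> = ?w s * (Q s \<omega> - X t \<omega>)^2" for s \<omega>
  have bw: "bdm T ?w" by (rule bdmI[of _ _ 1], rule measurable_restrict_space1) (auto simp: indicator_def)
  have sT: "s \<in> {0..T}" "s < T" if "s \<in> {a - h..a}" for s using that a by auto
  have Xt: "X t \<in> borel_measurable M" by (rule L2b_meas[OF Xb t])
  have mX: "(\<lambda>(s, \<omega>). X t \<omega>) \<in> borel_measurable (LT \<Otimes>\<^sub>M M)"
    using measurable_compose[OF measurable_snd Xt] by (simp add: split_def)
  have mV: "(\<lambda>(s, \<omega>). V s \<omega>) \<in> borel_measurable (LT \<Otimes>\<^sub>M M)"
    unfolding V_def
    using borel_measurable_times[OF bdm_joint_LT[OF bw] borel_measurable_power[OF borel_measurable_diff[OF L2b_jointly_measurable[OF Q] mX], of 2]]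
    by (simp add: split_def)
  have iV: "integrable M (V s)" if "s \<in> {0..T}" for s
  proof (cases "s \<in> {a - h..a}")
    case True
    then show ?thesis unfolding V_def[abs_def] using Q_X_bound(2)[OF _ sT(2)[OF True] t] sT(1)[OF True] by simp
  qed (simp add: V_def[abs_def])
  have eV: "(\<integral>\<omega>. V s \<omega> \<partial>M) \<le> ?w s * (2 * K + 2 * eXT)" if "s \<in> {0..T}" for s
  proof (cases "s \<in> {a - h..a}")
    case True
    then show ?thesis unfolding V_def using Q_X_bound(1)[OF _ sT(2)[OF True] t] sT(1)[OF True] by simp
  qed (simp add: V_def)
  have aV: "(\<integral>\<omega>. \<bar>V s \<omega>\<bar> \<partial>M) \<le> 2 * K + 2 * eXT" if "s \<in> {0..T}" for s
  proof -
    have "\<bar>V s \<omega>\<bar> = V s \<omega>" for \<omega> by (simp add: V_def)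
    moreover have "?w s * (2 * K + 2 * eXT) \<le> 2 * K + 2 * eXT" using K_nonneg eXT_nonneg by (cases "s \<in> {a - h..a}") auto
    ultimately show ?thesis using eV[OF that] by simp
  qed
  note j = integrable_joint_bounded[OF mV iV aV]
  have Vp: "prim (\<lambda>s. V s \<omega>) T = (LINT s:{a - h..a}|lborel. (Q s \<omega> - X t \<omega>)^2)" for \<omega>
    unfolding set_lebesgue_integral_def
    by (rule Bochner_Integration.integral_cong) (use a in \<open>auto simp: V_def split: split_indicator\<close>)
  have pw: "(bb 0 \<omega> - X t \<omega>)^2 \<le> 1 / h * prim (\<lambda>s. V s \<omega>) T" if w: "\<omega> \<in> space M" for \<omega>
  proof -
    have bq: "bdm T (\<lambda>s. Q s \<omega>)" by (rule L2b_bdm[OF Q w])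
    have bqx: "bdm T (\<lambda>s. Q s \<omega> - X t \<omega>)" by (rule bdm_diff[OF bq bdm_const])
    have hb: "h * bb 0 \<omega> = prim (\<lambda>s. Q s \<omega>) a - prim (\<lambda>s. Q s \<omega>) (a - h)" using h0 by (simp add: bb_0)
    have "(LINT s:{a - h..a}|lborel. Q s \<omega> - X t \<omega>) = (LINT s:{a - h..a}|lborel. Q s \<omega>) - (LINT s:{a - h..a}|lborel. X t \<omega>)"
      by (rule set_integral_diff(2)[OF bdm_set_integrable[OF bq] bdm_set_integrable[OF bdm_const]]) (use a in auto)
    also have "(LINT s:{a - h..a}|lborel. Q s \<omega>) = prim (\<lambda>s. Q s \<omega>) a - prim (\<lambda>s. Q s \<omega>) (a - h)"
      by (rule prim_diff[OF bq, symmetric]) (use a h0 in auto)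
    also have "(LINT s:{a - h..a}|lborel. X t \<omega>) = h * X t \<omega>" using h0 by (simp add: set_lebesgue_integral_def)
    finally have e: "(LINT s:{a - h..a}|lborel. Q s \<omega> - X t \<omega>) = h * (bb 0 \<omega> - X t \<omega>)"
      using hb by (simp only: right_diff_distrib)
    have "(h * (bb 0 \<omega> - X t \<omega>))^2 \<le> (a - (a - h)) * (LINT s:{a - h..a}|lborel. (Q s \<omega> - X t \<omega>)^2)"
      unfolding e[symmetric] by (rule set_integral_cauchy_schwarz[OF bqx]) (use a h0 in auto)
    then have "h * (h * (bb 0 \<omega> - X t \<omega>)^2) \<le> h * prim (\<lambda>s. V s \<omega>) T" unfolding Vp by (simp add: power2_eq_square mult_ac)
    then have "h * (bb 0 \<omega> - X t \<omega>)^2 \<le> prim (\<lambda>s. V s \<omega>) T" using h0 by simp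
    then show ?thesis using h0 by (simp add: field_simps)
  qed
  have "(\<integral>\<omega>. (bb 0 \<omega> - X t \<omega>)^2 \<partial>M) \<le> (\<integral>\<omega>. 1 / h * prim (\<lambda>s. V s \<omega>) T \<partial>M)"
  proof (rule integral_mono)
    show "integrable M (\<lambda>\<omega>. (bb 0 \<omega> - X t \<omega>)^2)"
      using expectation_square_add_le(1)[of "bb 0" "\<lambda>\<omega>. - X t \<omega>"] bb_meas bb_L2 Xt L2b_int[OF Xb t] by simp
    show "integrable M (\<lambda>\<omega>. 1 / h * prim (\<lambda>s. V s \<omega>) T)" using j(2) by simp
  qed (rule pw)
  also have "\<dots> = 1 / h * prim (\<lambda>s. \<integral>\<omega>. V s \<omega> \<partial>M) T" using j(3) by simp
  also have "\<dots> \<le> 1 / h * prim (\<lambda>s. ?w s * (2 * K + 2 * eXT)) T"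
  proof (rule mult_left_mono)
    show "prim (\<lambda>s. \<integral>\<omega>. V s \<omega> \<partial>M) T \<le> prim (\<lambda>s. ?w s * (2 * K + 2 * eXT)) T"
    proof (rule set_integral_mono)
      show "set_integrable lborel {0..T} (\<lambda>s. \<integral>\<omega>. V s \<omega> \<partial>M)"
      proof (rule set_integrable_bounded[OF j(4)])
        fix s assume "s \<in> {0..T}"
        then show "\<bar>\<integral>\<omega>. V s \<omega> \<partial>M\<bar> \<le> 2 * K + 2 * eXT" using aV integral_abs_bound[of M "V s"] by (meson order_trans)
      qed
      show "set_integrable lborel {0..T} (\<lambda>s. ?w s * (2 * K + 2 * eXT))"
        by (rule bdm_set_integrable[OF bdm_mult[OF bw bdm_const]]) auto
    qed (rule eV)
  qed (use h0 in auto)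
  also have "prim (\<lambda>s. ?w s * (2 * K + 2 * eXT)) T = (LINT s:{a - h..a}|lborel. 2 * K + 2 * eXT)"
    unfolding set_lebesgue_integral_def
    by (rule Bochner_Integration.integral_cong) (use a in \<open>auto split: split_indicator\<close>)
  also have "\<dots> = h * (2 * K + 2 * eXT)" using h0 by (simp add: set_lebesgue_integral_def)
  finally show ?thesis using h0 by simp
qed

lemma ek_0: "ek 0 \<le> 2 * K + 2 * eXT"
proof -
  have "ek 0 = (\<integral>\<omega>. (bb 0 \<omega> - X a \<omega>)^2 \<partial>M)" unfolding ek_def bb_Suc tk_0 by (simp add: power2_commute)
  then show ?thesis using average_bound[OF a(4)] by simp
qed

text \<open>The increment of \<open>X\<close> over the cell from \<open>tk k\<close> to
  \<open>tk (Suc k)\<close> is traded on the next piece, whose length is a quarter of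
  \<open>T - tk k\<close>; hence the factor \<open>4\<close>. On the cell \<open>1 / (T - s)\<close>
  is at least \<open>1 / (T - tk k)\<close>, so each term is at most four times the integral of the
  weight over the cell, and the cells are disjoint.\<close>

lemma ek_Lambda: "(\<Sum>k. ennreal (ek (Suc k) / len (Suc k))) \<le> 4 * Lam X"
proof -
  let ?\<mu> = "interval_measure (energy X)"
  let ?I = "\<lambda>k. {tk k<..tk (Suc k)}"
  have m: "(\<lambda>s. inverse (ennreal (T - s))) \<in> borel_measurable ?\<mu>" by measurable
  have one: "ennreal (ek (Suc k) / len (Suc k)) \<le> 4 * (\<integral>\<^sup>+s. inverse (ennreal (T - s)) * indicator (?I k) s \<partial>?\<mu>)" for k
  proof -
    have p: "T - tk k > 0" using tk_range(2)[of k] by simp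
    have d0: "0 \<le> ek (Suc k)" unfolding ek_def by simp
    have "ek (Suc k) / len (Suc k) = 4 * (1 / (T - tk k) * ek (Suc k))"
      using h0 by (simp add: len_def tk_def)
    then have "ennreal (ek (Suc k) / len (Suc k)) = ennreal 4 * ennreal (1 / (T - tk k) * ek (Suc k))"
      using p d0 by (simp only:) (rule ennreal_mult, auto)
    moreover have "ennreal (1 / (T - tk k) * ek (Suc k)) = ennreal (1 / (T - tk k)) * ennreal (ek (Suc k))"
      by (rule ennreal_mult) (use p d0 in auto)
    moreover have "ennreal (ek (Suc k)) = emeasure ?\<mu> (?I k)"
      unfolding ek_Suc by (rule energy_Ioc[OF X less_imp_le[OF tk_less], symmetric])
    moreover have "ennreal (1 / (T - tk k)) * emeasure ?\<mu> (?I k) = (\<integral>\<^sup>+s. ennreal (1 / (T - tk k)) * indicator (?I k) s \<partial>?\<mu>)"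
      by (rule nn_integral_cmult_indicator[symmetric]) simp
    ultimately have eq: "ennreal (ek (Suc k) / len (Suc k)) = 4 * (\<integral>\<^sup>+s. ennreal (1 / (T - tk k)) * indicator (?I k) s \<partial>?\<mu>)"
      by (simp only: ennreal_numeral)
    have le: "(\<integral>\<^sup>+s. ennreal (1 / (T - tk k)) * indicator (?I k) s \<partial>?\<mu>) \<le> (\<integral>\<^sup>+s. inverse (ennreal (T - s)) * indicator (?I k) s \<partial>?\<mu>)"
    proof (rule nn_integral_mono)
      fix s
      show "ennreal (1 / (T - tk k)) * indicator (?I k) s \<le> inverse (ennreal (T - s)) * indicator (?I k) s"
      proof (cases "s \<in> ?I k")
        case True
        then have s: "tk k < s" "s < T" using tk_range(2)[of "Suc k"] by auto
        then have "inverse (ennreal (T - s)) = ennreal (inverse (T - s))" by (intro inverse_ennreal) simp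
        moreover have "ennreal (1 / (T - tk k)) \<le> ennreal (inverse (T - s))"
          unfolding inverse_eq_divide using s by (intro ennreal_leI divide_left_mono) auto
        ultimately show ?thesis using True by simp
      qed simp
    qed
    show ?thesis unfolding eq by (rule mult_left_mono[OF le]) simp
  qed
  have disj: "disjoint_family ?I"
    unfolding disjoint_family_on_def
  proof (intro ballI impI)
    fix i j :: nat assume "i \<noteq> j"
    then consider "Suc i \<le> j" | "Suc j \<le> i" by linarith
    then show "?I i \<inter> ?I j = {}"
    proof cases
      case 1 then show ?thesis using tk_mono[OF 1] by auto
    next
      case 2 then show ?thesis using tk_mono[OF 2] by auto
    qed
  qed
  have "(\<Sum>k. ennreal (ek (Suc k) / len (Suc k))) \<le> (\<Sum>k. 4 * (\<integral>\<^sup>+s. inverse (ennreal (T - s)) * indicator (?I k) s \<partial>?\<mu>))"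
    by (intro suminf_le one summableI)
  also have "\<dots> = 4 * (\<Sum>k. \<integral>\<^sup>+s. inverse (ennreal (T - s)) * indicator (?I k) s \<partial>?\<mu>)"
    by (rule ennreal_suminf_cmult)
  also have "(\<Sum>k. \<integral>\<^sup>+s. inverse (ennreal (T - s)) * indicator (?I k) s \<partial>?\<mu>)
     = (\<integral>\<^sup>+s. (\<Sum>k. inverse (ennreal (T - s)) * indicator (?I k) s) \<partial>?\<mu>)"
    by (rule nn_integral_suminf[symmetric], rule borel_measurable_times_ennreal[OF m]) simp
  also have "\<dots> = (\<integral>\<^sup>+s. inverse (ennreal (T - s)) * indicator (\<Union>k. ?I k) s \<partial>?\<mu>)"
    by (simp only: ennreal_suminf_cmult suminf_indicator[OF disj])
  finally have "(\<Sum>k. ennreal (ek (Suc k) / len (Suc k)))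
     \<le> 4 * (\<integral>\<^sup>+s. inverse (ennreal (T - s)) * indicator (\<Union>k. ?I k) s \<partial>?\<mu>)" .
  moreover have "(\<integral>\<^sup>+s. inverse (ennreal (T - s)) * indicator (\<Union>k. ?I k) s \<partial>?\<mu>) \<le> Lam X"
  proof (rule nn_integral_mono)
    fix s
    have "(\<Union>k. ?I k) \<subseteq> {0<..T}"
    proof
      fix x assume "x \<in> (\<Union>k. ?I k)"
      then obtain k where "tk k < x" "x \<le> tk (Suc k)" by auto
      then show "x \<in> {0<..T}" using tk_range(4)[of k] tk_range(2)[of "Suc k"] by auto
    qed
    then have "indicator (\<Union>k. ?I k) s \<le> (indicator {0<..T} s :: ennreal)"
      unfolding indicator_def by (simp only: subset_eq split: if_split) auto
    then show "inverse (ennreal (T - s)) * indicator (\<Union>k. ?I k) s \<le> inverse (ennreal (T - s)) * indicator {0<..T} s"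
      by (rule mult_left_mono) simp
  qed
  ultimately show ?thesis by (rule order_trans[OF _ mult_left_mono]) simp
qed

text \<open>Three contributions. Before \<open>a\<close> the rate is a difference quotient of
  \<open>Q\<close> over the lag, which costs \<open>2 / h * (G + c0)\<close>. The first piece leads
  from the moving average to the target within time \<open>h / 2\<close>, hence the factor
  \<open>2 / h\<close> on the bound for \<open>ek 0\<close>. The later pieces are governed by
  \<open>Lambda\<close>.\<close>

lemma u_energy:
  "rate_energy u
    \<le> ennreal (2 / h * (G + c0) + 2 / h * (2 * K + 2 * eXT)) + 4 * Lam X"
proof -
  interpret P: pair_sigma_finite LT M by (rule pair_LT)
  let ?J = "\<lambda>k. {tk k..<tk (Suc k)}"
  let ?f = "\<lambda>t. (2 * shift_sq Q h t + 2 * c0 * indicator {0..h} t) / h^2"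
  have mu: "(\<lambda>(t, \<omega>). ennreal ((u t \<omega>)^2)) \<in> borel_measurable (LT \<Otimes>\<^sub>M M)"
    using u_joint by (simp add: split_def)
  have bi: "bdm T (\<lambda>t. indicator {0..h} t)"
    by (rule bdmI[of _ _ 1], rule measurable_restrict_space1) (auto simp: indicator_def)
  have bs: "bdm T (shift_sq Q h)" by (rule bdm_shift_sq[OF Q h0])
  have s0: "0 \<le> shift_sq Q r t" for r t unfolding shift_sq_def by simp
  have bnum: "bdm T (\<lambda>t. 2 * shift_sq Q h t + 2 * c0 * indicator {0..h} t)"
    by (rule bdm_add[OF bdm_mult[OF bdm_const bs] bdm_mult[OF bdm_const bi]])
  have bf: "bdm T ?f" using bdm_mult[OF bdm_const bnum, of "1 / h^2"] by simp
  have f0: "0 \<le> ?f t" for t using s0 c0_nonneg by (auto intro!: divide_nonneg_nonneg add_nonneg_nonneg mult_nonneg_nonneg)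
  have qa: "(\<integral>\<^sup>+\<omega>. ennreal ((u t \<omega>)^2) \<partial>M) \<le> ennreal (?f t)" if t: "t \<in> {0..T}" "t < a" for t
  proof -
    define Z where "Z \<omega> = (Q t \<omega> - Q (max (t - h) 0) \<omega>) / h" for \<omega>
    define W where "W \<omega> = indicator {0..h} t * Q 0 \<omega> / h" for \<omega>
    have r: "max (t - h) 0 \<in> {0..T}" using t h0 by auto
    have Qm: "Q t \<in> borel_measurable M" "Q (max (t - h) 0) \<in> borel_measurable M" "Q 0 \<in> borel_measurable M"
      using L2b_meas[OF Q] t(1) r zero_T by blast+
    have Zm: "Z \<in> borel_measurable M" and Wm: "W \<in> borel_measurable M"
      unfolding Z_def[abs_def] W_def[abs_def] using Qm by auto
    have iD: "integrable M (\<lambda>\<omega>. (Q t \<omega> - Q (max (t - h) 0) \<omega>)^2)" by (rule L2b_int[OF L2b_diff[OF Q L2b_shift[OF Q h0]] t(1)])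
    have Zi: "integrable M (\<lambda>\<omega>. (Z \<omega>)^2)" unfolding Z_def power_divide using iD by simp
    have Wi: "integrable M (\<lambda>\<omega>. (W \<omega>)^2)" unfolding W_def power_divide power_mult_distrib using L2b_int[OF Q zero_T] by simp
    have ZE: "(\<integral>\<omega>. (Z \<omega>)^2 \<partial>M) = shift_sq Q h t / h^2" unfolding Z_def power_divide shift_sq_def by simp
    have WE: "(\<integral>\<omega>. (W \<omega>)^2 \<partial>M) \<le> c0 * indicator {0..h} t / h^2"
    proof -
      have "(\<integral>\<omega>. (W \<omega>)^2 \<partial>M) = indicator {0..h} t * (\<integral>\<omega>. (Q 0 \<omega>)^2 \<partial>M) / h^2"
        unfolding W_def power_divide power_mult_distrib by (simp add: indicator_def)
      also have "\<dots> \<le> indicator {0..h} t * c0 / h^2"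
        using c0 by (intro divide_right_mono mult_left_mono) auto
      finally show ?thesis by (simp add: mult.commute)
    qed
    have le: "(u t \<omega>)^2 \<le> (Z \<omega>)^2 + (Z \<omega>)^2 + 2 * (W \<omega>)^2" for \<omega>
    proof (cases "h \<le> t")
      case True
      then have "u t \<omega> = Z \<omega>" using t by (simp add: u_def Z_def)
      then show ?thesis by simp
    next
      case False
      then have "u t \<omega> = Z \<omega> + W \<omega>" using t by (simp add: u_def Z_def W_def diff_divide_distrib add_divide_distrib)
      then show ?thesis using power2_add_le[of "Z \<omega>" "W \<omega>"] by simp
    qed
    have "(\<integral>\<^sup>+\<omega>. ennreal ((u t \<omega>)^2) \<partial>M) \<le> (\<integral>\<^sup>+\<omega>. ennreal ((Z \<omega>)^2 + (Z \<omega>)^2 + 2 * (W \<omega>)^2) \<partial>M)"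
      by (intro nn_integral_mono ennreal_leI le)
    also have "\<dots> = ennreal (\<integral>\<omega>. (Z \<omega>)^2 + (Z \<omega>)^2 + 2 * (W \<omega>)^2 \<partial>M)"
      by (rule nn_integral_eq_integral) (use Zi Wi in auto)
    also have "(\<integral>\<omega>. (Z \<omega>)^2 + (Z \<omega>)^2 + 2 * (W \<omega>)^2 \<partial>M) = 2 * (\<integral>\<omega>. (Z \<omega>)^2 \<partial>M) + 2 * (\<integral>\<omega>. (W \<omega>)^2 \<partial>M)"
      using Zi Wi by simp
    also have "ennreal \<dots> \<le> ennreal (?f t)"
      using ZE WE by (intro ennreal_leI) (simp add: add_divide_distrib)
    finally show ?thesis .
  qed
  have qb: "(\<integral>\<^sup>+\<omega>. ennreal ((u t \<omega>)^2) \<partial>M) = ennreal (ek k / (len k)^2)" if "t \<in> ?J k" for t k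
  proof -
    have "u t \<omega> = (bb (Suc k) \<omega> - bb k \<omega>) / len k" for \<omega> by (rule u_piece) (use that in auto)
    then have "(\<integral>\<^sup>+\<omega>. ennreal ((u t \<omega>)^2) \<partial>M) = (\<integral>\<^sup>+\<omega>. ennreal ((bb (Suc k) \<omega> - bb k \<omega>)^2 / (len k)^2) \<partial>M)"
      by (simp add: power_divide)
    also have "\<dots> = ennreal (\<integral>\<omega>. (bb (Suc k) \<omega> - bb k \<omega>)^2 / (len k)^2 \<partial>M)"
      by (rule nn_integral_eq_integral) (use ek_int in auto)
    finally show ?thesis unfolding ek_def by simp
  qed
  have disj: "disjoint_family (\<lambda>k. ?J (Suc k))"
    unfolding disjoint_family_on_def
  proof (intro ballI impI)
    fix i j :: nat assume "i \<noteq> j"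
    then consider "Suc (Suc i) \<le> Suc j" | "Suc (Suc j) \<le> Suc i" by linarith
    then show "?J (Suc i) \<inter> ?J (Suc j) = {}"
    proof cases
      case 1 then show ?thesis using tk_mono[OF 1] by auto
    next
      case 2 then show ?thesis using tk_mono[OF 2] by auto
    qed
  qed
  let ?c = "\<lambda>k. ennreal (ek k / (len k)^2)"
  \<comment> \<open>A majorant of the mean squared rate at every time. The first piece is kept apart
    because its increment is not one of the martingale.\<close>
  let ?\<psi> = "\<lambda>t. ennreal (?f t) + (?c 0 * indicator (?J 0) t + (\<Sum>k. ?c (Suc k) * indicator (?J (Suc k)) t))"
  have le: "(\<integral>\<^sup>+\<omega>. ennreal ((u t \<omega>)^2) \<partial>M) \<le> ?\<psi> t" if t: "t \<in> {0..T}" for t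
  proof -
    consider "t < a" | "a \<le> t" "t < T" | "t = T" using t by fastforce
    then show ?thesis
    proof cases
      case 1
      then show ?thesis using qa[OF t] by (meson add_increasing2 order_refl order_trans zero_le)
    next
      case 2
      define k where "k = idx t"
      have k: "t \<in> ?J k" using idx_bounds[OF 2] unfolding k_def by auto
      have "?c k \<le> ?c 0 * indicator (?J 0) t + (\<Sum>k. ?c (Suc k) * indicator (?J (Suc k)) t)"
      proof (cases k)
        case 0
        then have "?c k = ?c 0 * indicator (?J 0) t" using k by simp
        then show ?thesis by (simp add: add_increasing2)
      next
        case (Suc j)
        then have "(\<Sum>k. ?c (Suc k) * indicator (?J (Suc k)) t) = ?c (Suc j)"
          using suminf_cmult_indicator[OF disj, of t j "\<lambda>k. ?c (Suc k)"] k by simp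
        then show ?thesis using Suc by (simp add: add_increasing)
      qed
      then show ?thesis unfolding qb[OF k] by (simp add: add_increasing)
    next
      case 3
      then have "u t \<omega> = 0" for \<omega> using a by (simp add: u_def)
      then show ?thesis by simp
    qed
  qed
  have J: "?J k \<in> sets LT" "emeasure LT (?J k) = ennreal (len k)" for k
  proof -
    have "?J k \<subseteq> {0..T}" using tk_range(4)[of k] tk_range(2)[of "Suc k"] by auto
    then show "?J k \<in> sets LT" "emeasure LT (?J k) = ennreal (len k)"
      using tk_Suc[of k] len_pos[of k] by (auto simp: sets_restrict_space_iff emeasure_restrict_space)
  qed
  have cl: "?c k * ennreal (len k) = ennreal (ek k / len k)" for k
  proof -
    have "0 \<le> ek k" unfolding ek_def by simp
    then have "?c k * ennreal (len k) = ennreal (ek k / (len k)^2 * len k)" using len_pos[of k] by (subst ennreal_mult) auto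
    also have "ek k / (len k)^2 * len k = ek k / len k" using len_pos[of k] by (simp add: power2_eq_square)
    finally show ?thesis .
  qed
  have "rate_energy u = (\<integral>\<^sup>+\<omega>. (\<integral>\<^sup>+t. ennreal ((u t \<omega>)^2) \<partial>LT) \<partial>M)"
    unfolding nn_integral_LT ..
  also have "\<dots> = (\<integral>\<^sup>+t. (\<integral>\<^sup>+\<omega>. ennreal ((u t \<omega>)^2) \<partial>M) \<partial>LT)"
    by (rule P.Fubini'[OF mu])
  also have "\<dots> \<le> (\<integral>\<^sup>+t. ?\<psi> t \<partial>LT)"
    by (rule nn_integral_mono) (use le in \<open>simp add: space_LT\<close>)
  also have "\<dots> = (\<integral>\<^sup>+t. ennreal (?f t) \<partial>LT) + ((\<integral>\<^sup>+t. ?c 0 * indicator (?J 0) t \<partial>LT) + (\<integral>\<^sup>+t. (\<Sum>k. ?c (Suc k) * indicator (?J (Suc k)) t) \<partial>LT))"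
  proof -
    have m1: "(\<lambda>t. ennreal (?f t)) \<in> borel_measurable LT" using bdm_LT[OF bf] by measurable
    have m2: "(\<lambda>t. ?c k * indicator (?J k) t) \<in> borel_measurable LT" for k
      by (rule borel_measurable_times_ennreal[OF borel_measurable_const borel_measurable_indicator[OF J(1)]])
    have m3: "(\<lambda>t. (\<Sum>k. ?c (Suc k) * indicator (?J (Suc k)) t)) \<in> borel_measurable LT"
      by (rule borel_measurable_suminf_order) (rule m2)
    show ?thesis
      by (subst nn_integral_add[OF m1 borel_measurable_add[OF m2 m3]], subst nn_integral_add[OF m2 m3]) simp
  qed
  also have "(\<integral>\<^sup>+t. ?c 0 * indicator (?J 0) t \<partial>LT) = ennreal (ek 0 / len 0)"
    unfolding nn_integral_cmult_indicator[OF J(1)] J(2) cl ..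
  also have "(\<integral>\<^sup>+t. (\<Sum>k. ?c (Suc k) * indicator (?J (Suc k)) t) \<partial>LT) = (\<Sum>k. \<integral>\<^sup>+t. ?c (Suc k) * indicator (?J (Suc k)) t \<partial>LT)"
    by (rule nn_integral_suminf) (rule borel_measurable_times_ennreal[OF borel_measurable_const borel_measurable_indicator[OF J(1)]])
  also have "\<dots> = (\<Sum>k. ennreal (ek (Suc k) / len (Suc k)))"
    unfolding nn_integral_cmult_indicator[OF J(1)] J(2) cl ..
  also have "(\<integral>\<^sup>+t. ennreal (?f t) \<partial>LT) = ennreal (prim ?f T)"
    by (rule nn_prim_eq[OF bf f0])
  finally have main: "rate_energy u
     \<le> ennreal (prim ?f T) + (ennreal (ek 0 / len 0) + (\<Sum>k. ennreal (ek (Suc k) / len (Suc k))))" .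
  have pf: "prim ?f T \<le> 2 / h * (G + c0)"
  proof -
    have "prim ?f T = prim (\<lambda>t. 1 / h^2 * (2 * shift_sq Q h t + 2 * c0 * indicator {0..h} t)) T"
      by (rule prim_cong) simp
    also have "\<dots> = 1 / h^2 * (2 * prim (shift_sq Q h) T + 2 * c0 * prim (\<lambda>t. indicator {0..h} t) T)"
      using prim_add[OF bdm_mult[OF bdm_const bs] bdm_mult[OF bdm_const bi] T_T] by (simp only: prim_cmult)
    also have "prim (\<lambda>t. indicator {0..h} t) T = h"
    proof -
      have "prim (\<lambda>t. indicator {0..h} t) T = (LINT t|lborel. indicator {0..h} t)"
        unfolding set_lebesgue_integral_def by (rule Bochner_Integration.integral_cong) (use a h0 in \<open>auto split: split_indicator\<close>)
      then show ?thesis using h0 by simp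
    qed
    also have "1 / h^2 * (2 * prim (shift_sq Q h) T + 2 * c0 * h) \<le> 1 / h^2 * (2 * (h * G) + 2 * c0 * h)"
      by (rule mult_left_mono) (use G[OF h0] in simp_all)
    also have "1 / h^2 * (2 * (h * G) + 2 * c0 * h) = 2 / h * (G + c0)"
    proof -
      have "2 * (h * G) + 2 * c0 * h = h * (2 * (G + c0))" by algebra
      then show ?thesis using h0 by (simp add: power2_eq_square)
    qed
    finally show ?thesis .
  qed
  have pe: "ek 0 / len 0 \<le> 2 / h * (2 * K + 2 * eXT)"
  proof -
    have "ek 0 / len 0 = 2 / h * ek 0" by (simp add: len_def)
    then show ?thesis using mult_left_mono[OF ek_0, of "2 / h"] h0 by simp
  qed
  have "ennreal (prim ?f T) + ennreal (ek 0 / len 0) \<le> ennreal (2 / h * (G + c0) + 2 / h * (2 * K + 2 * eXT))"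
  proof -
    have "0 \<le> prim ?f T" by (rule prim_nonneg) (rule f0)
    moreover have "0 \<le> ek 0 / len 0" unfolding ek_def using len_pos[of 0] by simp
    ultimately have "ennreal (prim ?f T) + ennreal (ek 0 / len 0) = ennreal (prim ?f T + ek 0 / len 0)" by simp
    also have "\<dots> \<le> ennreal (2 / h * (G + c0) + 2 / h * (2 * K + 2 * eXT))"
      using pf pe by (intro ennreal_leI) linarith
    finally show ?thesis .
  qed
  then have "ennreal (prim ?f T) + ennreal (ek 0 / len 0) + (\<Sum>k. ennreal (ek (Suc k) / len (Suc k)))
     \<le> ennreal (2 / h * (G + c0) + 2 / h * (2 * K + 2 * eXT)) + 4 * Lam X"
    by (rule add_mono[OF _ ek_Lambda])
  then show ?thesis using main unfolding add.assoc[symmetric] by (rule order_trans[rotated])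
qed

end

text \<open>Primitives of square-integrable rates have this modulus by Cauchy-Schwarz. Replacing
  \<open>C\<close> by \<open>C + 1\<close> covers the case \<open>C = 0\<close>.\<close>

lemma continuous_on_holder_half:
  fixes f :: "real \<Rightarrow> real"
  assumes "0 \<le> C" and f: "\<And>s t. s \<in> S \<Longrightarrow> t \<in> S \<Longrightarrow> s \<le> t \<Longrightarrow> (f t - f s)^2 \<le> (t - s) * C"
  shows "continuous_on S f"
  unfolding continuous_on_iff
proof (intro ballI allI impI)
  fix x and e :: real assume x: "x \<in> S" and e: "0 < e"
  show "\<exists>d>0. \<forall>x'\<in>S. dist x' x < d \<longrightarrow> dist (f x') (f x) < e"
  proof (intro exI[of _ "e^2 / (C + 1)"] conjI ballI impI)
    show "0 < e^2 / (C + 1)" using e assms(1) by simp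
    fix x' assume x': "x' \<in> S" and d: "dist x' x < e^2 / (C + 1)"
    have "(f x' - f x)^2 \<le> \<bar>x' - x\<bar> * C"
      using f[OF x x'] f[OF x' x] by (cases "x \<le> x'") (auto simp: power2_commute abs_if)
    also have "\<dots> \<le> \<bar>x' - x\<bar> * (C + 1)" by (rule mult_left_mono) auto
    also have "\<dots> < e^2" using d assms(1) by (simp add: dist_real_def field_simps)
    finally have "\<bar>f x' - f x\<bar>^2 < e^2" by simp
    then have "\<bar>f x' - f x\<bar> < e" by (rule power2_less_imp_less) (use e in simp)
    then show "dist (f x') (f x) < e" by (simp add: dist_real_def)
  qed
qed

lemma finite_variation_dominated:
  assumes "\<And>s t. a \<le> s \<Longrightarrow> s \<le> t \<Longrightarrow> t \<le> b \<Longrightarrow> \<bar>f t - f s\<bar> \<le> v t - v s"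
  shows "finite_variation_on a b f"
  unfolding finite_variation_on_def
proof (intro exI[of _ "\<bar>v b - v a\<bar>"] allI impI)
  fix n :: nat and p :: "nat \<Rightarrow> real"
  assume p: "(\<forall>i\<le>n. p i \<in> {a..b}) \<and> (\<forall>i<n. p i \<le> p (Suc i))"
  have mono: "v s \<le> v t" if "a \<le> s" "s \<le> t" "t \<le> b" for s t
  proof -
    have "0 \<le> \<bar>f t - f s\<bar>" by simp
    then show ?thesis using assms[OF that] by linarith
  qed
  have "(\<Sum>i<n. \<bar>f (p (Suc i)) - f (p i)\<bar>) \<le> (\<Sum>i<n. v (p (Suc i)) - v (p i))"
  proof (rule sum_mono)
    fix i assume "i \<in> {..<n}"
    then have "p i \<in> {a..b}" "p (Suc i) \<in> {a..b}" "p i \<le> p (Suc i)" using p by auto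
    then show "\<bar>f (p (Suc i)) - f (p i)\<bar> \<le> v (p (Suc i)) - v (p i)" by (intro assms) auto
  qed
  also have "\<dots> = v (p n) - v (p 0)" by (rule sum_lessThan_telescope)
  also have "\<dots> \<le> v b - v a"
  proof -
    have "p 0 \<in> {a..b}" "p n \<in> {a..b}" using p by auto
    then show ?thesis using mono[of a "p 0"] mono[of "p n" b] by simp
  qed
  finally show "(\<Sum>i<n. \<bar>f (p (Suc i)) - f (p i)\<bar>) \<le> \<bar>v b - v a\<bar>" by simp
qed

section \<open>From square-integrable rates to admissible strategies\<close>

context filtered_horizon
begin

lemma martingale_zero: "martingale M F T (\<lambda>t \<omega>. 0)"
  unfolding martingale_def adapted_def
proof (intro conjI ballI)
  fix s t assume s: "s \<in> {0..T}"
  interpret S: sigma_finite_subalgebra M "F s"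
    by (intro finite_measure_subalgebra_is_sigma_finite finite_measure_subalgebra.intro) (use s subalg finite_measure_axioms in \<open>auto intro: finite_measure_subalgebra_axioms.intro\<close>)
  have "AE \<omega> in M. real_cond_exp M (F s) (\<lambda>\<omega>. 0) \<omega> = 0" by (rule S.real_cond_exp_F_meas) auto
  then show "AE \<omega> in M. 0 = real_cond_exp M (F s) (\<lambda>\<omega>. 0) \<omega>" by eventually_elim simp
qed auto

lemma cadlag_adapted_zero: "cadlag_adapted M F T (\<lambda>t \<omega>. 0)"
  unfolding cadlag_adapted_def adapted_def by (auto simp: cadlag_const)

lemma local_martingale_zero: "local_martingale M F T (\<lambda>t \<omega>. 0)"
  unfolding local_martingale_def
proof (intro conjI exI[of _ "\<lambda>n \<omega>. T"])
  show "\<forall>n::nat. \<forall>t\<in>{0..T}. {\<omega> \<in> space M. T \<le> t} \<in> sets (F t)"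
  proof (intro allI ballI)
    fix t assume "t \<in> {0..T}"
    then have "space M \<in> sets (F t)" using sets.top[of "F t"] space_F by simp
    then show "{\<omega> \<in> space M. T \<le> t} \<in> sets (F t)" by (cases "T \<le> t") auto
  qed
qed (auto simp: cadlag_adapted_zero martingale_zero incseq_def)

text \<open>The martingale part of the decomposition is zero, localized by the constant time
  \<open>T\<close>.\<close>

lemma semimartingale_finite_variation:
  assumes X: "cadlag_adapted M F T X" and fv: "AE \<omega> in M. finite_variation_on 0 T (\<lambda>t. X t \<omega>)"
    and zero: "AE \<omega> in M. X 0 \<omega> = 0"
  shows "semimartingale M F T X"
  unfolding semimartingale_def
proof (intro conjI X, rule exI[of _ "\<lambda>t \<omega>. 0"], rule exI[of _ X], intro conjI X fv)
  show "local_martingale M F T (\<lambda>t \<omega>. 0)" by (rule local_martingale_zero)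
  show "AE \<omega> in M. 0 = (0::real) \<and> X 0 \<omega> = 0" using zero by eventually_elim simp
  show "AE \<omega> in M. \<forall>t\<in>{0..T}. X t \<omega> = X 0 \<omega> + 0 + X t \<omega>" using zero by eventually_elim simp
qed

text \<open>Finite expected energy makes almost every path of the rate square-integrable; on a
  finite interval the bound \<open>\<bar>u\<bar> \<le> 1 + u^2\<close> makes it integrable as
  well.\<close>

lemma rate_square_integrable:
  assumes u: "progressive F T u"
    and fin: "rate_energy u < \<infinity>"
  shows "AE \<omega> in M. integrable LT (\<lambda>t. u t \<omega>) \<and> integrable LT (\<lambda>t. (u t \<omega>)^2)"
proof -
  interpret P: pair_sigma_finite LT M by (rule pair_LT)
  interpret L: finite_measure LT by (rule finite_LT)
  have j: "(\<lambda>(s, \<omega>). u s \<omega>) \<in> borel_measurable (LT \<Otimes>\<^sub>M M)"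
    by (rule joint_LT) (use u in \<open>auto simp: progressive_def\<close>)
  then have "(\<lambda>(\<omega>, s). u s \<omega>) \<in> borel_measurable (M \<Otimes>\<^sub>M LT)"
    using measurable_compose[OF measurable_pair_swap' j] by (simp add: split_def)
  then have j': "(\<lambda>(\<omega>, s). ennreal ((u s \<omega>)^2)) \<in> borel_measurable (M \<Otimes>\<^sub>M LT)" by (simp add: split_def)
  have "(\<lambda>\<omega>. \<integral>\<^sup>+t. ennreal ((u t \<omega>)^2) \<partial>LT) \<in> borel_measurable M"
    by (rule P.M1.borel_measurable_nn_integral[OF j'])
  then have "AE \<omega> in M. (\<integral>\<^sup>+t. ennreal ((u t \<omega>)^2) \<partial>LT) \<noteq> \<infinity>"
    by (rule nn_integral_PInf_AE) (use fin in \<open>simp add: nn_integral_LT\<close>)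
  then show ?thesis
  proof (rule AE_mp, intro AE_I2 impI)
    fix \<omega> assume w: "\<omega> \<in> space M" and f: "(\<integral>\<^sup>+t. ennreal ((u t \<omega>)^2) \<partial>LT) \<noteq> \<infinity>"
    have m: "(\<lambda>t. u t \<omega>) \<in> borel_measurable LT"
      using measurable_compose[OF measurable_Pair1'[OF w] measurable_compose[OF measurable_pair_swap' j]] by (simp add: split_def)
    have i2: "integrable LT (\<lambda>t. (u t \<omega>)^2)"
      by (rule integrableI_nonneg) (use m f in \<open>auto simp: top.not_eq_extremum\<close>)
    have "integrable LT (\<lambda>t. 1 + (u t \<omega>)^2)" using i2 by simp
    then have "integrable LT (\<lambda>t. u t \<omega>)"
    proof (rule Bochner_Integration.integrable_bound[OF _ m], intro AE_I2)
      fix t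
      have "\<bar>u t \<omega> * 1\<bar> \<le> (u t \<omega>)^2 + 1^2" by (rule abs_mult_le_power2)
      then show "norm (u t \<omega>) \<le> norm (1 + (u t \<omega>)^2)" by simp
    qed
    then show "integrable LT (\<lambda>t. u t \<omega>) \<and> integrable LT (\<lambda>t. (u t \<omega>)^2)" using i2 by blast
  qed
qed

lemma integrable_LT_set_integrable:
  fixes f :: "real \<Rightarrow> real"
  assumes "integrable LT f" "0 \<le> a" "b \<le> T" shows "set_integrable lborel {a..b} f"
proof -
  have "set_integrable lborel {0..T} f" using assms(1) by (simp add: set_integrable_def integrable_restrict_space)
  then show ?thesis by (rule set_integrable_subset) (use assms in auto)
qed

lemma prim_L2_increment:
  fixes f :: "real \<Rightarrow> real"
  assumes f: "integrable LT f" "integrable LT (\<lambda>t. (f t)^2)" and st: "0 \<le> s" "s \<le> t" "t \<le> T"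
  shows "prim f t - prim f s = (LINT r:{s..t}|lborel. f r)"
    "(prim f t - prim f s)^2 \<le> (t - s) * prim (\<lambda>r. (f r)^2) T"
    "\<bar>prim f t - prim f s\<bar> \<le> prim (\<lambda>r. \<bar>f r\<bar>) t - prim (\<lambda>r. \<bar>f r\<bar>) s"
proof -
  note si = integrable_LT_set_integrable
  have a: "integrable LT (\<lambda>t. \<bar>f t\<bar>)" using f(1) by simp
  show 1: "prim f t - prim f s = (LINT r:{s..t}|lborel. f r)"
    using set_integral_Icc_split[of 0 s t f] si[OF f(1), of 0 t] st by simp
  have 2: "(LINT r:{s..t}|lborel. (f r)^2) \<le> prim (\<lambda>r. (f r)^2) T"
    unfolding set_lebesgue_integral_def
    by (rule integral_mono)
      (use si[OF f(2), of s t] si[OF f(2), of 0 T] st in \<open>auto simp: set_integrable_def split: split_indicator\<close>)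
  have "(LINT r:{s..t}|lborel. f r)^2 \<le> (t - s) * (LINT r:{s..t}|lborel. (f r)^2)"
    by (rule set_integral_cauchy_schwarz_L2) (use si[OF f(1), of s t] si[OF f(2), of s t] st in auto)
  also have "\<dots> \<le> (t - s) * prim (\<lambda>r. (f r)^2) T" by (rule mult_left_mono[OF 2]) (use st in simp)
  finally show "(prim f t - prim f s)^2 \<le> (t - s) * prim (\<lambda>r. (f r)^2) T" unfolding 1 .
  have "prim (\<lambda>r. \<bar>f r\<bar>) t - prim (\<lambda>r. \<bar>f r\<bar>) s = (LINT r:{s..t}|lborel. \<bar>f r\<bar>)"
    using set_integral_Icc_split[of 0 s t "\<lambda>r. \<bar>f r\<bar>"] si[OF a, of 0 t] st by simp
  moreover have "\<bar>LINT r:{s..t}|lborel. f r\<bar> \<le> (LINT r:{s..t}|lborel. \<bar>f r\<bar>)"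
    using set_integral_norm_bound[OF si[OF f(1), of s t]] st by simp
  ultimately show "\<bar>prim f t - prim f s\<bar> \<le> prim (\<lambda>r. \<bar>f r\<bar>) t - prim (\<lambda>r. \<bar>f r\<bar>) s" unfolding 1 by simp
qed

text \<open>Equal primitives mean equal integrals over half-lines. To work with positive measures,
  positive and negative parts are regrouped so that \<open>p - q = f - g\<close> on
  \<open>{0..T}\<close> with \<open>p\<close> and \<open>q\<close> nonnegative; these densities
  define the same measure and so agree almost everywhere.\<close>

lemma integrable_eq_AE_of_prim:
  fixes f g :: "real \<Rightarrow> real"
  assumes f: "integrable LT f" and g: "integrable LT g"
    and eq: "\<And>t. t \<in> {0..T} \<Longrightarrow> prim f t = prim g t"
  shows "AE t in LT. f t = g t"
proof -
  let ?I = "indicator {0..T} :: real \<Rightarrow> real"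
  define p where "p t = ?I t * (max 0 (f t) + max 0 (- g t))" for t
  define q where "q t = ?I t * (max 0 (g t) + max 0 (- f t))" for t
  have fi: "integrable lborel (\<lambda>t. ?I t * f t)" and gi: "integrable lborel (\<lambda>t. ?I t * g t)"
    using f g by (simp_all add: integrable_restrict_space)
  have pq: "p = (\<lambda>t. max 0 (?I t * f t) + max 0 (- (?I t * g t)))" "q = (\<lambda>t. max 0 (?I t * g t) + max 0 (- (?I t * f t)))"
    unfolding p_def q_def by (auto simp: indicator_def)
  have pi: "integrable lborel p" and qi: "integrable lborel q"
    unfolding pq using fi gi by (auto intro!: Bochner_Integration.integrable_add integrable_max Bochner_Integration.integrable_minus)
  have p0: "0 \<le> p t" and q0: "0 \<le> q t" for t unfolding p_def q_def by auto
  have em: "emeasure (density lborel (\<lambda>t. ennreal (r t))) {x<..} = ennreal (\<integral>t. indicator {x<..} t * r t \<partial>lborel)"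
    if ri: "integrable lborel r" and r0: "\<And>t. 0 \<le> r t" for r :: "real \<Rightarrow> real" and x
  proof -
    have i: "integrable lborel (\<lambda>t. indicator {x<..} t * r t)" using integrable_mult_indicator[OF _ ri, of "{x<..}"] by simp
    have "emeasure (density lborel (\<lambda>t. ennreal (r t))) {x<..} = (\<integral>\<^sup>+t. ennreal (r t) * indicator {x<..} t \<partial>lborel)"
      using ri by (intro emeasure_density) auto
    also have "\<dots> = (\<integral>\<^sup>+t. ennreal (indicator {x<..} t * r t) \<partial>lborel)"
      by (rule nn_integral_cong) (auto split: split_indicator)
    also have "\<dots> = ennreal (\<integral>t. indicator {x<..} t * r t \<partial>lborel)"
      by (rule nn_integral_eq_integral[OF i]) (use r0 in auto)
    finally show ?thesis .
  qed
  have same: "(\<integral>t. indicator {x<..} t * p t \<partial>lborel) = (\<integral>t. indicator {x<..} t * q t \<partial>lborel)" for x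
  proof -
    have i: "integrable lborel (\<lambda>t. indicator {x<..} t * r t)" if "integrable lborel r" for r :: "real \<Rightarrow> real"
      using integrable_mult_indicator[OF _ that, of "{x<..}"] by simp
    have "(\<integral>t. indicator {x<..} t * p t \<partial>lborel) - (\<integral>t. indicator {x<..} t * q t \<partial>lborel)
        = (\<integral>t. indicator {x<..} t * p t - indicator {x<..} t * q t \<partial>lborel)"
      by (rule Bochner_Integration.integral_diff[symmetric, OF i[OF pi] i[OF qi]])
    also have "\<dots> = (\<integral>t. indicator {x<..} t * (?I t * f t) - indicator {x<..} t * (?I t * g t) \<partial>lborel)"
      by (rule Bochner_Integration.integral_cong) (auto simp: p_def q_def split: split_indicator)
    also have "\<dots> = (\<integral>t. indicator {x<..} t * (?I t * f t) \<partial>lborel) - (\<integral>t. indicator {x<..} t * (?I t * g t) \<partial>lborel)"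
      by (rule Bochner_Integration.integral_diff[OF i[OF fi] i[OF gi]])
    also have "(\<integral>t. indicator {x<..} t * (?I t * f t) \<partial>lborel) = (\<integral>t. indicator {x<..} t * (?I t * g t) \<partial>lborel)"
    proof -
      \<comment> \<open>The integral above \<open>x\<close> is the total minus the part up to
        \<open>x\<close>, a value of the primitive; for negative \<open>x\<close> that part is
        empty.\<close>
      have tail: "(\<integral>t. indicator {x<..} t * (?I t * r t) \<partial>lborel) = prim r T - (if x < 0 then 0 else prim r (min x T))"
        if ri: "integrable lborel (\<lambda>t. ?I t * r t)" for r
      proof -
        have "(\<integral>t. indicator {x<..} t * (?I t * r t) \<partial>lborel) = (\<integral>t. ?I t * r t - indicator {..x} t * (?I t * r t) \<partial>lborel)"
          by (rule Bochner_Integration.integral_cong) (auto split: split_indicator)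
        also have "\<dots> = (\<integral>t. ?I t * r t \<partial>lborel) - (\<integral>t. indicator {..x} t * (?I t * r t) \<partial>lborel)"
          by (rule Bochner_Integration.integral_diff[OF ri]) (use integrable_mult_indicator[OF _ ri, of "{..x}"] in simp)
        also have "(\<integral>t. indicator {..x} t * (?I t * r t) \<partial>lborel) = (if x < 0 then 0 else prim r (min x T))"
        proof (cases "x < 0")
          case True
          have "(\<lambda>t. indicator {..x} t * (?I t * r t)) = (\<lambda>t. 0)" by (rule ext) (use True in \<open>auto split: split_indicator\<close>)
          then show ?thesis using True by (simp only: if_True) simp
        next
          case False
          then show ?thesis unfolding set_lebesgue_integral_def
            by (simp, intro Bochner_Integration.integral_cong) (auto split: split_indicator)
        qed
        finally show ?thesis unfolding set_lebesgue_integral_def by simp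
      qed
      show ?thesis unfolding tail[OF fi] tail[OF gi] using eq[OF T_T] eq[of "min x T"] by auto
    qed
    finally show ?thesis by simp
  qed
  have "density lborel (\<lambda>t. ennreal (p t)) = density lborel (\<lambda>t. ennreal (q t))"
    by (rule measure_eqI_lessThan) (auto simp: em[OF pi p0] em[OF qi q0] same)
  then have "AE t in lborel. ennreal (p t) = ennreal (q t)"
    using pi qi by (intro iffD1[OF sigma_finite_measure.density_unique_iff[OF sigma_finite_lborel]]) auto
  then have "AE t in lborel. t \<in> {0..T} \<longrightarrow> f t = g t"
  proof eventually_elim
    case (elim t)
    then have "p t = q t" using p0 q0 by (simp add: ennreal_inj)
    then show ?case by (auto simp: p_def q_def max_def split: if_splits)
  qed
  then show ?thesis by (simp add: AE_restrict_space_iff)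
qed

text \<open>Links the chosen rate \<open>Q_dot\<close> to an explicit one: rates of the same
  strategy agree for almost every time on almost every path. If the left integrand fails to be
  integrable, its integral is \<open>0\<close> by convention, so the inequality holds in either
  case.\<close>

lemma rate_energy_unique:
  assumes "is_rate M F T Q u" "is_rate M F T Q v"
  shows "(\<integral>\<omega>. (LINT t:{0..T}|lborel. (u t \<omega>)^2) \<partial>M) \<le> enn2real (rate_energy v)"
proof -
  have u: "progressive F T u" "rate_energy u < \<infinity>" "AE \<omega> in M. \<forall>t\<in>{0..T}. Q t \<omega> = prim (\<lambda>s. u s \<omega>) t"
    and v: "progressive F T v" "rate_energy v < \<infinity>" "AE \<omega> in M. \<forall>t\<in>{0..T}. Q t \<omega> = prim (\<lambda>s. v s \<omega>) t"
    using assms unfolding is_rate_def by auto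
  have "AE \<omega> in M. ennreal (prim (\<lambda>t. (u t \<omega>)^2) T) = (\<integral>\<^sup>+t\<in>{0..T}. ennreal ((v t \<omega>)^2) \<partial>lborel)"
    using rate_square_integrable[OF u(1,2)] rate_square_integrable[OF v(1,2)] u(3) v(3)
  proof eventually_elim
    case (elim \<omega>)
    have iu: "integrable LT (\<lambda>t. u t \<omega>)" and iu2: "integrable LT (\<lambda>t. (u t \<omega>)^2)" and iv: "integrable LT (\<lambda>t. v t \<omega>)"
      using elim(1,2) by auto
    have "prim (\<lambda>s. u s \<omega>) t = prim (\<lambda>s. v s \<omega>) t" if "t \<in> {0..T}" for t
      using bspec[OF elim(3) that] bspec[OF elim(4) that] by simp
    from integrable_eq_AE_of_prim[OF iu iv this] have ae: "AE t in LT. u t \<omega> = v t \<omega>" .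
    have "ennreal (prim (\<lambda>t. (u t \<omega>)^2) T) = (\<integral>\<^sup>+t. ennreal ((u t \<omega>)^2) \<partial>LT)"
      unfolding integral_LT[symmetric] by (rule nn_integral_eq_integral[OF iu2, symmetric]) simp
    also have "\<dots> = (\<integral>\<^sup>+t. ennreal ((v t \<omega>)^2) \<partial>LT)"
      by (rule nn_integral_cong_AE) (use ae in \<open>eventually_elim, simp\<close>)
    finally show ?case unfolding nn_integral_LT .
  qed
  then have e: "(\<integral>\<^sup>+\<omega>. ennreal (prim (\<lambda>t. (u t \<omega>)^2) T) \<partial>M) = rate_energy v"
    by (rule nn_integral_cong_AE)
  have n: "0 \<le> prim (\<lambda>t. (u t \<omega>)^2) T" for \<omega> by (rule prim_nonneg) simp
  show ?thesis
  proof (cases "integrable M (\<lambda>\<omega>. prim (\<lambda>t. (u t \<omega>)^2) T)")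
    case True
    have "(\<integral>\<^sup>+\<omega>. ennreal (prim (\<lambda>t. (u t \<omega>)^2) T) \<partial>M) = ennreal (\<integral>\<omega>. prim (\<lambda>t. (u t \<omega>)^2) T \<partial>M)"
      by (rule nn_integral_eq_integral[OF True]) (use n in auto)
    then have "enn2real (rate_energy v) = (\<integral>\<omega>. prim (\<lambda>t. (u t \<omega>)^2) T \<partial>M)"
      unfolding e[symmetric] using n by simp
    then show ?thesis by simp
  next
    case False
    then show ?thesis by (simp add: not_integrable_integral_eq)
  qed
qed

text \<open>Cauchy-Schwarz bounds the squared position at all times by \<open>T\<close> times the
  energy of the path, which gives the moment condition; the integral of the absolute rate bounds the
  variation, which gives the semimartingale property.\<close>

lemma rate_ac_strategy:
  assumes u: "progressive F T u"
    and fin: "rate_energy u < \<infinity>"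
    and tm: "AE \<omega> in M. prim (\<lambda>s. u s \<omega>) T = \<Xi>T \<omega>"
  shows "(\<lambda>t \<omega>. prim (\<lambda>s. u s \<omega>) t) \<in> ac_strategies M F T \<Xi>T" (is "?R \<in> _")
    "is_rate M F T (\<lambda>t \<omega>. prim (\<lambda>s. u s \<omega>) t) u"
proof -
  note good = rate_square_integrable[OF u fin]
  show rate: "is_rate M F T ?R u" unfolding is_rate_def using u fin by auto
  have "adapted F T ?R"
    unfolding adapted_def using u prim_measurable unfolding progressive_def by blast
  moreover have "AE \<omega> in M. cadlag_on 0 T (\<lambda>t. ?R t \<omega>)"
    using good
  proof eventually_elim
    case (elim \<omega>)
    have "continuous_on {0..T} (\<lambda>t. ?R t \<omega>)"
      by (rule continuous_on_holder_half[of "prim (\<lambda>s. (u s \<omega>)^2) T"])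
        (use prim_L2_increment(2)[OF conjunct1[OF elim] conjunct2[OF elim]] in \<open>auto intro: prim_nonneg\<close>)
    then show ?case by (rule cadlag_continuous)
  qed
  ultimately have ca: "cadlag_adapted M F T ?R" unfolding cadlag_adapted_def by blast
  have "AE \<omega> in M. finite_variation_on 0 T (\<lambda>t. ?R t \<omega>)"
    using good
  proof eventually_elim
    case (elim \<omega>)
    show ?case
      by (rule finite_variation_dominated[where v = "prim (\<lambda>s. \<bar>u s \<omega>\<bar>)"])
        (rule prim_L2_increment(3)[OF conjunct1[OF elim] conjunct2[OF elim]])
  qed
  then have semi: "semimartingale M F T ?R"
    by (rule semimartingale_finite_variation[OF ca]) (simp add: prim_zero)
  have "(\<integral>\<^sup>+\<omega>. (SUP t\<in>{0..T}. ennreal (\<bar>?R t \<omega>\<bar>^2)) \<partial>M)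
      \<le> (\<integral>\<^sup>+\<omega>. ennreal T * (\<integral>\<^sup>+t\<in>{0..T}. ennreal ((u t \<omega>)^2) \<partial>lborel) \<partial>M)"
  proof (rule nn_integral_mono_AE)
    show "AE \<omega> in M. (SUP t\<in>{0..T}. ennreal (\<bar>?R t \<omega>\<bar>^2)) \<le> ennreal T * (\<integral>\<^sup>+t\<in>{0..T}. ennreal ((u t \<omega>)^2) \<partial>lborel)"
      using good
    proof eventually_elim
      case (elim \<omega>)
      have e: "(\<integral>\<^sup>+t\<in>{0..T}. ennreal ((u t \<omega>)^2) \<partial>lborel) = ennreal (prim (\<lambda>t. (u t \<omega>)^2) T)"
        unfolding nn_integral_LT[symmetric] integral_LT[symmetric]
        by (rule nn_integral_eq_integral[OF conjunct2[OF elim]]) simp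
      show ?case
      proof (rule SUP_least)
        fix t assume t: "t \<in> {0..T}"
        have p0: "0 \<le> prim (\<lambda>t. (u t \<omega>)^2) T" by (rule prim_nonneg) simp
        have "\<bar>?R t \<omega>\<bar>^2 \<le> t * prim (\<lambda>t. (u t \<omega>)^2) T"
          using prim_L2_increment(2)[OF conjunct1[OF elim] conjunct2[OF elim], of 0 t] t by (simp add: prim_zero)
        also have "\<dots> \<le> T * prim (\<lambda>t. (u t \<omega>)^2) T" by (rule mult_right_mono[OF _ p0]) (use t in simp)
        finally have "ennreal (\<bar>?R t \<omega>\<bar>^2) \<le> ennreal (T * prim (\<lambda>t. (u t \<omega>)^2) T)" by (rule ennreal_leI)
        then show "ennreal (\<bar>?R t \<omega>\<bar>^2) \<le> ennreal T * (\<integral>\<^sup>+t\<in>{0..T}. ennreal ((u t \<omega>)^2) \<partial>lborel)"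
          unfolding e using p0 by (simp add: ennreal_mult)
      qed
    qed
  qed
  also have "\<dots> \<le> ennreal T * rate_energy u"
  proof -
    interpret P: pair_sigma_finite LT M by (rule pair_LT)
    interpret L: finite_measure LT by (rule finite_LT)
    have j: "(\<lambda>(s, \<omega>). u s \<omega>) \<in> borel_measurable (LT \<Otimes>\<^sub>M M)"
      by (rule joint_LT) (use u in \<open>auto simp: progressive_def\<close>)
    have "(\<lambda>(\<omega>, s). u s \<omega>) \<in> borel_measurable (M \<Otimes>\<^sub>M LT)"
      using measurable_compose[OF measurable_pair_swap' j] by (simp add: split_def)
    then have j': "(\<lambda>(\<omega>, s). ennreal ((u s \<omega>)^2)) \<in> borel_measurable (M \<Otimes>\<^sub>M LT)" by (simp add: split_def)
    have "(\<lambda>\<omega>. \<integral>\<^sup>+t. ennreal ((u t \<omega>)^2) \<partial>LT) \<in> borel_measurable M"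
      by (rule P.M1.borel_measurable_nn_integral[OF j'])
    then show ?thesis unfolding nn_integral_LT[symmetric] by (simp add: nn_integral_cmult)
  qed
  also have "\<dots> < \<infinity>" using fin by (simp add: ennreal_mult_less_top)
  finally have "?R \<in> strategies M F T \<Xi>T" unfolding strategies_def using semi tm by simp
  then show "?R \<in> ac_strategies M F T \<Xi>T" unfolding ac_strategies_def using rate by blast
qed

end

section \<open>Position of the recovery strategy and its distance from the given process\<close>

context recovery
begin

lemma u_finite: "rate_energy u < \<infinity>"
proof -
  have "4 * Lam X < \<infinity>" using fin by (simp add: ennreal_mult_less_top)
  then have "ennreal (2 / h * (G + c0) + 2 / h * (2 * K + 2 * eXT)) + 4 * Lam X < \<infinity>" by simp
  then show ?thesis by (rule le_less_trans[OF u_energy])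
qed

definition good :: "'a \<Rightarrow> bool" where
  "good \<omega> \<longleftrightarrow> \<omega> \<in> space M \<and> integrable LT (\<lambda>t. u t \<omega>) \<and> integrable LT (\<lambda>t. (u t \<omega>)^2)"

lemma AE_good: "AE \<omega> in M. good \<omega>"
  using rate_square_integrable[OF u_progressive u_finite] AE_space by eventually_elim (simp add: good_def)

lemma u_integral_diff:
  assumes "good \<omega>" "0 \<le> s" "s \<le> t" "t \<le> T"
  shows "prim (\<lambda>r. u r \<omega>) t - prim (\<lambda>r. u r \<omega>) s = (LINT r:{s..t}|lborel. u r \<omega>)"
  by (rule prim_L2_increment(1)) (use assms in \<open>auto simp: good_def\<close>)

text \<open>Integrating the difference quotient telescopes to the mean of \<open>Q\<close> over the
  last \<open>h\<close> time units, with positions before time \<open>0\<close> counted as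
  zero.\<close>

lemma u_integral_early:
  assumes w: "good \<omega>" and t: "0 \<le> t" "t \<le> a"
  shows "prim (\<lambda>r. u r \<omega>) t = (prim (\<lambda>s. Q s \<omega>) t - prim (\<lambda>s. Q s \<omega>) (max (t - h) 0)) / h"
proof -
  have ws: "\<omega> \<in> space M" using w by (simp add: good_def)
  have bq: "bdm T (\<lambda>s. Q s \<omega>)" by (rule L2b_bdm[OF Q ws])
  have tT: "t \<le> T" using t a by simp
  let ?q = "\<lambda>s. if h \<le> s then Q (s - h) \<omega> else 0"
  have qe: "(LINT s:{0..t}|lborel. ?q s) = prim (\<lambda>s. Q s \<omega>) (max (t - h) 0)"
  proof (cases "h \<le> t")
    case True
    have "(LINT s:{0..t}|lborel. ?q s) = (LINT s:{h..t}|lborel. Q (s - h) \<omega>)"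
      unfolding set_lebesgue_integral_def
      by (rule Bochner_Integration.integral_cong) (use h0 in \<open>auto split: split_indicator\<close>)
    also have "\<dots> = (LINT s:{0..t - h}|lborel. Q s \<omega>)" by (subst set_integral_shift) simp
    finally show ?thesis using True by simp
  next
    case False
    have "(LINT s:{0..t}|lborel. ?q s) = (LINT s:{0..t}|lborel. 0)"
      by (rule set_lebesgue_integral_cong) (use False in auto)
    then show ?thesis using False by (simp add: max_def)
  qed
  have qi: "set_integrable lborel {0..t} ?q"
  proof (cases "h \<le> t")
    case True
    have b: "bdm T (\<lambda>s. indicator {h..T} s * Q (max (s - h) 0) \<omega>)"
      by (rule bdm_mult[OF _ bdm_shift[OF bq h0]], rule bdmI[of _ _ 1], rule measurable_restrict_space1) (auto simp: indicator_def)
    have "set_integrable lborel {0..t} (\<lambda>s. indicator {h..T} s * Q (max (s - h) 0) \<omega>)"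
      by (rule bdm_set_integrable[OF b]) (use t tT in auto)
    moreover have "set_integrable lborel {0..t} (\<lambda>s. indicator {h..T} s * Q (max (s - h) 0) \<omega>) = set_integrable lborel {0..t} ?q"
      by (rule set_integrable_cong) (use tT in auto)
    ultimately show ?thesis by simp
  next
    case False
    have "set_integrable lborel {0..t} ?q = set_integrable lborel {0..t} (\<lambda>s. 0::real)"
      by (intro set_integrable_cong refl) (use False in auto)
    then show ?thesis by (simp add: set_integrable_def)
  qed
  have Qi: "set_integrable lborel {0..t} (\<lambda>s. Q s \<omega>)" by (rule bdm_set_integrable[OF bq]) (use tT in auto)
  have di: "set_integrable lborel {0..t} (\<lambda>s. (Q s \<omega> - ?q s) / h)"
    using set_integral_diff(1)[OF Qi qi] by (rule set_integrable_divide)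
  have ui: "set_integrable lborel {0..t} (\<lambda>s. u s \<omega>)"
    by (rule integrable_LT_set_integrable) (use w tT in \<open>auto simp: good_def\<close>)
  have "prim (\<lambda>r. u r \<omega>) t = prim (\<lambda>s. (Q s \<omega> - ?q s) / h) t"
  proof (rule set_integral_cong_AE_Icc)
    show "AE s in lborel. s \<in> {0<..<t} \<longrightarrow> u s \<omega> = (Q s \<omega> - ?q s) / h"
      by (intro AE_I2) (use t in \<open>auto simp: u_def\<close>)
  qed (use ui di in \<open>auto simp: set_borel_measurable_def set_integrable_def\<close>)
  also have "\<dots> = (prim (\<lambda>s. Q s \<omega>) t - prim ?q t) / h"
    using set_integral_diff(2)[OF Qi qi] by (simp only: set_integral_divide_zero)
  finally show ?thesis unfolding qe .
qed

lemma u_integral_piece: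
  assumes w: "good \<omega>" and t: "tk k \<le> t" "t \<le> tk (Suc k)"
  shows "prim (\<lambda>r. u r \<omega>) t - prim (\<lambda>r. u r \<omega>) (tk k) = (t - tk k) * ((bb (Suc k) \<omega> - bb k \<omega>) / len k)"
proof -
  have tT: "0 \<le> tk k" "t \<le> T" using tk_range(4)[of k] tk_range(2)[of "Suc k"] t by auto
  have ui: "set_integrable lborel {tk k..t} (\<lambda>s. u s \<omega>)"
    by (rule integrable_LT_set_integrable) (use w tT in \<open>auto simp: good_def\<close>)
  have "(LINT r:{tk k..t}|lborel. u r \<omega>) = (LINT r:{tk k..t}|lborel. (bb (Suc k) \<omega> - bb k \<omega>) / len k)"
  proof (rule set_integral_cong_AE_Icc)
    show "AE s in lborel. s \<in> {tk k<..<t} \<longrightarrow> u s \<omega> = (bb (Suc k) \<omega> - bb k \<omega>) / len k"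
    proof (intro AE_I2 impI)
      fix s assume "s \<in> {tk k<..<t}"
      then show "u s \<omega> = (bb (Suc k) \<omega> - bb k \<omega>) / len k" using t by (intro u_piece) auto
    qed
  qed (use ui in \<open>auto simp: set_borel_measurable_def set_integrable_def\<close>)
  also have "\<dots> = (t - tk k) * ((bb (Suc k) \<omega> - bb k \<omega>) / len k)" using t by (simp add: set_lebesgue_integral_def)
  finally show ?thesis using u_integral_diff[OF w tT(1) t(1) tT(2)] by simp
qed

lemma u_integral_tk: assumes w: "good \<omega>" shows "prim (\<lambda>r. u r \<omega>) (tk k) = bb k \<omega>"
proof (induction k)
  case 0
  show ?case unfolding tk_0 bb_0 using u_integral_early[OF w] a by simp
next
  case (Suc k)
  have "prim (\<lambda>r. u r \<omega>) (tk (Suc k)) - prim (\<lambda>r. u r \<omega>) (tk k) = bb (Suc k) \<omega> - bb k \<omega>"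
    using u_integral_piece[OF w, of k "tk (Suc k)"] tk_less[of k] tk_Suc[of k] len_pos[of k] by simp
  then show ?case using Suc by linarith
qed

text \<open>On each piece the position is a convex combination of the two nodal values, and the
  square is convex.\<close>

lemma interpolation:
  assumes w: "good \<omega>" and t: "tk k \<le> t" "t \<le> tk (Suc k)"
  shows "(prim (\<lambda>r. u r \<omega>) t - x)^2 \<le> (1 - (t - tk k) / len k) * (bb k \<omega> - x)^2 + (t - tk k) / len k * (bb (Suc k) \<omega> - x)^2"
proof -
  define s where "s = (t - tk k) / len k"
  have s: "0 \<le> s" "s \<le> 1" unfolding s_def using t tk_Suc[of k] len_pos[of k] by auto
  have e: "prim (\<lambda>r. u r \<omega>) t - x = (1 - s) * (bb k \<omega> - x) + s * (bb (Suc k) \<omega> - x)"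
  proof -
    have "prim (\<lambda>r. u r \<omega>) t - bb k \<omega> = s * (bb (Suc k) \<omega> - bb k \<omega>)"
      using u_integral_piece[OF w t] unfolding u_integral_tk[OF w] s_def by simp
    then show ?thesis by algebra
  qed
  have conv: "((1 - s) * p + s * q)^2 \<le> (1 - s) * p^2 + s * q^2" for p q :: real
  proof -
    have "(1 - s) * p^2 + s * q^2 - ((1 - s) * p + s * q)^2 = s * (1 - s) * (p - q)^2"
      by (simp add: power2_eq_square algebra_simps)
    moreover have "0 \<le> s * (1 - s) * (p - q)^2" using s by simp
    ultimately show ?thesis by linarith
  qed
  show ?thesis
    unfolding e s_def[symmetric] by (rule conv)
qed

text \<open>At the nodes the position is the delayed target \<open>X (tk k)\<close>. It converges
  along the path to the position at \<open>T\<close>, by continuity, and in mean square to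
  \<open>X T\<close>, since the second moment has no jump at \<open>T\<close>. Fatou's lemma
  identifies the two limits.\<close>

lemma u_integral_terminal: "AE \<omega> in M. prim (\<lambda>r. u r \<omega>) T = \<Xi>T \<omega>"
proof -
  let ?V = "\<lambda>k \<omega>. ennreal ((X T \<omega> - X (tk k) \<omega>)^2)"
  have Xm: "X T \<in> borel_measurable M" "X (tk k) \<in> borel_measurable M" for k
    using L2b_meas[OF Xb] tk_range(3) T_T by blast+
  have Rm: "(\<lambda>\<omega>. prim (\<lambda>r. u r \<omega>) T) \<in> borel_measurable M"
    by (rule measurable_F_M[OF prim_measurable T_T]) (use u_progressive in \<open>auto simp: progressive_def\<close>)
  have lim: "AE \<omega> in M. ennreal ((X T \<omega> - prim (\<lambda>r. u r \<omega>) T)^2) = liminf (\<lambda>k. ?V k \<omega>)"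
    using AE_good
  proof eventually_elim
    case (elim \<omega>)
    have g: "integrable LT (\<lambda>t. u t \<omega>)" "integrable LT (\<lambda>t. (u t \<omega>)^2)" using elim by (auto simp: good_def)
    have c: "continuous_on {0..T} (\<lambda>t. prim (\<lambda>r. u r \<omega>) t)"
      by (rule continuous_on_holder_half[of "prim (\<lambda>s. (u s \<omega>)^2) T"])
        (use prim_nonneg prim_L2_increment(2)[OF g] in auto)
    have "(\<lambda>k. prim (\<lambda>r. u r \<omega>) (tk (Suc k))) \<longlonglongrightarrow> prim (\<lambda>r. u r \<omega>) T"
      by (rule continuous_on_tendsto_compose[OF c LIMSEQ_Suc[OF tk_lim]]) (use tk_range(3) in auto)
    then have "(\<lambda>k. X (tk k) \<omega>) \<longlonglongrightarrow> prim (\<lambda>r. u r \<omega>) T" unfolding u_integral_tk[OF elim] bb_Suc .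
    then have "(\<lambda>k. ?V k \<omega>) \<longlonglongrightarrow> ennreal ((X T \<omega> - prim (\<lambda>r. u r \<omega>) T)^2)"
      by (intro tendsto_ennrealI tendsto_intros)
    then show ?case by (intro lim_imp_Liminf[symmetric]) auto
  qed
  have "(\<integral>\<^sup>+\<omega>. ennreal ((X T \<omega> - prim (\<lambda>r. u r \<omega>) T)^2) \<partial>M) = (\<integral>\<^sup>+\<omega>. liminf (\<lambda>k. ?V k \<omega>) \<partial>M)"
    by (rule nn_integral_cong_AE[OF lim])
  also have "\<dots> \<le> liminf (\<lambda>k. \<integral>\<^sup>+\<omega>. ?V k \<omega> \<partial>M)"
    by (rule nn_integral_liminf) (use Xm in measurable)
  also have "(\<lambda>k. \<integral>\<^sup>+\<omega>. ?V k \<omega> \<partial>M) = (\<lambda>k. ennreal (energy X T - energy X (tk k)))"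
  proof
    fix k
    have "(\<integral>\<^sup>+\<omega>. ?V k \<omega> \<partial>M) = ennreal (\<integral>\<omega>. (X T \<omega> - X (tk k) \<omega>)^2 \<partial>M)"
      by (rule nn_integral_eq_integral[OF X_increment_le(2)[OF T_T tk_range(3)]]) simp
    also have "(\<integral>\<omega>. (X T \<omega> - X (tk k) \<omega>)^2 \<partial>M) = energy X T - energy X (tk k)"
      using L2mart_increment(1)[OF X tk_range(4) less_imp_le[OF tk_range(2)] order_refl] energy_at[OF T_T] energy_at[OF tk_range(3)] by simp
    finally show "(\<integral>\<^sup>+\<omega>. ?V k \<omega> \<partial>M) = ennreal (energy X T - energy X (tk k))" .
  qed
  also have "liminf (\<lambda>k. ennreal (energy X T - energy X (tk k))) = 0"
  proof (rule lim_imp_Liminf)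
    have "(\<lambda>k. energy X T - energy X (tk k)) \<longlonglongrightarrow> energy X T - energy X T"
      by (intro tendsto_diff tendsto_const energy_no_atom[OF X fin tk_lim]) (use tk_range in \<open>auto intro: less_imp_le\<close>)
    then show "(\<lambda>k. ennreal (energy X T - energy X (tk k))) \<longlonglongrightarrow> 0" using tendsto_ennrealI by fastforce
  qed simp
  finally have z: "(\<integral>\<^sup>+\<omega>. ennreal ((X T \<omega> - prim (\<lambda>r. u r \<omega>) T)^2) \<partial>M) = 0" by simp
  have mm: "(\<lambda>\<omega>. ennreal ((X T \<omega> - prim (\<lambda>r. u r \<omega>) T)^2)) \<in> borel_measurable M"
    using Xm(1) Rm by simp
  from z have "AE \<omega> in M. ennreal ((X T \<omega> - prim (\<lambda>r. u r \<omega>) T)^2) = 0"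
    using nn_integral_0_iff_AE[OF mm] by simp
  then show ?thesis using QX
  proof eventually_elim
    case (elim \<omega>)
    then have "(X T \<omega> - prim (\<lambda>r. u r \<omega>) T)^2 \<le> 0" by (simp add: ennreal_eq_0_iff)
    then show ?case using elim by simp
  qed
qed

lemma recovery_strategy:
  obtains R where "L2b R" "indist (\<lambda>t \<omega>. prim (\<lambda>s. u s \<omega>) t) R" "AE \<omega> in M. R T \<omega> = \<Xi>T \<omega>"
    "(\<lambda>t \<omega>. prim (\<lambda>s. u s \<omega>) t) \<in> ac_strategies M F T \<Xi>T"
    "is_rate M F T (\<lambda>t \<omega>. prim (\<lambda>s. u s \<omega>) t) u"
    "cadlag_adapted M F T (\<lambda>t \<omega>. prim (\<lambda>s. u s \<omega>) t)"
proof -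
  note ac = rate_ac_strategy[OF u_progressive u_finite u_integral_terminal]
  then have "(\<lambda>t \<omega>. prim (\<lambda>s. u s \<omega>) t) \<in> strategies M F T \<Xi>T" unfolding ac_strategies_def by blast
  from strategy_L2b[OF this] show ?thesis using that ac by blast
qed

text \<open>Convex interpolation keeps the mean squared distance to \<open>X t\<close> below the
  bound \<open>2 * K + 2 * eXT\<close> common to all nodes; passing from \<open>X t\<close> to
  \<open>Q t\<close> doubles this and adds \<open>2 * K\<close>.\<close>

lemma late_bound:
  assumes R: "L2b R" "indist (\<lambda>t \<omega>. prim (\<lambda>s. u s \<omega>) t) R" and t: "a \<le> t" "t < T"
  shows "(\<integral>\<omega>. (R t \<omega> - Q t \<omega>)^2 \<partial>M) \<le> 6 * K + 4 * eXT"
proof -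
  define k where "k = idx t"
  have k: "tk k \<le> t" "t \<le> tk (Suc k)" using idx_bounds[OF t] unfolding k_def by auto
  have tT: "t \<in> {0..T}" using t a by auto
  define s where "s = (t - tk k) / len k"
  have s: "0 \<le> s" "s \<le> 1" unfolding s_def using k tk_Suc[of k] len_pos[of k] by auto
  have Xt: "X t \<in> borel_measurable M" and Rt: "R t \<in> borel_measurable M" and Qt: "Q t \<in> borel_measurable M"
    using nice_meas[OF L2b_nice tT] Xb R(1) Q by blast+
  have bi: "integrable M (\<lambda>\<omega>. (bb j \<omega> - X t \<omega>)^2)" for j
    using expectation_square_add_le(1)[of "bb j" "\<lambda>\<omega>. - X t \<omega>"] bb_meas bb_L2 Xt L2b_int[OF Xb tT] by simp
  have be: "(\<integral>\<omega>. (bb j \<omega> - X t \<omega>)^2 \<partial>M) \<le> 2 * K + 2 * eXT" for j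
  proof (cases j)
    case 0 then show ?thesis using average_bound[OF tT] by simp
  next
    case (Suc i)
    then show ?thesis using X_increment_le(1)[OF tk_range(3) tT, of i] K_nonneg eXT_nonneg unfolding Suc bb_Suc by linarith
  qed
  have "AE \<omega> in M. (R t \<omega> - X t \<omega>)^2 \<le> (1 - s) * (bb k \<omega> - X t \<omega>)^2 + s * (bb (Suc k) \<omega> - X t \<omega>)^2"
    using AE_good indist_at[OF R(2) tT]
  proof eventually_elim
    case (elim \<omega>)
    then show ?case using interpolation[OF elim(1) k] unfolding s_def by simp
  qed
  moreover have iRX: "integrable M (\<lambda>\<omega>. (R t \<omega> - X t \<omega>)^2)" by (rule L2b_int[OF L2b_diff[OF R(1) Xb] tT])
  ultimately have "(\<integral>\<omega>. (R t \<omega> - X t \<omega>)^2 \<partial>M) \<le> (\<integral>\<omega>. (1 - s) * (bb k \<omega> - X t \<omega>)^2 + s * (bb (Suc k) \<omega> - X t \<omega>)^2 \<partial>M)"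
    by (intro integral_mono_AE) (use bi in auto)
  also have "\<dots> = (1 - s) * (\<integral>\<omega>. (bb k \<omega> - X t \<omega>)^2 \<partial>M) + s * (\<integral>\<omega>. (bb (Suc k) \<omega> - X t \<omega>)^2 \<partial>M)"
    using bi by simp
  also have "\<dots> \<le> (1 - s) * (2 * K + 2 * eXT) + s * (2 * K + 2 * eXT)"
    by (rule add_mono; rule mult_left_mono[OF be]) (use s in auto)
  also have "\<dots> = 2 * K + 2 * eXT" by (simp add: algebra_simps)
  finally have RX: "(\<integral>\<omega>. (R t \<omega> - X t \<omega>)^2 \<partial>M) \<le> 2 * K + 2 * eXT" .
  have XQ: "(\<integral>\<omega>. (X t \<omega> - Q t \<omega>)^2 \<partial>M) \<le> K" using K[of t] t tT by (simp add: power2_commute)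
  have iXQ: "integrable M (\<lambda>\<omega>. (X t \<omega> - Q t \<omega>)^2)" by (rule L2b_int[OF L2b_diff[OF Xb Q] tT])
  have "(\<integral>\<omega>. ((R t \<omega> - X t \<omega>) + (X t \<omega> - Q t \<omega>))^2 \<partial>M) \<le> 2 * (\<integral>\<omega>. (R t \<omega> - X t \<omega>)^2 \<partial>M) + 2 * (\<integral>\<omega>. (X t \<omega> - Q t \<omega>)^2 \<partial>M)"
    by (rule expectation_square_add_le(2)[OF _ _ iRX iXQ]) (use Rt Xt Qt in auto)
  then have "(\<integral>\<omega>. (R t \<omega> - Q t \<omega>)^2 \<partial>M) \<le> 2 * (\<integral>\<omega>. (R t \<omega> - X t \<omega>)^2 \<partial>M) + 2 * (\<integral>\<omega>. (X t \<omega> - Q t \<omega>)^2 \<partial>M)" by simp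
  then show ?thesis using RX XQ by linarith
qed

lemma shift_sq_bound: obtains B where "B \<ge> 0" "\<And>t r. t \<in> {0..T} \<Longrightarrow> 0 \<le> r \<Longrightarrow> shift_sq Q r t \<le> B"
  "\<And>t r. t \<in> {0..T} \<Longrightarrow> 0 \<le> r \<Longrightarrow> integrable M (\<lambda>\<omega>. (Q t \<omega> - Q (max (t - r) 0) \<omega>)^2)"
proof -
  obtain C where C: "C \<ge> 0" "\<And>t. t \<in> {0..T} \<Longrightarrow> (\<integral>\<omega>. (Q t \<omega>)^2 \<partial>M) \<le> C" using L2b_bound[OF Q] by blast
  have *: "integrable M (\<lambda>\<omega>. (Q t \<omega> - Q (max (t - r) 0) \<omega>)^2) \<and> shift_sq Q r t \<le> 4 * C" if t: "t \<in> {0..T}" and r: "0 \<le> r" for t r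
  proof -
    have m: "max (t - r) 0 \<in> {0..T}" using t r by auto
    have Qm: "Q t \<in> borel_measurable M" "(\<lambda>\<omega>. - Q (max (t - r) 0) \<omega>) \<in> borel_measurable M"
      using L2b_meas[OF Q t] L2b_meas[OF Q m] by auto
    have "integrable M (\<lambda>\<omega>. (- Q (max (t - r) 0) \<omega>)^2)" using L2b_int[OF Q m] by simp
    note l = expectation_square_add_le[OF Qm L2b_int[OF Q t] this]
    show ?thesis using l C(2)[OF t] C(2)[OF m] unfolding shift_sq_def by simp
  qed
  show ?thesis by (rule that[of "4 * C"]) (use * C(1) in auto)
qed

text \<open>The error of the moving average is the average over the lag \<open>r\<close> of
  \<open>Q t - Q (t - r)\<close>, and Cauchy-Schwarz moves the square inside. Where the window
  reaches before time \<open>0\<close>, a multiple of \<open>Q 0\<close> with factor at most one is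
  added.\<close>

lemma early_bound:
  assumes R: "L2b R" "indist (\<lambda>t \<omega>. prim (\<lambda>s. u s \<omega>) t) R" and t: "0 \<le> t" "t \<le> a"
  shows "(\<integral>\<omega>. (R t \<omega> - Q t \<omega>)^2 \<partial>M)
    \<le> 2 / h * prim (\<lambda>r. indicator {0..h} r * shift_sq Q r t) T + 2 * c0 * indicator {0..h} t"
proof -
  obtain B where B: "B \<ge> 0" "\<And>t r. t \<in> {0..T} \<Longrightarrow> 0 \<le> r \<Longrightarrow> shift_sq Q r t \<le> B"
    "\<And>t r. t \<in> {0..T} \<Longrightarrow> 0 \<le> r \<Longrightarrow> integrable M (\<lambda>\<omega>. (Q t \<omega> - Q (max (t - r) 0) \<omega>)^2)"
    using shift_sq_bound by blast
  have tT: "t \<in> {0..T}" using t a by auto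
  let ?w = "\<lambda>r. indicator {0..h} r :: real"
  define V where "V r \<omega> = ?w r * (Q t \<omega> - Q (max (t - r) 0) \<omega>)^2" for r \<omega>
  have bw: "bdm T ?w" by (rule bdmI[of _ _ 1], rule measurable_restrict_space1) (auto simp: indicator_def)
  have Qt: "Q t \<in> borel_measurable M" and Q0m: "Q 0 \<in> borel_measurable M"
    using L2b_meas[OF Q] tT zero_T by blast+
  have mQ: "(\<lambda>(r, \<omega>). Q t \<omega>) \<in> borel_measurable (LT \<Otimes>\<^sub>M M)"
    using measurable_compose[OF measurable_snd Qt] by (simp add: split_def)
  have mV: "(\<lambda>(r, \<omega>). V r \<omega>) \<in> borel_measurable (LT \<Otimes>\<^sub>M M)"
    unfolding V_def
    using borel_measurable_times[OF bdm_joint_LT[OF bw] borel_measurable_power[OF borel_measurable_diff[OF mQ joint_reflect[OF L2b_nice[OF Q] tT]], of 2]]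
    by (simp add: split_def)
  have iV: "integrable M (V r)" if "r \<in> {0..T}" for r
    unfolding V_def[abs_def] using B(3)[OF tT, of r] that by simp
  have eV: "(\<integral>\<omega>. V r \<omega> \<partial>M) = ?w r * shift_sq Q r t" for r
    unfolding V_def shift_sq_def by simp
  have aV: "(\<integral>\<omega>. \<bar>V r \<omega>\<bar> \<partial>M) \<le> B" if "r \<in> {0..T}" for r
  proof -
    have "\<bar>V r \<omega>\<bar> = V r \<omega>" for \<omega> by (simp add: V_def)
    moreover have "?w r * shift_sq Q r t \<le> B" using B(1) B(2)[OF tT, of r] that by (cases "r \<in> {0..h}") auto
    ultimately show ?thesis using eV by simp
  qed
  note j = integrable_joint_bounded[OF mV iV aV]
  define W where "W \<omega> = ?w t * Q 0 \<omega>" for \<omega>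
  have Wi: "integrable M (\<lambda>\<omega>. (W \<omega>)^2)" unfolding W_def power_mult_distrib using L2b_int[OF Q zero_T] by simp
  have WE: "(\<integral>\<omega>. (W \<omega>)^2 \<partial>M) \<le> c0 * ?w t"
  proof -
    have "(\<integral>\<omega>. (W \<omega>)^2 \<partial>M) = ?w t * (\<integral>\<omega>. (Q 0 \<omega>)^2 \<partial>M)"
      unfolding W_def power_mult_distrib by (simp add: indicator_def)
    also have "\<dots> \<le> ?w t * c0" by (rule mult_left_mono[OF c0]) simp
    finally show ?thesis by (simp add: mult.commute)
  qed
  have pw: "AE \<omega> in M. (R t \<omega> - Q t \<omega>)^2 \<le> 2 / h * prim (\<lambda>r. V r \<omega>) T + 2 * (W \<omega>)^2"
    using AE_good indist_at[OF R(2) tT]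
  proof eventually_elim
    case (elim \<omega>)
    have ws: "\<omega> \<in> space M" using elim(1) by (simp add: good_def)
    have bq: "bdm T (\<lambda>s. Q s \<omega>)" by (rule L2b_bdm[OF Q ws])
    have hT: "h \<in> {0..T}" "h \<le> T" using h0 h2 by auto
    have bqx: "bdm T (\<lambda>r. Q t \<omega> - Q (max (t - r) 0) \<omega>)" by (rule bdm_diff[OF bdm_const bdm_reflect[OF bq tT]])
    define Z where "Z = prim (\<lambda>r. Q t \<omega> - Q (max (t - r) 0) \<omega>) h / h"
    \<comment> \<open>The fraction of the window that lies before time \<open>0\<close>; it vanishes
      for \<open>t \<ge> h\<close>.\<close>
    define c where "c = max (h - t) 0 / h"
    have c: "0 \<le> c" "c \<le> ?w t" unfolding c_def using h0 t by (auto simp: indicator_def)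
    have "prim (\<lambda>r. Q t \<omega> - Q (max (t - r) 0) \<omega>) h = prim (\<lambda>r. Q t \<omega>) h - prim (\<lambda>r. Q (max (t - r) 0) \<omega>) h"
      by (rule prim_diff_fun[OF bdm_const bdm_reflect[OF bq tT] hT(1)])
    also have "prim (\<lambda>r. Q t \<omega>) h = Q t \<omega> * h" by (rule prim_const) (use h0 in simp)
    also have "prim (\<lambda>r. Q (max (t - r) 0) \<omega>) h = prim (\<lambda>s. Q s \<omega>) t - prim (\<lambda>s. Q s \<omega>) (max (t - h) 0) + max (h - t) 0 * Q 0 \<omega>"
      by (rule prim_reflect_eq[OF bq tT h0 hT(2)])
    finally have "Z = Q t \<omega> - R t \<omega> - c * Q 0 \<omega>"
      unfolding Z_def c_def elim(2)[symmetric] u_integral_early[OF elim(1) t] using h0 by (simp add: diff_divide_distrib add_divide_distrib)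
    then have e: "R t \<omega> - Q t \<omega> = - Z + - (c * Q 0 \<omega>)" by simp
    have "(h * Z)^2 \<le> (h - 0) * prim (\<lambda>r. (Q t \<omega> - Q (max (t - r) 0) \<omega>)^2) h"
      unfolding Z_def using set_integral_cauchy_schwarz[OF bqx, of 0 h] h0 hT by simp
    also have "prim (\<lambda>r. (Q t \<omega> - Q (max (t - r) 0) \<omega>)^2) h = prim (\<lambda>r. V r \<omega>) T"
      unfolding set_lebesgue_integral_def
      by (rule Bochner_Integration.integral_cong) (use hT in \<open>auto simp: V_def split: split_indicator\<close>)
    finally have "h * (h * Z^2) \<le> h * prim (\<lambda>r. V r \<omega>) T" by (simp add: power2_eq_square mult_ac)
    then have "h * Z^2 \<le> prim (\<lambda>r. V r \<omega>) T" using h0 by simp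
    then have Z2: "Z^2 \<le> 1 / h * prim (\<lambda>r. V r \<omega>) T" using h0 by (simp add: pos_le_divide_eq mult.commute)
    have "(c * Q 0 \<omega>)^2 = c^2 * (Q 0 \<omega>)^2" by (rule power_mult_distrib)
    also have "\<dots> \<le> (?w t)^2 * (Q 0 \<omega>)^2" by (rule mult_right_mono[OF power_mono]) (use c in auto)
    also have "\<dots> = (W \<omega>)^2" unfolding W_def power_mult_distrib ..
    finally have W2: "(c * Q 0 \<omega>)^2 \<le> (W \<omega>)^2" .
    have "(R t \<omega> - Q t \<omega>)^2 \<le> 2 * Z^2 + 2 * (c * Q 0 \<omega>)^2"
      unfolding e using power2_add_le[of "- Z" "- (c * Q 0 \<omega>)"] by simp
    then show ?case using Z2 W2 by simp
  qed
  have "(\<integral>\<omega>. (R t \<omega> - Q t \<omega>)^2 \<partial>M) \<le> (\<integral>\<omega>. 2 / h * prim (\<lambda>r. V r \<omega>) T + 2 * (W \<omega>)^2 \<partial>M)"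
    by (rule integral_mono_AE[OF L2b_int[OF L2b_diff[OF R(1) Q] tT] _ pw]) (use j(2) Wi in simp)
  also have "\<dots> = 2 / h * (\<integral>\<omega>. prim (\<lambda>r. V r \<omega>) T \<partial>M) + 2 * (\<integral>\<omega>. (W \<omega>)^2 \<partial>M)"
    using j(2) Wi by simp
  also have "(\<integral>\<omega>. prim (\<lambda>r. V r \<omega>) T \<partial>M) = prim (\<lambda>r. ?w r * shift_sq Q r t) T" using j(3) unfolding eV .
  finally show ?thesis using WE by simp
qed

lemma G_nonneg: "0 \<le> G"
proof -
  have "0 \<le> prim (shift_sq Q 1) T" by (rule prim_nonneg) (simp add: shift_sq_def)
  then show ?thesis using G[of 1] by simp
qed

text \<open>Interchanging time and lag leaves, for each lag \<open>r \<le> h\<close>, the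
  translation bound \<open>r * G \<le> h * G\<close>, integrated over lags in an interval of length
  \<open>h\<close>.\<close>

lemma averaged_shift:
  defines "\<psi> \<equiv> \<lambda>t. prim (\<lambda>r. indicator {0..h} r * shift_sq Q r t) T"
  shows "bdm T \<psi>" "prim \<psi> T \<le> h^2 * G"
proof -
  interpret L: finite_measure LT by (rule finite_LT)
  interpret P: pair_sigma_finite LT LT ..
  interpret PP: finite_measure "LT \<Otimes>\<^sub>M LT" by (rule finite_measure_pair_measure) (rule finite_LT)+
  obtain B where B: "B \<ge> 0" "\<And>t r. t \<in> {0..T} \<Longrightarrow> 0 \<le> r \<Longrightarrow> shift_sq Q r t \<le> B"
    "\<And>t r. t \<in> {0..T} \<Longrightarrow> 0 \<le> r \<Longrightarrow> integrable M (\<lambda>\<omega>. (Q t \<omega> - Q (max (t - r) 0) \<omega>)^2)"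
    using shift_sq_bound by blast
  let ?w = "\<lambda>r. indicator {0..h} r :: real"
  have bw: "bdm T ?w" by (rule bdmI[of _ _ 1], rule measurable_restrict_space1) (auto simp: indicator_def)
  have s0: "0 \<le> shift_sq Q r t" for r t unfolding shift_sq_def by simp
  have hT: "h \<in> {0..T}" using h0 h2 by auto
  have m: "(\<lambda>(t, r). ?w r * shift_sq Q r t) \<in> borel_measurable (LT \<Otimes>\<^sub>M LT)"
    using borel_measurable_times[OF measurable_compose[OF measurable_snd bdm_LT[OF bw]] shift_sq_joint[OF L2b_nice[OF Q]]]
    by (simp add: split_def)
  have bd: "\<bar>?w r * shift_sq Q r t\<bar> \<le> B" if "t \<in> {0..T}" "r \<in> {0..T}" for t r
    using B(1) B(2)[OF that(1), of r] that s0[of r t] by (auto simp: indicator_def)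
  have i: "integrable (LT \<Otimes>\<^sub>M LT) (\<lambda>(t, r). ?w r * shift_sq Q r t)"
    by (rule PP.integrable_const_bound[OF _ m, of B]) (use bd in \<open>auto intro!: AE_I2 simp: space_pair_measure space_LT\<close>)
  have "(\<lambda>t. \<integral>r. ?w r * shift_sq Q r t \<partial>LT) \<in> borel_measurable LT"
    by (rule L.borel_measurable_lebesgue_integral[OF m])
  then have pm: "\<psi> \<in> borel_measurable (restrict_space borel {0..T})"
    unfolding \<psi>_def integral_LT using measurable_cong_sets[OF sets_LT refl] by blast
  show "bdm T \<psi>"
  proof (rule bdmI[OF pm, of "B * T"])
    fix t assume t: "t \<in> {0..T}"
    show "\<bar>\<psi> t\<bar> \<le> B * T"
    proof -
      have "\<bar>LINT r:{0..T}|lborel. ?w r * shift_sq Q r t\<bar> \<le> B * (T - 0)"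
        by (rule set_integral_bound) (use bd[OF t] in auto)
      then show ?thesis unfolding \<psi>_def by simp
    qed
  qed
  have "prim \<psi> T = (\<integral>t. (\<integral>r. ?w r * shift_sq Q r t \<partial>LT) \<partial>LT)" unfolding integral_LT \<psi>_def ..
  also have "\<dots> = (\<integral>r. (\<integral>t. ?w r * shift_sq Q r t \<partial>LT) \<partial>LT)"
    using P.Fubini_integral[OF i] by simp
  also have "\<dots> = prim (\<lambda>r. ?w r * prim (shift_sq Q r) T) T" unfolding integral_LT by (simp only: prim_cmult)
  also have "\<dots> \<le> prim (\<lambda>r. ?w r * (h * G)) T"
  proof (rule set_integral_mono)
    have "integrable LT (\<lambda>r. \<integral>t. ?w r * shift_sq Q r t \<partial>LT)"
      using P.integrable_snd[OF i] by simp
    then have "integrable LT (\<lambda>r. ?w r * prim (shift_sq Q r) T)" unfolding integral_LT by (simp only: prim_cmult)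
    then show "set_integrable lborel {0..T} (\<lambda>r. ?w r * prim (shift_sq Q r) T)"
      by (simp add: set_integrable_def integrable_restrict_space)
    show "set_integrable lborel {0..T} (\<lambda>r. ?w r * (h * G))"
      by (rule bdm_set_integrable[OF bdm_mult[OF bw bdm_const]]) auto
    fix r assume r: "r \<in> {0..T}"
    show "?w r * prim (shift_sq Q r) T \<le> ?w r * (h * G)"
    proof (cases "r \<in> {0..h}")
      case True
      \<comment> \<open>The translation bound concerns positive lags; for lag zero the displacement
        vanishes.\<close>
      have "prim (shift_sq Q r) T \<le> r * G"
      proof (cases "r = 0")
        case True
        have "prim (shift_sq Q r) T = prim (\<lambda>t. 0) T" by (rule prim_cong) (use True in \<open>auto simp: shift_sq_def\<close>)
        then show ?thesis using True by simp
      next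
        case False then show ?thesis using G[of r] r by simp
      qed
      also have "\<dots> \<le> h * G" by (rule mult_right_mono[OF _ G_nonneg]) (use True in simp)
      finally show ?thesis by (rule mult_left_mono) simp
    qed simp
  qed
  also have "prim (\<lambda>r. ?w r * (h * G)) T = (LINT r:{0..h}|lborel. h * G)"
    unfolding set_lebesgue_integral_def
    by (rule Bochner_Integration.integral_cong) (use hT in \<open>auto split: split_indicator\<close>)
  also have "\<dots> = h^2 * G" using h0 by (simp add: set_lebesgue_integral_def power2_eq_square)
  finally show "prim \<psi> T \<le> h^2 * G" .
qed

text \<open>Before \<open>a\<close> the averaged displacement contributes \<open>2 * h * G\<close>
  and the initial correction \<open>2 * h * c0\<close>; after \<open>a\<close> a bounded error lasts
  only for time \<open>h\<close>.\<close>

lemma distance_bound: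
  assumes R: "L2b R" "indist (\<lambda>t \<omega>. prim (\<lambda>s. u s \<omega>) t) R"
  shows "prim (\<lambda>t. \<integral>\<omega>. (R t \<omega> - Q t \<omega>)^2 \<partial>M) T \<le> 2 * h * (G + c0) + h * (6 * K + 4 * eXT)"
proof -
  define \<psi> where "\<psi> t = prim (\<lambda>r. indicator {0..h} r * shift_sq Q r t) T" for t
  let ?w = "\<lambda>r. indicator {0..h} r :: real" and ?v = "\<lambda>r. indicator {a..T} r :: real"
  have bw: "bdm T ?w" "bdm T ?v"
    by (rule bdmI[of _ _ 1], rule measurable_restrict_space1; auto simp: indicator_def)+
  have bp: "bdm T \<psi>" and pG: "prim \<psi> T \<le> h^2 * G"
    using averaged_shift unfolding \<psi>_def[abs_def] by auto
  have p0: "0 \<le> \<psi> t" for t unfolding \<psi>_def by (rule prim_nonneg) (simp add: shift_sq_def)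
  have b1: "bdm T (\<lambda>t. 2 / h * \<psi> t)" and b2: "bdm T (\<lambda>t. 2 * c0 * ?w t)" and b3: "bdm T (\<lambda>t. (6 * K + 4 * eXT) * ?v t)"
    by (rule bdm_mult[OF bdm_const bp], rule bdm_mult[OF bdm_const bw(1)], rule bdm_mult[OF bdm_const bw(2)])
  have b: "bdm T (\<lambda>t. \<integral>\<omega>. (R t \<omega> - Q t \<omega>)^2 \<partial>M)" by (rule bdm_second_moment[OF L2b_diff[OF R(1) Q]])
  have "prim (\<lambda>t. \<integral>\<omega>. (R t \<omega> - Q t \<omega>)^2 \<partial>M) T \<le> prim (\<lambda>t. 2 / h * \<psi> t + 2 * c0 * ?w t + (6 * K + 4 * eXT) * ?v t) T"
  proof (rule prim_mono_AE[OF b bdm_add[OF bdm_add[OF b1 b2] b3] T_T], intro AE_I2 impI)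
    fix t assume t: "t \<in> {0<..<T}"
    have n: "0 \<le> 2 / h * \<psi> t" "0 \<le> 2 * c0 * ?w t" "0 \<le> (6 * K + 4 * eXT) * ?v t"
      using h0 p0 c0_nonneg K_nonneg eXT_nonneg by auto
    show "(\<integral>\<omega>. (R t \<omega> - Q t \<omega>)^2 \<partial>M) \<le> 2 / h * \<psi> t + 2 * c0 * ?w t + (6 * K + 4 * eXT) * ?v t"
    proof (cases "t < a")
      case True
      then show ?thesis using early_bound[OF R, of t] t n unfolding \<psi>_def by simp
    next
      case False
      then have "?v t = 1" using t by simp
      then show ?thesis using late_bound[OF R, of t] False t n by simp
    qed
  qed
  also have "\<dots> = 2 / h * prim \<psi> T + 2 * c0 * prim ?w T + (6 * K + 4 * eXT) * prim ?v T"
    unfolding prim_add[OF bdm_add[OF b1 b2] b3 T_T] prim_add[OF b1 b2 T_T] by (simp only: prim_cmult)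
  also have "prim ?w T = h"
  proof -
    have "prim ?w T = (LINT t|lborel. indicator {0..h} t)"
      unfolding set_lebesgue_integral_def by (rule Bochner_Integration.integral_cong) (use a h0 in \<open>auto split: split_indicator\<close>)
    then show ?thesis using h0 by simp
  qed
  also have "prim ?v T = h"
  proof -
    have "prim ?v T = (LINT t|lborel. indicator {a..T} t)"
      unfolding set_lebesgue_integral_def by (rule Bochner_Integration.integral_cong) (use a in \<open>auto split: split_indicator\<close>)
    then show ?thesis using a by (simp add: a_def)
  qed
  finally have "prim (\<lambda>t. \<integral>\<omega>. (R t \<omega> - Q t \<omega>)^2 \<partial>M) T \<le> 2 / h * prim \<psi> T + 2 * c0 * h + (6 * K + 4 * eXT) * h" .
  moreover have "2 / h * prim \<psi> T \<le> 2 / h * (h^2 * G)" by (rule mult_left_mono[OF pG]) (use h0 in simp)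
  moreover have "2 / h * (h^2 * G) = 2 * h * G" using h0 by (simp add: power2_eq_square)
  ultimately show ?thesis by (simp add: algebra_simps)
qed

text \<open>The energy is of order \<open>1 / h\<close>, and the factor \<open>h^2\<close>, later
  equal to \<open>\<epsilon>\<close>, makes the penalty of order \<open>h\<close>. The rate
  \<open>v\<close> is arbitrary because the cost functional uses a chosen one.\<close>

lemma recovery_energy:
  assumes "is_rate M F T (\<lambda>t \<omega>. prim (\<lambda>s. u s \<omega>) t) v"
  shows "h^2 * (\<integral>\<omega>. (LINT t:{0..T}|lborel. (v t \<omega>)^2) \<partial>M) \<le> 2 * h * (G + c0) + h * (4 * K + 4 * eXT) + 4 * enn2real (Lam X) * h^2"
proof -
  define E where "E = 2 / h * (G + c0) + 2 / h * (2 * K + 2 * eXT)"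
  have E0: "0 \<le> E" unfolding E_def using h0 G_nonneg c0_nonneg K_nonneg eXT_nonneg by (intro add_nonneg_nonneg mult_nonneg_nonneg) auto
  have LAMe: "Lam X = ennreal (enn2real (Lam X))" using fin by simp
  have "is_rate M F T (\<lambda>t \<omega>. prim (\<lambda>s. u s \<omega>) t) u" unfolding is_rate_def using u_progressive u_finite by auto
  from rate_energy_unique[OF assms this]
  have "(\<integral>\<omega>. (LINT t:{0..T}|lborel. (v t \<omega>)^2) \<partial>M) \<le> enn2real (rate_energy u)" .
  also have "\<dots> \<le> enn2real (ennreal (E + 4 * enn2real (Lam X)))"
  proof (rule enn2real_mono)
    have "rate_energy u \<le> ennreal E + 4 * Lam X"
      using u_energy unfolding E_def .
    also have "4 * Lam X = ennreal 4 * ennreal (enn2real (Lam X))" using LAMe by simp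
    also have "\<dots> = ennreal (4 * enn2real (Lam X))" by (rule ennreal_mult[symmetric]) auto
    also have "ennreal E + ennreal (4 * enn2real (Lam X)) = ennreal (E + 4 * enn2real (Lam X))" using E0 by (simp add: ennreal_plus)
    finally show "rate_energy u \<le> ennreal (E + 4 * enn2real (Lam X))" .
  qed simp
  also have "\<dots> = E + 4 * enn2real (Lam X)" by (rule enn2real_ennreal) (use E0 in simp)
  finally have "(\<integral>\<omega>. (LINT t:{0..T}|lborel. (v t \<omega>)^2) \<partial>M) \<le> E + 4 * enn2real (Lam X)" .
  then have "h^2 * (\<integral>\<omega>. (LINT t:{0..T}|lborel. (v t \<omega>)^2) \<partial>M) \<le> h^2 * (E + 4 * enn2real (Lam X))" by (rule mult_left_mono) simp
  also have "\<dots> = h^2 * E + 4 * enn2real (Lam X) * h^2" by (simp add: algebra_simps)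
  also have "h^2 * E = h * (2 * (G + c0)) + h * (2 * (2 * K + 2 * eXT))"
  proof -
    have "h^2 * (2 / h * x) = h * (2 * x)" for x using h0 by (simp add: power2_eq_square)
    then show ?thesis unfolding E_def distrib_left[of "h^2"] by (simp only:)
  qed
  also have "h * (2 * (G + c0)) + h * (2 * (2 * K + 2 * eXT)) + 4 * enn2real (Lam X) * h^2
      = 2 * h * (G + c0) + h * (4 * K + 4 * eXT) + 4 * enn2real (Lam X) * h^2" by (simp add: algebra_simps)
  finally show ?thesis .
qed

end

section \<open>Comparison with the minimizers\<close>

text \<open>A nonzero value would persist to the right by right-continuity and contribute to the
  integral; this argument reaches all times before \<open>T\<close>.\<close>

lemma cadlag_L2_zero:
  assumes f: "cadlag_on 0 T f" and T: "0 \<le> T" and z: "prim (\<lambda>s. (f s)^2) T = 0" and t: "0 \<le> t" "t < T"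
  shows "f t = 0"
proof (rule ccontr)
  assume n: "f t \<noteq> 0"
  define c where "c = (f t)^2 / 2"
  have c: "0 < c" "c < (f t)^2" unfolding c_def using n by auto
  have "((\<lambda>s. (f s)^2) \<longlongrightarrow> (f t)^2) (at_right t)"
    using f t unfolding cadlag_on_def by (intro tendsto_power) auto
  then have "\<forall>\<^sub>F s in at_right t. c < (f s)^2" by (rule order_tendstoD(1)) (rule c)
  then obtain b where b: "t < b" "\<And>s. t < s \<Longrightarrow> s < b \<Longrightarrow> c < (f s)^2"
    unfolding eventually_at_right_field by auto
  define d where "d = min b T"
  have d: "t < d" "d \<le> T" "d \<le> b" unfolding d_def using b(1) t by auto
  have bg: "bdm T (\<lambda>s. c * indicator {t<..<d} s)"
    by (rule bdm_mult[OF bdm_const], rule bdmI[of _ _ 1], rule measurable_restrict_space1) (auto simp: indicator_def)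
  have "prim (\<lambda>s. c * indicator {t<..<d} s) T \<le> prim (\<lambda>s. (f s)^2) T"
  proof (rule prim_mono[OF bg bdm_power2[OF cadlag_bdm[OF f T]]])
    fix s assume "s \<in> {0..T}"
    show "c * indicator {t<..<d} s \<le> (f s)^2"
      using b(2)[of s] d by (cases "s \<in> {t<..<d}") (auto intro: less_imp_le)
  qed (use T in auto)
  moreover have "prim (\<lambda>s. c * indicator {t<..<d} s) T = (LINT s|lborel. c * indicator {t<..<d} s)"
    unfolding set_lebesgue_integral_def
    by (rule Bochner_Integration.integral_cong) (use t d in \<open>auto split: split_indicator\<close>)
  moreover have "(LINT s|lborel. c * indicator {t<..<d} s) = c * (d - t)" using d by simp
  ultimately have "c * (d - t) \<le> 0" using z by (simp only:)
  moreover have "0 < c * (d - t)" using c d by simp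
  ultimately show False by simp
qed

text \<open>For \<open>e \<le> T^2 / 4\<close> the linear term is absorbed through
  \<open>e \<le> T / 2 * sqrt e\<close>.\<close>

lemma sqrt_bigoI:
  fixes f :: "real \<Rightarrow> real"
  assumes T: "0 < T" and C: "0 \<le> C" and B: "0 \<le> B"
    and f: "\<And>e. 0 < e \<Longrightarrow> e \<le> T^2 / 4 \<Longrightarrow> 0 \<le> f e \<and> f e \<le> C * (A * sqrt e + B * e)"
  shows "f \<in> O[at_right 0](sqrt)"
proof (rule bigoI[of _ "C * (A + B * (T / 2))"])
  have "\<forall>\<^sub>F e in at_right 0. 0 < e \<and> e < T^2 / 4"
    unfolding eventually_at_right_field by (rule exI[of _ "T^2 / 4"]) (use T in auto)
  then show "\<forall>\<^sub>F e in at_right 0. norm (f e) \<le> C * (A + B * (T / 2)) * norm (sqrt e)"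
  proof eventually_elim
    case (elim e)
    have "sqrt e \<le> sqrt ((T / 2)^2)" using elim by (intro real_sqrt_le_mono) (simp add: power_divide)
    then have s: "sqrt e \<le> T / 2" using T by simp
    have "e = sqrt e * sqrt e" using elim by simp
    also have "\<dots> \<le> T / 2 * sqrt e" by (rule mult_right_mono[OF s]) (use elim in simp)
    finally have "B * e \<le> B * (T / 2 * sqrt e)" using B by (rule mult_left_mono)
    then have "A * sqrt e + B * e \<le> (A + B * (T / 2)) * sqrt e" by (simp add: algebra_simps)
    then have "C * (A * sqrt e + B * e) \<le> C * ((A + B * (T / 2)) * sqrt e)" using C by (rule mult_left_mono)
    then show ?case using f[of e] elim by (simp add: mult.assoc)
  qed
qed

section \<open>Comparison in the Hilbert norm and the final estimates\<close>

context control
begin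

abbreviation NH :: "(real \<Rightarrow> 'a \<Rightarrow> real) \<Rightarrow> real" where "NH \<equiv> norm_H_sq M T \<beta> lam dlam"

abbreviation YD :: "real \<Rightarrow> (real \<Rightarrow> 'a \<Rightarrow> real) \<Rightarrow> (real \<Rightarrow> 'a \<Rightarrow> real) \<Rightarrow> real \<Rightarrow> 'a \<Rightarrow> real" where
  "YD y P Q \<equiv> \<lambda>t \<omega>. pst y P t \<omega> - pst y Q t \<omega>"

lemma L2b_YD: "L2b P \<Longrightarrow> L2b Q \<Longrightarrow> L2b (YD y P Q)"
  by (intro L2b_diff L2b_pst)

lemma norm_H_sq_le_L2:
  assumes P: "L2b P" and Q: "L2b Q" and eq: "AE \<omega> in M. P T \<omega> = Q T \<omega>"
  shows "NH (YD y P Q) \<le> C_J T \<beta> lam dlam * prim (\<lambda>t. \<integral>\<omega>. (P t \<omega> - Q t \<omega>)^2 \<partial>M) T"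
proof -
  note D = L2b_diff[OF P Q]
  note p = expectation_prim_cong[OF D AE_I2[where P = "\<lambda>\<omega>. \<forall>t\<in>{0..T}. (P t \<omega> - Q t \<omega>)^2 = (P t \<omega> - Q t \<omega>)^2"]]
  note n = norm_H_sq_L2b[OF L2b_YD[OF P Q, of y]]
  have "NH (YD y P Q) \<le> (\<integral>\<omega>. C_J T \<beta> lam dlam * prim (\<lambda>t. (P t \<omega> - Q t \<omega>)^2) T \<partial>M)"
    unfolding n(2)
  proof (rule integral_mono_AE[OF n(1)])
    show "integrable M (\<lambda>\<omega>. C_J T \<beta> lam dlam * prim (\<lambda>t. (P t \<omega> - Q t \<omega>)^2) T)" using p(2) by simp
    show "AE \<omega> in M. prim (\<lambda>t. wgt t * (YD y P Q t \<omega>)^2) T + 1 / (2 * lam T) * (YD y P Q T \<omega>)^2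
      \<le> C_J T \<beta> lam dlam * prim (\<lambda>t. (P t \<omega> - Q t \<omega>)^2) T"
      using eq AE_space
      by eventually_elim (rule H_norm_le[OF L2b_bdm[OF P] L2b_bdm[OF Q]])
  qed
  also have "\<dots> = C_J T \<beta> lam dlam * (\<integral>\<omega>. prim (\<lambda>t. (P t \<omega> - Q t \<omega>)^2) T \<partial>M)" by simp
  finally show ?thesis using p(1) by simp
qed

lemma L2_le_norm_H_sq:
  assumes P: "L2b P" and Q: "L2b Q"
  shows "prim (\<lambda>t. \<integral>\<omega>. (P t \<omega> - Q t \<omega>)^2 \<partial>M) T \<le> C_inv T \<beta> lam dlam * NH (YD y P Q)"
proof -
  note D = L2b_diff[OF P Q]
  note p = expectation_prim_cong[OF D AE_I2[where P = "\<lambda>\<omega>. \<forall>t\<in>{0..T}. (P t \<omega> - Q t \<omega>)^2 = (P t \<omega> - Q t \<omega>)^2"]]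
  note n = norm_H_sq_L2b[OF L2b_YD[OF P Q, of y]]
  have "prim (\<lambda>t. \<integral>\<omega>. (P t \<omega> - Q t \<omega>)^2 \<partial>M) T = (\<integral>\<omega>. prim (\<lambda>t. (P t \<omega> - Q t \<omega>)^2) T \<partial>M)" using p(1) by simp
  also have "\<dots> \<le> (\<integral>\<omega>. C_inv T \<beta> lam dlam * (prim (\<lambda>t. wgt t * (YD y P Q t \<omega>)^2) T + 1 / (2 * lam T) * (YD y P Q T \<omega>)^2) \<partial>M)"
  proof (rule integral_mono)
    show "integrable M (\<lambda>\<omega>. prim (\<lambda>t. (P t \<omega> - Q t \<omega>)^2) T)" using p(2) by simp
    show "integrable M (\<lambda>\<omega>. C_inv T \<beta> lam dlam * (prim (\<lambda>t. wgt t * (YD y P Q t \<omega>)^2) T + 1 / (2 * lam T) * (YD y P Q T \<omega>)^2))"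
      by (rule integrable_mult_right[OF n(1)])
    fix \<omega> assume "\<omega> \<in> space M"
    then show "prim (\<lambda>t. (P t \<omega> - Q t \<omega>)^2) T \<le> C_inv T \<beta> lam dlam * (prim (\<lambda>t. wgt t * (YD y P Q t \<omega>)^2) T + 1 / (2 * lam T) * (YD y P Q T \<omega>)^2)"
      by (intro L2_le_H_norm L2b_bdm[OF P] L2b_bdm[OF Q])
  qed
  also have "\<dots> = C_inv T \<beta> lam dlam * NH (YD y P Q)" unfolding n(2) by (rule integral_mult_right_zero)
  finally show ?thesis .
qed

lemma norm_H_sq_indist:
  assumes "nice Y'" "indist Y Y'" shows "NH Y = NH Y'"
  unfolding norm_H_sq_def by (rule inner_H_cong[OF assms assms])

lemma J_zero_pst:
  assumes "cadlag_adapted M F T Q" "indist Q Q'" "L2b Q'"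
  shows "J_zero M F T \<beta> lam dlam y Q = NH (pst y Q') - y^2 / (2 * lam 0)"
  unfolding J_zero_def
  using norm_H_sq_indist[OF nice_pst[OF L2b_nice[OF assms(3)]] indist_trans[OF state_indist[OF assms(1)] indist_pst[OF assms(2)]]] by simp

lemma norm_H_sq_state_diff:
  assumes P: "cadlag_adapted M F T P" "indist P P'" "L2b P'" and Q: "cadlag_adapted M F T Q" "indist Q Q'" "L2b Q'"
  shows "NH (\<lambda>t \<omega>. state M F T \<beta> lam y P t \<omega> - state M F T \<beta> lam y Q t \<omega>) = NH (YD y P' Q')"
proof (rule norm_H_sq_indist[OF L2b_nice[OF L2b_YD[OF P(3) Q(3)]]])
  have "indist (state M F T \<beta> lam y P) (pst y P')" "indist (state M F T \<beta> lam y Q) (pst y Q')"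
    using indist_trans state_indist indist_pst P Q by blast+
  then show "indist (\<lambda>t \<omega>. state M F T \<beta> lam y P t \<omega> - state M F T \<beta> lam y Q t \<omega>) (YD y P' Q')"
    unfolding indist_def by eventually_elim simp
qed

lemma L2_dist_sq_indist:
  assumes P: "indist P P'" "L2b P'" and Q: "indist Q Q'" "L2b Q'"
  shows "L2_dist_sq M T P Q = prim (\<lambda>t. \<integral>\<omega>. (P' t \<omega> - Q' t \<omega>)^2 \<partial>M) T"
  unfolding L2_dist_sq_def
proof (rule expectation_prim_cong(1)[OF L2b_diff[OF P(2) Q(2)]])
  show "AE \<omega> in M. \<forall>t\<in>{0..T}. \<bar>P t \<omega> - Q t \<omega>\<bar>^2 = (P' t \<omega> - Q' t \<omega>)^2"
    using P(1) Q(1) unfolding indist_def by eventually_elim simp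
qed

lemma Qh_T: "Qh y X T \<omega> = X T \<omega>"
  by (simp add: Qh_def)

text \<open>Collects what a recovery strategy offers: admissibility, closeness in \<open>H\<close>
  and a small penalty for the rate chosen by \<open>Q_dot\<close>. Nonnegativity of the constants is
  exported because the final bound enlarges their coefficients.\<close>

lemma recovery_Qh:
  assumes X: "L2mart X" and XT: "AE \<omega> in M. X T \<omega> = \<Xi>T \<omega>"
    and fin: "Lam X < \<infinity>"
    and h: "0 < h" "h \<le> T / 2"
    and G: "\<And>r. r > 0 \<Longrightarrow> prim (shift_sq (Qh y X) r) T \<le> r * G"
    and c0: "(\<integral>\<omega>. (Qh y X 0 \<omega>)^2 \<partial>M) \<le> c0"
    and K: "\<And>t. 0 \<le> t \<Longrightarrow> t < T \<Longrightarrow> (\<integral>\<omega>. (Qh y X t \<omega> - X t \<omega>)^2 \<partial>M) \<le> K"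
  obtains P R where "P \<in> ac_strategies M F T \<Xi>T" "cadlag_adapted M F T P" "L2b R" "indist P R" "AE \<omega> in M. R T \<omega> = X T \<omega>"
    "NH (YD y R (Qh y X)) \<le> C_J T \<beta> lam dlam * (2 * h * (G + c0) + h * (6 * K + 4 * energy X T))"
    "h^2 * (\<integral>\<omega>. (LINT t:{0..T}|lborel. (Q_dot M F T P t \<omega>)^2) \<partial>M) \<le> 2 * h * (G + c0) + h * (4 * K + 4 * energy X T)
       + 4 * enn2real (Lam X) * h^2"
    "0 \<le> G" "0 \<le> c0" "0 \<le> K" "0 \<le> energy X T"
proof -
  interpret R: recovery M F T "Qh y X" X h \<Xi>T G c0 K
    by unfold_locales (fact L2b_Qh[OF L2mart_L2b[OF X]] X XT h fin G c0 K)+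
  let ?P = "\<lambda>t \<omega>. prim (\<lambda>s. R.u s \<omega>) t"
  obtain R where R: "L2b R" "indist ?P R" "AE \<omega> in M. R T \<omega> = \<Xi>T \<omega>" "?P \<in> ac_strategies M F T \<Xi>T"
    "is_rate M F T ?P R.u" "cadlag_adapted M F T ?P" using R.recovery_strategy by blast
  have RT: "AE \<omega> in M. R T \<omega> = X T \<omega>" using R(3) XT by eventually_elim simp
  have RQ: "AE \<omega> in M. R T \<omega> = Qh y X T \<omega>" using RT by eventually_elim (simp add: Qh_T)
  have "NH (YD y R (Qh y X)) \<le> C_J T \<beta> lam dlam * prim (\<lambda>t. \<integral>\<omega>. (R t \<omega> - Qh y X t \<omega>)^2 \<partial>M) T"
    by (rule norm_H_sq_le_L2[OF R(1) L2b_Qh[OF L2mart_L2b[OF X]] RQ])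
  also have "\<dots> \<le> C_J T \<beta> lam dlam * (2 * h * (G + c0) + h * (6 * K + 4 * energy X T))"
    by (rule mult_left_mono[OF R.distance_bound[OF R(1,2)] C_J_nonneg])
  finally have d: "NH (YD y R (Qh y X)) \<le> C_J T \<beta> lam dlam * (2 * h * (G + c0) + h * (6 * K + 4 * energy X T))" .
  have "is_rate M F T ?P (Q_dot M F T ?P)" unfolding Q_dot_def by (rule someI[of "is_rate M F T ?P"]) (rule R(5))
  note e = R.recovery_energy[OF this]
  show ?thesis
    by (rule that[OF R(4,6,1,2) RT d e R.G_nonneg R.c0_nonneg R.K_nonneg R.eXT_nonneg])
qed

text \<open>That \<open>Qh y X\<close> is itself an admissible semimartingale is never needed: as the lag \<open>h\<close> of the
  recovery strategies vanishes, their costs, and hence the cost of \<open>Q0\<close>, are bounded by the cost of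
  \<open>Qh y X\<close> up to \<open>O(h)\<close>.\<close>

lemma minimizer_indist_Qh:
  assumes X: "L2mart X" and XT: "AE \<omega> in M. X T \<omega> = \<Xi>T \<omega>"
    and fin: "Lam X < \<infinity>"
    and Q0: "is_arg_min (J_zero M F T \<beta> lam dlam y) (\<lambda>Q. Q \<in> strategies M F T \<Xi>T) Q0"
  shows "indist Q0 (Qh y X)"
proof -
  have Q0s: "Q0 \<in> strategies M F T \<Xi>T" using Q0 unfolding is_arg_min_def by blast
  obtain Q where Q: "L2b Q" "indist Q0 Q" "AE \<omega> in M. Q T \<omega> = \<Xi>T \<omega>" "cadlag_adapted M F T Q0"
    using strategy_L2b[OF Q0s] by blast
  have QT: "AE \<omega> in M. Q T \<omega> = X T \<omega>" using Q(3) XT by eventually_elim simp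
  note bX = L2mart_L2b[OF X]
  note bH = L2b_Qh[OF bX, of y]
  obtain G where G: "\<And>r. r > 0 \<Longrightarrow> prim (shift_sq (Qh y X) r) T \<le> r * G" using shift_sq_Qh_bound[OF X] by blast
  obtain K where K: "\<And>t. t \<in> {0..T} \<Longrightarrow> (\<integral>\<omega>. (Qh y X t \<omega> - X t \<omega>)^2 \<partial>M) \<le> K"
    using L2b_bound[OF L2b_diff[OF bH bX]] by blast
  define c where "c = (\<integral>\<omega>. (Qh y X 0 \<omega>)^2 \<partial>M)"
  \<comment> \<open>The bound on the distance of the recovery strategy is linear in
    \<open>h\<close>, with slope \<open>B\<close>.\<close>
  define B where "B = C_J T \<beta> lam dlam * (2 * (G + c) + (6 * K + 4 * energy X T))"
  have le: "NH (YD y Q (Qh y X)) \<le> h * B" if h: "0 < h" "h \<le> T / 2" for h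
  proof -
    obtain P R where R: "P \<in> ac_strategies M F T \<Xi>T" "cadlag_adapted M F T P" "L2b R" "indist P R" "AE \<omega> in M. R T \<omega> = X T \<omega>"
      "NH (YD y R (Qh y X)) \<le> C_J T \<beta> lam dlam * (2 * h * (G + c) + h * (6 * K + 4 * energy X T))"
      by (rule recovery_Qh[where y = y and G = G and ?c0.0 = c and K = K, OF X XT fin h G]) (use K c_def in auto)
    have "P \<in> strategies M F T \<Xi>T" using R(1) unfolding ac_strategies_def by blast
    then have "J_zero M F T \<beta> lam dlam y Q0 \<le> J_zero M F T \<beta> lam dlam y P"
      using Q0 unfolding is_arg_min_def by (meson not_le)
    then have "NH (pst y Q) \<le> NH (pst y R)"
      unfolding J_zero_pst[OF Q(4,2,1)] J_zero_pst[OF R(2,4,3)] by simp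
    \<comment> \<open>By Pythagoras, comparing costs amounts to comparing distances to the state of
      \<open>Qh\<close>.\<close>
    then have "NH (YD y Q (Qh y X)) \<le> NH (YD y R (Qh y X))"
      using norm_H_sq_excess[OF X Q(1) QT, of y] norm_H_sq_excess[OF X R(3,5), of y] by linarith
    also have "\<dots> \<le> h * B" using R(6) unfolding B_def by (simp add: algebra_simps)
    finally show ?thesis .
  qed
  have "NH (YD y Q (Qh y X)) \<le> 0"
  proof (rule ccontr)
    assume n: "\<not> NH (YD y Q (Qh y X)) \<le> 0"
    define N where "N = NH (YD y Q (Qh y X))"
    have N: "0 < N" using n unfolding N_def by simp
    \<comment> \<open>Small enough for the linear bound to fall to half of the supposed
      distance.\<close>
    define h where "h = min (T / 2) (N / (2 * (\<bar>B\<bar> + 1)))"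
    have h: "h \<le> T / 2" "h \<le> N / (2 * (\<bar>B\<bar> + 1))" unfolding h_def by (rule min.cobounded1 min.cobounded2)+
    have hp: "0 < h" unfolding h_def using T N by auto
    have "N \<le> h * B" using le[OF hp h(1)] unfolding N_def .
    also have "\<dots> \<le> h * (\<bar>B\<bar> + 1)" by (rule mult_left_mono) (use hp in auto)
    also have "\<dots> \<le> N / (2 * (\<bar>B\<bar> + 1)) * (\<bar>B\<bar> + 1)" by (rule mult_right_mono[OF h(2)]) simp
    also have "\<dots> = N / 2"
    proof -
      have *: "b \<noteq> 0 \<Longrightarrow> N / (2 * b) * b = N / 2" for b by simp
      show ?thesis by (rule *) linarith
    qed
    finally show False using N by simp
  qed
  then have "C_inv T \<beta> lam dlam * NH (YD y Q (Qh y X)) \<le> 0"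
    using C_inv_nonneg by (rule mult_nonneg_nonpos[rotated])
  then have z: "prim (\<lambda>t. \<integral>\<omega>. (Q t \<omega> - Qh y X t \<omega>)^2 \<partial>M) T \<le> 0"
    using L2_le_norm_H_sq[OF Q(1) bH, of y] by linarith
  note D = L2b_diff[OF Q(1) bH]
  note p = expectation_prim_cong[OF D AE_I2[where P = "\<lambda>\<omega>. \<forall>t\<in>{0..T}. (Q t \<omega> - Qh y X t \<omega>)^2 = (Q t \<omega> - Qh y X t \<omega>)^2"]]
  have n: "0 \<le> prim (\<lambda>t. (Q t \<omega> - Qh y X t \<omega>)^2) T" for \<omega> by (rule prim_nonneg) simp
  have "(\<integral>\<omega>. prim (\<lambda>t. (Q t \<omega> - Qh y X t \<omega>)^2) T \<partial>M) \<le> 0" using p(1) z by simp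
  moreover have "0 \<le> (\<integral>\<omega>. prim (\<lambda>t. (Q t \<omega> - Qh y X t \<omega>)^2) T \<partial>M)" using n by simp
  ultimately have z0: "(\<integral>\<omega>. prim (\<lambda>t. (Q t \<omega> - Qh y X t \<omega>)^2) T \<partial>M) = 0" by (rule antisym)
  have pI: "integrable M (\<lambda>\<omega>. prim (\<lambda>t. (Q t \<omega> - Qh y X t \<omega>)^2) T)" using p(2) by simp
  \<comment> \<open>Zero expected distance gives zero distance on almost every path;
    right-continuity turns this into equality before \<open>T\<close>, and the terminal condition
    settles \<open>T\<close>.\<close>
  have "AE \<omega> in M. prim (\<lambda>t. (Q t \<omega> - Qh y X t \<omega>)^2) T = 0"
    using z0 by (subst (asm) integral_nonneg_eq_0_iff_AE[OF pI]) (use n in auto)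
  then have "indist Q (Qh y X)" unfolding indist_def using QT AE_space
  proof eventually_elim
    case (elim \<omega>)
    show ?case
    proof
      fix t assume t: "t \<in> {0..T}"
      show "Q t \<omega> = Qh y X t \<omega>"
      proof (cases "t < T")
        case True
        have "Q t \<omega> - Qh y X t \<omega> = 0"
          by (rule cadlag_L2_zero[OF L2b_cadlag[OF D elim(3)] _ elim(1)]) (use t True in auto)
        then show ?thesis by simp
      next
        case False
        then have "t = T" using t by simp
        then show ?thesis using elim(2) by (simp add: Qh_T)
      qed
    qed
  qed
  then show ?thesis by (rule indist_trans[OF Q(2)])
qed

text \<open>The minimizer of the penalized cost is compared with the recovery strategy of lag
  \<open>sqrt \<epsilon>\<close>. Its own penalty is nonnegative and is dropped; by Pythagoras the
  excess costs of both are squared distances to the optimal state. So \<open>N\<close> is at most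
  the squared distance of the recovery strategy, \<open>C_J\<close> times a displacement bound, plus
  its penalty; displacement bound and penalty are each at most \<open>B\<close>.\<close>

lemma regularization_estimate:
  assumes tm: "\<Xi>T \<in> borel_measurable (F T)" "integrable M (\<lambda>\<omega>. (\<Xi>T \<omega>)^2)"
    and Xi: "cadlag_version_of_closed_martingale M F T \<Xi>T \<Xi>"
    and Lam: "Lambda M T \<Xi> < \<infinity>"
    and Q0: "is_arg_min (J_zero M F T \<beta> lam dlam y) (\<lambda>Q. Q \<in> strategies M F T \<Xi>T) Q0"
    and Qs: "is_arg_min (J_eps M F T \<beta> lam dlam y \<epsilon>) (\<lambda>Q. Q \<in> ac_strategies M F T \<Xi>T) Qs"
    and eps: "0 < \<epsilon>" "\<epsilon> \<le> T^2 / 4"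
  defines "B \<equiv> C_tr M F T \<beta> lam dlam y \<Xi>T \<Xi> Q0 * sqrt \<epsilon> + 4 * enn2real (Lambda M T \<Xi>) * \<epsilon>"
    and "N \<equiv> NH (\<lambda>t \<omega>. state M F T \<beta> lam y Qs t \<omega> - state M F T \<beta> lam y Q0 t \<omega>)"
  shows "J_zero M F T \<beta> lam dlam y Qs - J_zero M F T \<beta> lam dlam y Q0 = N"
    "0 \<le> N" "N \<le> (1 + C_J T \<beta> lam dlam) * B"
    "L2_dist_sq M T Qs Q0 \<le> C_inv T \<beta> lam dlam * N"
proof -
  obtain X where X: "L2mart X" "indist \<Xi> X" "AE \<omega> in M. X T \<omega> = \<Xi>T \<omega>" "cadlag_adapted M F T \<Xi>"
    using closed_martingale_L2mart[OF tm Xi] by blast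
  note bX = L2mart_L2b[OF X(1)]
  define Q where "Q = Qh y X"
  have Qb: "L2b Q" unfolding Q_def by (rule L2b_Qh[OF bX])
  have L: "Lambda M T \<Xi> = Lam X"
    by (rule Lambda_energy[OF X(2) bX])
  note fin = Lam[unfolded L]
  have ind: "indist Q0 Q" unfolding Q_def by (rule minimizer_indist_Qh[OF X(1,3) fin Q0])
  have Q0s: "Q0 \<in> strategies M F T \<Xi>T" using Q0 unfolding is_arg_min_def by blast
  have ca0: "cadlag_adapted M F T Q0" using strategy_L2b[OF Q0s] by blast
  have Qsa: "Qs \<in> ac_strategies M F T \<Xi>T" using Qs unfolding is_arg_min_def by blast
  then have Qss: "Qs \<in> strategies M F T \<Xi>T" unfolding ac_strategies_def by blast
  obtain S where S: "L2b S" "indist Qs S" "AE \<omega> in M. S T \<omega> = \<Xi>T \<omega>" "cadlag_adapted M F T Qs"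
    using strategy_L2b[OF Qss] by blast
  have ST: "AE \<omega> in M. S T \<omega> = X T \<omega>" using S(3) X(3) by eventually_elim simp
  have Ne: "N = NH (YD y S Q)" unfolding N_def by (rule norm_H_sq_state_diff[OF S(4,2,1) ca0 ind Qb])
  note JQ0 = J_zero_pst[OF ca0 ind Qb, of y]
  show J: "J_zero M F T \<beta> lam dlam y Qs - J_zero M F T \<beta> lam dlam y Q0 = N"
    unfolding Ne JQ0 J_zero_pst[OF S(4,2,1)] using norm_H_sq_excess[OF X(1) S(1) ST, of y] unfolding Q_def by simp
  show "0 \<le> N" unfolding Ne by (rule norm_H_sq_L2b(3)[OF L2b_YD[OF S(1) Qb]])
  show "L2_dist_sq M T Qs Q0 \<le> C_inv T \<beta> lam dlam * N"
    unfolding Ne L2_dist_sq_indist[OF S(2,1) ind Qb] by (rule L2_le_norm_H_sq[OF S(1) Qb])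
  \<comment> \<open>The condition on \<open>\<epsilon>\<close> is exactly
    \<open>h \<le> T / 2\<close>.\<close>
  define h where "h = sqrt \<epsilon>"
  have h2: "h^2 = \<epsilon>" unfolding h_def using eps by simp
  have "h \<le> sqrt ((T / 2)^2)" unfolding h_def using eps by (intro real_sqrt_le_mono) (simp add: power_divide)
  then have h: "0 < h" "h \<le> T / 2" using T eps unfolding h_def by auto
  define G where "G = tr_seminorm_sq M T Q0"
  define K where "K = K_zero M T \<Xi> Q0"
  define c where "c = C_zero M F T \<beta> lam dlam y \<Xi>"
  define E where "E = energy X T"
  define l where "l = enn2real (Lambda M T \<Xi>)"
  \<comment> \<open>Some finite slope comes first; it makes the supremum in the seminorm a genuine
    upper bound.\<close>
  obtain G' where G': "\<And>r. r > 0 \<Longrightarrow> prim (shift_sq Q r) T \<le> r * G'" unfolding Q_def using shift_sq_Qh_bound[OF X(1)] by blast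
  have GG: "prim (shift_sq Q r) T \<le> r * G" if "r > 0" for r
    unfolding G_def by (rule tr_seminorm_upper[OF Qb ind G' that])
  have KK: "(\<integral>\<omega>. (Q t \<omega> - X t \<omega>)^2 \<partial>M) \<le> K" if "0 \<le> t" "t < T" for t
    unfolding K_def by (rule K_zero_upper[OF Qb ind bX X(2) that])
  have cc: "(\<integral>\<omega>. (Q 0 \<omega>)^2 \<partial>M) \<le> c" unfolding c_def Q_def by (rule Qh_initial_bound[OF X(1,2,4)])
  have EE: "E = (\<integral>\<omega>. (\<Xi>T \<omega>)^2 \<partial>M)"
  proof -
    have "E = (\<integral>\<omega>. (X T \<omega>)^2 \<partial>M)" unfolding E_def energy_def by simp
    also have "\<dots> = (\<integral>\<omega>. (\<Xi>T \<omega>)^2 \<partial>M)"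
      by (rule integral_cong_AE)
        (use X(3) L2b_meas[OF bX T_T] measurable_F_M[OF tm(1) T_T] in auto)
    finally show ?thesis .
  qed
  obtain P R where R: "P \<in> ac_strategies M F T \<Xi>T" "cadlag_adapted M F T P" "L2b R" "indist P R" "AE \<omega> in M. R T \<omega> = X T \<omega>"
    "NH (YD y R Q) \<le> C_J T \<beta> lam dlam * (2 * h * (G + c) + h * (6 * K + 4 * E))"
    "h^2 * (\<integral>\<omega>. (LINT t:{0..T}|lborel. (Q_dot M F T P t \<omega>)^2) \<partial>M) \<le> 2 * h * (G + c) + h * (4 * K + 4 * E) + 4 * l * h^2"
    "0 \<le> G" "0 \<le> c" "0 \<le> K" "0 \<le> E"
    unfolding Q_def E_def l_def L
    by (rule recovery_Qh[where y = y and G = G and ?c0.0 = c and K = K, OF X(1,3) fin h])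
      (use GG KK cc in \<open>auto simp: Q_def\<close>)
  have l0: "0 \<le> l" unfolding l_def by simp
  \<comment> \<open>\<open>C_tr\<close> expanded. Its coefficients are at least those in both
    recovery bounds, and the constants are nonnegative, so the single \<open>B\<close> covers
    displacement and penalty.\<close>
  have Bx: "B = (2 * c + 4 * G + 16 * K + 20 * E) * h + 4 * l * h^2"
    unfolding B_def C_tr_def h_def[symmetric] G_def[symmetric] K_def[symmetric] c_def[symmetric] l_def[symmetric] h2
      EE[symmetric] by simp
  have mon: "x * h \<le> y * h" if "x \<le> y" for x y using that h(1) by (intro mult_right_mono) auto
  have lh: "0 \<le> 4 * l * h^2" using l0 by simp
  have "2 * h * (G + c) + h * (6 * K + 4 * E) = (2 * c + 2 * G + 6 * K + 4 * E) * h" by (simp add: algebra_simps)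
  also have "\<dots> \<le> (2 * c + 4 * G + 16 * K + 20 * E) * h" by (rule mon) (use R(8-11) in linarith)
  finally have b1: "2 * h * (G + c) + h * (6 * K + 4 * E) \<le> B" unfolding Bx using lh by linarith
  have "2 * h * (G + c) + h * (4 * K + 4 * E) = (2 * c + 2 * G + 4 * K + 4 * E) * h" by (simp add: algebra_simps)
  also have "\<dots> \<le> (2 * c + 4 * G + 16 * K + 20 * E) * h" by (rule mon) (use R(8-11) in linarith)
  finally have b2: "2 * h * (G + c) + h * (4 * K + 4 * E) + 4 * l * h^2 \<le> B" unfolding Bx by linarith
  have "J_eps M F T \<beta> lam dlam y \<epsilon> Qs \<le> J_eps M F T \<beta> lam dlam y \<epsilon> P"
    using Qs R(1) unfolding is_arg_min_def by (meson not_le)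
  moreover have "0 \<le> \<epsilon> * (\<integral>\<omega>. (LINT t:{0..T}|lborel. (Q_dot M F T Qs t \<omega>)^2) \<partial>M)"
    using eps by (intro mult_nonneg_nonneg Bochner_Integration.integral_nonneg prim_nonneg) auto
  ultimately have "J_zero M F T \<beta> lam dlam y Qs
      \<le> J_zero M F T \<beta> lam dlam y P + h^2 * (\<integral>\<omega>. (LINT t:{0..T}|lborel. (Q_dot M F T P t \<omega>)^2) \<partial>M)"
    unfolding J_eps_def h2 by linarith
  moreover have "J_zero M F T \<beta> lam dlam y P - J_zero M F T \<beta> lam dlam y Q0 = NH (YD y R Q)"
    unfolding JQ0 J_zero_pst[OF R(2,4,3)] using norm_H_sq_excess[OF X(1) R(3,5), of y] unfolding Q_def by simp
  ultimately have "N \<le> C_J T \<beta> lam dlam * (2 * h * (G + c) + h * (6 * K + 4 * E)) + B"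
    using J R(6,7) b2 by linarith
  also have "\<dots> \<le> C_J T \<beta> lam dlam * B + B" using mult_left_mono[OF b1 C_J_nonneg] by simp
  also have "\<dots> = (1 + C_J T \<beta> lam dlam) * B" by (simp add: algebra_simps)
  finally show "N \<le> (1 + C_J T \<beta> lam dlam) * B" .
qed

end

theorem corollary5p8:
  fixes M :: "'a measure" and F :: "real \<Rightarrow> 'a measure" and T y :: real
    and \<beta> lam dlam :: "real \<Rightarrow> real"
    and \<Xi>T :: "'a \<Rightarrow> real" and \<Xi> Q0 :: "'a process" and Qs :: "real \<Rightarrow> 'a process"
  assumes T: "0 < T"
    and space: "usual_filtered_space M F T"
    and coeff: "coefficients T \<beta> lam dlam"
    and target: "\<Xi>T \<in> borel_measurable (F T)" "integrable M (\<lambda>\<omega>. (\<Xi>T \<omega>)^2)"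
    and Xi: "cadlag_version_of_closed_martingale M F T \<Xi>T \<Xi>"
    and Lambda: "Lambda M T \<Xi> < \<infinity>"
    and Q0: "is_arg_min (J_zero M F T \<beta> lam dlam y) (\<lambda>Q. Q \<in> strategies M F T \<Xi>T) Q0"
    and Qs: "\<And>\<epsilon>. 0 < \<epsilon> \<Longrightarrow>
      is_arg_min (J_eps M F T \<beta> lam dlam y \<epsilon>) (\<lambda>Q. Q \<in> ac_strategies M F T \<Xi>T) (Qs \<epsilon>)"
  shows
    "0 < c_H_low T \<beta> lam dlam \<and>
     (\<forall>\<epsilon>. 0 < \<epsilon> \<and> \<epsilon> \<le> T^2 / 4 \<longrightarrow>
        0 \<le> J_zero M F T \<beta> lam dlam y (Qs \<epsilon>) - J_zero M F T \<beta> lam dlam y Q0 \<and>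
        J_zero M F T \<beta> lam dlam y (Qs \<epsilon>) - J_zero M F T \<beta> lam dlam y Q0
          = norm_H_sq M T \<beta> lam dlam
              (\<lambda>t \<omega>. state M F T \<beta> lam y (Qs \<epsilon>) t \<omega> - state M F T \<beta> lam y Q0 t \<omega>) \<and>
        norm_H_sq M T \<beta> lam dlam
            (\<lambda>t \<omega>. state M F T \<beta> lam y (Qs \<epsilon>) t \<omega> - state M F T \<beta> lam y Q0 t \<omega>)
          \<le> (1 + C_J T \<beta> lam dlam)
             * (C_tr M F T \<beta> lam dlam y \<Xi>T \<Xi> Q0 * sqrt \<epsilon> + 4 * enn2real (Lambda M T \<Xi>) * \<epsilon>) \<and>
        L2_dist_sq M T (Qs \<epsilon>) Q0
          \<le> C_inv T \<beta> lam dlam * (1 + C_J T \<beta> lam dlam)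
             * (C_tr M F T \<beta> lam dlam y \<Xi>T \<Xi> Q0 * sqrt \<epsilon> + 4 * enn2real (Lambda M T \<Xi>) * \<epsilon>)) \<and>
     (\<lambda>\<epsilon>. J_zero M F T \<beta> lam dlam y (Qs \<epsilon>) - J_zero M F T \<beta> lam dlam y Q0) \<in> O[at_right 0](sqrt) \<and>
     (\<lambda>\<epsilon>. L2_dist_sq M T (Qs \<epsilon>) Q0) \<in> O[at_right 0](sqrt)"
proof -
  interpret control M F T \<beta> lam dlam
    by unfold_locales (fact T space coeff)+
  let ?N = "\<lambda>\<epsilon>. norm_H_sq M T \<beta> lam dlam (\<lambda>t \<omega>. state M F T \<beta> lam y (Qs \<epsilon>) t \<omega> - state M F T \<beta> lam y Q0 t \<omega>)"
  let ?A = "C_tr M F T \<beta> lam dlam y \<Xi>T \<Xi> Q0" and ?L = "4 * enn2real (Lambda M T \<Xi>)"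
  let ?B = "\<lambda>\<epsilon>. ?A * sqrt \<epsilon> + ?L * \<epsilon>" and ?C = "1 + C_J T \<beta> lam dlam" and ?I = "C_inv T \<beta> lam dlam"
  note est = regularization_estimate[OF target Xi Lambda Q0 Qs]
  have d0: "0 \<le> L2_dist_sq M T (Qs \<epsilon>) Q0" for \<epsilon>
    unfolding L2_dist_sq_def by (intro Bochner_Integration.integral_nonneg prim_nonneg) auto
  have C0: "0 \<le> ?C" using C_J_nonneg by simp
  have d: "L2_dist_sq M T (Qs \<epsilon>) Q0 \<le> ?I * ?C * ?B \<epsilon>" if e: "0 < \<epsilon>" "\<epsilon> \<le> T^2 / 4" for \<epsilon>
  proof -
    have "L2_dist_sq M T (Qs \<epsilon>) Q0 \<le> ?I * ?N \<epsilon>" by (rule est(4)[OF e(1) e])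
    also have "\<dots> \<le> ?I * (?C * ?B \<epsilon>)" by (rule mult_left_mono[OF est(3)[OF e(1) e] C_inv_nonneg])
    finally show ?thesis by (simp only: mult.assoc)
  qed
  have "(\<lambda>\<epsilon>. J_zero M F T \<beta> lam dlam y (Qs \<epsilon>) - J_zero M F T \<beta> lam dlam y Q0) \<in> O[at_right 0](sqrt)"
    by (rule sqrt_bigoI[OF T C0, of ?L _ ?A]) (use est(1-3) in auto)
  moreover have "(\<lambda>\<epsilon>. L2_dist_sq M T (Qs \<epsilon>) Q0) \<in> O[at_right 0](sqrt)"
    by (rule sqrt_bigoI[OF T mult_nonneg_nonneg[OF C_inv_nonneg C0], of ?L _ ?A]) (use d0 d in auto)
  ultimately show ?thesis
    using c_H_low(1) est(1-3) d by auto
qed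

end
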